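(* Let $M$ be a real three-dimensional manifold with a flag structure, and let $Y\to E\to M$ be its adapted coframe bundle. Then $Y\to M$ is a principal bundle with structure group $B/(\mathbb Z/3\mathbb Z)$, where $B\subset\mathrm{SL}(3,\mathbb C)$ is the Borel group of upper triangular matrices and $\mathbb Z/3\mathbb Z$ is the subgroup of scalar matrices in $B$; the action of $B/(\mathbb Z/3\mathbb Z)$ on $Y$ is the right action of the group $H\cong B/(\mathbb Z/3\mathbb Z)$.
   Context: Flag structure: for a real 3-manifold $M$ put $T^{\mathbb C}=TM\otimes\mathbb C$. A flag structure is a choice of two complex line sub-bundles $T^1,T^2\subset T^{\mathbb C}$ with $T^1\cap T^2=\{0\}$ such that $T^1\oplus T^2$ is a contact distribution: locally there is a complex-valued 1-form $\theta$ with $\ker\theta=T^1\oplus T^2$ and $d\theta\wedge\theta$ nowhere zero. The bundle $E$: $E\to M$ is the $\mathbb C^*$-bundle whose fibre at $x$ consists of all complex covectors $\theta$ on $T_xM$ with $\ker\theta=T^1_x\oplus T^2_x$. It carries the tautological 1-form $\omega_\theta=(\text{pull-back of }\theta\text{ to }T_\theta E)$. The coframe bundle $Y$: the fibre of $Y\to E$ over $\varepsilon\in E$ (lying over $x\in M$) is the set of quadruples $(\omega,\omega^1,\omega^2,\phi)$ of complex covectors on $T_\varepsilon E$ where $\omega$ is the tautological form, $\omega^1$ and $\omega^2$ are pull-backs of complex covectors on $T_xM$, the first nonzero on $T^1$ and zero on $T^2$, the second zero on $T^1$ and nonzero on $T^2$, and $d\omega=\omega\wedge\phi+\omega^1\wedge\omega^2$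 at $\varepsilon$. In terms of a local section $\theta$ of $E$ and forms $\theta^1,\theta^2$ on $M$ (with $\theta^1$ nonzero on $T^1$ and zero on $T^2$, $\theta^2$ zero on $T^1$ and nonzero on $T^2$) with $d\theta=\theta^1\wedge\theta^2$, these are $\omega=\lambda\theta$, $\omega^i=a^i\theta^i+v^i\lambda\theta$, $\phi=-\frac{d\lambda}\lambda+a^1v^2\theta^1-a^2v^1\theta^2+s\theta$, with $a^1a^2=\lambda$. Group action: $H$ is the group of matrices $$\begin{pmatrix}\lambda & v^1\lambda & v^2\lambda & s\\ 0&a^1&0&a^1v^2\\0&0&a^2&-a^2v^1\\0&0&0&1\end{pmatrix},\quad s,v^1,v^2\in\mathbb C,\ a^1,a^2\in\mathbb C^*,\ a^1a^2=\lambda .$$ $H$ acts on $Y$ on the right over $M$ by $(\omega,\omega^1,\omega^2,\phi)\mapsto(\omega,\omega^1,\omega^2,\phi)\cdot A$, the result being a coframe at the point $\lambda\varepsilon$ (covectors at $\varepsilon$ and $\lambda\varepsilon$ being identified by the dilation of $E$ by $\lambda$). The identification $H\cong B/(\mathbb Z/3\mathbb Z)$ is induced by the surjective homomorphism $j:B\to H$, $$j\begin{pmatrix}a&c&e\\0&\frac1{ab}&d\\0&0&b\end{pmatrix}=\begin{pmatrix}\frac ab&-2a^2d&\frac cb&\frac{4e}b-2acd\\0&a^2b&0&abc\\0&0&\frac1{ab^2}&\frac{2d}b\\0&0&0&1\end{pmatrix}.$$ *)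

theory Defs
  imports "HOL-Analysis.Analysis" "HOL-Algebra.Coset"
begin

section \<open>Smooth manifolds given by atlases\<close>

text \<open>\<open>S\<close> is meant to be an open subset of a finite-dimensional normed space; there this is the
  usual notion of a C-infinity map (all iterated directional derivatives exist, are continuous and
  differentiable).\<close>

primrec ck_on :: "nat \<Rightarrow> 'e::real_normed_vector set \<Rightarrow> ('e \<Rightarrow> 'f::real_normed_vector) \<Rightarrow> bool" where
  "ck_on 0 S f \<longleftrightarrow> continuous_on S f"
| "ck_on (Suc k) S f \<longleftrightarrow>
     (\<forall>x\<in>S. f differentiable (at x)) \<and> (\<forall>v. ck_on k S (\<lambda>x. frechet_derivative f (at x) v))"

definition smooth_on :: "'e::real_normed_vector set \<Rightarrow> ('e \<Rightarrow> 'f::real_normed_vector) \<Rightarrow> bool" where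
  "smooth_on S f \<longleftrightarrow> (\<forall>k. ck_on k S f)"

text \<open>A chart is a pair of its domain and its coordinate map; the values of the coordinate map
  outside the domain are irrelevant. The model space is a normed space rather than a Euclidean one
  only because the type of bounded linear maps, used for the coordinates of covectors, is no
  instance of the class of Euclidean spaces. All model spaces used below have finite dimension.\<close>

type_synonym ('a, 'e) chart = "'a set \<times> ('a \<Rightarrow> 'e)"
type_synonym ('a, 'e) atlas = "('a, 'e) chart set"

abbreviation chart_inv :: "('a, 'e) chart \<Rightarrow> 'e \<Rightarrow> 'a" where
  "chart_inv c \<equiv> inv_into (fst c) (snd c)"

definition charts_at :: "('a, 'e) atlas \<Rightarrow> 'a \<Rightarrow> ('a, 'e) chart set" where
  "charts_at A p = {c \<in> A. p \<in> fst c}"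

definition in_charts :: "('a, 'e) chart \<Rightarrow> ('b, 'f) chart \<Rightarrow> ('a \<Rightarrow> 'b) \<Rightarrow> 'e \<Rightarrow> 'f" where
  "in_charts c d F = snd d \<circ> F \<circ> chart_inv c"

definition atlas_topology :: "('a, 'e::real_normed_vector) atlas \<Rightarrow> 'a topology" where
  "atlas_topology A = topology_generated_by {fst c \<inter> snd c -` V | c V. c \<in> A \<and> open V}"

definition smooth_manifold :: "'a set \<Rightarrow> ('a, 'e::real_normed_vector) atlas \<Rightarrow> bool" where
  "smooth_manifold X A \<longleftrightarrow>
     (\<forall>c\<in>A. inj_on (snd c) (fst c) \<and> open (snd c ` fst c)) \<and>
     \<Union> (fst ` A) = X \<and>
     (\<forall>c\<in>A. \<forall>d\<in>A. open (snd c ` (fst c \<inter> fst d)) \<and>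
                    smooth_on (snd c ` (fst c \<inter> fst d)) (in_charts c d id)) \<and>
     Hausdorff_space (atlas_topology A) \<and> second_countable (atlas_topology A)"

text \<open>Openness of the coordinate domains below expresses continuity of \<open>F\<close>.\<close>

definition smooth_map ::
  "'a set \<Rightarrow> ('a, 'e::real_normed_vector) atlas \<Rightarrow> 'b set \<Rightarrow> ('b, 'f::real_normed_vector) atlas
     \<Rightarrow> ('a \<Rightarrow> 'b) \<Rightarrow> bool" where
  "smooth_map X A Y B F \<longleftrightarrow> F \<in> X \<rightarrow> Y \<and>
     (\<forall>c\<in>A. \<forall>d\<in>B. open (snd c ` (fst c \<inter> F -` fst d)) \<and>
                    smooth_on (snd c ` (fst c \<inter> F -` fst d)) (in_charts c d F))"

definition diffeomorphism ::
  "'a set \<Rightarrow> ('a, 'e::real_normed_vector) atlas \<Rightarrow> 'b set \<Rightarrow> ('b, 'f::real_normed_vector) atlas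
     \<Rightarrow> ('a \<Rightarrow> 'b) \<Rightarrow> bool" where
  "diffeomorphism X A Y B F \<longleftrightarrow>
     bij_betw F X Y \<and> smooth_map X A Y B F \<and> smooth_map Y B X A (inv_into X F)"

definition restrict_atlas :: "('a, 'e) atlas \<Rightarrow> 'a set \<Rightarrow> ('a, 'e) atlas" where
  "restrict_atlas A W = (\<lambda>c. (fst c \<inter> W, snd c)) ` A"

definition prod_atlas :: "('a, 'e) atlas \<Rightarrow> ('b, 'f) atlas \<Rightarrow> ('a \<times> 'b, 'e \<times> 'f) atlas" where
  "prod_atlas A B = (\<lambda>(c, d). (fst c \<times> fst d, map_prod (snd c) (snd d))) ` (A \<times> B)"

text \<open>All charts, with model space \<open>'f\<close>, of the smooth structure that a subset \<open>S\<close> of a manifold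
  carries as an embedded submanifold: homeomorphisms of relatively open subsets of \<open>S\<close> onto open
  sets whose inverse is smooth into the ambient manifold and which locally extend to smooth maps on
  the ambient manifold. They cover \<open>S\<close> iff \<open>S\<close> is an embedded submanifold modelled on \<open>'f\<close>.\<close>

definition submanifold_atlas ::
  "('a, 'e::real_normed_vector) atlas \<Rightarrow> 'a set \<Rightarrow> ('a, 'f::real_normed_vector) atlas" where
  "submanifold_atlas A S =
     {d. openin (subtopology (atlas_topology A) S) (fst d) \<and>
         inj_on (snd d) (fst d) \<and> open (snd d ` fst d) \<and>
         (\<forall>c\<in>A. open (snd d ` (fst d \<inter> fst c)) \<and>
                smooth_on (snd d ` (fst d \<inter> fst c)) (in_charts d c id)) \<and>
         (\<forall>p\<in>fst d. \<exists>c\<in>charts_at A p. \<exists>V g. open V \<and> V \<subseteq> snd c ` fst c \<and> snd c p \<in> V \<and>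
            smooth_on V g \<and> (\<forall>q \<in> fst d \<inter> fst c. snd c q \<in> V \<longrightarrow> snd d q = g (snd c q)))}"

definition normed_space_atlas :: "('e, 'e) atlas" where
  "normed_space_atlas = {(UNIV, id)}"

text \<open>Charts of the quotient by a map \<open>q\<close> that is locally a diffeomorphism.\<close>

definition quotient_atlas :: "('a, 'e) atlas \<Rightarrow> ('a \<Rightarrow> 'b) \<Rightarrow> ('b, 'e) atlas" where
  "quotient_atlas A q = (\<lambda>c. (q ` fst c, snd c \<circ> inv_into (fst c) q)) ` {c \<in> A. inj_on q (fst c)}"

section \<open>Tangent vectors, complex covectors and forms\<close>

text \<open>A tangent vector at \<open>p\<close> is a family of coordinate vectors, one for each chart at \<open>p\<close>,
  that transform by the derivatives of the coordinate changes. The value 0 at all other arguments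
  makes equality of tangent vectors the equality of functions.\<close>

type_synonym ('a, 'e) tangent = "('a, 'e) chart \<Rightarrow> 'e"

definition tangent_space :: "('a, 'e::real_normed_vector) atlas \<Rightarrow> 'a \<Rightarrow> ('a, 'e) tangent set" where
  "tangent_space A p =
     {u. (\<forall>c\<in>charts_at A p. \<forall>d\<in>charts_at A p.
            u d = frechet_derivative (in_charts c d id) (at (snd c p)) (u c)) \<and>
         (\<forall>c. c \<notin> charts_at A p \<longrightarrow> u c = 0)}"

definition coord_tangent ::
  "('a, 'e::real_normed_vector) atlas \<Rightarrow> ('a, 'e) chart \<Rightarrow> 'a \<Rightarrow> 'e \<Rightarrow> ('a, 'e) tangent" where
  "coord_tangent A c p e =
     (\<lambda>d. if d \<in> charts_at A p then frechet_derivative (in_charts c d id) (at (snd c p)) e else 0)"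

definition some_chart :: "('a, 'e) atlas \<Rightarrow> 'a \<Rightarrow> ('a, 'e) chart" where
  "some_chart A p = (SOME c. c \<in> charts_at A p)"

text \<open>The differential of a smooth map at \<open>p\<close>; by the chain rule it does not depend on the chart
  chosen at \<open>p\<close>.\<close>

definition tangent_map ::
  "('a, 'e::real_normed_vector) atlas \<Rightarrow> ('b, 'f::real_normed_vector) atlas \<Rightarrow> ('a \<Rightarrow> 'b) \<Rightarrow> 'a
     \<Rightarrow> ('a, 'e) tangent \<Rightarrow> ('b, 'f) tangent" where
  "tangent_map A B F p u =
     (\<lambda>d. if d \<in> charts_at B (F p)
          then frechet_derivative (in_charts (some_chart A p) d F) (at (snd (some_chart A p) p))
                 (u (some_chart A p))
          else 0)"

text \<open>Complex covectors at \<open>p\<close>: complex-valued real-linear maps on the real tangent space.\<close>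

type_synonym ('a, 'e) covector = "('a, 'e) tangent \<Rightarrow> complex"

definition covectors :: "('a, 'e::real_normed_vector) atlas \<Rightarrow> 'a \<Rightarrow> ('a, 'e) covector set" where
  "covectors A p =
     {\<alpha>. (\<forall>u\<in>tangent_space A p. \<forall>v\<in>tangent_space A p. \<alpha> (\<lambda>c. u c + v c) = \<alpha> u + \<alpha> v) \<and>
         (\<forall>r. \<forall>u\<in>tangent_space A p. \<alpha> (\<lambda>c. r *\<^sub>R u c) = of_real r * \<alpha> u) \<and>
         (\<forall>u. u \<notin> tangent_space A p \<longrightarrow> \<alpha> u = 0)}"

definition pullback ::
  "('a, 'e::real_normed_vector) atlas \<Rightarrow> ('b, 'f::real_normed_vector) atlas \<Rightarrow> ('a \<Rightarrow> 'b) \<Rightarrow> 'a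
     \<Rightarrow> ('b, 'f) covector \<Rightarrow> ('a, 'e) covector" where
  "pullback A B F p \<beta> = (\<lambda>u. if u \<in> tangent_space A p then \<beta> (tangent_map A B F p u) else 0)"

definition coord_form ::
  "('a, 'e::real_normed_vector) atlas \<Rightarrow> ('a \<Rightarrow> ('a, 'e) covector) \<Rightarrow> ('a, 'e) chart
     \<Rightarrow> 'e \<Rightarrow> 'e \<Rightarrow> complex" where
  "coord_form A \<alpha> c y e = \<alpha> (chart_inv c y) (coord_tangent A c (chart_inv c y) e)"

definition smooth_form ::
  "('a, 'e::real_normed_vector) atlas \<Rightarrow> 'a set \<Rightarrow> ('a \<Rightarrow> ('a, 'e) covector) \<Rightarrow> bool" where
  "smooth_form A U \<alpha> \<longleftrightarrow> (\<forall>p\<in>U. \<alpha> p \<in> covectors A p) \<and>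
     (\<forall>c\<in>A. \<forall>e. smooth_on (snd c ` (fst c \<inter> U)) (\<lambda>y. coord_form A \<alpha> c y e))"

text \<open>The convention for the exterior derivative and the wedge product is
  \<open>d\<alpha>(X,Y) = X(\<alpha>(Y)) - Y(\<alpha>(X)) - \<alpha>([X,Y])\<close>, evaluated on vector fields with constant coordinates
  (for smooth forms the result does not depend on the chart), and
  \<open>(\<alpha> \<and> \<beta>)(u,v) = \<alpha>(u) \<beta>(v) - \<alpha>(v) \<beta>(u)\<close>.\<close>

definition ext_deriv ::
  "('a, 'e::real_normed_vector) atlas \<Rightarrow> ('a \<Rightarrow> ('a, 'e) covector) \<Rightarrow> 'a
     \<Rightarrow> ('a, 'e) tangent \<Rightarrow> ('a, 'e) tangent \<Rightarrow> complex" where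
  "ext_deriv A \<alpha> p u v =
     (let c = some_chart A p; y = snd c p in
        frechet_derivative (\<lambda>y. coord_form A \<alpha> c y (v c)) (at y) (u c)
      - frechet_derivative (\<lambda>y. coord_form A \<alpha> c y (u c)) (at y) (v c))"

definition wedge :: "('t \<Rightarrow> complex) \<Rightarrow> ('t \<Rightarrow> complex) \<Rightarrow> 't \<Rightarrow> 't \<Rightarrow> complex" where
  "wedge \<alpha> \<beta> u v = \<alpha> u * \<beta> v - \<alpha> v * \<beta> u"

definition wedge21 :: "('t \<Rightarrow> 't \<Rightarrow> complex) \<Rightarrow> ('t \<Rightarrow> complex) \<Rightarrow> 't \<Rightarrow> 't \<Rightarrow> 't \<Rightarrow> complex" where
  "wedge21 \<sigma> \<beta> u v w = \<sigma> u v * \<beta> w + \<sigma> v w * \<beta> u + \<sigma> w u * \<beta> v"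

subsection \<open>The complexified tangent bundle\<close>

text \<open>A pair \<open>(u, v)\<close> stands for \<open>u + \<i> v\<close>.\<close>

type_synonym ('a, 'e) ctangent = "('a, 'e) tangent \<times> ('a, 'e) tangent"

definition ctangent_space :: "('a, 'e::real_normed_vector) atlas \<Rightarrow> 'a \<Rightarrow> ('a, 'e) ctangent set" where
  "ctangent_space A p = tangent_space A p \<times> tangent_space A p"

definition ct_zero :: "('a, 'e::real_normed_vector) ctangent" where
  "ct_zero = (\<lambda>c. 0, \<lambda>c. 0)"

definition ct_add ::
  "('a, 'e::real_normed_vector) ctangent \<Rightarrow> ('a, 'e) ctangent \<Rightarrow> ('a, 'e) ctangent" where
  "ct_add z w = (\<lambda>c. fst z c + fst w c, \<lambda>c. snd z c + snd w c)"

definition ct_scale :: "complex \<Rightarrow> ('a, 'e::real_normed_vector) ctangent \<Rightarrow> ('a, 'e) ctangent" where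
  "ct_scale k z = (\<lambda>c. Re k *\<^sub>R fst z c - Im k *\<^sub>R snd z c, \<lambda>c. Im k *\<^sub>R fst z c + Re k *\<^sub>R snd z c)"

definition ct_sum ::
  "('a, 'e::real_normed_vector) ctangent set \<Rightarrow> ('a, 'e) ctangent set \<Rightarrow> ('a, 'e) ctangent set" where
  "ct_sum K L = {ct_add z w | z w. z \<in> K \<and> w \<in> L}"

definition ct_eval :: "('a, 'e) covector \<Rightarrow> ('a, 'e) ctangent \<Rightarrow> complex" where
  "ct_eval \<alpha> z = \<alpha> (fst z) + \<i> * \<alpha> (snd z)"

definition ct_kernel ::
  "('a, 'e::real_normed_vector) atlas \<Rightarrow> 'a \<Rightarrow> ('a, 'e) covector \<Rightarrow> ('a, 'e) ctangent set" where
  "ct_kernel A p \<alpha> = {z \<in> ctangent_space A p. ct_eval \<alpha> z = 0}"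

definition smooth_ctangent_field ::
  "('a, 'e::real_normed_vector) atlas \<Rightarrow> 'a set \<Rightarrow> ('a \<Rightarrow> ('a, 'e) ctangent) \<Rightarrow> bool" where
  "smooth_ctangent_field A U Z \<longleftrightarrow> (\<forall>p\<in>U. Z p \<in> ctangent_space A p) \<and>
     (\<forall>c\<in>A. smooth_on (snd c ` (fst c \<inter> U)) (\<lambda>y. fst (Z (chart_inv c y)) c) \<and>
            smooth_on (snd c ` (fst c \<inter> U)) (\<lambda>y. snd (Z (chart_inv c y)) c))"

definition complex_line_subbundle ::
  "'a set \<Rightarrow> ('a, 'e::real_normed_vector) atlas \<Rightarrow> ('a \<Rightarrow> ('a, 'e) ctangent set) \<Rightarrow> bool" where
  "complex_line_subbundle X A L \<longleftrightarrow>
     (\<forall>p\<in>X. \<exists>U Z. openin (atlas_topology A) U \<and> p \<in> U \<and> smooth_ctangent_field A U Z \<and>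
        (\<forall>q\<in>U. Z q \<noteq> ct_zero \<and> L q = range (\<lambda>k. ct_scale k (Z q))))"

section \<open>Flag structures and the adapted coframe bundle\<close>

text \<open>A complex 3-form on a real 3-dimensional space vanishes iff it vanishes on real vectors.\<close>

definition flag_structure ::
  "'a set \<Rightarrow> ('a, real^3) atlas \<Rightarrow> ('a \<Rightarrow> ('a, real^3) ctangent set)
     \<Rightarrow> ('a \<Rightarrow> ('a, real^3) ctangent set) \<Rightarrow> bool" where
  "flag_structure M A T1 T2 \<longleftrightarrow>
     complex_line_subbundle M A T1 \<and> complex_line_subbundle M A T2 \<and>
     (\<forall>x\<in>M. T1 x \<inter> T2 x = {ct_zero}) \<and>
     (\<forall>x\<in>M. \<exists>U \<theta>. openin (atlas_topology A) U \<and> x \<in> U \<and> smooth_form A U \<theta> \<and>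
        (\<forall>y\<in>U. ct_kernel A y (\<theta> y) = ct_sum (T1 y) (T2 y) \<and>
           (\<exists>u\<in>tangent_space A y. \<exists>v\<in>tangent_space A y. \<exists>w\<in>tangent_space A y.
              wedge21 (ext_deriv A \<theta> y) (\<theta> y) u v w \<noteq> 0)))"

definition coord_covector ::
  "('a, 'e::euclidean_space) atlas \<Rightarrow> ('a, 'e) chart \<Rightarrow> 'a \<Rightarrow> ('a, 'e) covector
     \<Rightarrow> 'e \<Rightarrow>\<^sub>L complex" where
  "coord_covector A c p \<alpha> = Blinfun (\<lambda>e. \<alpha> (coord_tangent A c p e))"

text \<open>The total space of the bundle of complex covectors.\<close>

type_synonym ('a, 'e) covector_pt = "'a \<times> ('a, 'e) covector"

definition covector_atlas ::
  "('a, 'e::euclidean_space) atlas \<Rightarrow> (('a, 'e) covector_pt, 'e \<times> ('e \<Rightarrow>\<^sub>L complex)) atlas" where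
  "covector_atlas A =
     (\<lambda>c. ({(p, \<alpha>). p \<in> fst c \<and> \<alpha> \<in> covectors A p},
           \<lambda>(p, \<alpha>). (snd c p, coord_covector A c p \<alpha>))) ` A"

text \<open>The total space of the bundle of quadruples of complex covectors.\<close>

type_synonym ('a, 'e) coframe_pt = "'a \<times> (('a, 'e) covector ^ 4)"

definition covector4_atlas ::
  "('a, 'e::euclidean_space) atlas
     \<Rightarrow> (('a, 'e) coframe_pt, 'e \<times> (('e \<Rightarrow>\<^sub>L complex) ^ 4)) atlas" where
  "covector4_atlas A =
     (\<lambda>c. ({(p, \<eta>). p \<in> fst c \<and> (\<forall>i. \<eta> $ i \<in> covectors A p)},
           \<lambda>(p, \<eta>). (snd c p, \<chi> i. coord_covector A c p (\<eta> $ i)))) ` A"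

type_synonym 'a E_pt = "('a, real^3) covector_pt"

definition E_space ::
  "'a set \<Rightarrow> ('a, real^3) atlas \<Rightarrow> ('a \<Rightarrow> ('a, real^3) ctangent set)
     \<Rightarrow> ('a \<Rightarrow> ('a, real^3) ctangent set) \<Rightarrow> 'a E_pt set" where
  "E_space M A T1 T2 =
     {(x, \<theta>). x \<in> M \<and> \<theta> \<in> covectors A x \<and> ct_kernel A x \<theta> = ct_sum (T1 x) (T2 x)}"

definition E_atlas ::
  "'a set \<Rightarrow> ('a, real^3) atlas \<Rightarrow> ('a \<Rightarrow> ('a, real^3) ctangent set)
     \<Rightarrow> ('a \<Rightarrow> ('a, real^3) ctangent set) \<Rightarrow> ('a E_pt, (real^3) \<times> complex) atlas" where
  "E_atlas M A T1 T2 = submanifold_atlas (covector_atlas A) (E_space M A T1 T2)"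

type_synonym 'a E_covector = "('a E_pt, (real^3) \<times> complex) covector"

definition tautological_form ::
  "'a set \<Rightarrow> ('a, real^3) atlas \<Rightarrow> ('a \<Rightarrow> ('a, real^3) ctangent set)
     \<Rightarrow> ('a \<Rightarrow> ('a, real^3) ctangent set) \<Rightarrow> 'a E_pt \<Rightarrow> 'a E_covector" where
  "tautological_form M A T1 T2 \<epsilon> = pullback (E_atlas M A T1 T2) A fst \<epsilon> (snd \<epsilon>)"

type_synonym 'a Y_pt = "('a E_pt, (real^3) \<times> complex) coframe_pt"

text \<open>The components \<open>\<eta> $ 1\<close>, \<open>\<eta> $ 2\<close>, \<open>\<eta> $ 3\<close>, \<open>\<eta> $ 4\<close> are \<open>\<omega>\<close>, \<open>\<omega>\<^sup>1\<close>, \<open>\<omega>\<^sup>2\<close>, \<open>\<phi>\<close>.\<close>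

definition Y_space ::
  "'a set \<Rightarrow> ('a, real^3) atlas \<Rightarrow> ('a \<Rightarrow> ('a, real^3) ctangent set)
     \<Rightarrow> ('a \<Rightarrow> ('a, real^3) ctangent set) \<Rightarrow> 'a Y_pt set" where
  "Y_space M A T1 T2 =
     {(\<epsilon>, \<eta>). \<epsilon> \<in> E_space M A T1 T2 \<and>
        (\<forall>i. \<eta> $ i \<in> covectors (E_atlas M A T1 T2) \<epsilon>) \<and>
        \<eta> $ 1 = tautological_form M A T1 T2 \<epsilon> \<and>
        (\<exists>\<alpha>\<in>covectors A (fst \<epsilon>). \<eta> $ 2 = pullback (E_atlas M A T1 T2) A fst \<epsilon> \<alpha> \<and>
           (\<forall>z\<in>T1 (fst \<epsilon>) - {ct_zero}. ct_eval \<alpha> z \<noteq> 0) \<and> (\<forall>z\<in>T2 (fst \<epsilon>). ct_eval \<alpha> z = 0)) \<and>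
        (\<exists>\<alpha>\<in>covectors A (fst \<epsilon>). \<eta> $ 3 = pullback (E_atlas M A T1 T2) A fst \<epsilon> \<alpha> \<and>
           (\<forall>z\<in>T1 (fst \<epsilon>). ct_eval \<alpha> z = 0) \<and> (\<forall>z\<in>T2 (fst \<epsilon>) - {ct_zero}. ct_eval \<alpha> z \<noteq> 0)) \<and>
        (\<forall>u\<in>tangent_space (E_atlas M A T1 T2) \<epsilon>. \<forall>v\<in>tangent_space (E_atlas M A T1 T2) \<epsilon>.
           ext_deriv (E_atlas M A T1 T2) (tautological_form M A T1 T2) \<epsilon> u v =
           wedge (\<eta> $ 1) (\<eta> $ 4) u v + wedge (\<eta> $ 2) (\<eta> $ 3) u v)}"

text \<open>The model space \<open>(real^3) \<times> (complex^5)\<close> has the dimension 13 of \<open>Y\<close>.\<close>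

definition Y_atlas ::
  "'a set \<Rightarrow> ('a, real^3) atlas \<Rightarrow> ('a \<Rightarrow> ('a, real^3) ctangent set)
     \<Rightarrow> ('a \<Rightarrow> ('a, real^3) ctangent set) \<Rightarrow> ('a Y_pt, (real^3) \<times> (complex^5)) atlas" where
  "Y_atlas M A T1 T2 =
     submanifold_atlas (covector4_atlas (E_atlas M A T1 T2)) (Y_space M A T1 T2)"

definition Y_proj :: "'a Y_pt \<Rightarrow> 'a" where
  "Y_proj y = fst (fst y)"

definition dilation :: "complex \<Rightarrow> 'a E_pt \<Rightarrow> 'a E_pt" where
  "dilation k \<epsilon> = (fst \<epsilon>, \<lambda>u. k * snd \<epsilon> u)"

text \<open>The row vector \<open>\<eta>\<close> is multiplied by the matrix \<open>h\<close>; the resulting covectors at \<open>\<epsilon>\<close> become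
  covectors at \<open>\<lambda>\<epsilon>\<close>, \<open>\<lambda> = h $ 1 $ 1\<close>, by pulling them back along the inverse dilation.\<close>

definition Y_act ::
  "'a set \<Rightarrow> ('a, real^3) atlas \<Rightarrow> ('a \<Rightarrow> ('a, real^3) ctangent set)
     \<Rightarrow> ('a \<Rightarrow> ('a, real^3) ctangent set) \<Rightarrow> 'a Y_pt \<Rightarrow> complex^4^4 \<Rightarrow> 'a Y_pt" where
  "Y_act M A T1 T2 y h =
     (dilation (h $ 1 $ 1) (fst y),
      \<chi> j. pullback (E_atlas M A T1 T2) (E_atlas M A T1 T2) (dilation (inverse (h $ 1 $ 1)))
             (dilation (h $ 1 $ 1) (fst y)) (\<lambda>u. \<Sum>i\<in>UNIV. (snd y $ i) u * h $ i $ j))"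

section \<open>The groups\<close>

definition H_matrix :: "complex \<Rightarrow> complex \<Rightarrow> complex \<Rightarrow> complex \<Rightarrow> complex \<Rightarrow> complex^4^4" where
  "H_matrix a1 a2 v1 v2 s =
     (let l = a1 * a2 in
      vector [vector [l, v1 * l, v2 * l, s],
              vector [0, a1, 0, a1 * v2],
              vector [0, 0, a2, - (a2 * v1)],
              vector [0, 0, 0, 1]])"

definition H_group :: "(complex^4^4) monoid" where
  "H_group = \<lparr>carrier = {H_matrix a1 a2 v1 v2 s | a1 a2 v1 v2 s. a1 \<noteq> 0 \<and> a2 \<noteq> 0},
              monoid.mult = (**), one = mat 1\<rparr>"

definition H_atlas :: "(complex^4^4, complex^5) atlas" where
  "H_atlas = submanifold_atlas normed_space_atlas (carrier H_group)"

definition borel_group :: "(complex^3^3) monoid" where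
  "borel_group = \<lparr>carrier = {g. det g = 1 \<and> g $ 2 $ 1 = 0 \<and> g $ 3 $ 1 = 0 \<and> g $ 3 $ 2 = 0},
                  monoid.mult = (**), one = mat 1\<rparr>"

definition borel_atlas :: "(complex^3^3, complex^5) atlas" where
  "borel_atlas = submanifold_atlas normed_space_atlas (carrier borel_group)"

text \<open>The scalar matrices of determinant 1, a group of order 3.\<close>

definition scalar_subgroup :: "(complex^3^3) set" where
  "scalar_subgroup = {g \<in> carrier borel_group. \<exists>k. g = mat k}"

definition borel_quotient :: "(complex^3^3) set monoid" where
  "borel_quotient = borel_group Mod scalar_subgroup"

definition borel_quotient_atlas :: "((complex^3^3) set, complex^5) atlas" where
  "borel_quotient_atlas =
     quotient_atlas borel_atlas (\<lambda>g. scalar_subgroup #>\<^bsub>borel_group\<^esub> g)"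

definition borel_to_H :: "complex^3^3 \<Rightarrow> complex^4^4" where
  "borel_to_H g =
     (let a = g $ 1 $ 1; b = g $ 3 $ 3; c = g $ 1 $ 2; d = g $ 2 $ 3; e = g $ 1 $ 3 in
      vector [vector [a / b, - 2 * a\<^sup>2 * d, c / b, 4 * e / b - 2 * a * c * d],
              vector [0, a\<^sup>2 * b, 0, a * b * c],
              vector [0, 0, 1 / (a * b\<^sup>2), 2 * d / b],
              vector [0, 0, 0, 1]])"

text \<open>\<open>borel_to_H\<close> is constant on cosets, so this is the map that it induces on the quotient.\<close>

definition borel_quotient_to_H :: "(complex^3^3) set \<Rightarrow> complex^4^4" where
  "borel_quotient_to_H C = the_elem (borel_to_H ` C)"

section \<open>Principal bundles\<close>

definition lie_group :: "('g, 'm) monoid_scheme \<Rightarrow> ('g, 'e::real_normed_vector) atlas \<Rightarrow> bool" where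
  "lie_group G B \<longleftrightarrow> group G \<and> smooth_manifold (carrier G) B \<and>
     smooth_map (carrier G \<times> carrier G) (prod_atlas B B) (carrier G) B (\<lambda>(g, h). g \<otimes>\<^bsub>G\<^esub> h) \<and>
     smooth_map (carrier G) B (carrier G) B (\<lambda>g. inv\<^bsub>G\<^esub> g)"

definition lie_group_iso ::
  "('g, 'm) monoid_scheme \<Rightarrow> ('g, 'e::real_normed_vector) atlas
     \<Rightarrow> ('h, 'n) monoid_scheme \<Rightarrow> ('h, 'f::real_normed_vector) atlas \<Rightarrow> ('g \<Rightarrow> 'h) \<Rightarrow> bool" where
  "lie_group_iso G B G' B' F \<longleftrightarrow> lie_group G B \<and> lie_group G' B' \<and>
     F \<in> hom G G' \<and> diffeomorphism (carrier G) B (carrier G') B' F"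

definition principal_bundle ::
  "'p set \<Rightarrow> ('p, 'e::real_normed_vector) atlas \<Rightarrow> 'a set \<Rightarrow> ('a, 'f::real_normed_vector) atlas
     \<Rightarrow> ('p \<Rightarrow> 'a) \<Rightarrow> ('g, 'm) monoid_scheme \<Rightarrow> ('g, 'k::real_normed_vector) atlas
     \<Rightarrow> ('p \<Rightarrow> 'g \<Rightarrow> 'p) \<Rightarrow> bool" where
  "principal_bundle P AP X AX \<pi> G AG act \<longleftrightarrow>
     smooth_manifold P AP \<and> smooth_manifold X AX \<and> lie_group G AG \<and>
     smooth_map P AP X AX \<pi> \<and>
     smooth_map (P \<times> carrier G) (prod_atlas AP AG) P AP (\<lambda>(p, g). act p g) \<and>
     (\<forall>p\<in>P. act p \<one>\<^bsub>G\<^esub> = p) \<and>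
     (\<forall>p\<in>P. \<forall>g\<in>carrier G. \<forall>h\<in>carrier G. act (act p g) h = act p (g \<otimes>\<^bsub>G\<^esub> h)) \<and>
     (\<forall>p\<in>P. \<forall>g\<in>carrier G. \<pi> (act p g) = \<pi> p) \<and>
     (\<forall>x\<in>X. \<exists>U \<Phi>. openin (atlas_topology AX) U \<and> x \<in> U \<and>
        diffeomorphism (U \<times> carrier G) (prod_atlas (restrict_atlas AX U) AG)
                       {p \<in> P. \<pi> p \<in> U} (restrict_atlas AP {p \<in> P. \<pi> p \<in> U}) \<Phi> \<and>
        (\<forall>y\<in>U. \<forall>g\<in>carrier G. \<pi> (\<Phi> (y, g)) = y \<and>
           (\<forall>h\<in>carrier G. act (\<Phi> (y, g)) h = \<Phi> (y, g \<otimes>\<^bsub>G\<^esub> h))))"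

end

(*
Near a point choose a contact form theta and sections z1, z2 of T1, T2. Since
dtheta is nondegenerate on ker theta, the contractions theta1 = - iota(z2) dtheta and
theta2 = iota(z1) dtheta / dtheta(z1, z2) satisfy dtheta = theta1 /\ theta2, because both
sides have the same contractions with z1 and z2. Over such a chart E is trivial with
fibre coordinate lambda, omega = lambda theta, and the equation
domega = omega /\ phi + omega1 /\ omega2 says exactly that a coframe is the row vector
(theta, theta1, theta2, - dlambda) times a unique matrix of H. So the fibres are the
orbits of a local section, and the entries of the matrix are submanifold charts of Y in
which the action is the multiplication of H. Finally j is a local diffeomorphism, with
local inverses built from a cube root of a1^2 a2, so it identifies B/(Z/3Z) with H.
*)
theory Submission
  imports Defs
begin

section \<open>Smooth calculus\<close>

text \<open>Neither E nor Y is given an atlas by construction: their atlases are defined as all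
  charts of the induced embedded submanifold structure. Hence the work is to exhibit, through each
  point, one chart that also extends smoothly to the ambient covector bundle. The dual frame of
  (\<theta>, \<theta>1, \<theta>2) provides the extension: contracting with it reads off the entries
  of the H-matrix from arbitrary covectors, not only from adapted ones. The matrices have their base
  point at \<lambda> = 1, and the transport of covectors along dilations by \<lambda> turns -
  d\<lambda> there into - d\<lambda> / \<lambda>, the vertical part that the structure equation
  forces on \<phi>. An obstacle of the encoding: the exterior derivative and the tangent map are
  defined by an unspecified chart, so independence of the chart must be proved before anything can
  be computed, for forms by the symmetry of second derivatives. Separation and countability of Y are
  inherited from M through the trivialisations.\<close>

text \<open>The composition of smooth maps needs finitely many coordinates on the intermediate space only;
  a class wider than the Euclidean spaces also covers the spaces of bounded linear maps. Bounded
  linearity is spelled out because the constant is not available for the type variable of a class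
  that is being defined.\<close>

class findim = real_normed_vector +
  assumes ex_fin_coords_unfolded: "\<exists>xs :: ('a \<times> ('a \<Rightarrow> real)) list.
    (\<forall>(b, c) \<in> set xs. (\<forall>x y. c (x + y) = c x + c y) \<and> (\<forall>r x. c (r *\<^sub>R x) = r * c x) \<and>
       (\<exists>K. \<forall>x. \<bar>c x\<bar> \<le> norm x * K)) \<and>
    (\<forall>x. x = (\<Sum>(b, c)\<leftarrow>xs. c x *\<^sub>R b))"

lemma ex_fin_coords: "\<exists>xs :: ('a::findim \<times> ('a \<Rightarrow> real)) list. (\<forall>(b, c) \<in> set xs. bounded_linear c) \<and>
    (\<forall>x. x = (\<Sum>(b, c)\<leftarrow>xs. c x *\<^sub>R b))"
proof -
  obtain xs :: "('a \<times> ('a \<Rightarrow> real)) list" where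
    xs: "\<And>b c. (b, c) \<in> set xs \<Longrightarrow> (\<forall>x y. c (x + y) = c x + c y) \<and> (\<forall>r x. c (r *\<^sub>R x) = r * c x) \<and>
       (\<exists>K. \<forall>x. \<bar>c x\<bar> \<le> norm x * K)" "\<forall>x. x = (\<Sum>(b, c)\<leftarrow>xs. c x *\<^sub>R b)"
    using ex_fin_coords_unfolded[where 'a = 'a] by (elim exE conjE) (rule, fastforce+)
  have "bounded_linear c" if bc: "(b, c) \<in> set xs" for b c
  proof -
    obtain K where "\<And>x. \<bar>c x\<bar> \<le> norm x * K" using xs(1)[OF bc] by auto
    then show ?thesis using xs(1)[OF bc] by (intro bounded_linear_intro[where K = K]) auto
  qed
  then show ?thesis using xs(2) by blast
qed

lemma ex_fin_coords_unfoldI: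
  fixes xs :: "('a::real_normed_vector \<times> ('a \<Rightarrow> real)) list"
  assumes "\<forall>(b, c) \<in> set xs. bounded_linear c" "\<And>x. x = (\<Sum>(b, c)\<leftarrow>xs. c x *\<^sub>R b)"
  shows "\<exists>xs :: ('a \<times> ('a \<Rightarrow> real)) list.
    (\<forall>(b, c) \<in> set xs. (\<forall>x y. c (x + y) = c x + c y) \<and> (\<forall>r x. c (r *\<^sub>R x) = r * c x) \<and>
       (\<exists>K. \<forall>x. \<bar>c x\<bar> \<le> norm x * K)) \<and>
    (\<forall>x. x = (\<Sum>(b, c)\<leftarrow>xs. c x *\<^sub>R b))"
proof (intro exI[of _ xs] conjI allI assms(2) ballI)
  fix z assume "z \<in> set xs"
  then interpret bounded_linear "snd z" using assms(1) by (auto simp: case_prod_unfold)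
  show "case z of (b, c) \<Rightarrow> (\<forall>x y. c (x + y) = c x + c y) \<and> (\<forall>r x. c (r *\<^sub>R x) = r * c x) \<and>
       (\<exists>K. \<forall>x. \<bar>c x\<bar> \<le> norm x * K)"
    using bounded by (auto simp: case_prod_unfold add scaleR)
qed

instance euclidean_space \<subseteq> findim
proof
  obtain bs :: "'a list" where bs: "set bs = Basis" "distinct bs"
    using finite_distinct_list[OF finite_Basis] by blast
  have "x = (\<Sum>(b, c)\<leftarrow>map (\<lambda>b. (b, \<lambda>x. x \<bullet> b)) bs. c x *\<^sub>R b)" for x :: 'a
    using bs by (simp add: comp_def sum_list_distinct_conv_sum_set euclidean_representation)
  moreover have "\<forall>(b, c) \<in> set (map (\<lambda>b. (b, \<lambda>x. x \<bullet> b)) bs). bounded_linear c"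
    by (auto intro: bounded_linear_intros)
  ultimately show "\<exists>xs :: ('a \<times> ('a \<Rightarrow> real)) list.
    (\<forall>(b, c) \<in> set xs. (\<forall>x y. c (x + y) = c x + c y) \<and> (\<forall>r x. c (r *\<^sub>R x) = r * c x) \<and>
       (\<exists>K. \<forall>x. \<bar>c x\<bar> \<le> norm x * K)) \<and>
    (\<forall>x. x = (\<Sum>(b, c)\<leftarrow>xs. c x *\<^sub>R b))"
    by (rule ex_fin_coords_unfoldI[rotated])
qed

text \<open>Coordinates pull back along a finite resolution of the identity: if x is the sum of the
  \<open>e j (p j x)\<close>, then the functionals \<open>c \<circ> p j\<close> with the vectors
  \<open>e j b\<close> serve for x. Powers use the components and \<open>axis\<close>; spaces of
  bounded linear maps use evaluation on the basis and rank-one maps.\<close>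

lemma fin_coords_transfer:
  fixes p :: "'j \<Rightarrow> 'a::real_normed_vector \<Rightarrow> 'b::findim" and e :: "'j \<Rightarrow> 'b \<Rightarrow> 'a"
  assumes "finite J" and p: "\<And>j. j \<in> J \<Longrightarrow> bounded_linear (p j)"
    and e: "\<And>j. j \<in> J \<Longrightarrow> bounded_linear (e j)" and x: "\<And>x. x = (\<Sum>j\<in>J. e j (p j x))"
  shows "\<exists>xs :: ('a \<times> ('a \<Rightarrow> real)) list.
    (\<forall>(b, c) \<in> set xs. (\<forall>x y. c (x + y) = c x + c y) \<and> (\<forall>r x. c (r *\<^sub>R x) = r * c x) \<and>
       (\<exists>K. \<forall>x. \<bar>c x\<bar> \<le> norm x * K)) \<and>
    (\<forall>x. x = (\<Sum>(b, c)\<leftarrow>xs. c x *\<^sub>R b))"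
proof -
  obtain js where js: "set js = J" "distinct js" using finite_distinct_list[OF \<open>finite J\<close>] by blast
  obtain xs :: "('b \<times> ('b \<Rightarrow> real)) list" where xs: "\<forall>(b, c) \<in> set xs. bounded_linear c"
    "\<And>x. x = (\<Sum>(b, c)\<leftarrow>xs. c x *\<^sub>R b)" using ex_fin_coords by blast
  define ys where "ys = concat (map (\<lambda>j. map (\<lambda>(b, c). (e j b, c \<circ> p j)) xs) js)"
  have lin: "e j (\<Sum>(b, c)\<leftarrow>zs. c y *\<^sub>R b) = (\<Sum>(b, c)\<leftarrow>zs. c y *\<^sub>R e j b)" if "j \<in> J"
    for j y and zs :: "('b \<times> ('b \<Rightarrow> real)) list"
  proof -
    interpret bounded_linear "e j" using e that .
    show ?thesis by (induction zs) (auto simp: add scaleR zero)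
  qed
  have "x = (\<Sum>(b, c)\<leftarrow>ys. c x *\<^sub>R b)" for x
  proof -
    have "x = (\<Sum>j\<leftarrow>js. e j (p j x))"
      using x[of x] js by (simp add: sum_list_distinct_conv_sum_set)
    also have "\<dots> = (\<Sum>j\<leftarrow>js. \<Sum>(b, c)\<leftarrow>xs. c (p j x) *\<^sub>R e j b)"
      using lin js by (intro arg_cong[where f = sum_list] map_cong refl) (metis xs(2))
    also have "\<dots> = (\<Sum>(b, c)\<leftarrow>ys. c x *\<^sub>R b)"
      unfolding ys_def
      by (induction js) (simp_all add: comp_def case_prod_unfold)
    finally show ?thesis .
  qed
  moreover have "\<forall>(b, c) \<in> set ys. bounded_linear c"
    using xs(1) js bounded_linear_compose[OF _ p] unfolding ys_def by (fastforce simp: comp_def)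
  ultimately show ?thesis by (rule ex_fin_coords_unfoldI[rotated])
qed

lemma bounded_linear_axis: "bounded_linear (axis i :: 'b::real_normed_vector \<Rightarrow> 'b ^ 'n)"
proof (rule bounded_linear_intro[where K = 1])
  fix x y :: 'b and r :: real
  show "axis i (x + y) = (axis i x + axis i y :: 'b ^ 'n)" by (simp add: vec_eq_iff axis_def)
  show "axis i (r *\<^sub>R x) = (r *\<^sub>R axis i x :: 'b ^ 'n)" by (simp add: vec_eq_iff axis_def)
  have "norm (axis i x :: 'b ^ 'n) \<le> (\<Sum>j\<in>UNIV. norm (axis i x $ j))"
    unfolding norm_vec_def by (rule L2_set_le_sum) simp
  also have "\<dots> = (\<Sum>j\<in>UNIV. if j = i then norm x else 0)" by (intro sum.cong) (auto simp: axis_def)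
  finally show "norm (axis i x :: 'b ^ 'n) \<le> norm x * 1" by simp
qed

lemma vec_sum_axis: "x = (\<Sum>i\<in>UNIV. axis i (x $ i))" for x :: "'b::real_normed_vector ^ 'n"
  by (simp add: vec_eq_iff axis_def if_distrib cong: if_cong)

instance vec :: (findim, finite) findim
  by standard (rule fin_coords_transfer[where J = UNIV and p = "\<lambda>i x. x $ i" and e = axis],
    rule finite, rule bounded_linear_vec_nth, rule bounded_linear_axis, rule vec_sum_axis)

text \<open>Decomposition into rank-one maps. It reduces the operator norm topology to the finitely
  many values on \<open>Basis\<close>, which is also why \<open>smooth_on_blinfun\<close> may test
  smoothness on single vectors.\<close>

lemma blinfun_sum_Basis:
  "L = (\<Sum>b\<in>Basis. blinfun_scaleR_left (blinfun_apply L b) o\<^sub>L blinfun_inner_left b)"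
  for L :: "'e::euclidean_space \<Rightarrow>\<^sub>L 'f::real_normed_vector"
  by (rule blinfun_euclidean_eqI)
     (simp add: blinfun.sum_left inner_Basis if_distrib[of "\<lambda>x. x *\<^sub>R _"] cong: if_cong)

lemma bounded_linear_blinfun_coord:
  "bounded_linear (\<lambda>z. blinfun_scaleR_left z o\<^sub>L blinfun_inner_left b)"
  by (rule bounded_linear_compose[OF
      bounded_bilinear.bounded_linear_left[OF bounded_bilinear_blinfun_compose] bounded_linear_blinfun_scaleR_left])

lemma bounded_linear_eval: "bounded_linear (\<lambda>L :: 'e::real_normed_vector \<Rightarrow>\<^sub>L 'f::real_normed_vector. blinfun_apply L x)"
  by (rule bounded_bilinear.bounded_linear_left[OF bounded_bilinear_blinfun_apply])

instance blinfun :: (euclidean_space, findim) findim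
  by standard (rule fin_coords_transfer[where J = Basis and p = "\<lambda>b L. blinfun_apply L b"
        and e = "\<lambda>b z. blinfun_scaleR_left z o\<^sub>L blinfun_inner_left b"],
    rule finite_Basis, rule bounded_linear_eval,
    rule bounded_linear_blinfun_coord, rule blinfun_sum_Basis)

instance prod :: (findim, findim) findim
proof
  obtain xs :: "('a \<times> ('a \<Rightarrow> real)) list" where xs: "\<forall>(b, c) \<in> set xs. bounded_linear c"
    "\<And>x. x = (\<Sum>(b, c)\<leftarrow>xs. c x *\<^sub>R b)" using ex_fin_coords by blast
  obtain ys :: "('b \<times> ('b \<Rightarrow> real)) list" where ys: "\<forall>(b, c) \<in> set ys. bounded_linear c"
    "\<And>x. x = (\<Sum>(b, c)\<leftarrow>ys. c x *\<^sub>R b)" using ex_fin_coords by blast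
  define zs :: "(('a \<times> 'b) \<times> ('a \<times> 'b \<Rightarrow> real)) list"
    where "zs = map (\<lambda>(b, c). ((b, 0), c \<circ> fst)) xs @ map (\<lambda>(b, c). ((0, b), c \<circ> snd)) ys"
  have 1: "(\<Sum>(b, c)\<leftarrow>map (\<lambda>(b, c). ((b, 0::'b), c \<circ> fst)) us. c z *\<^sub>R b) = ((\<Sum>(b, c)\<leftarrow>us. c (fst z) *\<^sub>R b), 0)"
    for us :: "('a \<times> ('a \<Rightarrow> real)) list" and z
    by (induction us) (auto simp: zero_prod_def)
  have 2: "(\<Sum>(b, c)\<leftarrow>map (\<lambda>(b, c). ((0::'a, b), c \<circ> snd)) us. c z *\<^sub>R b) = (0, (\<Sum>(b, c)\<leftarrow>us. c (snd z) *\<^sub>R b))"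
    for us :: "('b \<times> ('b \<Rightarrow> real)) list" and z
    by (induction us) (auto simp: zero_prod_def)
  have "z = (\<Sum>(b, c)\<leftarrow>zs. c z *\<^sub>R b)" for z
    unfolding zs_def map_append sum_list_append 1 2 using xs(2)[of "fst z"] ys(2)[of "snd z"]
    by (simp add: prod_eq_iff)
  moreover have "\<forall>(b, c) \<in> set zs. bounded_linear c"
    using xs(1) ys(1) bounded_linear_compose[OF _ bounded_linear_fst] bounded_linear_compose[OF _ bounded_linear_snd]
    unfolding zs_def by (fastforce simp: comp_def)
  ultimately show "\<exists>xs :: (('a \<times> 'b) \<times> ('a \<times> 'b \<Rightarrow> real)) list.
    (\<forall>(b, c) \<in> set xs. (\<forall>x y. c (x + y) = c x + c y) \<and> (\<forall>r x. c (r *\<^sub>R x) = r * c x) \<and>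
       (\<exists>K. \<forall>x. \<bar>c x\<bar> \<le> norm x * K)) \<and>
    (\<forall>x. x = (\<Sum>(b, c)\<leftarrow>xs. c x *\<^sub>R b))"
    by (rule ex_fin_coords_unfoldI[rotated])
qed

text \<open>Openness of S matters: \<open>ck_on\<close> differentiates at points of S in the whole
  space, so the values of f on a neighbourhood enter, and agreement on an arbitrary set would say
  nothing about them.\<close>

lemma ck_on_cong:
  assumes "open S" "\<And>x. x \<in> S \<Longrightarrow> f x = g x"
  shows "ck_on k S f \<longleftrightarrow> ck_on k S g"
  using assms
proof (induction k arbitrary: f g)
  case 0
  then show ?case by (simp cong: continuous_on_cong)
next
  case (Suc k)
  have d: "(f has_derivative D) (at x) \<longleftrightarrow> (g has_derivative D) (at x)" if "x \<in> S" for x D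
    using has_derivative_transform_within_open[OF _ Suc.prems(1) that] Suc.prems(2) by metis
  have e: "frechet_derivative f (at x) = frechet_derivative g (at x)" if "x \<in> S" for x
    unfolding frechet_derivative_def using d[OF that] by simp
  show ?case
    using Suc.IH[OF Suc.prems(1), of "\<lambda>x. frechet_derivative f (at x) _" "\<lambda>x. frechet_derivative g (at x) _"] d e
    by (simp add: differentiable_def)
qed

text \<open>Replaces the chosen \<open>frechet_derivative\<close> by any derivative D known in
  closed form; uniqueness of the derivative makes the two agree on S.\<close>

lemma ck_on_SucI:
  assumes "open S" "\<And>x. x \<in> S \<Longrightarrow> (f has_derivative D x) (at x)" "\<And>v. ck_on k S (\<lambda>x. D x v)"
  shows "ck_on (Suc k) S f"
proof -
  have "D x = frechet_derivative f (at x)" if "x \<in> S" for x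
    using frechet_derivative_at assms(2) that by blast
  then have "ck_on k S (\<lambda>x. frechet_derivative f (at x) v)" for v
    using ck_on_cong[OF assms(1), of "\<lambda>x. D x v" "\<lambda>x. frechet_derivative f (at x) v" k] assms(3) by simp
  then show ?thesis using assms(2) by (auto simp: differentiable_def)
qed

lemma ck_on_SucD:
  "ck_on (Suc k) S f \<Longrightarrow> x \<in> S \<Longrightarrow> (f has_derivative frechet_derivative f (at x)) (at x)"
  by (simp add: frechet_derivative_works)

lemma ck_on_Suc_imp: "ck_on (Suc k) S f \<Longrightarrow> ck_on k S f"
proof (induction k arbitrary: f)
  case 0
  then show ?case
    by (auto intro!: continuous_at_imp_continuous_on differentiable_imp_continuous_within)
qed auto

lemma ck_on_subset: "ck_on k S f \<Longrightarrow> T \<subseteq> S \<Longrightarrow> ck_on k T f"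
  by (induction k arbitrary: f) (auto intro: continuous_on_subset)

lemma ck_on_local:
  assumes "\<And>x. x \<in> S \<Longrightarrow> \<exists>T. open T \<and> x \<in> T \<and> ck_on k T f"
  shows "ck_on k S f"
  using assms
proof (induction k arbitrary: f)
  case 0
  then show ?case
    by (metis ck_on.simps(1) continuous_at_imp_continuous_on continuous_on_eq_continuous_at)
next
  case (Suc k)
  show ?case unfolding ck_on.simps
  proof (intro conjI ballI allI)
    fix x assume "x \<in> S"
    then show "f differentiable at x" using Suc.prems by fastforce
  next
    fix v
    show "ck_on k S (\<lambda>x. frechet_derivative f (at x) v)"
      using Suc.prems by (intro Suc.IH) fastforce
  qed
qed

lemma ck_on_bounded_linear_comp:
  assumes "bounded_linear L" "open S" "ck_on k S f"
  shows "ck_on k S (\<lambda>x. L (f x))"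
  using assms(3)
proof (induction k arbitrary: f)
  case 0
  then show ?case using bounded_linear.continuous_on[OF assms(1)] by simp
next
  case (Suc k)
  show ?case
    by (rule ck_on_SucI[OF assms(2) bounded_linear.has_derivative[OF assms(1) ck_on_SucD[OF Suc.prems]]])
       (use Suc in auto)
qed

lemma ck_on_const: "ck_on k S (\<lambda>x. c)"
  by (induction k arbitrary: c) auto

lemma ck_on_add:
  assumes "open S" "ck_on k S f" "ck_on k S g"
  shows "ck_on k S (\<lambda>x. f x + g x)"
  using assms(2,3)
proof (induction k arbitrary: f g)
  case 0
  then show ?case by (simp add: continuous_on_add)
next
  case (Suc k)
  show ?case
    by (rule ck_on_SucI[OF assms(1) has_derivative_add[OF ck_on_SucD[OF Suc.prems(1)] ck_on_SucD[OF Suc.prems(2)]]])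
       (use Suc in auto)
qed

text \<open>The product rule expresses the derivative by the same bilinear map, applied to one
  function and the derivative of the other. So the induction runs over all f and g at once and uses
  that C^(k+1) implies C^k for the undifferentiated factor.\<close>

lemma ck_on_bilinear:
  assumes "bounded_bilinear b" "open S" "ck_on k S f" "ck_on k S g"
  shows "ck_on k S (\<lambda>x. b (f x) (g x))"
  using assms(3,4)
proof (induction k arbitrary: f g)
  case 0
  then show ?case using bounded_bilinear.continuous_on[OF assms(1)] by simp
next
  case (Suc k)
  note fg = ck_on_Suc_imp[OF Suc.prems(1)] ck_on_Suc_imp[OF Suc.prems(2)]
  show ?case
    by (rule ck_on_SucI[OF assms(2) bounded_bilinear.FDERIV[OF assms(1) ck_on_SucD[OF Suc.prems(1)] ck_on_SucD[OF Suc.prems(2)]]])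
       (use Suc fg in \<open>auto intro!: ck_on_add assms(2)\<close>)
qed

lemma ck_on_sum_list:
  assumes "open S" "\<And>x. x \<in> set xs \<Longrightarrow> ck_on k S (f x)"
  shows "ck_on k S (\<lambda>y. \<Sum>x\<leftarrow>xs. f x y)"
  using assms(2) by (induction xs) (auto intro!: ck_on_const ck_on_add assms(1))

text \<open>In the chain rule both the map \<open>frechet_derivative g (at (f x))\<close> and its
  argument vary with x. Expanding the argument in finite coordinates leaves a sum of products of
  scalars with derivatives of g in fixed directions b, to which the induction hypothesis
  applies.\<close>

lemma ck_on_compose:
  fixes f :: "'e::real_normed_vector \<Rightarrow> 'f::findim" and g :: "'f \<Rightarrow> 'g::real_normed_vector"
  assumes "open S" "open T" "ck_on k S f" "ck_on k T g" "f ` S \<subseteq> T"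
  shows "ck_on k S (\<lambda>x. g (f x))"
  using assms(3,4)
proof (induction k arbitrary: g)
  case 0
  then show ?case using assms(5) by (auto intro: continuous_on_compose2)
next
  case (Suc k)
  obtain xs :: "('f \<times> ('f \<Rightarrow> real)) list" where xs: "\<forall>(b, c) \<in> set xs. bounded_linear c"
    "\<And>x. x = (\<Sum>(b, c)\<leftarrow>xs. c x *\<^sub>R b)" using ex_fin_coords by blast
  let ?D = "\<lambda>f x. frechet_derivative f (at x)"
  have d: "((\<lambda>x. g (f x)) has_derivative (\<lambda>v. ?D g (f x) (?D f x v))) (at x)" if "x \<in> S" for x
    using diff_chain_at[OF ck_on_SucD[OF Suc.prems(1) that] ck_on_SucD[OF Suc.prems(2)]] that assms(5)
    by (auto simp: comp_def)
  have e: "?D g (f x) (?D f x v) = (\<Sum>(b, c)\<leftarrow>xs. c (?D f x v) *\<^sub>R ?D g (f x) b)" if "x \<in> S" for x v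
  proof -
    interpret bounded_linear "?D g (f x)"
      using ck_on_SucD[OF Suc.prems(2)] that assms(5) by (auto intro: has_derivative_bounded_linear)
    have "?D g (f x) (\<Sum>(b, c)\<leftarrow>xs. c w *\<^sub>R b) = (\<Sum>(b, c)\<leftarrow>xs. c w *\<^sub>R ?D g (f x) b)" for w
      by (induction xs) (auto simp: add scaleR zero)
    then have "?D g (f x) (\<Sum>(b, c)\<leftarrow>xs. c (?D f x v) *\<^sub>R b) = (\<Sum>(b, c)\<leftarrow>xs. c (?D f x v) *\<^sub>R ?D g (f x) b)" .
    then show ?thesis by (simp only: xs(2)[symmetric])
  qed
  show ?case
  proof (rule ck_on_SucI[OF assms(1) d])
    fix v
    have "ck_on k S (\<lambda>x. ?D g (f x) b)" for b
      by (rule Suc.IH) (use Suc.prems ck_on_Suc_imp in auto)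
    then have "ck_on k S (\<lambda>x. c (?D f x v) *\<^sub>R ?D g (f x) b)" if "(b, c) \<in> set xs" for b c
      using xs(1) Suc.prems(1) that
      by (intro ck_on_bilinear[OF bounded_bilinear_scaleR] ck_on_bounded_linear_comp[of c]) (auto simp: assms(1))
    then have "ck_on k S (\<lambda>x. (\<Sum>(b, c)\<leftarrow>xs. c (?D f x v) *\<^sub>R ?D g (f x) b))"
      by (intro ck_on_sum_list assms(1)) (auto simp: case_prod_unfold)
    then show "ck_on k S (\<lambda>x. ?D g (f x) (?D f x v))"
      using ck_on_cong[OF assms(1), of "\<lambda>x. ?D g (f x) (?D f x v)"] e by simp
  qed
qed

section \<open>Closure properties of smooth maps\<close>

lemma smooth_on_cong:
  assumes "open S" "\<And>x. x \<in> S \<Longrightarrow> f x = g x"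
  shows "smooth_on S f \<longleftrightarrow> smooth_on S g"
  unfolding smooth_on_def using ck_on_cong[OF assms] by simp

lemma smooth_on_subset: "smooth_on S f \<Longrightarrow> T \<subseteq> S \<Longrightarrow> smooth_on T f"
  unfolding smooth_on_def using ck_on_subset by blast

lemma smooth_on_local:
  "(\<And>x. x \<in> S \<Longrightarrow> \<exists>T. open T \<and> x \<in> T \<and> smooth_on T f) \<Longrightarrow> smooth_on S f"
  unfolding smooth_on_def using ck_on_local by metis

lemma smooth_on_imp_continuous_on: "smooth_on S f \<Longrightarrow> continuous_on S f"
  unfolding smooth_on_def by (metis ck_on.simps(1))

lemma smooth_on_has_derivative:
  "smooth_on S f \<Longrightarrow> x \<in> S \<Longrightarrow> (f has_derivative frechet_derivative f (at x)) (at x)"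
  unfolding smooth_on_def using ck_on_SucD by blast

lemma smooth_on_frechet_derivative:
  "smooth_on S f \<Longrightarrow> smooth_on S (\<lambda>x. frechet_derivative f (at x) v)"
  unfolding smooth_on_def using ck_on.simps(2) by blast

lemma smooth_on_compose:
  fixes f :: "'e::real_normed_vector \<Rightarrow> 'f::findim"
  shows "smooth_on S f \<Longrightarrow> smooth_on T g \<Longrightarrow> open S \<Longrightarrow> open T \<Longrightarrow> f ` S \<subseteq> T \<Longrightarrow> smooth_on S (\<lambda>x. g (f x))"
  unfolding smooth_on_def using ck_on_compose by blast

named_theorems smooth_intros

lemma smooth_on_const [smooth_intros]: "smooth_on S (\<lambda>x. c)"
  unfolding smooth_on_def by (simp add: ck_on_const)

lemma smooth_on_linear_comp: "bounded_linear L \<Longrightarrow> open S \<Longrightarrow> smooth_on S f \<Longrightarrow> smooth_on S (\<lambda>x. L (f x))"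
  unfolding smooth_on_def by (simp add: ck_on_bounded_linear_comp)

lemma smooth_on_ident [smooth_intros]: "open S \<Longrightarrow> smooth_on S (\<lambda>x. x)"
  unfolding smooth_on_def
proof
  fix k assume "open S"
  then show "ck_on k S (\<lambda>x. x)"
  proof (cases k)
    case (Suc k)
    show ?thesis unfolding Suc
      by (rule ck_on_SucI[OF \<open>open S\<close> has_derivative_ident]) (rule ck_on_const)
  qed simp
qed

lemma smooth_on_bounded_linear: "bounded_linear L \<Longrightarrow> open S \<Longrightarrow> smooth_on S L"
  using smooth_on_linear_comp[OF _ _ smooth_on_ident] by blast

lemma smooth_on_add [smooth_intros]:
  "open S \<Longrightarrow> smooth_on S f \<Longrightarrow> smooth_on S g \<Longrightarrow> smooth_on S (\<lambda>x. f x + g x)"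
  unfolding smooth_on_def by (simp add: ck_on_add)

lemma smooth_on_bilinear:
  "bounded_bilinear b \<Longrightarrow> open S \<Longrightarrow> smooth_on S f \<Longrightarrow> smooth_on S g \<Longrightarrow> smooth_on S (\<lambda>x. b (f x) (g x))"
  unfolding smooth_on_def by (simp add: ck_on_bilinear)

lemmas smooth_on_mult [smooth_intros] =
  smooth_on_bilinear[OF bounded_bilinear_mult]
lemmas smooth_on_blinfun_apply [smooth_intros] = smooth_on_bilinear[OF bounded_bilinear_blinfun_apply]
lemmas smooth_on_fst [smooth_intros] = smooth_on_linear_comp[OF bounded_linear_fst]
lemmas smooth_on_snd [smooth_intros] = smooth_on_linear_comp[OF bounded_linear_snd]
lemmas smooth_on_of_real [smooth_intros] =
  smooth_on_linear_comp[OF bounded_linear_of_real]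
lemmas smooth_on_vec_nth [smooth_intros] = smooth_on_linear_comp[OF bounded_linear_vec_nth]

lemma smooth_on_minus [smooth_intros]: "open S \<Longrightarrow> smooth_on S f \<Longrightarrow> smooth_on S (\<lambda>x. - f x)"
  by (rule smooth_on_linear_comp[OF bounded_linear_minus[OF bounded_linear_ident]])

lemma smooth_on_diff [smooth_intros]:
  "open S \<Longrightarrow> smooth_on S f \<Longrightarrow> smooth_on S g \<Longrightarrow> smooth_on S (\<lambda>x. f x - g x)"
  using smooth_on_add[OF _ _ smooth_on_minus] by fastforce

lemma smooth_on_sum [smooth_intros]:
  "open S \<Longrightarrow> (\<And>i. i \<in> I \<Longrightarrow> smooth_on S (f i)) \<Longrightarrow> smooth_on S (\<lambda>x. \<Sum>i\<in>I. f i x)"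
  by (induction I rule: infinite_finite_induct) (auto intro!: smooth_intros)

lemma smooth_on_power [smooth_intros]:
  fixes f :: "_ \<Rightarrow> 'a::real_normed_algebra_1"
  shows "open S \<Longrightarrow> smooth_on S f \<Longrightarrow> smooth_on S (\<lambda>x. f x ^ n)"
  by (induction n) (auto intro!: smooth_intros)

lemma smooth_on_Pair [smooth_intros]:
  assumes "open S" "smooth_on S f" "smooth_on S g"
  shows "smooth_on S (\<lambda>x. (f x, g x))"
proof -
  have "smooth_on S (\<lambda>x. (f x, 0) + (0, g x))"
    by (intro smooth_on_add assms
      smooth_on_linear_comp[OF bounded_linear_Pair[OF bounded_linear_ident bounded_linear_zero]]
      smooth_on_linear_comp[OF bounded_linear_Pair[OF bounded_linear_zero bounded_linear_ident]])
  then show ?thesis by simp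
qed

lemma smooth_on_vec_lambda [smooth_intros]:
  assumes "open S" "\<And>i. smooth_on S (\<lambda>x. f x i)"
  shows "smooth_on S (\<lambda>x. \<chi> i. f x i)"
proof -
  have "smooth_on S (\<lambda>x. \<Sum>i\<in>UNIV. axis i (f x i))"
    by (intro smooth_on_sum assms smooth_on_linear_comp[OF bounded_linear_axis])
  also have "(\<lambda>x. \<Sum>i\<in>UNIV. axis i (f x i)) = (\<lambda>x. \<chi> i. f x i)"
    using vec_sum_axis[of "\<chi> i. f _ i"] by simp
  finally show ?thesis .
qed

lemma smooth_on_blinfun:
  fixes f :: "'a::real_normed_vector \<Rightarrow> 'e::euclidean_space \<Rightarrow>\<^sub>L 'f::real_normed_vector"
  assumes "open S" "\<And>b. smooth_on S (\<lambda>x. blinfun_apply (f x) b)"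
  shows "smooth_on S f"
proof -
  have "smooth_on S (\<lambda>x. \<Sum>b\<in>Basis. blinfun_scaleR_left (blinfun_apply (f x) b) o\<^sub>L blinfun_inner_left b)"
    by (intro smooth_on_sum assms smooth_on_linear_comp[OF bounded_linear_blinfun_coord])
  then show ?thesis using blinfun_sum_Basis[of "f _"] by simp
qed

text \<open>The derivative of inversion is a polynomial in the inverse itself, so C^k bootstraps to
  C^(k+1).\<close>

lemma smooth_on_inverse_ident: "smooth_on (- {0}) (inverse :: complex \<Rightarrow> complex)"
  unfolding smooth_on_def
proof
  fix k
  show "ck_on k (- {0}) (inverse :: complex \<Rightarrow> complex)"
  proof (induction k)
    case 0
    then show ?case by (auto intro!: continuous_intros)
  next
    case (Suc k)
    show ?case
    proof (rule ck_on_SucI)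
      show "(inverse has_derivative (\<lambda>h. - (inverse x * h * inverse x))) (at x)" if "x \<in> - {0}" for x :: complex
        using that by (intro has_derivative_inverse') simp
      show "ck_on k (- {0}) (\<lambda>x. - (inverse x * v * inverse x))" for v :: complex
        by (intro ck_on_bounded_linear_comp[OF bounded_linear_minus[OF bounded_linear_ident]]
          ck_on_bilinear[OF bounded_bilinear_mult] Suc.IH ck_on_const) auto
    qed auto
  qed
qed

lemma smooth_on_inverse [smooth_intros]:
  fixes f :: "_ \<Rightarrow> complex"
  shows "open S \<Longrightarrow> smooth_on S f \<Longrightarrow> (\<And>x. x \<in> S \<Longrightarrow> f x \<noteq> 0) \<Longrightarrow> smooth_on S (\<lambda>x. inverse (f x))"
  by (rule smooth_on_compose[OF _ smooth_on_inverse_ident]) auto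

lemma smooth_on_divide [smooth_intros]:
  fixes f :: "_ \<Rightarrow> complex"
  shows "open S \<Longrightarrow> smooth_on S f \<Longrightarrow> smooth_on S g \<Longrightarrow> (\<And>x. x \<in> S \<Longrightarrow> g x \<noteq> 0)
    \<Longrightarrow> smooth_on S (\<lambda>x. f x / g x)"
  unfolding divide_inverse by (intro smooth_intros)

text \<open>The logarithmic derivative of a cube root is \<open>1 / (3 z)\<close>, so regularity bootstraps.\<close>

lemma smooth_cube_root:
  fixes a :: complex
  assumes "a \<noteq> 0"
  obtains V r where "open V" "a ^ 3 \<in> V" "smooth_on V r" "r (a ^ 3) = a" "\<And>z. z \<in> V \<Longrightarrow> r z ^ 3 = z" "0 \<notin> V"
proof -
  \<comment> \<open>The half-plane around a ^ 3 keeps z / a ^ 3 off the branch cut of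
    \<open>Ln\<close> and off 0. The normalisation by a ^ 3 gives \<open>Ln 1 = 0\<close> at the
    base point, hence the branch whose value there is a.\<close>
  define V where "V = {z. 0 < Re (z / a ^ 3)}"
  define r where "r z = a * exp (Ln (z / a ^ 3) / 3)" for z
  have V: "open V" unfolding V_def by (intro open_Collect_less continuous_intros) (use assms in auto)
  have nz: "z / a ^ 3 \<noteq> 0" "z / a ^ 3 \<notin> \<real>\<^sub>\<le>\<^sub>0" "z \<noteq> 0" if "z \<in> V" for z
    using that unfolding V_def by (auto simp: complex_nonpos_Reals_iff)
  have cube: "r z ^ 3 = z" if "z \<in> V" for z
  proof -
    have "exp (Ln (z / a ^ 3) / 3) ^ 3 = exp (Ln (z / a ^ 3))"
      by (simp flip: exp_of_nat_mult)
    then show ?thesis unfolding r_def power_mult_distrib using nz[OF that] assms by simp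
  qed
  have der: "(r has_derivative (\<lambda>h. r z / (3 * z) * h)) (at z)" if "z \<in> V" for z
  proof -
    have "(r has_field_derivative (r z / (3 * z))) (at z)"
      unfolding r_def using nz[OF that] assms
      by (auto intro!: derivative_eq_intros simp: field_simps)
    then show ?thesis by (simp add: has_field_derivative_def times_divide_eq_left[symmetric] del: times_divide_eq_left)
  qed
  have "ck_on k V r" for k
  proof (induction k)
    case 0
    have "continuous (at z) r" if "z \<in> V" for z
      using has_derivative_continuous[OF der[OF that]] .
    then show ?case by (simp add: continuous_at_imp_continuous_on)
  next
    case (Suc k)
    have "ck_on k V (\<lambda>z. inverse (3 * z))"
      using smooth_on_inverse[OF V, of "\<lambda>z. 3 * z"] nz(3)
        smooth_on_mult[OF V smooth_on_const smooth_on_ident[OF V]]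
      unfolding smooth_on_def by auto
    then show ?case
      unfolding divide_inverse
      by (intro ck_on_SucI[OF V der[unfolded divide_inverse]] ck_on_bilinear[OF bounded_bilinear_mult] V Suc.IH
          ck_on_const) auto
  qed
  then have "smooth_on V r" by (simp add: smooth_on_def)
  moreover have "a ^ 3 \<in> V" "0 \<notin> V" "r (a ^ 3) = a" using assms unfolding V_def r_def by auto
  ultimately show thesis using that V cube by blast
qed

subsection \<open>Symmetry of second derivatives\<close>

text \<open>Two applications of the mean value theorem to the mixed difference over a parallelogram:
  along u, and then along v. The left side of the equation is symmetric in u and v while the right
  side is not, which is what the symmetry of second derivatives exploits.\<close>

lemma second_difference:
  fixes f :: "'e::real_normed_vector \<Rightarrow> real"
  assumes sm: "smooth_on S f" and "0 < h"
    and S: "\<And>s t. 0 \<le> s \<Longrightarrow> s \<le> h \<Longrightarrow> 0 \<le> t \<Longrightarrow> t \<le> h \<Longrightarrow> x + s *\<^sub>R u + t *\<^sub>R v \<in> S"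
  shows "\<exists>s t. 0 < s \<and> s < h \<and> 0 < t \<and> t < h \<and>
    f (x + h *\<^sub>R u + h *\<^sub>R v) - f (x + h *\<^sub>R u) - f (x + h *\<^sub>R v) + f x =
    h * h * frechet_derivative (\<lambda>y. frechet_derivative f (at y) u) (at (x + s *\<^sub>R u + t *\<^sub>R v)) v"
proof -
  let ?D = "\<lambda>f y. frechet_derivative f (at y)"
  have line: "((\<lambda>s. g (a + s *\<^sub>R w)) has_real_derivative ?D g (a + s *\<^sub>R w) w) (at s)"
    if g: "smooth_on S g" "a + s *\<^sub>R w \<in> S" for g :: "'e \<Rightarrow> real" and a w s
  proof -
    have l: "((\<lambda>s. a + s *\<^sub>R w) has_derivative (\<lambda>r. r *\<^sub>R w)) (at s)"
      by (auto intro!: derivative_eq_intros)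
    note d = diff_chain_at[OF l smooth_on_has_derivative[OF g], unfolded comp_def]
    interpret bounded_linear "?D g (a + s *\<^sub>R w)"
      using smooth_on_has_derivative[OF g] by (rule has_derivative_bounded_linear)
    show ?thesis by (rule has_derivative_imp_has_field_derivative[OF d]) (simp add: scaleR)
  qed
  let ?\<phi> = "\<lambda>s. f ((x + h *\<^sub>R v) + s *\<^sub>R u) - f (x + s *\<^sub>R u)"
  have "\<exists>s. 0 < s \<and> s < h \<and> ?\<phi> h - ?\<phi> 0 =
      (h - 0) * (?D f ((x + h *\<^sub>R v) + s *\<^sub>R u) u - ?D f (x + s *\<^sub>R u) u)"
  proof (rule MVT2[OF \<open>0 < h\<close>])
    fix s :: real assume s: "0 \<le> s" "s \<le> h"
    show "(?\<phi> has_real_derivative ?D f ((x + h *\<^sub>R v) + s *\<^sub>R u) u - ?D f (x + s *\<^sub>R u) u) (at s)"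
      using S[OF s, of h] S[OF s, of 0] \<open>0 < h\<close>
      by (intro DERIV_diff line sm) (auto simp: algebra_simps)
  qed
  then obtain s where s: "0 < s" "s < h" "?\<phi> h - ?\<phi> 0 =
      h * (?D f ((x + h *\<^sub>R v) + s *\<^sub>R u) u - ?D f (x + s *\<^sub>R u) u)" by auto
  have "\<exists>t. 0 < t \<and> t < h \<and> ?D f ((x + s *\<^sub>R u) + h *\<^sub>R v) u - ?D f ((x + s *\<^sub>R u) + 0 *\<^sub>R v) u =
      (h - 0) * ?D (\<lambda>y. ?D f y u) ((x + s *\<^sub>R u) + t *\<^sub>R v) v"
    using S[of s] s by (intro MVT2[OF \<open>0 < h\<close>] line smooth_on_frechet_derivative[OF sm]) auto
  then obtain t where "0 < t" "t < h" "?D f ((x + s *\<^sub>R u) + h *\<^sub>R v) u - ?D f (x + s *\<^sub>R u) u =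
      h * ?D (\<lambda>y. ?D f y u) ((x + s *\<^sub>R u) + t *\<^sub>R v) v" by auto
  with s show ?thesis by (intro exI[of _ s] exI[of _ t]) (simp add: algebra_simps)
qed

text \<open>Schwarz's theorem: the mixed difference divided by h * h equals each of the two mixed
  derivatives at some point of the parallelogram. These points tend to x as h shrinks, and both
  mixed derivatives are continuous.\<close>

lemma symmetric_second_derivative_real:
  fixes f :: "'e::real_normed_vector \<Rightarrow> real"
  assumes sm: "smooth_on S f" and S: "open S" "x \<in> S"
  shows "frechet_derivative (\<lambda>y. frechet_derivative f (at y) u) (at x) v =
         frechet_derivative (\<lambda>y. frechet_derivative f (at y) v) (at x) u"
proof -
  define F where "F u v y = frechet_derivative (\<lambda>y. frechet_derivative f (at y) u) (at y) v" for u v y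
  have cont: "continuous (at x) (F u v)" for u v
    using smooth_on_frechet_derivative[OF smooth_on_frechet_derivative[OF sm]] S
    unfolding F_def by (metis smooth_on_imp_continuous_on continuous_on_eq_continuous_at)
  obtain e where e: "0 < e" "ball x e \<subseteq> S" using S openE by blast
  \<comment> \<open>The summand 1 makes N positive even for u = v = 0 and gives the strict
    inequality (norm u + norm v) / N < 1 in \<open>small\<close>.\<close>
  define N where "N = norm u + norm v + 1"
  have N: "0 < N" unfolding N_def by (simp add: add_nonneg_pos)
  have small: "dist (x + s *\<^sub>R u + t *\<^sub>R v) x < \<epsilon>" if "0 \<le> s" "s \<le> \<epsilon> / (2 * N)" "0 \<le> t" "t \<le> \<epsilon> / (2 * N)" "0 < \<epsilon>" for s t \<epsilon>
  proof -
    have "norm (s *\<^sub>R u + t *\<^sub>R v) \<le> s * norm u + t * norm v"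
      using that by (metis norm_triangle_le norm_scaleR abs_of_nonneg order_refl)
    also have "\<dots> \<le> \<epsilon> / (2 * N) * norm u + \<epsilon> / (2 * N) * norm v"
      using that by (intro add_mono mult_right_mono) auto
    also have "\<dots> = \<epsilon> / 2 * ((norm u + norm v) / N)" by (simp add: field_simps add_divide_distrib)
    also have "\<dots> < \<epsilon> / 2 * 1" using that N by (intro mult_strict_left_mono) (auto simp: N_def)
    also have "\<dots> < \<epsilon>" using that by simp
    finally show ?thesis by (simp add: dist_norm add.assoc)
  qed
  have "dist (F u v x) (F v u x) < \<epsilon>" if "0 < \<epsilon>" for \<epsilon>
  proof -
    obtain d1 where d1: "0 < d1" "\<And>y. dist y x < d1 \<Longrightarrow> dist (F u v y) (F u v x) < \<epsilon> / 2"
      using cont[of u v] \<open>0 < \<epsilon>\<close> unfolding continuous_at_eps_delta by (metis half_gt_zero)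
    obtain d2 where d2: "0 < d2" "\<And>y. dist y x < d2 \<Longrightarrow> dist (F v u y) (F v u x) < \<epsilon> / 2"
      using cont[of v u] \<open>0 < \<epsilon>\<close> unfolding continuous_at_eps_delta by (metis half_gt_zero)
    define d where "d = min e (min d1 d2)"
    define h where "h = d / (2 * N)"
    have d: "0 < d" "d \<le> e" "d \<le> d1" "d \<le> d2" using e d1 d2 by (auto simp: d_def)
    have h: "0 < h" using d N by (simp add: h_def)
    have near: "dist (x + s *\<^sub>R u + t *\<^sub>R v) x < d" "dist (x + s *\<^sub>R v + t *\<^sub>R u) x < d"
      if "0 \<le> s" "s \<le> h" "0 \<le> t" "t \<le> h" for s t
      using small[of s d t] small[of t d s] that d unfolding h_def by (auto simp: algebra_simps)
    have inS: "x + s *\<^sub>R u + t *\<^sub>R v \<in> S" "x + s *\<^sub>R v + t *\<^sub>R u \<in> S"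
      if "0 \<le> s" "s \<le> h" "0 \<le> t" "t \<le> h" for s t
      using near[OF that] d e(2) by (auto simp: dist_commute subset_iff)
    obtain s t where 1: "0 < s" "s < h" "0 < t" "t < h"
      "f (x + h *\<^sub>R u + h *\<^sub>R v) - f (x + h *\<^sub>R u) - f (x + h *\<^sub>R v) + f x = h * h * F u v (x + s *\<^sub>R u + t *\<^sub>R v)"
      using second_difference[OF sm h inS(1)] unfolding F_def by blast
    obtain s' t' where 2: "0 < s'" "s' < h" "0 < t'" "t' < h"
      "f (x + h *\<^sub>R v + h *\<^sub>R u) - f (x + h *\<^sub>R v) - f (x + h *\<^sub>R u) + f x = h * h * F v u (x + s' *\<^sub>R v + t' *\<^sub>R u)"
      using second_difference[OF sm h inS(2)] unfolding F_def by blast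
    have "h * h * F u v (x + s *\<^sub>R u + t *\<^sub>R v) = h * h * F v u (x + s' *\<^sub>R v + t' *\<^sub>R u)"
      using 1(5) 2(5) by (simp add: algebra_simps)
    then have eq: "F u v (x + s *\<^sub>R u + t *\<^sub>R v) = F v u (x + s' *\<^sub>R v + t' *\<^sub>R u)" using h by simp
    have "dist (F u v (x + s *\<^sub>R u + t *\<^sub>R v)) (F u v x) < \<epsilon> / 2" using d1(2) near(1)[of s t] 1 d by force
    moreover have "dist (F v u (x + s' *\<^sub>R v + t' *\<^sub>R u)) (F v u x) < \<epsilon> / 2" using d2(2) near(2)[of s' t'] 2 d by force
    ultimately show ?thesis using eq by (metis dist_triangle_half_l dist_commute)
  qed
  then have "dist (F u v x) (F v u x) \<le> 0" by (meson dense_ge less_imp_le)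
  then show ?thesis unfolding F_def by simp
qed

lemma symmetric_second_derivative:
  fixes f :: "'e::real_normed_vector \<Rightarrow> 'f::euclidean_space"
  assumes sm: "smooth_on S f" and S: "open S" "x \<in> S"
  shows "frechet_derivative (\<lambda>y. frechet_derivative f (at y) u) (at x) v =
         frechet_derivative (\<lambda>y. frechet_derivative f (at y) v) (at x) u"
proof (rule euclidean_eqI)
  fix b :: 'f assume "b \<in> Basis"
  let ?D = "\<lambda>f y. frechet_derivative f (at y)"
  have 1: "?D (\<lambda>y. g y \<bullet> b) y w = ?D g y w \<bullet> b" if "smooth_on S g" "y \<in> S" for g :: "'e \<Rightarrow> 'f" and y w
    using frechet_derivative_at[OF bounded_linear.has_derivative[OF bounded_linear_inner_left[of b] smooth_on_has_derivative[OF that]]]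
    by metis
  have 2: "?D (\<lambda>y. ?D f y u) x v \<bullet> b = ?D (\<lambda>y. ?D (\<lambda>y. f y \<bullet> b) y u) x v" for u v
  proof -
    note sm2 = smooth_on_frechet_derivative[OF sm, of u]
    have "((\<lambda>y. ?D f y u \<bullet> b) has_derivative (\<lambda>w. ?D (\<lambda>y. ?D f y u) x w \<bullet> b)) (at x)"
      by (rule bounded_linear.has_derivative[OF bounded_linear_inner_left[of b] smooth_on_has_derivative[OF sm2 S(2)]])
    then have "((\<lambda>y. ?D (\<lambda>y. f y \<bullet> b) y u) has_derivative (\<lambda>w. ?D (\<lambda>y. ?D f y u) x w \<bullet> b)) (at x)"
      by (rule has_derivative_transform_within_open[OF _ S]) (simp add: 1 sm)
    then show ?thesis using frechet_derivative_at by metis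
  qed
  have "smooth_on S (\<lambda>y. f y \<bullet> b)"
    by (rule smooth_on_linear_comp[OF bounded_linear_inner_left S(1) sm])
  then show "?D (\<lambda>y. ?D f y u) x v \<bullet> b = ?D (\<lambda>y. ?D f y v) x u \<bullet> b"
    unfolding 2 by (rule symmetric_second_derivative_real[OF _ S])
qed

section \<open>Smooth atlases\<close>

definition wf_chart :: "('a, 'e::topological_space) chart \<Rightarrow> bool" where
  "wf_chart c \<longleftrightarrow> inj_on (snd c) (fst c) \<and> open (snd c ` fst c)"

lemma wf_chartD: "wf_chart c \<Longrightarrow> inj_on (snd c) (fst c)" "wf_chart c \<Longrightarrow> open (snd c ` fst c)"
  by (simp_all add: wf_chart_def)

lemma chart_inv_eq: "wf_chart c \<Longrightarrow> p \<in> fst c \<Longrightarrow> chart_inv c (snd c p) = p"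
  by (simp add: wf_chart_def)

lemma in_charts_eq: "wf_chart c \<Longrightarrow> p \<in> fst c \<Longrightarrow> in_charts c d F (snd c p) = snd d (F p)"
  by (simp add: in_charts_def chart_inv_eq)

lemma chart_mem: "wf_chart c \<Longrightarrow> p \<in> fst c \<Longrightarrow> snd c p \<in> snd c ` (fst c \<inter> W) \<Longrightarrow> p \<in> W"
  unfolding wf_chart_def using inj_onD by fastforce

lemma charts_atD: "c \<in> charts_at A p \<Longrightarrow> c \<in> A" "c \<in> charts_at A p \<Longrightarrow> p \<in> fst c"
  by (simp_all add: charts_at_def)

lemma charts_atI: "c \<in> A \<Longrightarrow> p \<in> fst c \<Longrightarrow> c \<in> charts_at A p"
  by (simp add: charts_at_def)

text \<open>Smoothness near \<open>p\<close> in given charts, phrased without inverses of charts.\<close>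

definition local_smooth :: "('a, 'e::real_normed_vector) chart \<Rightarrow> ('b, 'f::real_normed_vector) chart
    \<Rightarrow> ('a \<Rightarrow> 'b) \<Rightarrow> 'a \<Rightarrow> bool" where
  "local_smooth c d F p \<longleftrightarrow> p \<in> fst c \<and> (\<exists>V g. open V \<and> snd c p \<in> V \<and> V \<subseteq> snd c ` fst c \<and>
     smooth_on V g \<and> (\<forall>q\<in>fst c. snd c q \<in> V \<longrightarrow> F q \<in> fst d \<and> snd d (F q) = g (snd c q)))"

lemma local_smoothI:
  assumes "p \<in> fst c" "open V" "snd c p \<in> V" "V \<subseteq> snd c ` fst c" "smooth_on V g"
    "\<And>q. q \<in> fst c \<Longrightarrow> snd c q \<in> V \<Longrightarrow> F q \<in> fst d"
    "\<And>q. q \<in> fst c \<Longrightarrow> snd c q \<in> V \<Longrightarrow> snd d (F q) = g (snd c q)"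
  shows "local_smooth c d F p"
  unfolding local_smooth_def using assms by blast

lemma local_smoothE:
  assumes "local_smooth c d F p"
  obtains V g where "p \<in> fst c" "open V" "snd c p \<in> V" "V \<subseteq> snd c ` fst c" "smooth_on V g"
    "\<forall>q\<in>fst c. snd c q \<in> V \<longrightarrow> F q \<in> fst d"
    "\<forall>q\<in>fst c. snd c q \<in> V \<longrightarrow> snd d (F q) = g (snd c q)"
  using assms unfolding local_smooth_def by auto

text \<open>Links the definitions, which speak of open coordinate images and of inverse charts, with
  the pointwise notion. The set V of \<open>local_smooth\<close> lies inside the coordinate image of
  the preimage, which yields openness of that image, that is, continuity of F.\<close>

lemma local_smooth_chart_iff:
  assumes "wf_chart c"
  shows "(\<forall>p\<in>fst c \<inter> F -` fst d. local_smooth c d F p) \<longleftrightarrow>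
    open (snd c ` (fst c \<inter> F -` fst d)) \<and> smooth_on (snd c ` (fst c \<inter> F -` fst d)) (in_charts c d F)"
    (is "?L \<longleftrightarrow> open ?U \<and> smooth_on ?U ?f")
proof
  assume ?L
  have "\<exists>V. open V \<and> y \<in> V \<and> V \<subseteq> ?U \<and> smooth_on V ?f" if y: "y \<in> ?U" for y
  proof -
    obtain p where p: "p \<in> fst c \<inter> F -` fst d" "y = snd c p" using y by blast
    then have "local_smooth c d F p" using \<open>?L\<close> by blast
    then obtain V g where "p \<in> fst c" and V: "open V" "snd c p \<in> V" "V \<subseteq> snd c ` fst c" "smooth_on V g"
      "\<forall>q\<in>fst c. snd c q \<in> V \<longrightarrow> F q \<in> fst d"
      "\<forall>q\<in>fst c. snd c q \<in> V \<longrightarrow> snd d (F q) = g (snd c q)" by (rule local_smoothE)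
    have "V \<subseteq> ?U" using V by auto
    moreover have "g z = ?f z" if "z \<in> V" for z
    proof -
      obtain q where "q \<in> fst c" "z = snd c q" using V(3) \<open>z \<in> V\<close> by blast
      then show ?thesis using V(6) that in_charts_eq[OF assms, of q d F] by simp
    qed
    then have "smooth_on V ?f" using V smooth_on_cong[OF V(1)] by metis
    ultimately show ?thesis using V p by blast
  qed
  then show "open ?U \<and> smooth_on ?U ?f"
    using topological_space_class.openI[of ?U] by (intro conjI smooth_on_local) metis+
next
  assume R: "open ?U \<and> smooth_on ?U ?f"
  show ?L
  proof
    fix p assume p: "p \<in> fst c \<inter> F -` fst d"
    show "local_smooth c d F p"
    proof (rule local_smoothI[of p c ?U ?f])
      fix q assume q: "q \<in> fst c" "snd c q \<in> ?U"
      then obtain r where r: "r \<in> fst c" "F r \<in> fst d" "snd c q = snd c r" by auto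
      then have "q = r" using wf_chartD(1)[OF assms] q by (meson inj_onD)
      then show "F q \<in> fst d" using r by simp
      show "snd d (F q) = in_charts c d F (snd c q)" using in_charts_eq[OF assms q(1), of d F] by simp
    qed (use p R in auto)
  qed
qed

lemma local_smooth_comp:
  fixes d :: "('b, 'f::findim) chart"
  assumes "local_smooth c d F p" "local_smooth d e G (F p)"
  shows "local_smooth c e (\<lambda>x. G (F x)) p"
proof -
  obtain V g where V: "p \<in> fst c" "open V" "snd c p \<in> V" "V \<subseteq> snd c ` fst c" "smooth_on V g"
    "\<forall>q\<in>fst c. snd c q \<in> V \<longrightarrow> F q \<in> fst d"
    "\<forall>q\<in>fst c. snd c q \<in> V \<longrightarrow> snd d (F q) = g (snd c q)" using assms(1) by (rule local_smoothE)
  obtain U h where U: "F p \<in> fst d" "open U" "snd d (F p) \<in> U" "U \<subseteq> snd d ` fst d" "smooth_on U h"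
    "\<forall>q\<in>fst d. snd d q \<in> U \<longrightarrow> G q \<in> fst e"
    "\<forall>q\<in>fst d. snd d q \<in> U \<longrightarrow> snd e (G q) = h (snd d q)" using assms(2) by (rule local_smoothE)
  have o: "open (V \<inter> g -` U)"
    using continuous_open_preimage[OF smooth_on_imp_continuous_on[OF V(5)] V(2) U(2)] .
  show ?thesis
  proof (rule local_smoothI[OF V(1) o, of "\<lambda>x. h (g x)"])
    show "snd c p \<in> V \<inter> g -` U" using V U by auto
    show "V \<inter> g -` U \<subseteq> snd c ` fst c" using V by auto
    show "smooth_on (V \<inter> g -` U) (\<lambda>x. h (g x))"
      by (rule smooth_on_compose[OF smooth_on_subset[OF V(5)] U(5) o U(2)]) auto
  qed (use V(6,7) U(6,7) in auto)
qed

lemma local_smooth_cong: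
  assumes "local_smooth c d F p" "\<And>q. q \<in> fst c \<Longrightarrow> F q = G q"
  shows "local_smooth c d G p"
proof -
  obtain V g where V: "p \<in> fst c" "open V" "snd c p \<in> V" "V \<subseteq> snd c ` fst c" "smooth_on V g"
    "\<forall>q\<in>fst c. snd c q \<in> V \<longrightarrow> F q \<in> fst d"
    "\<forall>q\<in>fst c. snd c q \<in> V \<longrightarrow> snd d (F q) = g (snd c q)" using assms(1) by (rule local_smoothE)
  then show ?thesis by (intro local_smoothI[OF V(1-5)]) (simp_all flip: assms(2))
qed

text \<open>The part of \<open>smooth_manifold\<close> without the topological axioms. For the
  covector bundles and for E this part is what gets established; for Y separation and countability
  are derived afterwards from those of M.\<close>

definition smooth_atlas :: "'a set \<Rightarrow> ('a, 'e::real_normed_vector) atlas \<Rightarrow> bool" where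
  "smooth_atlas X A \<longleftrightarrow> (\<forall>c\<in>A. wf_chart c) \<and> \<Union> (fst ` A) = X \<and>
     (\<forall>c\<in>A. \<forall>d\<in>A. \<forall>p\<in>fst c \<inter> fst d. local_smooth c d id p)"

lemma local_smooth_id_iff:
  "wf_chart c \<Longrightarrow> (\<forall>p\<in>fst c \<inter> fst d. local_smooth c d id p) \<longleftrightarrow>
     open (snd c ` (fst c \<inter> fst d)) \<and> smooth_on (snd c ` (fst c \<inter> fst d)) (in_charts c d id)"
  using local_smooth_chart_iff[of c id d] by simp

lemma smooth_manifold_iff:
  "smooth_manifold X A \<longleftrightarrow>
    smooth_atlas X A \<and> Hausdorff_space (atlas_topology A) \<and> second_countable (atlas_topology A)"
proof -
  have "(\<forall>c\<in>A. wf_chart c) \<Longrightarrow> (\<forall>c\<in>A. \<forall>d\<in>A. \<forall>p\<in>fst c \<inter> fst d. local_smooth c d id p) \<longleftrightarrow>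
     (\<forall>c\<in>A. \<forall>d\<in>A. open (snd c ` (fst c \<inter> fst d)) \<and> smooth_on (snd c ` (fst c \<inter> fst d)) (in_charts c d id))"
    using local_smooth_id_iff by blast
  moreover have "(\<forall>c\<in>A. inj_on (snd c) (fst c) \<and> open (snd c ` fst c)) \<longleftrightarrow> (\<forall>c\<in>A. wf_chart c)"
    unfolding wf_chart_def ..
  ultimately show ?thesis unfolding smooth_manifold_def smooth_atlas_def by argo
qed

lemma smooth_atlasD:
  assumes "smooth_atlas X A"
  shows "c \<in> A \<Longrightarrow> wf_chart c" "c \<in> A \<Longrightarrow> fst c \<subseteq> X" "p \<in> X \<Longrightarrow> \<exists>c. c \<in> charts_at A p"
    "c \<in> charts_at A p \<Longrightarrow> d \<in> charts_at A p \<Longrightarrow> local_smooth c d id p"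
  using assms unfolding smooth_atlas_def charts_at_def by auto

lemma local_smooth_change:
  fixes A :: "('a, 'e::findim) atlas" and B :: "('b, 'f::findim) atlas"
  assumes "smooth_atlas X A" "smooth_atlas Y B" "local_smooth c d F p"
    "c \<in> charts_at A p" "c' \<in> charts_at A p" "d \<in> charts_at B (F p)" "d' \<in> charts_at B (F p)"
  shows "local_smooth c' d' F p"
proof -
  have 1: "local_smooth c' c id p" by (rule smooth_atlasD(4)[OF assms(1) assms(5,4)])
  have 2: "local_smooth d d' id (F p)" by (rule smooth_atlasD(4)[OF assms(2) assms(6,7)])
  have 3: "local_smooth c d F (id p)" using assms(3) by simp
  from local_smooth_comp[OF 1 3] have "local_smooth c' d F p" by simp
  from local_smooth_comp[OF this 2] show ?thesis by simp
qed

definition smooth_at :: "('a, 'e::real_normed_vector) atlas \<Rightarrow> ('b, 'f::real_normed_vector) atlas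
    \<Rightarrow> ('a \<Rightarrow> 'b) \<Rightarrow> 'a \<Rightarrow> bool" where
  "smooth_at A B F p \<longleftrightarrow> (\<exists>c\<in>charts_at A p. \<exists>d\<in>charts_at B (F p). local_smooth c d F p)"

lemma smooth_atI: "c \<in> charts_at A p \<Longrightarrow> d \<in> charts_at B (F p) \<Longrightarrow> local_smooth c d F p \<Longrightarrow> smooth_at A B F p"
  unfolding smooth_at_def by blast

text \<open>The existential of \<open>smooth_at\<close> is as strong as a universal statement,
  because coordinate changes on both sides compose with the local representative.\<close>

lemma smooth_atD:
  fixes A :: "('a, 'e::findim) atlas" and B :: "('b, 'f::findim) atlas"
  assumes "smooth_atlas X A" "smooth_atlas Y B" "smooth_at A B F p" "c \<in> charts_at A p" "d \<in> charts_at B (F p)"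
  shows "local_smooth c d F p"
  using assms unfolding smooth_at_def by (meson local_smooth_change)

lemma smooth_map_iff:
  fixes A :: "('a, 'e::findim) atlas" and B :: "('b, 'f::findim) atlas"
  assumes A: "smooth_atlas X A" and B: "smooth_atlas Y B"
  shows "smooth_map X A Y B F \<longleftrightarrow> F \<in> X \<rightarrow> Y \<and> (\<forall>p\<in>X. smooth_at A B F p)"
proof -
  have "smooth_map X A Y B F \<longleftrightarrow> F \<in> X \<rightarrow> Y \<and> (\<forall>c\<in>A. \<forall>d\<in>B. \<forall>p\<in>fst c \<inter> F -` fst d. local_smooth c d F p)"
    unfolding smooth_map_def using local_smooth_chart_iff smooth_atlasD(1)[OF A] by blast
  also have "\<dots> \<longleftrightarrow> F \<in> X \<rightarrow> Y \<and> (\<forall>p\<in>X. smooth_at A B F p)"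
  proof (rule conj_cong[OF refl], standard)
    assume F: "F \<in> X \<rightarrow> Y" and *: "\<forall>c\<in>A. \<forall>d\<in>B. \<forall>p\<in>fst c \<inter> F -` fst d. local_smooth c d F p"
    show "\<forall>p\<in>X. smooth_at A B F p"
    proof
      fix p assume "p \<in> X"
      then obtain c d where "c \<in> charts_at A p" "d \<in> charts_at B (F p)"
        using smooth_atlasD(3)[OF A, of p] smooth_atlasD(3)[OF B, of "F p"] F by (meson PiE)
      then show "smooth_at A B F p" using * by (auto simp: charts_at_def intro!: smooth_atI)
    qed
  next
    assume "\<forall>p\<in>X. smooth_at A B F p"
    then show "\<forall>c\<in>A. \<forall>d\<in>B. \<forall>p\<in>fst c \<inter> F -` fst d. local_smooth c d F p"
      using smooth_atD[OF A B] smooth_atlasD(2)[OF A] by (fastforce simp: charts_at_def)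
  qed
  finally show ?thesis .
qed

lemma smooth_at_comp:
  fixes A :: "('a, 'e::findim) atlas" and B :: "('b, 'f::findim) atlas" and C :: "('c, 'g::findim) atlas"
  assumes "smooth_atlas X A" "smooth_atlas Y B" "smooth_atlas Z C"
    "smooth_at A B F p" "smooth_at B C G (F p)"
  shows "smooth_at A C (\<lambda>x. G (F x)) p"
proof -
  obtain c d where cd: "c \<in> charts_at A p" "d \<in> charts_at B (F p)" "local_smooth c d F p"
    using assms(4) unfolding smooth_at_def by blast
  obtain e where e: "e \<in> charts_at C (G (F p))" using assms(5) unfolding smooth_at_def by blast
  show ?thesis
    using smooth_atI[OF cd(1) _ local_smooth_comp[OF cd(3) smooth_atD[OF assms(2,3,5) cd(2) e]]] e by blast
qed

lemma smooth_map_comp: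
  fixes A :: "('a, 'e::findim) atlas" and B :: "('b, 'f::findim) atlas" and C :: "('c, 'g::findim) atlas"
  assumes "smooth_atlas X A" "smooth_atlas Y B" "smooth_atlas Z C"
    "smooth_map X A Y B F" "smooth_map Y B Z C G"
  shows "smooth_map X A Z C (\<lambda>x. G (F x))"
  using assms(4,5) smooth_at_comp[OF assms(1-3)]
  unfolding smooth_map_iff[OF assms(1,2)] smooth_map_iff[OF assms(2,3)] smooth_map_iff[OF assms(1,3)]
  by (auto simp: Pi_iff)

subsection \<open>The topology of an atlas\<close>

lemma openin_chart_vimage: "c \<in> A \<Longrightarrow> open V \<Longrightarrow> openin (atlas_topology A) (fst c \<inter> snd c -` V)"
  unfolding atlas_topology_def by (rule topology_generated_by_Basis) blast

text \<open>Forwards by induction on the generation of the topology: injectivity of a chart lets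
  images commute with intersections, and continuity of the coordinate changes handles the
  generators. Backwards, W is the union of its traces in the chart domains, and each trace is a
  generator.\<close>

lemma openin_atlas_topology:
  assumes A: "smooth_atlas X A"
  shows "openin (atlas_topology A) W \<longleftrightarrow> W \<subseteq> X \<and> (\<forall>c\<in>A. open (snd c ` (fst c \<inter> W)))"
proof
  assume "openin (atlas_topology A) W"
  then have "generate_topology_on {fst c \<inter> snd c -` V | c V. c \<in> A \<and> open V} W"
    unfolding atlas_topology_def openin_topology_generated_by_iff .
  then show "W \<subseteq> X \<and> (\<forall>c\<in>A. open (snd c ` (fst c \<inter> W)))"
  proof induction
    case Empty
    then show ?case by simp
  next
    case (Int a b)
    have "snd c ` (fst c \<inter> (a \<inter> b)) = snd c ` (fst c \<inter> a) \<inter> snd c ` (fst c \<inter> b)" if "c \<in> A" for c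
      using inj_on_image_Int[OF wf_chartD(1)[OF smooth_atlasD(1)[OF A that]], of "fst c \<inter> a" "fst c \<inter> b"]
      by (simp add: Int_ac)
    then show ?case using Int.IH by auto
  next
    case (UN K)
    have "snd c ` (fst c \<inter> \<Union> K) = (\<Union>k\<in>K. snd c ` (fst c \<inter> k))" for c :: "('a, 'b) chart" by blast
    moreover have "open (\<Union>k\<in>K. snd c ` (fst c \<inter> k))" if "c \<in> A" for c using UN.IH that by blast
    ultimately have "open (snd c ` (fst c \<inter> \<Union> K))" if "c \<in> A" for c using that by simp
    moreover have "\<Union> K \<subseteq> X" using UN.IH by blast
    ultimately show ?case by blast
  next
    case (Basis s)
    then obtain d V where s: "s = fst d \<inter> snd d -` V" "d \<in> A" "open V" by blast
    have "open (snd c ` (fst c \<inter> s))" if "c \<in> A" for c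
    proof (rule topological_space_class.openI)
      fix y assume "y \<in> snd c ` (fst c \<inter> s)"
      then obtain p where p: "y = snd c p" "p \<in> fst c" "p \<in> fst d" "snd d p \<in> V" using s by auto
      then have "local_smooth c d id p" using smooth_atlasD(4)[OF A] s that by (simp add: charts_at_def)
      then obtain U g where "p \<in> fst c" and U: "open U" "snd c p \<in> U" "U \<subseteq> snd c ` fst c" "smooth_on U g"
        "\<forall>q\<in>fst c. snd c q \<in> U \<longrightarrow> id q \<in> fst d"
        "\<forall>q\<in>fst c. snd c q \<in> U \<longrightarrow> snd d (id q) = g (snd c q)" by (rule local_smoothE)
      have "open (U \<inter> g -` V)"
        using continuous_open_preimage[OF smooth_on_imp_continuous_on[OF U(4)] U(1) s(3)] .
      moreover have "y \<in> U \<inter> g -` V" using p U by force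
      moreover have "U \<inter> g -` V \<subseteq> snd c ` (fst c \<inter> s)" using U s by force
      ultimately show "\<exists>T. open T \<and> y \<in> T \<and> T \<subseteq> snd c ` (fst c \<inter> s)" by blast
    qed
    then show ?case using smooth_atlasD(2)[OF A s(2)] s by auto
  qed
next
  assume R: "W \<subseteq> X \<and> (\<forall>c\<in>A. open (snd c ` (fst c \<inter> W)))"
  have "W = \<Union> {fst c \<inter> snd c -` (snd c ` (fst c \<inter> W)) | c. c \<in> A}"
  proof (rule equalityI; rule subsetI)
    fix p assume "p \<in> W"
    then obtain c where "c \<in> charts_at A p" using R smooth_atlasD(3)[OF A, of p] by blast
    then have "c \<in> A" "p \<in> fst c \<inter> snd c -` (snd c ` (fst c \<inter> W))" using \<open>p \<in> W\<close> by (simp_all add: charts_at_def)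
    then show "p \<in> \<Union> {fst c \<inter> snd c -` (snd c ` (fst c \<inter> W)) | c. c \<in> A}" by blast
  next
    fix p assume "p \<in> \<Union> {fst c \<inter> snd c -` (snd c ` (fst c \<inter> W)) | c. c \<in> A}"
    then obtain c q where "c \<in> A" "p \<in> fst c" "q \<in> fst c" "q \<in> W" "snd c p = snd c q" by auto
    then show "p \<in> W" using wf_chartD(1)[OF smooth_atlasD(1)[OF A]] by (metis inj_onD)
  qed
  moreover have "openin (atlas_topology A) (\<Union> {fst c \<inter> snd c -` (snd c ` (fst c \<inter> W)) | c. c \<in> A})"
    using R openin_chart_vimage by (intro openin_Union) fastforce
  ultimately show "openin (atlas_topology A) W" by simp
qed

lemma openin_atlasD: "smooth_atlas X A \<Longrightarrow> openin (atlas_topology A) W \<Longrightarrow> c \<in> A \<Longrightarrow> open (snd c ` (fst c \<inter> W))"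
  using openin_atlas_topology by blast

lemma openin_chart: "c \<in> A \<Longrightarrow> openin (atlas_topology A) (fst c)"
  using openin_chart_vimage[of c A UNIV] by simp

lemma topspace_atlas_topology: "smooth_atlas X A \<Longrightarrow> topspace (atlas_topology A) = X"
proof -
  assume A: "smooth_atlas X A"
  have "openin (atlas_topology A) X"
    using smooth_atlasD(1,2)[OF A] unfolding openin_atlas_topology[OF A]
    by (simp add: wf_chart_def Int_absorb2)
  then show ?thesis using openin_atlas_topology[OF A] openin_subset by blast
qed

lemma smooth_map_continuous:
  fixes A :: "('a, 'e::findim) atlas" and B :: "('b, 'f::findim) atlas"
  assumes A: "smooth_atlas X A" and B: "smooth_atlas Y B" and F: "smooth_map X A Y B F"
  shows "continuous_map (atlas_topology A) (atlas_topology B) F"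
  unfolding continuous_map_def topspace_atlas_topology[OF A] topspace_atlas_topology[OF B]
proof (intro conjI allI impI)
  show "F \<in> X \<rightarrow> Y" using F smooth_map_iff[OF A B] by blast
  fix W assume W: "openin (atlas_topology B) W"
  show "openin (atlas_topology A) {p \<in> X. F p \<in> W}"
    unfolding openin_atlas_topology[OF A]
  proof (intro conjI ballI)
    fix c assume c: "c \<in> A"
    show "open (snd c ` (fst c \<inter> {p \<in> X. F p \<in> W}))"
    proof (rule topological_space_class.openI)
      fix y assume "y \<in> snd c ` (fst c \<inter> {p \<in> X. F p \<in> W})"
      then obtain p where p: "y = snd c p" "p \<in> fst c" "p \<in> X" "F p \<in> W" by auto
      then obtain d where d: "d \<in> charts_at B (F p)"
        using \<open>F \<in> X \<rightarrow> Y\<close> smooth_atlasD(3)[OF B] by blast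
      have "local_smooth c d F p"
        using smooth_atD[where F = F, OF A B _ charts_atI[OF c p(2)] d] p(3) F smooth_map_iff[OF A B, of F] by blast
      then obtain U g where "p \<in> fst c" and U: "open U" "snd c p \<in> U" "U \<subseteq> snd c ` fst c" "smooth_on U g"
        "\<forall>q\<in>fst c. snd c q \<in> U \<longrightarrow> F q \<in> fst d"
        "\<forall>q\<in>fst c. snd c q \<in> U \<longrightarrow> snd d (F q) = g (snd c q)" by (rule local_smoothE)
      let ?V = "snd d ` (fst d \<inter> W)"
      have "open (U \<inter> g -` ?V)"
        using continuous_open_preimage[OF smooth_on_imp_continuous_on[OF U(4)] U(1)]
          openin_atlasD[OF B W] charts_atD(1)[OF d] by blast
      moreover have "y \<in> U \<inter> g -` ?V" using p U charts_atD(2)[OF d] by force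
      moreover have "U \<inter> g -` ?V \<subseteq> snd c ` (fst c \<inter> {p \<in> X. F p \<in> W})"
      proof
        fix z assume z: "z \<in> U \<inter> g -` ?V"
        then obtain q where q: "q \<in> fst c" "z = snd c q" using U by auto
        then have "F q \<in> fst d" "snd d (F q) \<in> ?V" using U z by auto
        then have "F q \<in> W" using chart_mem[OF smooth_atlasD(1)[OF B charts_atD(1)[OF d]]] by blast
        then show "z \<in> snd c ` (fst c \<inter> {p \<in> X. F p \<in> W})" using q smooth_atlasD(2)[OF A c] by auto
      qed
      ultimately show "\<exists>T. open T \<and> y \<in> T \<and> T \<subseteq> snd c ` (fst c \<inter> {p \<in> X. F p \<in> W})" by blast
    qed
  qed blast
qed

text \<open>Two points of a common chart are separated by their coordinates, so open sets have to be
  supplied only for pairs of points that no chart contains.\<close>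

lemma Hausdorff_atlas:
  assumes A: "smooth_atlas X A"
    and sep: "\<And>p q. p \<in> X \<Longrightarrow> q \<in> X \<Longrightarrow> p \<noteq> q \<Longrightarrow> (\<exists>c\<in>A. p \<in> fst c \<and> q \<in> fst c) \<or>
      (\<exists>U V. openin (atlas_topology A) U \<and> openin (atlas_topology A) V \<and> p \<in> U \<and> q \<in> V \<and> disjnt U V)"
  shows "Hausdorff_space (atlas_topology A)"
  unfolding Hausdorff_space_def topspace_atlas_topology[OF A]
proof (intro allI impI)
  fix p q assume pq: "p \<in> X \<and> q \<in> X \<and> p \<noteq> q"
  consider (c) c where "c \<in> A" "p \<in> fst c" "q \<in> fst c"
    | (s) U V where "openin (atlas_topology A) U" "openin (atlas_topology A) V" "p \<in> U" "q \<in> V" "disjnt U V"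
    using sep[of p q] pq by blast
  then show "\<exists>U V. openin (atlas_topology A) U \<and> openin (atlas_topology A) V \<and> p \<in> U \<and> q \<in> V \<and> disjnt U V"
  proof cases
    case c
    have "snd c p \<noteq> snd c q" using wf_chartD(1)[OF smooth_atlasD(1)[OF A c(1)]] c pq by (meson inj_onD)
    then obtain U V where UV: "open U" "open V" "snd c p \<in> U" "snd c q \<in> V" "U \<inter> V = {}"
      using hausdorff by metis
    show ?thesis
      using UV c openin_chart_vimage[OF c(1) UV(1)] openin_chart_vimage[OF c(1) UV(2)]
      by (intro exI[of _ "fst c \<inter> snd c -` U"] exI[of _ "fst c \<inter> snd c -` V"]) (auto simp: disjnt_def)
  qed blast
qed

text \<open>Preimages of a countable base of the model space under the charts of C form the base: C
  covers X, and a neighbourhood of a point can be shrunk within a chart of C around it.\<close>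

lemma second_countable_atlas:
  fixes A :: "('a, 'e::{real_normed_vector, second_countable_topology}) atlas"
  assumes A: "smooth_atlas X A" and C: "countable C" "C \<subseteq> A" "X \<subseteq> \<Union> (fst ` C)"
  shows "second_countable (atlas_topology A)"
proof -
  obtain B :: "'e set set" where B: "countable B" "topological_basis B" using ex_countable_basis by blast
  define BB where "BB = (\<lambda>(c, V). fst c \<inter> snd c -` V) ` (C \<times> B)"
  show ?thesis unfolding second_countable_def
  proof (intro exI[of _ BB] conjI ballI allI impI)
    show "countable BB" unfolding BB_def using B C by auto
    show "openin (atlas_topology A) V" if V: "V \<in> BB" for V
    proof -
      obtain c W where W: "V = fst c \<inter> snd c -` W" "c \<in> C" "W \<in> B" using V unfolding BB_def by auto
      show ?thesis
        unfolding W(1) using W C topological_basis_open[OF B(2)] by (intro openin_chart_vimage) auto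
    qed
    fix U p assume U: "openin (atlas_topology A) U \<and> p \<in> U"
    then have "p \<in> X" "U \<subseteq> X" using openin_atlas_topology[OF A] by auto
    then obtain c where c: "c \<in> C" "p \<in> fst c" using C by blast
    have "open (snd c ` (fst c \<inter> U))" using openin_atlasD[OF A] U C c by blast
    then obtain V where V: "V \<in> B" "snd c p \<in> V" "V \<subseteq> snd c ` (fst c \<inter> U)"
      using topological_basisE[OF B(2)] U c by blast
    have "wf_chart c" using smooth_atlasD(1)[OF A] c C by blast
    from chart_mem[OF this] have "fst c \<inter> snd c -` V \<subseteq> U" using V(3) by blast
    then show "\<exists>V\<in>BB. p \<in> V \<and> V \<subseteq> U" unfolding BB_def using V c by force
  qed
qed

subsection \<open>Restrictions, products and submanifolds\<close>

lemma local_smooth_restrict: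
  assumes "local_smooth c d F p" "wf_chart c" "open (snd c ` (fst c \<inter> W))" "p \<in> W"
    "\<And>q. q \<in> fst c \<inter> W \<Longrightarrow> F q \<in> W'"
  shows "local_smooth (fst c \<inter> W, snd c) (fst d \<inter> W', snd d) F p"
proof -
  obtain V g where V: "p \<in> fst c" "open V" "snd c p \<in> V" "V \<subseteq> snd c ` fst c" "smooth_on V g"
    "\<forall>q\<in>fst c. snd c q \<in> V \<longrightarrow> F q \<in> fst d"
    "\<forall>q\<in>fst c. snd c q \<in> V \<longrightarrow> snd d (F q) = g (snd c q)" using assms(1) by (rule local_smoothE)
  show ?thesis
    by (rule local_smoothI[of _ _ "V \<inter> snd c ` (fst c \<inter> W)" g])
       (use V assms smooth_on_subset[OF V(5)] in auto)
qed

lemma smooth_atlas_restrict: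
  assumes A: "smooth_atlas X A" and W: "openin (atlas_topology A) W"
  shows "smooth_atlas W (restrict_atlas A W)"
  unfolding smooth_atlas_def restrict_atlas_def
proof (intro conjI ballI)
  show "wf_chart c" if "c \<in> (\<lambda>c. (fst c \<inter> W, snd c)) ` A" for c
    using that smooth_atlasD(1)[OF A] openin_atlasD[OF A W]
    by (fastforce simp: wf_chart_def intro: inj_on_subset)
  show "\<Union> (fst ` (\<lambda>c. (fst c \<inter> W, snd c)) ` A) = W"
    using A W openin_atlas_topology[OF A] unfolding smooth_atlas_def by auto
  fix c d p assume "c \<in> (\<lambda>c. (fst c \<inter> W, snd c)) ` A" "d \<in> (\<lambda>c. (fst c \<inter> W, snd c)) ` A" "p \<in> fst c \<inter> fst d"
  then obtain c' d' where cd: "c = (fst c' \<inter> W, snd c')" "d = (fst d' \<inter> W, snd d')" "c' \<in> A" "d' \<in> A"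
    "p \<in> fst c'" "p \<in> fst d'" "p \<in> W" by auto
  show "local_smooth c d id p" unfolding cd(1,2)
    by (rule local_smooth_restrict) (use cd smooth_atlasD(1,4)[OF A] openin_atlasD[OF A W] in \<open>auto simp: charts_at_def\<close>)
qed

definition prod_chart :: "('a, 'e) chart \<Rightarrow> ('b, 'f) chart \<Rightarrow> ('a \<times> 'b, 'e \<times> 'f) chart" where
  "prod_chart c d = (fst c \<times> fst d, map_prod (snd c) (snd d))"

lemma prod_atlas_eq: "prod_atlas A B = (\<lambda>(c, d). prod_chart c d) ` (A \<times> B)"
  unfolding prod_atlas_def prod_chart_def ..

lemma wf_prod_chart: "wf_chart c \<Longrightarrow> wf_chart d \<Longrightarrow> wf_chart (prod_chart c d)"
  unfolding wf_chart_def prod_chart_def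
  by (auto simp: map_prod_inj_on map_prod_surj_on[OF refl refl] intro: open_Times)

lemma local_smooth_fst: "wf_chart c \<Longrightarrow> wf_chart d \<Longrightarrow> p \<in> fst (prod_chart c d) \<Longrightarrow> local_smooth (prod_chart c d) c fst p"
  using wf_prod_chart[of c d]
  by (intro local_smoothI[of p _ "snd (prod_chart c d) ` fst (prod_chart c d)" fst])
     (auto simp: wf_chart_def prod_chart_def intro: smooth_on_fst smooth_on_ident)

lemma local_smooth_snd: "wf_chart c \<Longrightarrow> wf_chart d \<Longrightarrow> p \<in> fst (prod_chart c d) \<Longrightarrow> local_smooth (prod_chart c d) d snd p"
  using wf_prod_chart[of c d]
  by (intro local_smoothI[of p _ "snd (prod_chart c d) ` fst (prod_chart c d)" snd])
     (auto simp: wf_chart_def prod_chart_def intro: smooth_on_snd smooth_on_ident)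

lemma local_smooth_Pair:
  assumes "local_smooth c d F p" "local_smooth c e G p"
  shows "local_smooth c (prod_chart d e) (\<lambda>x. (F x, G x)) p"
proof -
  obtain V g where V: "p \<in> fst c" "open V" "snd c p \<in> V" "V \<subseteq> snd c ` fst c" "smooth_on V g"
    "\<forall>q\<in>fst c. snd c q \<in> V \<longrightarrow> F q \<in> fst d"
    "\<forall>q\<in>fst c. snd c q \<in> V \<longrightarrow> snd d (F q) = g (snd c q)" using assms(1) by (rule local_smoothE)
  obtain U h where U: "p \<in> fst c" "open U" "snd c p \<in> U" "U \<subseteq> snd c ` fst c" "smooth_on U h"
    "\<forall>q\<in>fst c. snd c q \<in> U \<longrightarrow> G q \<in> fst e"
    "\<forall>q\<in>fst c. snd c q \<in> U \<longrightarrow> snd e (G q) = h (snd c q)" using assms(2) by (rule local_smoothE)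
  show ?thesis
    by (rule local_smoothI[of _ _ "V \<inter> U" "\<lambda>x. (g x, h x)"])
       (use V U in \<open>auto simp: prod_chart_def intro!: smooth_on_Pair intro: smooth_on_subset\<close>)
qed

lemma charts_at_prod:
  "e \<in> charts_at (prod_atlas A B) p \<longleftrightarrow> (\<exists>c d. c \<in> charts_at A (fst p) \<and> d \<in> charts_at B (snd p) \<and> e = prod_chart c d)"
proof -
  have "fst (prod_chart c d) = fst c \<times> fst d" for c :: "('a, 'c) chart" and d :: "('b, 'd) chart"
    by (simp add: prod_chart_def)
  then have "e \<in> prod_atlas A B \<and> p \<in> fst e \<longleftrightarrow> (\<exists>c\<in>A. \<exists>d\<in>B. e = prod_chart c d \<and> fst p \<in> fst c \<and> snd p \<in> fst d)"
    unfolding prod_atlas_eq by (cases p) (fastforce simp: image_iff)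
  then show ?thesis unfolding charts_at_def by blast
qed

lemma smooth_atlas_prod:
  fixes A :: "('a, 'e::findim) atlas" and B :: "('b, 'f::findim) atlas"
  assumes A: "smooth_atlas X A" and B: "smooth_atlas Y B"
  shows "smooth_atlas (X \<times> Y) (prod_atlas A B)"
  unfolding smooth_atlas_def
proof (intro conjI ballI)
  show "wf_chart c" if "c \<in> prod_atlas A B" for c
    using that smooth_atlasD(1)[OF A] smooth_atlasD(1)[OF B] by (auto simp: prod_atlas_eq intro!: wf_prod_chart)
  have "X = \<Union> (fst ` A)" "Y = \<Union> (fst ` B)" using A B unfolding smooth_atlas_def by auto
  then show "\<Union> (fst ` prod_atlas A B) = X \<times> Y"
    unfolding prod_atlas_eq prod_chart_def by fastforce
  fix u v p assume "u \<in> prod_atlas A B" "v \<in> prod_atlas A B" "p \<in> fst u \<inter> fst v"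
  then obtain c d c' d' where u: "u = prod_chart c d" "c \<in> charts_at A (fst p)" "d \<in> charts_at B (snd p)"
    and v: "v = prod_chart c' d'" "c' \<in> charts_at A (fst p)" "d' \<in> charts_at B (snd p)"
    unfolding prod_atlas_eq by (auto simp: prod_chart_def charts_at_def)
  have w: "wf_chart c" "wf_chart d"
    using smooth_atlasD(1)[OF A, of c] smooth_atlasD(1)[OF B, of d] u by (simp_all add: charts_at_def)
  have p: "p \<in> fst (prod_chart c d)" using \<open>p \<in> fst u \<inter> fst v\<close> u by simp
  have "local_smooth u (prod_chart c' d') (\<lambda>x. (id (fst x), id (snd x))) p"
    unfolding u(1)
    by (rule local_smooth_Pair; rule local_smooth_comp,
       rule local_smooth_fst[OF w p] local_smooth_snd[OF w p],
       use smooth_atlasD(4)[OF A] smooth_atlasD(4)[OF B] u v in blast)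
  then show "local_smooth u v id p" unfolding v(1) by (rule local_smooth_cong) auto
qed

lemma smooth_at_fst:
  assumes A: "smooth_atlas X A" and B: "smooth_atlas Y B" and "p \<in> X \<times> Y"
  shows "smooth_at (prod_atlas A B) A fst p" "smooth_at (prod_atlas A B) B snd p"
proof -
  obtain c d where cd: "c \<in> charts_at A (fst p)" "d \<in> charts_at B (snd p)"
    using smooth_atlasD(3)[OF A, of "fst p"] smooth_atlasD(3)[OF B, of "snd p"] assms(3) by auto
  have w: "wf_chart c" "wf_chart d"
    using smooth_atlasD(1)[OF A, of c] smooth_atlasD(1)[OF B, of d] cd by (simp_all add: charts_at_def)
  have p: "prod_chart c d \<in> charts_at (prod_atlas A B) p" using cd charts_at_prod by blast
  show "smooth_at (prod_atlas A B) A fst p" by (rule smooth_atI[OF p cd(1) local_smooth_fst[OF w charts_atD(2)[OF p]]])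
  show "smooth_at (prod_atlas A B) B snd p" by (rule smooth_atI[OF p cd(2) local_smooth_snd[OF w charts_atD(2)[OF p]]])
qed

lemma smooth_at_Pair:
  fixes A :: "('a, 'e::findim) atlas" and B :: "('b, 'f::findim) atlas" and C :: "('c, 'g::findim) atlas"
  assumes A: "smooth_atlas X A" and B: "smooth_atlas Y B" and C: "smooth_atlas Z C"
    and "smooth_at A B F p" "smooth_at A C G p"
  shows "smooth_at A (prod_atlas B C) (\<lambda>x. (F x, G x)) p"
proof -
  obtain c d where cd: "c \<in> charts_at A p" "d \<in> charts_at B (F p)" "local_smooth c d F p"
    using assms(4) unfolding smooth_at_def by blast
  obtain e where e: "e \<in> charts_at C (G p)" using assms(5) unfolding smooth_at_def by blast
  show ?thesis
    by (rule smooth_atI[OF cd(1) _ local_smooth_Pair[OF cd(3) smooth_atD[OF A C assms(5) cd(1) e]]])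
       (use cd(2) e charts_at_prod in fastforce)
qed

text \<open>The definition asks for smoothness into all ambient charts. Compatibility of the ambient
  atlas reduces this to one ambient chart at each point, which is the form in which membership is
  verified for the charts of E and Y.\<close>

lemma submanifold_atlas_iff:
  fixes A :: "('a, 'e::findim) atlas" and d :: "('a, 'f::findim) chart"
  assumes A: "smooth_atlas X A"
  shows "d \<in> submanifold_atlas A S \<longleftrightarrow>
    openin (subtopology (atlas_topology A) S) (fst d) \<and> wf_chart d \<and>
    (\<forall>p\<in>fst d. \<exists>c\<in>charts_at A p. local_smooth d c id p \<and>
       (\<exists>V g. open V \<and> V \<subseteq> snd c ` fst c \<and> snd c p \<in> V \<and> smooth_on V g \<and>
          (\<forall>q\<in>fst d \<inter> fst c. snd c q \<in> V \<longrightarrow> snd d q = g (snd c q))))"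
    (is "_ \<longleftrightarrow> ?O \<and> ?W \<and> ?P")
proof -
  define ext where "ext c p \<longleftrightarrow> (\<exists>V g. open V \<and> V \<subseteq> snd c ` fst c \<and> snd c p \<in> V \<and> smooth_on V g \<and>
          (\<forall>q\<in>fst d \<inter> fst c. snd c q \<in> V \<longrightarrow> snd d q = g (snd c q)))" for c :: "('a, 'e) chart" and p
  have "d \<in> submanifold_atlas A S \<longleftrightarrow> ?O \<and> wf_chart d \<and>
      (\<forall>c\<in>A. open (snd d ` (fst d \<inter> fst c)) \<and> smooth_on (snd d ` (fst d \<inter> fst c)) (in_charts d c id)) \<and>
      (\<forall>p\<in>fst d. \<exists>c\<in>charts_at A p. ext c p)"
    unfolding submanifold_atlas_def wf_chart_def ext_def by simp
  also have "\<dots> \<longleftrightarrow> ?O \<and> wf_chart d \<and> (\<forall>c\<in>A. \<forall>p\<in>fst d \<inter> fst c. local_smooth d c id p) \<and>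
      (\<forall>p\<in>fst d. \<exists>c\<in>charts_at A p. ext c p)"
    using local_smooth_id_iff[of d] by (intro conj_cong refl ball_cong) blast
  also have "\<dots> \<longleftrightarrow> ?O \<and> wf_chart d \<and> (\<forall>p\<in>fst d. \<exists>c\<in>charts_at A p. local_smooth d c id p \<and> ext c p)"
  proof (intro conj_cong refl iffI conjI ballI)
    fix p assume "(\<forall>c\<in>A. \<forall>p\<in>fst d \<inter> fst c. local_smooth d c id p) \<and> (\<forall>p\<in>fst d. \<exists>c\<in>charts_at A p. ext c p)" "p \<in> fst d"
    then show "\<exists>c\<in>charts_at A p. local_smooth d c id p \<and> ext c p" by (auto simp: charts_at_def)
  next
    fix c p assume *: "\<forall>p\<in>fst d. \<exists>c\<in>charts_at A p. local_smooth d c id p \<and> ext c p" and cp: "c \<in> A" "p \<in> fst d \<inter> fst c"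
    then obtain c' where c': "c' \<in> charts_at A p" "local_smooth d c' id p" by blast
    have "local_smooth c' c id (id p)" using smooth_atlasD(4)[OF A c'(1)] cp by (simp add: charts_at_def)
    from local_smooth_comp[OF c'(2) this] show "local_smooth d c id p" by (simp add: id_def)
  next
    fix p assume *: "\<forall>p\<in>fst d. \<exists>c\<in>charts_at A p. local_smooth d c id p \<and> ext c p" and p: "p \<in> fst d"
    then show "\<exists>c\<in>charts_at A p. ext c p" by blast
  qed
  finally show ?thesis unfolding ext_def .
qed

lemma submanifold_atlasD:
  fixes A :: "('a, 'e::findim) atlas" and d :: "('a, 'f::findim) chart"
  assumes A: "smooth_atlas X A" and d: "d \<in> submanifold_atlas A S"
  shows "wf_chart d" "fst d \<subseteq> S" "c \<in> charts_at A p \<Longrightarrow> p \<in> fst d \<Longrightarrow> local_smooth d c id p"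
proof -
  have *: "openin (subtopology (atlas_topology A) S) (fst d)" "wf_chart d"
    using d submanifold_atlas_iff[OF A, of d S] by simp_all
  then show "wf_chart d" "fst d \<subseteq> S" using openin_imp_subset by blast+
  assume c: "c \<in> charts_at A p" "p \<in> fst d"
  then obtain c' where c': "c' \<in> charts_at A p" "local_smooth d c' id p"
    using d submanifold_atlas_iff[OF A, of d S] by meson
  have "local_smooth c' c id (id p)" using smooth_atlasD(4)[OF A c'(1) c(1)] by simp
  from local_smooth_comp[OF c'(2) this] show "local_smooth d c id p" by (simp add: id_def)
qed

lemma submanifold_chartE:
  fixes A :: "('a, 'e::findim) atlas" and d :: "('a, 'f::findim) chart"
  assumes A: "smooth_atlas X A" and d: "d \<in> submanifold_atlas A S" "p \<in> fst d"
  obtains c V g where "c \<in> charts_at A p" "open V" "V \<subseteq> snd c ` fst c" "snd c p \<in> V" "smooth_on V g"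
    "\<And>q. q \<in> fst d \<Longrightarrow> q \<in> fst c \<Longrightarrow> snd c q \<in> V \<Longrightarrow> snd d q = g (snd c q)"
proof -
  have "\<forall>p\<in>fst d. \<exists>c\<in>charts_at A p. \<exists>V g. open V \<and> V \<subseteq> snd c ` fst c \<and> snd c p \<in> V \<and> smooth_on V g \<and>
          (\<forall>q\<in>fst d \<inter> fst c. snd c q \<in> V \<longrightarrow> snd d q = g (snd c q))"
    using d(1) unfolding submanifold_atlas_def by simp
  from bspec[OF this d(2)] show thesis by (elim bexE exE conjE) (rule that, auto)
qed

text \<open>What embeddedness gives: a map that is smooth into the ambient manifold and has values
  in S is smooth into S, because near a point the chart d is the restriction of a smooth function h
  of ambient coordinates. Relative openness of \<open>fst d\<close> keeps nearby values in its
  domain.\<close>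

lemma local_smooth_into_submanifold:
  fixes A :: "('a, 'e::findim) atlas" and d :: "('a, 'f::findim) chart" and e :: "('b, 'g::findim) chart"
  assumes A: "smooth_atlas X A" and d: "d \<in> submanifold_atlas A S" "F p \<in> fst d"
    and F: "local_smooth e c F p" "c \<in> charts_at A (F p)" "\<And>q. q \<in> fst e \<Longrightarrow> F q \<in> S"
  shows "local_smooth e d F p"
proof -
  obtain c' U h where c': "c' \<in> charts_at A (F p)" and U: "open U" "U \<subseteq> snd c' ` fst c'" "snd c' (F p) \<in> U"
    "smooth_on U h" "\<And>q. q \<in> fst d \<Longrightarrow> q \<in> fst c' \<Longrightarrow> snd c' q \<in> U \<Longrightarrow> snd d q = h (snd c' q)"
    using submanifold_chartE[OF A d] by metis
  have "local_smooth c c' id (F p)" using smooth_atlasD(4)[OF A F(2) c'] .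
  from local_smooth_comp[OF F(1) this] have "local_smooth e c' F p" by simp
  then obtain V g where V: "p \<in> fst e" "open V" "snd e p \<in> V" "V \<subseteq> snd e ` fst e" "smooth_on V g"
    "\<forall>q\<in>fst e. snd e q \<in> V \<longrightarrow> F q \<in> fst c'"
    "\<forall>q\<in>fst e. snd e q \<in> V \<longrightarrow> snd c' (F q) = g (snd e q)" by (rule local_smoothE)
  obtain W where W: "openin (atlas_topology A) W" "fst d = W \<inter> S"
    using d(1) submanifold_atlas_iff[OF A, of d S] by (auto simp: openin_subtopology)
  \<comment> \<open>U is where h is defined; cutting it down to the coordinates of W forces values
    in S into W \<inter> S, the domain of d.\<close>
  let ?U = "U \<inter> snd c' ` (fst c' \<inter> W)"
  have c'A: "c' \<in> A" "F p \<in> fst c'" using c' by (simp_all add: charts_at_def)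
  have oU: "open ?U" using U openin_atlasD[OF A W(1) c'A(1)] by blast
  have o: "open (V \<inter> g -` ?U)"
    using continuous_open_preimage[OF smooth_on_imp_continuous_on[OF V(5)] V(2) oU] .
  have in_d: "F q \<in> fst d" if q: "q \<in> fst e" "snd e q \<in> V \<inter> g -` ?U" for q
  proof -
    have "F q \<in> fst c'" "snd c' (F q) \<in> snd c' ` (fst c' \<inter> W)" using q V by auto
    then have "F q \<in> W" using chart_mem[OF smooth_atlasD(1)[OF A c'A(1)]] by blast
    then show ?thesis using W F(3) q by auto
  qed
  show ?thesis
  proof (rule local_smoothI[OF V(1) o, of "\<lambda>x. h (g x)"])
    have "snd c' (F p) = g (snd e p)" "F p \<in> W" using V(1,3,7) W d(2) by auto
    then show "snd e p \<in> V \<inter> g -` ?U" using V(3) U(3) c'A(2) by (metis IntI image_eqI vimageI)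
    show "V \<inter> g -` ?U \<subseteq> snd e ` fst e" using V by auto
    show "smooth_on (V \<inter> g -` ?U) (\<lambda>x. h (g x))"
      by (rule smooth_on_compose[OF smooth_on_subset[OF V(5)] U(4) o U(1)]) auto
    show "snd d (F q) = h (g (snd e q))" if q: "q \<in> fst e" "snd e q \<in> V \<inter> g -` ?U" for q
      using U(5)[of "F q"] in_d[OF q] V q by auto
  qed (rule in_d)
qed

text \<open>Coordinate changes between submanifold charts are smooth automatically: the identity is
  smooth from one of them into the ambient manifold, hence into the other. What remains to be
  supplied is that the charts cover S.\<close>

lemma smooth_atlas_submanifold:
  fixes A :: "('a, 'e::findim) atlas"
  assumes A: "smooth_atlas X A"
    and cover: "\<And>p. p \<in> S \<Longrightarrow> \<exists>d :: ('a, 'f::findim) chart. d \<in> charts_at (submanifold_atlas A S) p"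
  shows "smooth_atlas S (submanifold_atlas A S :: ('a, 'f) atlas)"
  unfolding smooth_atlas_def
proof (intro conjI ballI)
  show "wf_chart c" if "c \<in> submanifold_atlas A S" for c :: "('a, 'f) chart"
    using submanifold_atlasD(1)[OF A that] .
  show "\<Union> (fst ` (submanifold_atlas A S :: ('a, 'f) atlas)) = S"
    using cover submanifold_atlasD(2)[OF A] by (fastforce simp: charts_at_def)
  fix d d' :: "('a, 'f) chart" and p
  assume d: "d \<in> submanifold_atlas A S" "d' \<in> submanifold_atlas A S" "p \<in> fst d \<inter> fst d'"
  then obtain c where c: "c \<in> charts_at A p" using submanifold_chartE[OF A d(1)] by blast
  show "local_smooth d d' id p"
    using local_smooth_into_submanifold[OF A d(2), of id p d c] c d submanifold_atlasD[OF A d(1)] by auto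
qed

lemma smooth_atlas_normed_space: "smooth_atlas UNIV normed_space_atlas"
  unfolding smooth_atlas_def normed_space_atlas_def wf_chart_def
  by (auto intro!: local_smoothI[of _ _ UNIV "\<lambda>x. x"] smooth_on_ident)

lemma openin_normed_space: "openin (atlas_topology normed_space_atlas) W \<longleftrightarrow> open W"
  unfolding openin_atlas_topology[OF smooth_atlas_normed_space] by (simp add: normed_space_atlas_def)

section \<open>Smooth maps, diffeomorphisms and transfer of structure\<close>

lemma smooth_at_cong:
  assumes "smooth_atlas X A" "\<And>q. q \<in> X \<Longrightarrow> F q = G q" "p \<in> X" "smooth_at A B F p"
  shows "smooth_at A B G p"
proof -
  obtain c d where cd: "c \<in> charts_at A p" "d \<in> charts_at B (F p)" "local_smooth c d F p"
    using assms(4) unfolding smooth_at_def by blast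
  have "fst c \<subseteq> X" using smooth_atlasD(2)[OF assms(1)] cd by (simp add: charts_at_def)
  then show ?thesis
    using smooth_atI[OF cd(1) _ local_smooth_cong[OF cd(3)]] cd(2) assms(2,3) by (metis subsetD)
qed

lemma smooth_map_cong:
  fixes A :: "('a, 'e::findim) atlas" and B :: "('b, 'f::findim) atlas"
  assumes A: "smooth_atlas X A" and B: "smooth_atlas Y B" and eq: "\<And>q. q \<in> X \<Longrightarrow> F q = G q"
    and F: "smooth_map X A Y B F"
  shows "smooth_map X A Y B G"
proof -
  have 1: "F \<in> X \<rightarrow> Y" "\<And>p. p \<in> X \<Longrightarrow> smooth_at A B F p" using F unfolding smooth_map_iff[OF A B] by blast+
  have "smooth_at A B G p" if "p \<in> X" for p by (rule smooth_at_cong[OF A eq that 1(2)[OF that]])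
  then show ?thesis unfolding smooth_map_iff[OF A B] using 1(1) eq by (metis Pi_iff)
qed

lemma diffeomorphismI:
  fixes A :: "('a, 'e::findim) atlas" and B :: "('b, 'f::findim) atlas"
  assumes F: "bij_betw F X Y" and A: "smooth_atlas X A" and B: "smooth_atlas Y B"
    and loc: "\<And>p. p \<in> X \<Longrightarrow> \<exists>c\<in>charts_at A p. \<exists>d\<in>charts_at B (F p).
      local_smooth c d F p \<and> local_smooth d c (inv_into X F) (F p)"
  shows "diffeomorphism X A Y B F"
  unfolding diffeomorphism_def smooth_map_iff[OF A B] smooth_map_iff[OF B A]
proof (intro conjI F ballI)
  have inv: "inv_into X F (F p) = p" if "p \<in> X" for p using F that by (simp add: bij_betw_def)
  have inv2: "F (inv_into X F q) = q" "inv_into X F q \<in> X" if "q \<in> Y" for q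
    using F that by (auto simp: bij_betw_def f_inv_into_f inv_into_into)
  show "F \<in> X \<rightarrow> Y" "inv_into X F \<in> Y \<rightarrow> X" using F inv2 by (auto simp: bij_betw_def)
  show "smooth_at A B F p" if "p \<in> X" for p using loc[OF that] unfolding smooth_at_def by blast
  show "smooth_at B A (inv_into X F) q" if q: "q \<in> Y" for q
    using loc[OF inv2(2)[OF q]] unfolding smooth_at_def inv2(1)[OF q] by blast
qed

lemma diffeomorphism_comp:
  fixes A :: "('a, 'e::findim) atlas" and B :: "('b, 'f::findim) atlas" and C :: "('c, 'g::findim) atlas"
  assumes A: "smooth_atlas X A" and B: "smooth_atlas Y B" and C: "smooth_atlas Z C"
    and F: "diffeomorphism X A Y B F" and G: "diffeomorphism Y B Z C G"
  shows "diffeomorphism X A Z C (\<lambda>x. G (F x))"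
  unfolding diffeomorphism_def
proof (intro conjI)
  have b: "bij_betw F X Y" "bij_betw G Y Z" using F G by (auto simp: diffeomorphism_def)
  then have bij: "bij_betw (\<lambda>x. G (F x)) X Z" using bij_betw_trans[OF b] by (simp add: comp_def)
  then show "bij_betw (\<lambda>x. G (F x)) X Z" .
  show "smooth_map X A Z C (\<lambda>x. G (F x))"
    using smooth_map_comp[OF A B C] F G by (simp add: diffeomorphism_def)
  have "inv_into X F (inv_into Y G z) = inv_into X (\<lambda>x. G (F x)) z" if "z \<in> Z" for z
  proof (rule sym, rule inv_into_f_eq)
    show "inj_on (\<lambda>x. G (F x)) X" using bij by (simp add: bij_betw_def)
    show "inv_into X F (inv_into Y G z) \<in> X" "G (F (inv_into X F (inv_into Y G z))) = z"
      using b that by (auto simp: bij_betw_def inv_into_into f_inv_into_f)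
  qed
  then show "smooth_map Z C X A (inv_into X (\<lambda>x. G (F x)))"
    using smooth_map_cong[OF C A] smooth_map_comp[OF C B A] F G by (metis (no_types, lifting) diffeomorphism_def)
qed

lemma diffeomorphism_prod:
  fixes A :: "('a, 'e::findim) atlas" and B :: "('b, 'f::findim) atlas" and C :: "('c, 'g::findim) atlas"
  assumes A: "smooth_atlas X A" and B: "smooth_atlas Y B" and C: "smooth_atlas Z C"
    and F: "diffeomorphism X A Y B F"
  shows "diffeomorphism (Z \<times> X) (prod_atlas C A) (Z \<times> Y) (prod_atlas C B) (\<lambda>z. (fst z, F (snd z)))"
proof -
  have sm: "smooth_map (Z \<times> X) (prod_atlas C A) (Z \<times> Y) (prod_atlas C B) (\<lambda>z. (fst z, F (snd z)))"
    if A: "smooth_atlas X A" and B: "smooth_atlas Y B" and F: "smooth_map X A Y B F"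
    for X Y F and A :: "('x, 'y::findim) atlas" and B :: "('u, 'v::findim) atlas"
    unfolding smooth_map_iff[OF smooth_atlas_prod[OF C A] smooth_atlas_prod[OF C B]]
  proof (intro conjI ballI)
    have 1: "F \<in> X \<rightarrow> Y" "\<And>p. p \<in> X \<Longrightarrow> smooth_at A B F p" using F unfolding smooth_map_iff[OF A B] by blast+
    then show "(\<lambda>z. (fst z, F (snd z))) \<in> Z \<times> X \<rightarrow> Z \<times> Y" by auto
    fix p assume p: "p \<in> Z \<times> X"
    then have "smooth_at A B F (snd p)" using 1(2) by auto
    then show "smooth_at (prod_atlas C A) (prod_atlas C B) (\<lambda>z. (fst z, F (snd z))) p"
      by (intro smooth_at_Pair[OF smooth_atlas_prod[OF C A] C B] smooth_at_fst(1)[OF C A p]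
          smooth_at_comp[OF smooth_atlas_prod[OF C A] A B smooth_at_fst(2)[OF C A p]])
  qed
  have b: "bij_betw F X Y" using F by (simp add: diffeomorphism_def)
  have bij: "bij_betw (\<lambda>z. (fst z, F (snd z))) (Z \<times> X) (Z \<times> Y)"
    using b unfolding bij_betw_def inj_on_def by (auto simp: image_iff)
  have inv: "(fst z, inv_into X F (snd z)) = inv_into (Z \<times> X) (\<lambda>z. (fst z, F (snd z))) z" if "z \<in> Z \<times> Y" for z
    by (rule sym, rule inv_into_f_eq)
       (use bij b that in \<open>auto simp: bij_betw_def inv_into_into f_inv_into_f\<close>)
  show ?thesis unfolding diffeomorphism_def
    using bij sm[OF A B] F smooth_map_cong[OF smooth_atlas_prod[OF C B] smooth_atlas_prod[OF C A] inv sm[OF B A]]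
    by (simp add: diffeomorphism_def)
qed

text \<open>Compatibility of A is a conclusion: a coordinate change of A factors into F in charts, a
  coordinate change of B, and the inverse of F in charts. The topological axioms follow since F is
  then a homeomorphism. It serves for B/(Z/3Z), which is compared with H.\<close>

lemma transfer_manifold:
  fixes A :: "('a, 'e::findim) atlas" and B :: "('b, 'f::findim) atlas"
  assumes F: "bij_betw F X Y" and B: "smooth_manifold Y B"
    and wf: "\<And>c. c \<in> A \<Longrightarrow> wf_chart c" and cover: "\<Union> (fst ` A) = X"
    and loc: "\<And>c p. c \<in> A \<Longrightarrow> p \<in> fst c \<Longrightarrow>
      \<exists>d\<in>charts_at B (F p). local_smooth c d F p \<and> local_smooth d c (inv_into X F) (F p)"
  shows "smooth_manifold X A" "diffeomorphism X A Y B F"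
proof -
  have sB: "smooth_atlas Y B" using B by (simp add: smooth_manifold_iff)
  have inv: "inv_into X F (F p) = p" if "p \<in> X" for p using F that by (simp add: bij_betw_def)
  have inv2: "F (inv_into X F q) = q" "inv_into X F q \<in> X" if "q \<in> Y" for q
    using F that by (auto simp: bij_betw_def f_inv_into_f inv_into_into)
  have sA: "smooth_atlas X A" unfolding smooth_atlas_def
  proof (intro conjI ballI wf cover)
    fix c c' p assume c: "c \<in> A" "c' \<in> A" "p \<in> fst c \<inter> fst c'"
    then obtain d d' where d: "d \<in> charts_at B (F p)" "local_smooth c d F p"
      "d' \<in> charts_at B (F p)" "local_smooth d' c' (inv_into X F) (F p)" using loc[of c p] loc[of c' p] by auto
    have "local_smooth d d' id (F p)" using smooth_atlasD(4)[OF sB d(1,3)] .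
    from local_smooth_comp[OF d(2) this] have "local_smooth c d' F p" by simp
    from local_smooth_comp[OF this d(4)] show "local_smooth c c' id p"
      by (rule local_smooth_cong) (use inv cover c in auto)
  qed
  show d: "diffeomorphism X A Y B F"
    by (rule diffeomorphismI[OF F sA sB]) (use loc smooth_atlasD(3)[OF sA] in \<open>unfold charts_at_def, blast\<close>)
  then have 1: "smooth_map X A Y B F" and 2: "smooth_map Y B X A (inv_into X F)"
    by (simp_all add: diffeomorphism_def)
  have "homeomorphic_maps (atlas_topology A) (atlas_topology B) F (inv_into X F)"
    unfolding homeomorphic_maps_def topspace_atlas_topology[OF sA] topspace_atlas_topology[OF sB]
    using smooth_map_continuous[OF sA sB 1] smooth_map_continuous[OF sB sA 2] inv inv2 by auto
  then have h: "atlas_topology A homeomorphic_space atlas_topology B" unfolding homeomorphic_space_def by blast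
  show "smooth_manifold X A" using sA B h homeomorphic_Hausdorff_space[OF h]
      homeomorphic_space_second_countability[OF h] unfolding smooth_manifold_iff by blast
qed

section \<open>Tangent vectors, covectors and exterior derivatives in charts\<close>

abbreviation chart_deriv :: "('a, 'e::real_normed_vector) chart \<Rightarrow> ('b, 'f::real_normed_vector) chart
    \<Rightarrow> ('a \<Rightarrow> 'b) \<Rightarrow> 'a \<Rightarrow> 'e \<Rightarrow> 'f" where
  "chart_deriv c d F p \<equiv> frechet_derivative (in_charts c d F) (at (snd c p))"

lemma local_smooth_in_charts:
  assumes "wf_chart c" "local_smooth c d F p"
  obtains V where "open V" "snd c p \<in> V" "V \<subseteq> snd c ` fst c" "smooth_on V (in_charts c d F)"
    "\<forall>q\<in>fst c. snd c q \<in> V \<longrightarrow> F q \<in> fst d"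
proof -
  obtain V g where V: "p \<in> fst c" "open V" "snd c p \<in> V" "V \<subseteq> snd c ` fst c" "smooth_on V g"
    "\<forall>q\<in>fst c. snd c q \<in> V \<longrightarrow> F q \<in> fst d"
    "\<forall>q\<in>fst c. snd c q \<in> V \<longrightarrow> snd d (F q) = g (snd c q)" using assms(2) by (rule local_smoothE)
  have "g y = in_charts c d F y" if y: "y \<in> V" for y
  proof -
    obtain q where "q \<in> fst c" "y = snd c q" using V(4) y by blast
    then show ?thesis using V(7) y in_charts_eq[OF assms(1), of q d F] by simp
  qed
  then have "smooth_on V (in_charts c d F)" using V smooth_on_cong[OF V(2)] by metis
  then show thesis using V that by blast
qed

lemma chart_deriv_has_derivative:
  assumes "wf_chart c" "local_smooth c d F p"
  shows "(in_charts c d F has_derivative chart_deriv c d F p) (at (snd c p))"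
proof -
  obtain V where V: "open V" "snd c p \<in> V" "V \<subseteq> snd c ` fst c" "smooth_on V (in_charts c d F)"
    "\<forall>q\<in>fst c. snd c q \<in> V \<longrightarrow> F q \<in> fst d" using local_smooth_in_charts[OF assms] .
  show ?thesis by (rule smooth_on_has_derivative[OF V(4,2)])
qed

lemma bounded_linear_chart_deriv:
  "wf_chart c \<Longrightarrow> local_smooth c d F p \<Longrightarrow> bounded_linear (chart_deriv c d F p)"
  by (rule has_derivative_bounded_linear[OF chart_deriv_has_derivative])

lemma chart_deriv_eqI:
  assumes "wf_chart c" "p \<in> fst c" "open V" "snd c p \<in> V" "V \<subseteq> snd c ` fst c"
    "\<And>q. q \<in> fst c \<Longrightarrow> snd c q \<in> V \<Longrightarrow> snd d (F q) = g (snd c q)" "(g has_derivative D) (at (snd c p))"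
  shows "chart_deriv c d F p = D"
proof -
  have "(in_charts c d F has_derivative D) (at (snd c p))"
  proof (rule has_derivative_transform_within_open[OF assms(7,3,4)])
    fix y assume "y \<in> V"
    then obtain q where "q \<in> fst c" "y = snd c q" using assms(5) by blast
    then show "g y = in_charts c d F y" using assms(6) \<open>y \<in> V\<close> in_charts_eq[OF assms(1), of q d F] by simp
  qed
  then show ?thesis using frechet_derivative_at by metis
qed

lemma chart_deriv_comp:
  assumes c: "wf_chart c" and d: "wf_chart d" and F: "local_smooth c d F p" and G: "local_smooth d e G (F p)"
  shows "chart_deriv c e (\<lambda>x. G (F x)) p = (\<lambda>u. chart_deriv d e G (F p) (chart_deriv c d F p u))"
proof -
  obtain V where V: "open V" "snd c p \<in> V" "V \<subseteq> snd c ` fst c" "smooth_on V (in_charts c d F)"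
    "\<forall>q\<in>fst c. snd c q \<in> V \<longrightarrow> F q \<in> fst d" using local_smooth_in_charts[OF c F] .
  have p: "p \<in> fst c" using F unfolding local_smooth_def by blast
  have Fp: "in_charts c d F (snd c p) = snd d (F p)" using in_charts_eq[OF c p] .
  show ?thesis
  proof (rule chart_deriv_eqI[OF c p V(1-3), where g = "\<lambda>y. in_charts d e G (in_charts c d F y)"])
    show "snd e (G (F q)) = in_charts d e G (in_charts c d F (snd c q))" if "q \<in> fst c" "snd c q \<in> V" for q
      using in_charts_eq[OF c that(1), of d F] in_charts_eq[OF d, of "F q" e G] V(5) that by simp
    show "((\<lambda>y. in_charts d e G (in_charts c d F y)) has_derivative
        (\<lambda>u. chart_deriv d e G (F p) (chart_deriv c d F p u))) (at (snd c p))"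
      using diff_chain_at[OF chart_deriv_has_derivative[OF c F], of "in_charts d e G" "chart_deriv d e G (F p)"]
        chart_deriv_has_derivative[OF d G] unfolding Fp by (simp add: comp_def)
  qed
qed

lemma chart_deriv_id: "wf_chart c \<Longrightarrow> p \<in> fst c \<Longrightarrow> chart_deriv c c id p = (\<lambda>u. u)"
  by (rule chart_deriv_eqI[of c p "snd c ` fst c" _ _ "\<lambda>y. y"]) (auto simp: wf_chart_def)

lemma charts_at_wf: "smooth_atlas X A \<Longrightarrow> c \<in> charts_at A p \<Longrightarrow> wf_chart c"
  using smooth_atlasD(1) charts_atD(1) by metis

lemma chart_deriv_trans:
  assumes A: "smooth_atlas X A" and c: "c \<in> charts_at A p" and d: "d \<in> charts_at A p" and e: "e \<in> charts_at A p"
  shows "chart_deriv d e id p (chart_deriv c d id p u) = chart_deriv c e id p u"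
proof -
  note w = charts_at_wf[OF A c] charts_at_wf[OF A d]
  have "local_smooth d e id (id p)" using smooth_atlasD(4)[OF A d e] by simp
  from chart_deriv_comp[OF w smooth_atlasD(4)[OF A c d] this] show ?thesis by (simp add: fun_eq_iff id_def)
qed

lemma some_chart: "smooth_atlas X A \<Longrightarrow> p \<in> X \<Longrightarrow> some_chart A p \<in> charts_at A p"
  unfolding some_chart_def using smooth_atlasD(3) someI_ex by fast

lemma charts_at_mem: "smooth_atlas X A \<Longrightarrow> c \<in> charts_at A p \<Longrightarrow> p \<in> X"
  using smooth_atlasD(2) unfolding charts_at_def by fastforce

lemma linear_chart_deriv:
  assumes A: "smooth_atlas X A" and c: "c \<in> charts_at A p" and d: "d \<in> charts_at A p"
  shows "bounded_linear (chart_deriv c d id p)"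
  using bounded_linear_chart_deriv[OF charts_at_wf[OF A c] smooth_atlasD(4)[OF A c d]] .

section \<open>Tangent vectors in coordinates\<close>

lemma coord_tangent_apply:
  "d \<in> charts_at A p \<Longrightarrow> coord_tangent A c p e d = chart_deriv c d id p e"
  by (simp add: coord_tangent_def)

lemma coord_tangent_self:
  "smooth_atlas X A \<Longrightarrow> c \<in> charts_at A p \<Longrightarrow> coord_tangent A c p e c = e"
  using chart_deriv_id[OF charts_at_wf charts_atD(2), of X A c p A p] by (simp add: coord_tangent_apply)

lemma coord_tangent_in:
  "smooth_atlas X A \<Longrightarrow> c \<in> charts_at A p \<Longrightarrow> coord_tangent A c p e \<in> tangent_space A p"
  unfolding tangent_space_def by (auto simp: coord_tangent_apply chart_deriv_trans) (simp add: coord_tangent_def)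

lemma tangent_space_change:
  "u \<in> tangent_space A p \<Longrightarrow> c \<in> charts_at A p \<Longrightarrow> d \<in> charts_at A p \<Longrightarrow> u d = chart_deriv c d id p (u c)"
  unfolding tangent_space_def by blast

lemma coord_tangent_eq:
  assumes "u \<in> tangent_space A p" "c \<in> charts_at A p"
  shows "coord_tangent A c p (u c) = u"
proof
  fix d
  have *: "\<forall>c\<in>charts_at A p. \<forall>d\<in>charts_at A p. u d = chart_deriv c d id p (u c)" "\<forall>d. d \<notin> charts_at A p \<longrightarrow> u d = 0"
    using assms(1) unfolding tangent_space_def by blast+
  from bspec[OF *(1) assms(2)] *(2) show "coord_tangent A c p (u c) d = u d"
    unfolding coord_tangent_def by (cases "d \<in> charts_at A p") (simp_all only: if_True if_False, metis)
qed

lemma coord_tangent_change: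
  assumes "smooth_atlas X A" "c \<in> charts_at A p" "d \<in> charts_at A p"
  shows "coord_tangent A c p e = coord_tangent A d p (chart_deriv c d id p e)"
  using coord_tangent_eq[OF coord_tangent_in[OF assms(1,2)] assms(3)] assms by (simp add: coord_tangent_apply)

lemma coord_tangent_linear:
  assumes A: "smooth_atlas X A" and c: "c \<in> charts_at A p"
  shows "coord_tangent A c p (e + f) = (\<lambda>d. coord_tangent A c p e d + coord_tangent A c p f d)"
    "coord_tangent A c p (r *\<^sub>R e) = (\<lambda>d. r *\<^sub>R coord_tangent A c p e d)"
  using linear_chart_deriv[OF A c]
  by (auto simp: coord_tangent_def fun_eq_iff linear_simps bounded_linear.linear linear_scale linear_add)

lemma tangent_space_add:
  assumes A: "smooth_atlas X A" and c: "c \<in> charts_at A p" and u: "u \<in> tangent_space A p" and v: "v \<in> tangent_space A p"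
  shows "(\<lambda>d. u d + v d) \<in> tangent_space A p" "(\<lambda>d. r *\<^sub>R u d) \<in> tangent_space A p"
proof -
  have "(\<lambda>d. u d + v d) = coord_tangent A c p (u c + v c)"
    using coord_tangent_linear(1)[OF A c] coord_tangent_eq[OF u c] coord_tangent_eq[OF v c] by simp
  moreover have "(\<lambda>d. r *\<^sub>R u d) = coord_tangent A c p (r *\<^sub>R u c)"
    using coord_tangent_linear(2)[OF A c] coord_tangent_eq[OF u c] by simp
  ultimately show "(\<lambda>d. u d + v d) \<in> tangent_space A p" "(\<lambda>d. r *\<^sub>R u d) \<in> tangent_space A p"
    using coord_tangent_in[OF A c] by simp_all
qed

text \<open>\<open>tangent_map\<close> is computed in the arbitrary \<open>some_chart\<close>; the
  chain rule through that chart, c, d and any further chart d' removes the choice.\<close>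

lemma tangent_map_coord:
  fixes A :: "('a, 'e::findim) atlas" and B :: "('b, 'f::findim) atlas"
  assumes A: "smooth_atlas X A" and B: "smooth_atlas Y B"
    and c: "c \<in> charts_at A p" and d: "d \<in> charts_at B (F p)" and F: "local_smooth c d F p"
  shows "tangent_map A B F p (coord_tangent A c p e) = coord_tangent B d (F p) (chart_deriv c d F p e)"
proof
  fix d'
  define c0 where "c0 = some_chart A p"
  have c0: "c0 \<in> charts_at A p" unfolding c0_def by (rule some_chart[OF A charts_at_mem[OF A c]])
  show "tangent_map A B F p (coord_tangent A c p e) d' = coord_tangent B d (F p) (chart_deriv c d F p e) d'"
  proof (cases "d' \<in> charts_at B (F p)")
    case True
    note w = charts_at_wf[OF A c0] charts_at_wf[OF A c] charts_at_wf[OF B d]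
    have 1: "local_smooth c0 c id p" "local_smooth c c0 id p" using smooth_atlasD(4)[OF A] c0 c by blast+
    have 2: "local_smooth d d' id (F p)" using smooth_atlasD(4)[OF B d True] .
    have Fi: "local_smooth c d F (id p)" using F by simp
    have 3: "chart_deriv c0 d F p = (\<lambda>u. chart_deriv c d F p (chart_deriv c0 c id p u))"
      using chart_deriv_comp[where F = id and G = F, OF w(1,2) 1(1) Fi] by simp
    have 4: "local_smooth c0 d F p" using local_smooth_comp[where F = id and G = F, OF 1(1) Fi] by simp
    have 5: "chart_deriv c0 d' F p = (\<lambda>u. chart_deriv d d' id (F p) (chart_deriv c0 d F p u))"
      using chart_deriv_comp[where G = id, OF w(1,3) 4 2] by simp
    have "chart_deriv c0 c id p (chart_deriv c c0 id p e) = e"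
      using chart_deriv_trans[OF A c c0 c] chart_deriv_id[OF w(2) charts_atD(2)[OF c]] by simp
    then show ?thesis unfolding tangent_map_def using True c0 5 3
      by (simp add: coord_tangent_apply flip: c0_def)
  qed (simp add: tangent_map_def coord_tangent_def)
qed

section \<open>Covectors, pullbacks and exterior derivatives in coordinates\<close>

lemma covector_linear:
  assumes A: "smooth_atlas X A" and c: "c \<in> charts_at A p" and \<alpha>: "\<alpha> \<in> covectors A p"
  shows "linear (\<lambda>e. \<alpha> (coord_tangent A c p e))"
proof
  fix e f r
  show "\<alpha> (coord_tangent A c p (e + f)) = \<alpha> (coord_tangent A c p e) + \<alpha> (coord_tangent A c p f)"
    using \<alpha> coord_tangent_in[OF A c] unfolding covectors_def coord_tangent_linear(1)[OF A c] by simp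
  show "\<alpha> (coord_tangent A c p (r *\<^sub>R e)) = r *\<^sub>R \<alpha> (coord_tangent A c p e)"
    using \<alpha> coord_tangent_in[OF A c] unfolding covectors_def coord_tangent_linear(2)[OF A c]
    by (simp add: scaleR_conv_of_real)
qed

text \<open>Equality holds as functions, not merely on tangent vectors, because covectors are
  normalised to 0 elsewhere.\<close>

lemma covector_eqI:
  assumes "c \<in> charts_at A p" "\<alpha> \<in> covectors A p" "\<beta> \<in> covectors A p"
    "\<And>e. \<alpha> (coord_tangent A c p e) = \<beta> (coord_tangent A c p e)"
  shows "\<alpha> = \<beta>"
proof
  fix u show "\<alpha> u = \<beta> u"
    using assms(4)[of "u c"] coord_tangent_eq[OF _ assms(1), of u] assms(2,3)
    by (cases "u \<in> tangent_space A p") (auto simp: covectors_def)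
qed

lemma covector_out: "\<alpha> \<in> covectors A p \<Longrightarrow> u \<notin> tangent_space A p \<Longrightarrow> \<alpha> u = 0"
  by (simp add: covectors_def)

text \<open>Inverse to taking coordinates: the covector at p with the expression l in the chart c,
  extended by 0 as \<open>covectors\<close> demands.\<close>

definition covector_of :: "('a, 'e::real_normed_vector) atlas \<Rightarrow> ('a, 'e) chart \<Rightarrow> 'a \<Rightarrow> ('e \<Rightarrow> complex) \<Rightarrow> ('a, 'e) covector" where
  "covector_of A c p l = (\<lambda>u. if u \<in> tangent_space A p then l (u c) else 0)"

lemma covector_of_coord:
  "smooth_atlas X A \<Longrightarrow> c \<in> charts_at A p \<Longrightarrow> covector_of A c p l (coord_tangent A c p e) = l e"
  by (simp add: covector_of_def coord_tangent_in coord_tangent_self)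

lemma covector_of_in:
  assumes A: "smooth_atlas X A" and c: "c \<in> charts_at A p" and l: "linear l"
  shows "covector_of A c p l \<in> covectors A p"
  unfolding covectors_def covector_of_def
  using tangent_space_add[OF A c] linear_add[OF l] linear_scale[OF l]
  by (auto simp: scaleR_conv_of_real)

lemma pullback_coord:
  fixes A :: "('a, 'e::findim) atlas" and B :: "('b, 'f::findim) atlas"
  assumes A: "smooth_atlas X A" and B: "smooth_atlas Y B"
    and c: "c \<in> charts_at A p" and d: "d \<in> charts_at B (F p)" and F: "local_smooth c d F p"
  shows "pullback A B F p \<beta> (coord_tangent A c p e) = \<beta> (coord_tangent B d (F p) (chart_deriv c d F p e))"
  unfolding pullback_def using coord_tangent_in[OF A c] tangent_map_coord[OF assms] by simp

lemma coord_form_eq: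
  "wf_chart c \<Longrightarrow> p \<in> fst c \<Longrightarrow> coord_form A \<omega> c (snd c p) e = \<omega> p (coord_tangent A c p e)"
  by (simp add: coord_form_def chart_inv_eq)

lemma linear_euclidean_sum:
  fixes l :: "'e::euclidean_space \<Rightarrow> complex"
  assumes "linear l"
  shows "l w = (\<Sum>b\<in>Basis. of_real (w \<bullet> b) * l b)"
proof -
  have "l w = l (\<Sum>b\<in>Basis. (w \<bullet> b) *\<^sub>R b)" by (simp add: euclidean_representation)
  also have "\<dots> = (\<Sum>b\<in>Basis. (w \<bullet> b) *\<^sub>R l b)" by (simp add: linear_sum[OF assms] linear_scale[OF assms])
  finally show ?thesis by (simp add: scaleR_conv_of_real)
qed

text \<open>The second derivatives of the coordinate change cancel by their symmetry.\<close>

lemma ext_deriv_chart: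
  fixes A :: "('a, 'e::euclidean_space) atlas"
  assumes A: "smooth_atlas X A" and c: "c \<in> charts_at A p"
    and U: "openin (atlas_topology A) U" "p \<in> U" and \<omega>: "\<And>q. q \<in> U \<Longrightarrow> \<omega> q \<in> covectors A q"
    and sm: "\<And>e. smooth_on (snd c ` (fst c \<inter> U)) (\<lambda>y. coord_form A \<omega> c y e)"
    and u: "u \<in> tangent_space A p" and v: "v \<in> tangent_space A p"
  shows "ext_deriv A \<omega> p u v =
    frechet_derivative (\<lambda>y. coord_form A \<omega> c y (v c)) (at (snd c p)) (u c) -
    frechet_derivative (\<lambda>y. coord_form A \<omega> c y (u c)) (at (snd c p)) (v c)"
proof -
  let ?D = "\<lambda>f y. frechet_derivative f (at y)"
  define c0 where "c0 = some_chart A p"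
  have c0: "c0 \<in> charts_at A p" unfolding c0_def by (rule some_chart[OF A charts_at_mem[OF A c]])
  note w = charts_at_wf[OF A c0] charts_at_wf[OF A c]
  have cA: "c \<in> A" "c0 \<in> A" "p \<in> fst c" "p \<in> fst c0" using c c0 by (auto simp: charts_at_def)
  define S where "S = snd c ` (fst c \<inter> U)"
  define \<tau> where "\<tau> = in_charts c0 c id"
  define f where "f b y = coord_form A \<omega> c y b" for b y
  have S: "open S" "snd c p \<in> S" using openin_atlasD[OF A U(1) cA(1)] cA U unfolding S_def by auto
  obtain V1 where V1: "open V1" "snd c0 p \<in> V1" "V1 \<subseteq> snd c0 ` fst c0" "smooth_on V1 \<tau>"
    "\<forall>q\<in>fst c0. snd c0 q \<in> V1 \<longrightarrow> id q \<in> fst c"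
    using local_smooth_in_charts[OF w(1) smooth_atlasD(4)[OF A c0 c]] unfolding \<tau>_def by metis
  define V where "V = V1 \<inter> snd c0 ` (fst c0 \<inter> U)"
  have V: "open V" "snd c0 p \<in> V" "V \<subseteq> V1"
    using V1 openin_atlasD[OF A U(1) cA(2)] cA U unfolding V_def by auto
  have sm\<tau>: "smooth_on V \<tau>" using V1 V smooth_on_subset by blast
  have rep: "\<exists>q. q \<in> fst c0 \<and> q \<in> fst c \<and> q \<in> U \<and> y = snd c0 q \<and> \<tau> y = snd c q" if y: "y \<in> V" for y
  proof -
    obtain q where q: "q \<in> fst c0" "q \<in> U" "y = snd c0 q" using y unfolding V_def by auto
    then show ?thesis using V1(5) y V in_charts_eq[OF w(1) q(1), of c id] unfolding \<tau>_def by auto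
  qed
  have \<tau>p: "\<tau> (snd c0 p) = snd c p" unfolding \<tau>_def using in_charts_eq[OF w(1) cA(4), of c id] by simp
  have exp_f: "f e y = (\<Sum>b\<in>Basis. of_real (e \<bullet> b) * f b y)" if y: "y \<in> S" for e y
  proof -
    obtain q where q: "y = snd c q" "q \<in> fst c" "q \<in> U" using y unfolding S_def by auto
    have "c \<in> charts_at A q" using cA q by (simp add: charts_at_def)
    from linear_euclidean_sum[OF covector_linear[OF A this \<omega>[OF q(3)]], of e] show ?thesis
      unfolding f_def q(1) coord_form_eq[OF w(2) q(2)] .
  qed
  \<comment> \<open>In the chart c0 the form is the pullback under \<tau>: its components are those
    in c, composed with \<tau> and weighted by the entries of the derivative of \<tau>.\<close>
  have trans: "coord_form A \<omega> c0 y e = (\<Sum>b\<in>Basis. of_real (?D \<tau> y e \<bullet> b) * f b (\<tau> y))" if y: "y \<in> V" for y e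
  proof -
    obtain q where q: "q \<in> fst c0" "q \<in> fst c" "q \<in> U" "y = snd c0 q" "\<tau> y = snd c q" using rep[OF y] by blast
    have qc: "c \<in> charts_at A q" "c0 \<in> charts_at A q" using cA q by (auto simp: charts_at_def)
    have "coord_form A \<omega> c0 y e = \<omega> q (coord_tangent A c0 q e)"
      unfolding q(4) using coord_form_eq[OF w(1) q(1)] .
    also have "\<dots> = \<omega> q (coord_tangent A c q (?D \<tau> y e))"
      using coord_tangent_change[OF A qc(2,1)] unfolding \<tau>_def q(4) by simp
    also have "\<dots> = f (?D \<tau> y e) (\<tau> y)" unfolding f_def q(5) coord_form_eq[OF w(2) q(2)] ..
    also have "\<dots> = (\<Sum>b\<in>Basis. of_real (?D \<tau> y e \<bullet> b) * f b (\<tau> y))"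
      by (rule exp_f) (use q in \<open>auto simp: S_def\<close>)
    finally show ?thesis .
  qed
  let ?y0 = "snd c0 p"
  let ?y1 = "snd c p"
  have df: "(f b has_derivative ?D (f b) ?y1) (at ?y1)" for b
    using smooth_on_has_derivative[OF sm S(2)[unfolded S_def]] unfolding f_def .
  have d\<tau>: "(\<tau> has_derivative ?D \<tau> ?y0) (at ?y0)" using smooth_on_has_derivative[OF sm\<tau> V(2)] .
  have d2\<tau>: "((\<lambda>y. ?D \<tau> y e) has_derivative ?D (\<lambda>y. ?D \<tau> y e) ?y0) (at ?y0)" for e
    using smooth_on_has_derivative[OF smooth_on_frechet_derivative[OF sm\<tau>] V(2)] .
  \<comment> \<open>Product rule for the pullback. The second group of terms carries the second
    derivative of \<tau>, which is symmetric in e and h and so drops out of the antisymmetrised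
    difference.\<close>
  have d0: "?D (\<lambda>y. coord_form A \<omega> c0 y e) ?y0 h =
     (\<Sum>b\<in>Basis. of_real (?D \<tau> ?y0 e \<bullet> b) * ?D (f b) ?y1 (?D \<tau> ?y0 h) + of_real (?D (\<lambda>y. ?D \<tau> y e) ?y0 h \<bullet> b) * f b ?y1)"
    for e h
  proof -
    have dfb: "((\<lambda>y. f b (\<tau> y)) has_derivative (\<lambda>h. ?D (f b) ?y1 (?D \<tau> ?y0 h))) (at ?y0)" for b
      using diff_chain_at[OF d\<tau>, of "f b" "?D (f b) ?y1"] df unfolding \<tau>p comp_def by simp
    have "((\<lambda>y. \<Sum>b\<in>Basis. of_real (?D \<tau> y e \<bullet> b) * f b (\<tau> y)) has_derivative
      (\<lambda>h. \<Sum>b\<in>Basis. of_real (?D \<tau> ?y0 e \<bullet> b) * ?D (f b) ?y1 (?D \<tau> ?y0 h) +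
         of_real (?D (\<lambda>y. ?D \<tau> y e) ?y0 h \<bullet> b) * f b (\<tau> ?y0))) (at ?y0)"
      by (intro has_derivative_sum has_derivative_mult has_derivative_of_real has_derivative_inner_left d2\<tau> dfb)
    then have "((\<lambda>y. coord_form A \<omega> c0 y e) has_derivative
      (\<lambda>h. \<Sum>b\<in>Basis. of_real (?D \<tau> ?y0 e \<bullet> b) * ?D (f b) ?y1 (?D \<tau> ?y0 h) +
         of_real (?D (\<lambda>y. ?D \<tau> y e) ?y0 h \<bullet> b) * f b (\<tau> ?y0))) (at ?y0)"
      by (rule has_derivative_transform_within_open[OF _ V(1,2)]) (simp add: trans)
    from fun_cong[OF frechet_derivative_at[OF this, unfolded \<tau>p], of h, symmetric] show ?thesis .
  qed
  have d1: "?D (f e) ?y1 h = (\<Sum>b\<in>Basis. of_real (e \<bullet> b) * ?D (f b) ?y1 h)" for e h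
  proof -
    have "((\<lambda>y. \<Sum>b\<in>Basis. of_real (e \<bullet> b) * f b y) has_derivative
      (\<lambda>h. \<Sum>b\<in>Basis. of_real (e \<bullet> b) * ?D (f b) ?y1 h)) (at ?y1)"
      by (intro has_derivative_sum has_derivative_mult_right df)
    then have "(f e has_derivative (\<lambda>h. \<Sum>b\<in>Basis. of_real (e \<bullet> b) * ?D (f b) ?y1 h)) (at ?y1)"
      by (rule has_derivative_transform_within_open[OF _ S]) (simp add: exp_f[of _ e])
    from fun_cong[OF frechet_derivative_at[OF this], of h, symmetric] show ?thesis .
  qed
  have uv: "?D \<tau> ?y0 (u c0) = u c" "?D \<tau> ?y0 (v c0) = v c"
    unfolding \<tau>_def by (rule tangent_space_change[OF u c0 c, symmetric], rule tangent_space_change[OF v c0 c, symmetric])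
  have sym: "?D (\<lambda>y. ?D \<tau> y (v c0)) ?y0 (u c0) = ?D (\<lambda>y. ?D \<tau> y (u c0)) ?y0 (v c0)"
    by (rule symmetric_second_derivative[OF sm\<tau> V(1,2)])
  have "ext_deriv A \<omega> p u v = ?D (\<lambda>y. coord_form A \<omega> c0 y (v c0)) ?y0 (u c0) - ?D (\<lambda>y. coord_form A \<omega> c0 y (u c0)) ?y0 (v c0)"
    unfolding ext_deriv_def by (simp add: Let_def flip: c0_def)
  also have "\<dots> = ?D (f (v c)) ?y1 (u c) - ?D (f (u c)) ?y1 (v c)"
    unfolding d0 uv sym d1[of "u c"] d1[of "v c"] sum.distrib by simp
  finally show ?thesis unfolding f_def .
qed

section \<open>The bundles of covectors and of quadruples of covectors\<close>

definition covector_chart ::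
  "('a, 'e::euclidean_space) atlas \<Rightarrow> ('a, 'e) chart \<Rightarrow> (('a, 'e) covector_pt, 'e \<times> ('e \<Rightarrow>\<^sub>L complex)) chart" where
  "covector_chart A c = ({(p, \<alpha>). p \<in> fst c \<and> \<alpha> \<in> covectors A p}, \<lambda>(p, \<alpha>). (snd c p, coord_covector A c p \<alpha>))"

definition covector4_chart ::
  "('a, 'e::euclidean_space) atlas \<Rightarrow> ('a, 'e) chart \<Rightarrow> (('a, 'e) coframe_pt, 'e \<times> (('e \<Rightarrow>\<^sub>L complex) ^ 4)) chart" where
  "covector4_chart A c = ({(p, \<eta>). p \<in> fst c \<and> (\<forall>i. \<eta> $ i \<in> covectors A p)},
     \<lambda>(p, \<eta>). (snd c p, \<chi> i. coord_covector A c p (\<eta> $ i)))"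

lemma covector_atlas_eq: "covector_atlas A = covector_chart A ` A"
  unfolding covector_atlas_def covector_chart_def ..

lemma covector4_atlas_eq: "covector4_atlas A = covector4_chart A ` A"
  unfolding covector4_atlas_def covector4_chart_def ..

lemma coord_covector_apply:
  fixes A :: "('a, 'e::euclidean_space) atlas"
  assumes "smooth_atlas X A" "c \<in> charts_at A p" "\<alpha> \<in> covectors A p"
  shows "blinfun_apply (coord_covector A c p \<alpha>) e = \<alpha> (coord_tangent A c p e)"
  unfolding coord_covector_def
  using bounded_linear_Blinfun_apply linear_conv_bounded_linear covector_linear[OF assms] by metis

lemma coord_covector_inj:
  fixes A :: "('a, 'e::euclidean_space) atlas"
  assumes "smooth_atlas X A" "c \<in> charts_at A p" "\<alpha> \<in> covectors A p" "\<beta> \<in> covectors A p"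
    "coord_covector A c p \<alpha> = coord_covector A c p \<beta>"
  shows "\<alpha> = \<beta>"
  using covector_eqI[OF assms(2-4)] coord_covector_apply[OF assms(1-3)]
    coord_covector_apply[OF assms(1,2,4)] assms(5) by simp

lemma coord_covector_surj:
  fixes A :: "('a, 'e::euclidean_space) atlas"
  assumes "smooth_atlas X A" "c \<in> charts_at A p"
  obtains \<alpha> where "\<alpha> \<in> covectors A p" "coord_covector A c p \<alpha> = L"
proof
  let ?\<alpha> = "covector_of A c p (blinfun_apply L)"
  show 1: "?\<alpha> \<in> covectors A p"
    by (intro covector_of_in[OF assms] bounded_linear.linear blinfun.bounded_linear_right)
  show "coord_covector A c p ?\<alpha> = L"
    by (rule blinfun_eqI) (simp add: coord_covector_apply[OF assms 1] covector_of_coord[OF assms])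
qed

lemma wf_covector_chart:
  fixes A :: "('a, 'e::euclidean_space) atlas"
  assumes A: "smooth_atlas X A" and c: "c \<in> A"
  shows "wf_chart (covector_chart A c)" "snd (covector_chart A c) ` fst (covector_chart A c) = snd c ` fst c \<times> UNIV"
    "wf_chart (covector4_chart A c)" "snd (covector4_chart A c) ` fst (covector4_chart A c) = snd c ` fst c \<times> UNIV"
proof -
  have at: "c \<in> charts_at A p" if "p \<in> fst c" for p using that c by (simp add: charts_at_def)
  note inj = wf_chartD(1)[OF smooth_atlasD(1)[OF A c]]
  have o: "open (snd c ` fst c)" using wf_chartD(2)[OF smooth_atlasD(1)[OF A c]] .
  show im: "snd (covector_chart A c) ` fst (covector_chart A c) = snd c ` fst c \<times> UNIV"
  proof (rule equalityI; rule subsetI)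
    fix z assume "z \<in> snd c ` fst c \<times> (UNIV :: ('e \<Rightarrow>\<^sub>L complex) set)"
    then obtain p L where z: "z = (snd c p, L)" "p \<in> fst c" by auto
    obtain \<alpha> where "\<alpha> \<in> covectors A p" "coord_covector A c p \<alpha> = L" using coord_covector_surj[OF A at[OF z(2)]] .
    then show "z \<in> snd (covector_chart A c) ` fst (covector_chart A c)"
      using z unfolding covector_chart_def by force
  qed (auto simp: covector_chart_def)
  show im4: "snd (covector4_chart A c) ` fst (covector4_chart A c) = snd c ` fst c \<times> UNIV"
  proof (rule equalityI; rule subsetI)
    fix z assume "z \<in> snd c ` fst c \<times> (UNIV :: (('e \<Rightarrow>\<^sub>L complex) ^ 4) set)"
    then obtain p L where z: "z = (snd c p, L)" "p \<in> fst c" by auto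
    have "\<forall>i. \<exists>\<alpha>. \<alpha> \<in> covectors A p \<and> coord_covector A c p \<alpha> = L $ i"
      using coord_covector_surj[OF A at[OF z(2)]] by metis
    then obtain \<eta> where "\<And>i. \<eta> i \<in> covectors A p \<and> coord_covector A c p (\<eta> i) = L $ i" by metis
    then have "(p, \<chi> i. \<eta> i) \<in> fst (covector4_chart A c)" "snd (covector4_chart A c) (p, \<chi> i. \<eta> i) = z"
      using z unfolding covector4_chart_def by (auto simp: vec_eq_iff)
    then show "z \<in> snd (covector4_chart A c) ` fst (covector4_chart A c)" by force
  qed (auto simp: covector4_chart_def)
  have "inj_on (snd (covector_chart A c)) (fst (covector_chart A c))"
  proof (rule inj_onI)
    fix z w assume zw: "z \<in> fst (covector_chart A c)" "w \<in> fst (covector_chart A c)"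
      "snd (covector_chart A c) z = snd (covector_chart A c) w"
    obtain p \<alpha> q \<beta> where pq: "z = (p, \<alpha>)" "w = (q, \<beta>)" by (cases z, cases w)
    have 1: "p \<in> fst c" "q \<in> fst c" "\<alpha> \<in> covectors A p" "\<beta> \<in> covectors A q" "snd c p = snd c q"
      "coord_covector A c p \<alpha> = coord_covector A c q \<beta>" using zw unfolding covector_chart_def pq by simp_all
    have "p = q" by (rule inj_onD[OF inj 1(5,1,2)])
    then show "z = w" using coord_covector_inj[OF A at[OF 1(1)] 1(3)] 1 pq by simp
  qed
  then show "wf_chart (covector_chart A c)" unfolding wf_chart_def im using o by (auto intro: open_Times)
  have "inj_on (snd (covector4_chart A c)) (fst (covector4_chart A c))"
  proof (rule inj_onI)
    fix z w assume zw: "z \<in> fst (covector4_chart A c)" "w \<in> fst (covector4_chart A c)"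
      "snd (covector4_chart A c) z = snd (covector4_chart A c) w"
    obtain p \<alpha> q \<beta> where pq: "z = (p, \<alpha>)" "w = (q, \<beta>)" by (cases z, cases w)
    have 1: "p \<in> fst c" "q \<in> fst c" "\<And>i. \<alpha> $ i \<in> covectors A p" "\<And>i. \<beta> $ i \<in> covectors A q" "snd c p = snd c q"
      "\<And>i. coord_covector A c p (\<alpha> $ i) = coord_covector A c q (\<beta> $ i)"
      using zw unfolding covector4_chart_def pq by (simp_all add: vec_eq_iff)
    have "p = q" by (rule inj_onD[OF inj 1(5,1,2)])
    then have "\<alpha> $ i = \<beta> $ i" for i using coord_covector_inj[OF A at[OF 1(1)] 1(3)] 1 by simp
    then show "z = w" using \<open>p = q\<close> pq by (simp add: vec_eq_iff)
  qed
  then show "wf_chart (covector4_chart A c)" unfolding wf_chart_def im4 using o by (auto intro: open_Times)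
qed

lemma coord_covector_change:
  fixes A :: "('a, 'e::euclidean_space) atlas"
  assumes A: "smooth_atlas X A" and c: "c \<in> charts_at A p" and d: "d \<in> charts_at A p" and \<alpha>: "\<alpha> \<in> covectors A p"
  shows "coord_covector A d p \<alpha> = Blinfun (\<lambda>e. blinfun_apply (coord_covector A c p \<alpha>) (chart_deriv d c id p e))"
  unfolding coord_covector_apply[OF A c \<alpha>] using coord_tangent_change[OF A d c]
  by (simp add: coord_covector_def)

text \<open>The fibre part of a coordinate change: the components of a covector transform by the
  derivative of the inverse coordinate change, taken at the image point. The parameter x and the
  maps f and L let one statement serve single covectors and every component of a quadruple.\<close>

lemma smooth_covector_change:
  fixes A :: "('a, 'e::euclidean_space) atlas" and f :: "'x::real_normed_vector \<Rightarrow> 'e"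
  assumes A: "smooth_atlas X A" and c: "c \<in> A" and d: "d \<in> A"
    and S: "open S" and f: "smooth_on S f" "f ` S \<subseteq> snd c ` (fst c \<inter> fst d)" and L: "smooth_on S L"
  shows "smooth_on S (\<lambda>x. Blinfun (\<lambda>e. blinfun_apply (L x)
    (frechet_derivative (in_charts d c id) (at (in_charts c d id (f x))) e)))"
proof -
  let ?\<tau> = "in_charts c d id" let ?\<sigma> = "in_charts d c id"
  let ?V = "snd c ` (fst c \<inter> fst d)" let ?W = "snd d ` (fst d \<inter> fst c)"
  note w = smooth_atlasD(1)[OF A c] smooth_atlasD(1)[OF A d]
  have ls: "\<forall>p\<in>fst c \<inter> fst d. local_smooth c d id p" "\<forall>p\<in>fst d \<inter> fst c. local_smooth d c id p"
    using smooth_atlasD(4)[OF A] c d by (auto simp: charts_at_def)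
  have V: "open ?V" "smooth_on ?V ?\<tau>" using ls(1) unfolding local_smooth_id_iff[OF w(1)] by auto
  have W: "open ?W" "smooth_on ?W ?\<sigma>" using ls(2) unfolding local_smooth_id_iff[OF w(2)] by auto
  have \<tau>f: "smooth_on S (\<lambda>x. ?\<tau> (f x))" by (rule smooth_on_compose[OF f(1) V(2) S V(1) f(2)])
  have im: "?\<tau> (f x) \<in> ?W" if x: "x \<in> S" for x
  proof -
    obtain p where "p \<in> fst c" "p \<in> fst d" "f x = snd c p" using f(2) x by auto
    then show ?thesis using in_charts_eq[OF w(1), of p d id] by auto
  qed
  have bl: "bounded_linear (frechet_derivative ?\<sigma> (at (?\<tau> (f x))))" if "x \<in> S" for x
    by (rule has_derivative_bounded_linear[OF smooth_on_has_derivative[OF W(2) im[OF that]]])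
  show ?thesis
  proof (rule smooth_on_blinfun[OF S])
    fix e
    have "smooth_on S (\<lambda>x. blinfun_apply (L x) (frechet_derivative ?\<sigma> (at (?\<tau> (f x))) e))"
      by (intro smooth_on_blinfun_apply S L
          smooth_on_compose[OF \<tau>f smooth_on_frechet_derivative[OF W(2)] S W(1)]) (use im in auto)
    then show "smooth_on S (\<lambda>x. blinfun_apply (Blinfun (\<lambda>e. blinfun_apply (L x) (frechet_derivative ?\<sigma> (at (?\<tau> (f x))) e))) e)"
      by (rule smooth_on_cong[OF S, THEN iffD1, rotated])
         (simp add: bounded_linear_Blinfun_apply[OF bounded_linear_compose[OF blinfun.bounded_linear_right bl]])
  qed
qed

lemma smooth_atlas_covector:
  fixes A :: "('a, 'e::euclidean_space) atlas"
  assumes A: "smooth_atlas X A"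
  shows "smooth_atlas {(p, \<alpha>). p \<in> X \<and> \<alpha> \<in> covectors A p} (covector_atlas A)"
  unfolding smooth_atlas_def covector_atlas_eq ball_simps
proof (intro conjI ballI)
  show "wf_chart (covector_chart A c)" if "c \<in> A" for c using wf_covector_chart(1)[OF A that] .
  show "\<Union> (fst ` covector_chart A ` A) = {(p, \<alpha>). p \<in> X \<and> \<alpha> \<in> covectors A p}"
    using A unfolding smooth_atlas_def covector_chart_def by auto
  fix c d z assume c: "c \<in> A" and d: "d \<in> A" and z: "z \<in> fst (covector_chart A c) \<inter> fst (covector_chart A d)"
  let ?V = "snd c ` (fst c \<inter> fst d)"
  let ?g = "\<lambda>(y, L :: 'e \<Rightarrow>\<^sub>L complex). (in_charts c d id y, Blinfun (\<lambda>e. blinfun_apply L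
    (frechet_derivative (in_charts d c id) (at (in_charts c d id y)) e)))"
  have ls: "\<forall>p\<in>fst c \<inter> fst d. local_smooth c d id p" using smooth_atlasD(4)[OF A] c d by (auto simp: charts_at_def)
  note w = smooth_atlasD(1)[OF A c]
  have V: "open ?V" "smooth_on ?V (in_charts c d id)" using ls unfolding local_smooth_id_iff[OF w] by auto
  have o: "open (?V \<times> (UNIV :: ('e \<Rightarrow>\<^sub>L complex) set))" using V by (intro open_Times) auto
  note f1 = smooth_on_bounded_linear[OF bounded_linear_fst o]
  note f2 = smooth_on_bounded_linear[OF bounded_linear_snd o]
  show "local_smooth (covector_chart A c) (covector_chart A d) id z"
  proof (rule local_smoothI[of _ _ "?V \<times> UNIV" ?g])
    show "smooth_on (?V \<times> UNIV) ?g"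
      unfolding case_prod_unfold
      by (intro smooth_on_Pair[OF o] smooth_on_compose[where g = "in_charts c d id", OF f1 V(2) o V(1)]
          smooth_covector_change[OF A c d o f1 _ f2]) auto
    fix q assume q: "q \<in> fst (covector_chart A c)" "snd (covector_chart A c) q \<in> ?V \<times> UNIV"
    obtain p \<alpha> where p: "q = (p, \<alpha>)" "p \<in> fst c" "\<alpha> \<in> covectors A p" "snd c p \<in> ?V"
      using q unfolding covector_chart_def by auto
    then have "p \<in> fst d" using chart_mem[OF w p(2,4)] by simp
    then show "id q \<in> fst (covector_chart A d)" using p unfolding covector_chart_def by simp
    have at: "c \<in> charts_at A p" "d \<in> charts_at A p" using c d p \<open>p \<in> fst d\<close> by (auto simp: charts_at_def)
    show "snd (covector_chart A d) (id q) = ?g (snd (covector_chart A c) q)"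
      using coord_covector_change[OF A at p(3)] in_charts_eq[OF w p(2), of d id]
      unfolding covector_chart_def p(1) by simp
  qed (use z o wf_covector_chart(2)[OF A c] in \<open>auto simp: covector_chart_def\<close>)
qed

lemma smooth_atlas_covector4:
  fixes A :: "('a, 'e::euclidean_space) atlas"
  assumes A: "smooth_atlas X A"
  shows "smooth_atlas {(p, \<eta>). p \<in> X \<and> (\<forall>i. \<eta> $ i \<in> covectors A p)} (covector4_atlas A)"
  unfolding smooth_atlas_def covector4_atlas_eq ball_simps
proof (intro conjI ballI)
  show "wf_chart (covector4_chart A c)" if "c \<in> A" for c using wf_covector_chart(3)[OF A that] .
  show "\<Union> (fst ` covector4_chart A ` A) = {(p, \<eta>). p \<in> X \<and> (\<forall>i. \<eta> $ i \<in> covectors A p)}"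
    using A unfolding smooth_atlas_def covector4_chart_def by auto
  fix c d z assume c: "c \<in> A" and d: "d \<in> A" and z: "z \<in> fst (covector4_chart A c) \<inter> fst (covector4_chart A d)"
  let ?V = "snd c ` (fst c \<inter> fst d)"
  let ?g = "\<lambda>(y, L :: ('e \<Rightarrow>\<^sub>L complex) ^ 4). (in_charts c d id y, \<chi> i. Blinfun (\<lambda>e. blinfun_apply (L $ i)
    (frechet_derivative (in_charts d c id) (at (in_charts c d id y)) e)))"
  have ls: "\<forall>p\<in>fst c \<inter> fst d. local_smooth c d id p" using smooth_atlasD(4)[OF A] c d by (auto simp: charts_at_def)
  note w = smooth_atlasD(1)[OF A c]
  have V: "open ?V" "smooth_on ?V (in_charts c d id)" using ls unfolding local_smooth_id_iff[OF w] by auto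
  have o: "open (?V \<times> (UNIV :: (('e \<Rightarrow>\<^sub>L complex) ^ 4) set))" using V by (intro open_Times) auto
  note f1 = smooth_on_bounded_linear[OF bounded_linear_fst o]
  note f2 = smooth_on_bounded_linear[OF bounded_linear_snd o]
  show "local_smooth (covector4_chart A c) (covector4_chart A d) id z"
  proof (rule local_smoothI[of _ _ "?V \<times> UNIV" ?g])
    show "smooth_on (?V \<times> UNIV) ?g"
      unfolding case_prod_unfold
      by (intro smooth_on_Pair[OF o] smooth_on_compose[where g = "in_charts c d id", OF f1 V(2) o V(1)]
          smooth_on_vec_lambda[OF o] smooth_covector_change[OF A c d o f1 _ smooth_on_vec_nth[OF o f2]]) auto
    fix q assume q: "q \<in> fst (covector4_chart A c)" "snd (covector4_chart A c) q \<in> ?V \<times> UNIV"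
    obtain p \<eta> where p: "q = (p, \<eta>)" "p \<in> fst c" "\<And>i. \<eta> $ i \<in> covectors A p" "snd c p \<in> ?V"
      using q unfolding covector4_chart_def by auto
    then have "p \<in> fst d" using chart_mem[OF w p(2,4)] by simp
    then show "id q \<in> fst (covector4_chart A d)" using p unfolding covector4_chart_def by simp
    have at: "c \<in> charts_at A p" "d \<in> charts_at A p" using c d p \<open>p \<in> fst d\<close> by (auto simp: charts_at_def)
    show "snd (covector4_chart A d) (id q) = ?g (snd (covector4_chart A c) q)"
      using coord_covector_change[OF A at p(3)] in_charts_eq[OF w p(2), of d id]
      unfolding covector4_chart_def p(1) by simp
  qed (use z o wf_covector_chart(4)[OF A c] in \<open>auto simp: covector4_chart_def\<close>)
qed

section \<open>The groups\<close>

lemma vector_4 [simp]: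
  "(vector [w, x, y, z] :: ('a::zero)^4) $ 1 = w"
  "(vector [w, x, y, z] :: ('a::zero)^4) $ 2 = x"
  "(vector [w, x, y, z] :: ('a::zero)^4) $ 3 = y"
  "(vector [w, x, y, z] :: ('a::zero)^4) $ 4 = z"
  unfolding vector_def by simp_all

lemma vector_5 [simp]:
  "(vector [v, w, x, y, z] :: ('a::zero)^5) $ 1 = v"
  "(vector [v, w, x, y, z] :: ('a::zero)^5) $ 2 = w"
  "(vector [v, w, x, y, z] :: ('a::zero)^5) $ 3 = x"
  "(vector [v, w, x, y, z] :: ('a::zero)^5) $ 4 = y"
  "(vector [v, w, x, y, z] :: ('a::zero)^5) $ 5 = z"
  unfolding vector_def by simp_all

lemma exhaust_5: "x = 1 \<or> x = 2 \<or> x = 3 \<or> x = 4 \<or> x = 5" for x :: 5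
proof (induct x)
  case (of_int z)
  then have "z = 0 \<or> z = 1 \<or> z = 2 \<or> z = 3 \<or> z = 4" by fastforce
  then show ?case by auto
qed

lemma forall_5: "(\<forall>i::5. P i) \<longleftrightarrow> P 1 \<and> P 2 \<and> P 3 \<and> P 4 \<and> P 5"
  by (metis exhaust_5)

lemma smooth_on_vecI:
  assumes "open S" "\<And>i. smooth_on S (\<lambda>x. f x $ i)"
  shows "smooth_on S f"
  using smooth_on_vec_lambda[of S "\<lambda>x i. f x $ i"] assms by simp

lemma smooth_on_vec5I:
  assumes "open S" "smooth_on S (\<lambda>x. f x $ 1)" "smooth_on S (\<lambda>x. f x $ 2)" "smooth_on S (\<lambda>x. f x $ 3)"
    "smooth_on S (\<lambda>x. f x $ 4)" "smooth_on S (\<lambda>x. f x $ (5::5))"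
  shows "smooth_on S f"
  using assms smooth_on_vecI[OF assms(1), of f] by (metis exhaust_5)

lemma smooth_on_vec4I:
  assumes "open S" "smooth_on S (\<lambda>x. f x $ 1)" "smooth_on S (\<lambda>x. f x $ 2)" "smooth_on S (\<lambda>x. f x $ 3)"
    "smooth_on S (\<lambda>x. f x $ (4::4))"
  shows "smooth_on S f"
  using assms smooth_on_vecI[OF assms(1), of f] by (metis exhaust_4)

lemma smooth_on_vec3I:
  assumes "open S" "smooth_on S (\<lambda>x. f x $ 1)" "smooth_on S (\<lambda>x. f x $ 2)" "smooth_on S (\<lambda>x. f x $ (3::3))"
  shows "smooth_on S f"
  using assms smooth_on_vecI[OF assms(1), of f] by (metis exhaust_3)

lemmas matrix_4_simps = vec_eq_iff forall_4 sum_4 matrix_matrix_mult_def mat_def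
lemmas matrix_3_simps = vec_eq_iff forall_3 sum_3 matrix_matrix_mult_def mat_def

text \<open>Shared by both groups: an element of H has the coordinates (a1, a2, v1, v2, s), an
  element of B the coordinates (a, b, c, d, e). In both cases the first two are the ones that must
  not vanish.\<close>

definition coord_dom :: "(complex ^ 5) set" where
  "coord_dom = {x. x $ 1 \<noteq> 0 \<and> x $ 2 \<noteq> 0}"

lemma coord_domD: "x \<in> coord_dom \<Longrightarrow> x $ 1 \<noteq> 0" "x \<in> coord_dom \<Longrightarrow> x $ 2 \<noteq> 0"
  by (simp_all add: coord_dom_def)

lemma open_coord_dom: "open coord_dom"
  unfolding coord_dom_def by (intro open_Collect_conj open_Collect_neq continuous_intros)

definition H_of :: "complex ^ 5 \<Rightarrow> complex ^ 4 ^ 4" where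
  "H_of x = H_matrix (x $ 1) (x $ 2) (x $ 3) (x $ 4) (x $ 5)"

definition H_coord :: "complex ^ 4 ^ 4 \<Rightarrow> complex ^ 5" where
  "H_coord h = vector [h $ 2 $ 2, h $ 3 $ 3, h $ 1 $ 2 / h $ 1 $ 1, h $ 1 $ 3 / h $ 1 $ 1, h $ 1 $ 4]"

text \<open>The group law of H in the coordinates (a1, a2, v1, v2, s). The third and fourth entries
  come from the matrix product by dividing its first row by the new \<lambda> = a1 a2, whence the
  quotients.\<close>

definition H_mult :: "complex ^ 5 \<Rightarrow> complex ^ 5 \<Rightarrow> complex ^ 5" where
  "H_mult x y = vector [x $ 1 * y $ 1, x $ 2 * y $ 2, y $ 3 + x $ 3 / y $ 2, y $ 4 + x $ 4 / y $ 1,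
     x $ 5 + x $ 1 * x $ 2 * (y $ 5 + x $ 3 * y $ 1 * y $ 4 - x $ 4 * y $ 2 * y $ 3)]"

definition H_inv :: "complex ^ 5 \<Rightarrow> complex ^ 5" where
  "H_inv x = vector [1 / x $ 1, 1 / x $ 2, - (x $ 3 * x $ 2), - (x $ 4 * x $ 1), - (x $ 5 / (x $ 1 * x $ 2))]"

definition H_one :: "complex ^ 5" where
  "H_one = vector [1, 1, 0, 0, 0]"

definition B_of :: "complex ^ 5 \<Rightarrow> complex ^ 3 ^ 3" where
  "B_of x = vector [vector [x $ 1, x $ 3, x $ 5], vector [0, 1 / (x $ 1 * x $ 2), x $ 4], vector [0, 0, x $ 2]]"

definition B_coord :: "complex ^ 3 ^ 3 \<Rightarrow> complex ^ 5" where
  "B_coord g = vector [g $ 1 $ 1, g $ 3 $ 3, g $ 1 $ 2, g $ 2 $ 3, g $ 1 $ 3]"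

definition B_mult :: "complex ^ 5 \<Rightarrow> complex ^ 5 \<Rightarrow> complex ^ 5" where
  "B_mult x y = vector [x $ 1 * y $ 1, x $ 2 * y $ 2, x $ 1 * y $ 3 + x $ 3 / (y $ 1 * y $ 2),
     y $ 4 / (x $ 1 * x $ 2) + x $ 4 * y $ 2, x $ 1 * y $ 5 + x $ 3 * y $ 4 + x $ 5 * y $ 2]"

definition B_inv :: "complex ^ 5 \<Rightarrow> complex ^ 5" where
  "B_inv x = vector [1 / x $ 1, 1 / x $ 2, - (x $ 3 * x $ 2), - (x $ 1 * x $ 4),
     x $ 3 * x $ 4 - x $ 5 / (x $ 1 * x $ 2)]"

text \<open>The homomorphism j in coordinates: a1 = a^2 b and a2 = 1 / (a b^2) are diagonal entries,
  while v1 = - 2 a b d and v2 = c / a are entries of the first row divided by \<lambda> = a /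
  b.\<close>

definition B_to_H :: "complex ^ 5 \<Rightarrow> complex ^ 5" where
  "B_to_H x = vector [x $ 1 ^ 2 * x $ 2, 1 / (x $ 1 * x $ 2 ^ 2), - 2 * x $ 1 * x $ 2 * x $ 4, x $ 3 / x $ 1,
     4 * x $ 5 / x $ 2 - 2 * x $ 1 * x $ 3 * x $ 4]"

section \<open>The group H in coordinates\<close>

lemma H_of_entries:
  "H_of x $ 1 = vector [x $ 1 * x $ 2, x $ 3 * (x $ 1 * x $ 2), x $ 4 * (x $ 1 * x $ 2), x $ 5]"
  "H_of x $ 2 = vector [0, x $ 1, 0, x $ 1 * x $ 4]"
  "H_of x $ 3 = vector [0, 0, x $ 2, - (x $ 2 * x $ 3)]"
  "H_of x $ 4 = vector [0, 0, 0, 1]"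
  by (simp_all add: H_of_def H_matrix_def Let_def)

lemma carrier_H_group: "carrier H_group = H_of ` coord_dom"
proof -
  have "H_matrix a1 a2 v1 v2 s \<in> H_of ` coord_dom" if "a1 \<noteq> 0" "a2 \<noteq> 0" for a1 a2 v1 v2 s
    using that by (intro image_eqI[of _ _ "vector [a1, a2, v1, v2, s]"]) (simp_all add: H_of_def coord_dom_def)
  moreover have "H_of x \<in> carrier H_group" if "x \<in> coord_dom" for x
    using that unfolding H_group_def H_of_def coord_dom_def by fastforce
  ultimately show ?thesis by (auto simp: H_group_def)
qed

lemma H_coord_of: "x \<in> coord_dom \<Longrightarrow> H_coord (H_of x) = x"
  by (simp add: H_coord_def vec_eq_iff forall_5 H_of_entries coord_dom_def)

lemma H_of_coord: "h \<in> carrier H_group \<Longrightarrow> H_of (H_coord h) = h" "h \<in> carrier H_group \<Longrightarrow> H_coord h \<in> coord_dom"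
  by (auto simp: carrier_H_group H_coord_of)

lemma H_of_mult: "x \<in> coord_dom \<Longrightarrow> y \<in> coord_dom \<Longrightarrow> H_of x ** H_of y = H_of (H_mult x y)"
  by (simp add: matrix_4_simps H_of_entries H_mult_def coord_dom_def field_simps)

lemma H_mult_dom: "x \<in> coord_dom \<Longrightarrow> y \<in> coord_dom \<Longrightarrow> H_mult x y \<in> coord_dom"
  by (simp add: H_mult_def coord_dom_def)

lemma H_inv_dom: "x \<in> coord_dom \<Longrightarrow> H_inv x \<in> coord_dom"
  by (simp add: H_inv_def coord_dom_def)

lemma H_of_one: "H_of H_one = mat 1" "H_one \<in> coord_dom"
  by (simp_all add: matrix_4_simps H_of_entries H_one_def coord_dom_def)

lemma H_mult_inv: "x \<in> coord_dom \<Longrightarrow> H_mult (H_inv x) x = H_one"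
  by (simp add: vec_eq_iff forall_5 H_mult_def H_inv_def H_one_def coord_dom_def field_simps)

lemma H_group_simps:
  "\<one>\<^bsub>H_group\<^esub> = mat 1" "x \<otimes>\<^bsub>H_group\<^esub> y = x ** y"
  by (simp_all add: H_group_def)

lemma group_H: "group H_group"
proof (rule groupI)
  show "x \<otimes>\<^bsub>H_group\<^esub> y \<in> carrier H_group" if "x \<in> carrier H_group" "y \<in> carrier H_group" for x y
    using that H_mult_dom by (auto simp: carrier_H_group H_group_simps H_of_mult)
  show "\<one>\<^bsub>H_group\<^esub> \<in> carrier H_group" unfolding carrier_H_group H_group_simps using H_of_one by (metis image_eqI)
  show "x \<otimes>\<^bsub>H_group\<^esub> y \<otimes>\<^bsub>H_group\<^esub> z = x \<otimes>\<^bsub>H_group\<^esub> (y \<otimes>\<^bsub>H_group\<^esub> z)" for x y z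
    by (simp add: H_group_simps matrix_mul_assoc)
  show "\<one>\<^bsub>H_group\<^esub> \<otimes>\<^bsub>H_group\<^esub> x = x" for x
    by (simp add: H_group_simps matrix_mul_lid)
  fix h assume "h \<in> carrier H_group"
  then obtain x where x: "h = H_of x" "x \<in> coord_dom" unfolding carrier_H_group by blast
  show "\<exists>y\<in>carrier H_group. y \<otimes>\<^bsub>H_group\<^esub> h = \<one>\<^bsub>H_group\<^esub>"
  proof
    show "H_of (H_inv x) \<in> carrier H_group" unfolding carrier_H_group using H_inv_dom x by blast
    show "H_of (H_inv x) \<otimes>\<^bsub>H_group\<^esub> h = \<one>\<^bsub>H_group\<^esub>"
      using H_of_mult[OF H_inv_dom[OF x(2)] x(2)] H_mult_inv[OF x(2)] H_of_one x by (simp add: H_group_simps)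
  qed
qed

lemma H_group_inv: "x \<in> coord_dom \<Longrightarrow> inv\<^bsub>H_group\<^esub> (H_of x) = H_of (H_inv x)"
  by (rule group.inv_equality[OF group_H])
     (simp_all add: H_group_simps H_of_mult H_inv_dom H_mult_inv H_of_one carrier_H_group)

section \<open>The Borel group in coordinates\<close>

lemma B_of_entries:
  "B_of x $ 1 = vector [x $ 1, x $ 3, x $ 5]"
  "B_of x $ 2 = vector [0, 1 / (x $ 1 * x $ 2), x $ 4]"
  "B_of x $ 3 = vector [0, 0, x $ 2]"
  by (simp_all add: B_of_def)

lemma B_coord_of: "B_coord (B_of x) = x"
  by (simp add: B_coord_def vec_eq_iff forall_5 B_of_entries)

lemma carrier_borel_group: "carrier borel_group = B_of ` coord_dom"
proof (rule equalityI; rule subsetI)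
  fix g assume "g \<in> carrier borel_group"
  then have g: "det g = 1" "g $ 2 $ 1 = 0" "g $ 3 $ 1 = 0" "g $ 3 $ 2 = 0" by (auto simp: borel_group_def)
  then have d: "g $ 1 $ 1 * g $ 2 $ 2 * g $ 3 $ 3 = 1" by (simp add: det_3)
  then have "g $ 1 $ 1 \<noteq> 0" "g $ 3 $ 3 \<noteq> 0" by auto
  then have "g = B_of (B_coord g)" "B_coord g \<in> coord_dom"
    using g d by (simp_all add: B_coord_def coord_dom_def B_of_entries vec_eq_iff forall_3 field_simps)
  then show "g \<in> B_of ` coord_dom" by blast
next
  fix g assume "g \<in> B_of ` coord_dom"
  then show "g \<in> carrier borel_group"
    by (auto simp: borel_group_def det_3 B_of_entries coord_dom_def)
qed

lemma B_of_coord: "g \<in> carrier borel_group \<Longrightarrow> B_of (B_coord g) = g" "g \<in> carrier borel_group \<Longrightarrow> B_coord g \<in> coord_dom"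
  by (auto simp: carrier_borel_group B_coord_of)

lemma B_of_mult: "x \<in> coord_dom \<Longrightarrow> y \<in> coord_dom \<Longrightarrow> B_of x ** B_of y = B_of (B_mult x y)"
  by (simp add: matrix_3_simps B_of_entries B_mult_def coord_dom_def field_simps)

lemma B_mult_dom: "x \<in> coord_dom \<Longrightarrow> y \<in> coord_dom \<Longrightarrow> B_mult x y \<in> coord_dom"
  by (simp add: B_mult_def coord_dom_def)

lemma B_inv_dom: "x \<in> coord_dom \<Longrightarrow> B_inv x \<in> coord_dom"
  by (simp add: B_inv_def coord_dom_def)

lemma B_of_one: "B_of H_one = mat 1"
  by (simp add: matrix_3_simps B_of_entries H_one_def)

lemma B_mult_inv: "x \<in> coord_dom \<Longrightarrow> B_mult (B_inv x) x = H_one"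
  by (simp add: vec_eq_iff forall_5 B_mult_def B_inv_def H_one_def coord_dom_def field_simps)

lemma borel_group_simps:
  "\<one>\<^bsub>borel_group\<^esub> = mat 1" "x \<otimes>\<^bsub>borel_group\<^esub> y = x ** y"
  by (simp_all add: borel_group_def)

lemma group_borel: "group borel_group"
proof (rule groupI)
  show "x \<otimes>\<^bsub>borel_group\<^esub> y \<in> carrier borel_group" if "x \<in> carrier borel_group" "y \<in> carrier borel_group" for x y
    using that B_mult_dom by (auto simp: carrier_borel_group borel_group_simps B_of_mult)
  show "\<one>\<^bsub>borel_group\<^esub> \<in> carrier borel_group"
    unfolding carrier_borel_group borel_group_simps using B_of_one H_of_one(2) by (metis image_eqI)
  show "x \<otimes>\<^bsub>borel_group\<^esub> y \<otimes>\<^bsub>borel_group\<^esub> z = x \<otimes>\<^bsub>borel_group\<^esub> (y \<otimes>\<^bsub>borel_group\<^esub> z)" for x y z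
    by (simp add: borel_group_simps matrix_mul_assoc)
  show "\<one>\<^bsub>borel_group\<^esub> \<otimes>\<^bsub>borel_group\<^esub> x = x" for x
    by (simp add: borel_group_simps matrix_mul_lid)
  fix h assume "h \<in> carrier borel_group"
  then obtain x where x: "h = B_of x" "x \<in> coord_dom" unfolding carrier_borel_group by blast
  show "\<exists>y\<in>carrier borel_group. y \<otimes>\<^bsub>borel_group\<^esub> h = \<one>\<^bsub>borel_group\<^esub>"
  proof
    show "B_of (B_inv x) \<in> carrier borel_group" unfolding carrier_borel_group using B_inv_dom x by blast
    show "B_of (B_inv x) \<otimes>\<^bsub>borel_group\<^esub> h = \<one>\<^bsub>borel_group\<^esub>"
      using B_of_mult[OF B_inv_dom[OF x(2)] x(2)] B_mult_inv[OF x(2)] B_of_one x by (simp add: borel_group_simps)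
  qed
qed

section \<open>The homomorphism j, its image and its kernel\<close>

lemma B_to_H_dom: "x \<in> coord_dom \<Longrightarrow> B_to_H x \<in> coord_dom"
  by (simp add: B_to_H_def coord_dom_def)

lemma borel_to_H_of: "x \<in> coord_dom \<Longrightarrow> borel_to_H (B_of x) = H_of (B_to_H x)"
  by (simp add: borel_to_H_def Let_def vec_eq_iff forall_4 H_of_entries B_of_entries B_to_H_def coord_dom_def
      field_simps power2_eq_square)

lemma B_to_H_mult: "x \<in> coord_dom \<Longrightarrow> y \<in> coord_dom \<Longrightarrow> B_to_H (B_mult x y) = H_mult (B_to_H x) (B_to_H y)"
  by (simp add: vec_eq_iff forall_5 B_to_H_def B_mult_def H_mult_def coord_dom_def field_simps power2_eq_square)

lemma borel_to_H_hom: "borel_to_H \<in> hom borel_group H_group"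
  unfolding hom_def using B_to_H_dom
  by (auto simp: carrier_borel_group carrier_H_group H_group_simps borel_group_simps borel_to_H_of B_of_mult
      B_mult_dom B_to_H_mult H_of_mult)

text \<open>A right inverse of \<^const>\<open>B_to_H\<close>, for a cube root \<open>a\<close> of \<open>x $ 1 ^ 2 * x $ 2\<close>.\<close>

definition H_lift :: "complex \<Rightarrow> complex ^ 5 \<Rightarrow> complex ^ 5" where
  "H_lift a x = vector [a, x $ 1 / a ^ 2, x $ 4 * a, - (x $ 3 * a / (2 * x $ 1)),
     x $ 1 / a ^ 2 * (x $ 5 - x $ 4 * x $ 3 * a ^ 3 / x $ 1) / 4]"

text \<open>The equations a^2 b = a1 and 1 / (a b^2) = a2 amount to a^3 = a1^2 a2 and b = a1 / a^2.
  The remaining three equations are solved one after another for c, d and e.\<close>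

lemma H_lift:
  assumes x: "x \<in> coord_dom" and a: "a ^ 3 = x $ 1 ^ 2 * x $ 2"
  shows "H_lift a x \<in> coord_dom" "B_to_H (H_lift a x) = x"
proof -
  have nz: "a \<noteq> 0" "x $ 1 \<noteq> 0" "x $ 2 \<noteq> 0" using assms by (auto simp: coord_dom_def)
  have x2: "x $ 2 = a ^ 3 / x $ 1 ^ 2" using nz a by (simp add: field_simps)
  show "H_lift a x \<in> coord_dom" using nz by (simp add: H_lift_def coord_dom_def)
  show "B_to_H (H_lift a x) = x"
    using nz x2 by (simp add: vec_eq_iff forall_5 B_to_H_def H_lift_def field_simps power2_eq_square power3_eq_cube)
qed

text \<open>A preimage under j is determined by its entry a, and a is a cube root of a known number.
  So the elements of a coset are told apart by a alone, which is used to find charts on which the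
  coset map is injective.\<close>

lemma H_lift_unique:
  assumes x: "x \<in> coord_dom"
  shows "H_lift (x $ 1) (B_to_H x) = x" "x $ 1 ^ 3 = B_to_H x $ 1 ^ 2 * B_to_H x $ 2"
  using x by (simp_all add: vec_eq_iff forall_5 B_to_H_def H_lift_def coord_dom_def field_simps power2_eq_square power3_eq_cube)

lemma borel_to_H_onto: "borel_to_H ` carrier borel_group = carrier H_group"
proof -
  have "\<exists>y\<in>coord_dom. B_to_H y = x" if x: "x \<in> coord_dom" for x
  proof -
    have nz: "x $ 1 ^ 2 * x $ 2 \<noteq> 0" using x by (simp add: coord_dom_def)
    define a where "a = exp (Ln (x $ 1 ^ 2 * x $ 2) / 3)"
    have "a ^ 3 = exp (Ln (x $ 1 ^ 2 * x $ 2))" unfolding a_def by (simp flip: exp_of_nat_mult)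
    then have "a ^ 3 = x $ 1 ^ 2 * x $ 2" using nz by simp
    then show ?thesis using H_lift[OF x] by blast
  qed
  then have "B_to_H ` coord_dom = coord_dom" using B_to_H_dom by blast
  then show ?thesis unfolding carrier_borel_group carrier_H_group image_image
    by (metis (no_types, lifting) borel_to_H_of image_cong image_image)
qed

lemma kernel_borel_to_H: "kernel borel_group H_group borel_to_H = scalar_subgroup"
proof (rule equalityI; rule subsetI)
  fix g assume "g \<in> kernel borel_group H_group borel_to_H"
  then obtain x where x: "g = B_of x" "x \<in> coord_dom" "H_of (B_to_H x) = H_of H_one" and g: "g \<in> carrier borel_group"
    by (auto simp: kernel_def carrier_borel_group borel_to_H_of H_group_simps H_of_one)
  have "B_to_H x = H_one" using x(2,3) H_coord_of[OF B_to_H_dom[OF x(2)]] H_coord_of[OF H_of_one(2)] by metis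
  then have eq: "x $ 1 ^ 2 * x $ 2 = 1" "1 / (x $ 1 * x $ 2 ^ 2) = 1" "x $ 3 = 0" "x $ 4 = 0" "x $ 5 = 0"
    using x(2) by (auto simp: vec_eq_iff forall_5 B_to_H_def H_one_def coord_dom_def)
  \<comment> \<open>From a^2 b = 1 and a b^2 = 1. The factor a b is nonzero, so a = b, and then the
    middle diagonal entry 1 / (a b) equals b as well: the matrix is scalar.\<close>
  have "x $ 1 * x $ 2 * (x $ 1 - x $ 2) = 0"
    using eq(1,2) x(2) by (simp add: coord_dom_def field_simps power2_eq_square)
  then have "x $ 1 = x $ 2" using x(2) by (simp add: coord_dom_def)
  moreover from this have "1 / (x $ 2 * x $ 2) = x $ 2"
    using eq(1) x(2) by (simp add: coord_dom_def field_simps power2_eq_square)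
  ultimately have "g = mat (x $ 2)" using eq(3-5) unfolding x(1)
    by (simp add: matrix_3_simps B_of_entries)
  then show "g \<in> scalar_subgroup" using g unfolding scalar_subgroup_def by blast
next
  fix g assume "g \<in> scalar_subgroup"
  then obtain k where g: "g \<in> carrier borel_group" "g = mat k" unfolding scalar_subgroup_def by blast
  then have "det (mat k :: complex ^ 3 ^ 3) = 1" by (simp add: borel_group_def)
  then have k: "k ^ 3 = 1" by (simp add: det_3 mat_def power3_eq_cube)
  then have "k \<noteq> 0" by auto
  have "borel_to_H g = mat 1" unfolding g(2) borel_to_H_def
    using k \<open>k \<noteq> 0\<close> by (simp add: Let_def matrix_4_simps) (simp add: mat_def field_simps power2_eq_square power3_eq_cube)
  then show "g \<in> kernel borel_group H_group borel_to_H" using g by (simp add: kernel_def H_group_simps)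
qed

lemma group_hom_borel: "group_hom borel_group H_group borel_to_H"
  using group_borel group_H borel_to_H_hom by (simp add: group_hom_def group_hom_axioms_def)

subsection \<open>Smooth structures of the groups\<close>

text \<open>In a normed space the ambient chart is the identity, so f itself is the smooth extension
  that a submanifold chart requires, and g is the inverse of the chart.\<close>

lemma normed_space_submanifold_chart:
  fixes f :: "'e::findim \<Rightarrow> 'f::findim"
  assumes U: "open U" "smooth_on U g" "\<And>x. x \<in> U \<Longrightarrow> g x \<in> S \<inter> V" "\<And>x. x \<in> U \<Longrightarrow> f (g x) = x"
    and S: "\<And>p. p \<in> S \<inter> V \<Longrightarrow> f p \<in> U" "\<And>p. p \<in> S \<inter> V \<Longrightarrow> g (f p) = p" and V: "open V" "smooth_on V f"
  shows "(S \<inter> V, f) \<in> submanifold_atlas normed_space_atlas S"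
proof -
  have im: "f ` (S \<inter> V) = U"
  proof
    show "U \<subseteq> f ` (S \<inter> V)" using U(3,4) by (metis image_eqI subsetI)
  qed (use S in auto)
  have w: "wf_chart (S \<inter> V, f)" unfolding wf_chart_def using U im S(2) by (auto intro: inj_on_inverseI)
  have c: "(UNIV, id) \<in> charts_at normed_space_atlas p" for p :: 'e
    by (simp add: charts_at_def normed_space_atlas_def)
  show ?thesis unfolding submanifold_atlas_iff[OF smooth_atlas_normed_space]
  proof (intro conjI w ballI bexI[OF _ c])
    show "openin (subtopology (atlas_topology normed_space_atlas) S) (fst (S \<inter> V, f))"
      unfolding openin_subtopology openin_normed_space using V by (intro exI[of _ V]) auto
    fix p assume p: "p \<in> fst (S \<inter> V, f)"
    then show "local_smooth (S \<inter> V, f) (UNIV, id) id p"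
      using U S im by (intro local_smoothI[of _ _ U g]) auto
    show "\<exists>V' g. open V' \<and> V' \<subseteq> snd (UNIV, id) ` fst (UNIV :: 'e set, id) \<and> snd (UNIV, id) p \<in> V' \<and> smooth_on V' g \<and>
          (\<forall>q\<in>fst (S \<inter> V, f) \<inter> fst (UNIV, id). snd (UNIV, id) q \<in> V' \<longrightarrow> snd (S \<inter> V, f) q = g (snd (UNIV, id) q))"
      using V p by (intro exI[of _ V] exI[of _ f]) auto
  qed
qed

text \<open>Since a single chart covers S, its coordinates separate points and carry over a
  countable base of the model space.\<close>

lemma global_chart:
  fixes f :: "'e::findim \<Rightarrow> 'f::{findim, second_countable_topology}"
  assumes U: "open U" "smooth_on U g" "\<And>x. x \<in> U \<Longrightarrow> g x \<in> S" "\<And>x. x \<in> U \<Longrightarrow> f (g x) = x"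
    and S: "\<And>p. p \<in> S \<Longrightarrow> f p \<in> U" "\<And>p. p \<in> S \<Longrightarrow> g (f p) = p" and V: "open V" "S \<subseteq> V" "smooth_on V f"
  shows "(S, f) \<in> submanifold_atlas normed_space_atlas S" (is ?A)
    "smooth_manifold S (submanifold_atlas normed_space_atlas S :: ('e, 'f) atlas)" (is ?B)
proof -
  have "S \<inter> V = S" using V by blast
  then show A: ?A
    using normed_space_submanifold_chart[OF U(1,2) _ U(4) _ _ V(1,3), of S] U(3) S by simp
  have sa: "smooth_atlas S (submanifold_atlas normed_space_atlas S :: ('e, 'f) atlas)"
    by (rule smooth_atlas_submanifold[OF smooth_atlas_normed_space]) (use A in \<open>auto simp: charts_at_def\<close>)
  have "Hausdorff_space (atlas_topology (submanifold_atlas normed_space_atlas S :: ('e, 'f) atlas))"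
    by (rule Hausdorff_atlas[OF sa]) (use A in force)
  moreover have "second_countable (atlas_topology (submanifold_atlas normed_space_atlas S :: ('e, 'f) atlas))"
    by (rule second_countable_atlas[OF sa, of "{(S, f)}"]) (use A in auto)
  ultimately show ?B using sa by (simp add: smooth_manifold_iff)
qed

definition H_chart :: "(complex ^ 4 ^ 4, complex ^ 5) chart" where
  "H_chart = (carrier H_group, H_coord)"

definition B_chart :: "(complex ^ 3 ^ 3, complex ^ 5) chart" where
  "B_chart = (carrier borel_group, B_coord)"

lemma H_chart: "H_chart \<in> H_atlas" "smooth_manifold (carrier H_group) H_atlas"
proof -
  have 1: "smooth_on coord_dom H_of"
    unfolding H_of_def H_matrix_def Let_def
    by (intro smooth_on_vec4I open_coord_dom; simp; intro smooth_intros open_coord_dom)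
  let ?V = "{h :: complex ^ 4 ^ 4. h $ 1 $ 1 \<noteq> 0}"
  have V: "open ?V" by (intro open_Collect_neq continuous_intros)
  have 2: "smooth_on ?V H_coord"
    unfolding H_coord_def by (intro smooth_on_vec5I V; simp; intro smooth_intros V) auto
  have 3: "carrier H_group \<subseteq> ?V" by (auto simp: carrier_H_group H_of_entries coord_dom_def)
  show "H_chart \<in> H_atlas" "smooth_manifold (carrier H_group) H_atlas"
    unfolding H_chart_def H_atlas_def
    by (rule global_chart[OF open_coord_dom 1 _ _ _ _ V 3 2]; simp add: carrier_H_group H_coord_of H_of_coord; fail)+
qed

lemma B_chart: "B_chart \<in> borel_atlas" "smooth_manifold (carrier borel_group) borel_atlas"
proof -
  have 1: "smooth_on coord_dom B_of"
    unfolding B_of_def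
    by (intro smooth_on_vec3I open_coord_dom; simp; intro smooth_intros open_coord_dom) (auto simp: coord_dom_def)
  have 2: "smooth_on UNIV B_coord"
    unfolding B_coord_def by (intro smooth_on_vec5I open_UNIV; simp; intro smooth_intros open_UNIV)
  show "B_chart \<in> borel_atlas" "smooth_manifold (carrier borel_group) borel_atlas"
    unfolding B_chart_def borel_atlas_def
    by (rule global_chart[OF open_coord_dom 1 _ _ _ _ open_UNIV subset_UNIV 2]; simp add: carrier_borel_group B_coord_of B_of_coord; fail)+
qed

lemma smooth_atlas_H: "smooth_atlas (carrier H_group) H_atlas"
  and smooth_atlas_borel: "smooth_atlas (carrier borel_group) borel_atlas"
  using H_chart B_chart by (simp_all add: smooth_manifold_iff)

lemma H_chart_at: "h \<in> carrier H_group \<Longrightarrow> H_chart \<in> charts_at H_atlas h"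
  using H_chart by (simp add: charts_at_def H_chart_def)

lemma B_chart_at: "g \<in> carrier borel_group \<Longrightarrow> B_chart \<in> charts_at borel_atlas g"
  using B_chart by (simp add: charts_at_def B_chart_def)

lemma H_chart_image: "snd H_chart ` fst H_chart = coord_dom"
  using H_coord_of by (force simp: H_chart_def carrier_H_group image_image)

lemma B_chart_image: "snd B_chart ` fst B_chart = coord_dom"
  using B_coord_of by (force simp: B_chart_def carrier_borel_group image_image)

lemma H_coord_mult:
  "g \<in> carrier H_group \<Longrightarrow> h \<in> carrier H_group \<Longrightarrow> H_coord (g ** h) = H_mult (H_coord g) (H_coord h)"
  using H_of_mult H_coord_of H_mult_dom H_of_coord by metis

lemma smooth_on_H_mult:
  assumes "open S" "smooth_on S f" "smooth_on S g" "\<And>x. x \<in> S \<Longrightarrow> g x \<in> coord_dom"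
  shows "smooth_on S (\<lambda>x. H_mult (f x) (g x))"
  unfolding H_mult_def
  by (intro smooth_on_vec5I assms; simp; intro smooth_intros assms) (use assms(4) coord_domD in auto)

lemma lie_group_H: "lie_group H_group H_atlas"
  unfolding lie_group_def
    smooth_map_iff[OF smooth_atlas_prod[OF smooth_atlas_H smooth_atlas_H] smooth_atlas_H]
    smooth_map_iff[OF smooth_atlas_H smooth_atlas_H]
proof (intro conjI group_H H_chart ballI)
  interpret group H_group by (rule group_H)
  show "(\<lambda>(g, h). g \<otimes>\<^bsub>H_group\<^esub> h) \<in> carrier H_group \<times> carrier H_group \<rightarrow> carrier H_group" by auto
  show "(\<lambda>g. inv\<^bsub>H_group\<^esub> g) \<in> carrier H_group \<rightarrow> carrier H_group" by auto
  have H: "fst H_chart = carrier H_group" "snd H_chart = H_coord" by (simp_all add: H_chart_def)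
  have w: "wf_chart H_chart" using smooth_atlasD(1)[OF smooth_atlas_H H_chart(1)] .
  fix p assume p: "p \<in> carrier H_group \<times> carrier H_group"
  show "smooth_at (prod_atlas H_atlas H_atlas) H_atlas (\<lambda>(g, h). g \<otimes>\<^bsub>H_group\<^esub> h) p"
  proof (rule smooth_atI)
    show "prod_chart H_chart H_chart \<in> charts_at (prod_atlas H_atlas H_atlas) p"
      using p H_chart_at charts_at_prod by fastforce
    show "H_chart \<in> charts_at H_atlas ((\<lambda>(g, h). g \<otimes>\<^bsub>H_group\<^esub> h) p)"
      using p by (intro H_chart_at) auto
    let ?U = "coord_dom \<times> coord_dom"
    have U: "open ?U" using open_coord_dom by (intro open_Times)
    show "local_smooth (prod_chart H_chart H_chart) H_chart (\<lambda>(g, h). g \<otimes>\<^bsub>H_group\<^esub> h) p"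
    proof (rule local_smoothI[OF _ U])
      show "smooth_on ?U (\<lambda>z. H_mult (fst z) (snd z))"
        by (intro smooth_on_H_mult smooth_intros U) auto
    qed (use p H_of_coord H_coord_mult m_closed H_chart_image in
        \<open>auto simp: prod_chart_def H H_group_simps map_prod_surj_on[OF H_chart_image H_chart_image, unfolded H]\<close>)
  qed
next
  interpret group H_group by (rule group_H)
  have H: "fst H_chart = carrier H_group" "snd H_chart = H_coord" by (simp_all add: H_chart_def)
  fix h assume h: "h \<in> carrier H_group"
  show "smooth_at H_atlas H_atlas (\<lambda>g. inv\<^bsub>H_group\<^esub> g) h"
  proof (rule smooth_atI[OF H_chart_at H_chart_at local_smoothI[OF _ open_coord_dom]])
    show "smooth_on coord_dom H_inv"
      unfolding H_inv_def
      by (intro smooth_on_vec5I open_coord_dom; simp; intro smooth_intros open_coord_dom) (auto simp: coord_dom_def)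
    show "snd H_chart (inv\<^bsub>H_group\<^esub> q) = H_inv (snd H_chart q)" if "q \<in> fst H_chart" for q
      using that H_group_inv[OF H_of_coord(2), of q] H_of_coord H_coord_of[OF H_inv_dom] by (simp add: H)
  qed (use h H_of_coord H_chart_image in \<open>auto simp: H\<close>)
qed

subsection \<open>The quotient of the Borel group\<close>

abbreviation borel_coset :: "complex ^ 3 ^ 3 \<Rightarrow> (complex ^ 3 ^ 3) set" where
  "borel_coset g \<equiv> scalar_subgroup #>\<^bsub>borel_group\<^esub> g"

lemma borel_quotient_iso: "borel_quotient_to_H \<in> iso borel_quotient H_group"
  using group_hom.FactGroup_iso_set[OF group_hom_borel borel_to_H_onto]
  unfolding kernel_borel_to_H borel_quotient_def borel_quotient_to_H_def .

lemma borel_quotient_bij: "bij_betw borel_quotient_to_H (carrier borel_quotient) (carrier H_group)"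
  using borel_quotient_iso by (simp add: iso_def)

lemma group_borel_quotient: "group borel_quotient"
  using normal.factorgroup_is_group[OF group_hom.normal_kernel[OF group_hom_borel]]
  unfolding kernel_borel_to_H borel_quotient_def .

lemma carrier_borel_quotient: "carrier borel_quotient = borel_coset ` carrier borel_group"
  unfolding borel_quotient_def by (rule carrier_FactGroup)

lemma borel_quotient_to_H_coset:
  assumes g: "g \<in> carrier borel_group"
  shows "borel_quotient_to_H (borel_coset g) = borel_to_H g"
proof -
  interpret group_hom borel_group H_group borel_to_H by (rule group_hom_borel)
  have "borel_to_H ` borel_coset g = {borel_to_H g}"
  proof
    show "borel_to_H ` borel_coset g \<subseteq> {borel_to_H g}"
      using g hom_mult by (auto simp: r_coset_def kernel_def simp flip: kernel_borel_to_H)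
    have "\<one>\<^bsub>borel_group\<^esub> \<in> scalar_subgroup" by (simp add: kernel_def flip: kernel_borel_to_H)
    then have "\<one>\<^bsub>borel_group\<^esub> \<otimes>\<^bsub>borel_group\<^esub> g \<in> borel_coset g" unfolding r_coset_def by blast
    then show "{borel_to_H g} \<subseteq> borel_to_H ` borel_coset g" using g by auto
  qed
  then show ?thesis by (simp add: borel_quotient_to_H_def)
qed

lemma borel_coset_eq_iff:
  assumes "g \<in> carrier borel_group" "g' \<in> carrier borel_group"
  shows "borel_coset g = borel_coset g' \<longleftrightarrow> borel_to_H g = borel_to_H g'"
  using inj_on_eq_iff[OF bij_betw_imp_inj_on[OF borel_quotient_bij], of "borel_coset g" "borel_coset g'"]
    assms borel_quotient_to_H_coset by (simp add: carrier_borel_quotient)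

lemma borel_quotient_to_H_inv:
  assumes "g \<in> carrier borel_group"
  shows "inv_into (carrier borel_quotient) borel_quotient_to_H (borel_to_H g) = borel_coset g"
  using inv_into_f_f[OF bij_betw_imp_inj_on[OF borel_quotient_bij], of "borel_coset g"]
    assms borel_quotient_to_H_coset by (simp add: carrier_borel_quotient)

lemma H_coord_borel_to_H: "g \<in> carrier borel_group \<Longrightarrow> H_coord (borel_to_H g) = B_to_H (B_coord g)"
  by (auto simp: carrier_borel_group borel_to_H_of B_coord_of H_coord_of B_to_H_dom)

lemma borel_to_H_in: "g \<in> carrier borel_group \<Longrightarrow> borel_to_H g \<in> carrier H_group"
  using borel_to_H_hom by (auto simp: hom_def)

lemma local_smooth_borel_to_H:
  assumes g: "g \<in> carrier borel_group"
  shows "local_smooth B_chart H_chart borel_to_H g"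
proof (rule local_smoothI[OF _ open_coord_dom])
  show "smooth_on coord_dom B_to_H"
    unfolding B_to_H_def
    by (intro smooth_on_vec5I open_coord_dom; simp; intro smooth_intros open_coord_dom) (auto simp: coord_dom_def)
qed (use g B_chart_image B_of_coord borel_to_H_in H_coord_borel_to_H in \<open>auto simp: B_chart_def H_chart_def\<close>)

text \<open>The branch of the cube root is taken at the entry a = \<open>x $ 1\<close> of g, so that
  the lift passes through g itself and not through another element of its coset.\<close>

lemma borel_local_section:
  assumes g: "g \<in> carrier borel_group"
  obtains s W where "open W" "H_coord (borel_to_H g) \<in> W" "local_smooth H_chart B_chart s (borel_to_H g)"
    "s (borel_to_H g) = g"
    "\<And>h. h \<in> carrier H_group \<Longrightarrow> H_coord h \<in> W \<Longrightarrow> s h \<in> carrier borel_group \<and> borel_to_H (s h) = h"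
proof -
  define x where "x = B_coord g"
  have x: "x \<in> coord_dom" "B_of x = g" using B_of_coord[OF g] by (simp_all add: x_def)
  obtain V r where V: "open V" "x $ 1 ^ 3 \<in> V" "smooth_on V r" "r (x $ 1 ^ 3) = x $ 1" "\<And>z. z \<in> V \<Longrightarrow> r z ^ 3 = z" "0 \<notin> V"
    using smooth_cube_root[OF coord_domD(1)[OF x(1)]] by metis
  define m where "m y = y $ 1 ^ 2 * y $ 2" for y :: "complex ^ 5"
  define W where "W = coord_dom \<inter> m -` V"
  have sm: "smooth_on coord_dom m" unfolding m_def by (intro smooth_intros open_coord_dom)
  have W: "open W" unfolding W_def
    using continuous_open_preimage[OF smooth_on_imp_continuous_on[OF sm] open_coord_dom V(1)] .
  define l where "l y = H_lift (r (m y)) y" for y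
  have l: "l y \<in> coord_dom" "B_to_H (l y) = y" if "y \<in> W" for y
    using that V(5)[of "m y"] H_lift[of y "r (m y)"] unfolding W_def l_def m_def by auto
  have rm: "smooth_on W (\<lambda>y. r (m y))"
    by (rule smooth_on_compose[OF smooth_on_subset[OF sm] V(3) W V(1)]) (auto simp: W_def)
  have rnz: "r (m y) \<noteq> 0" if "y \<in> W" for y using that V(5)[of "m y"] V(6) by (auto simp: W_def)
  have sml: "smooth_on W l"
    unfolding l_def H_lift_def
    by (intro smooth_on_vec5I W; simp; intro smooth_intros W rm) (auto simp: rnz W_def coord_dom_def)
  define s where "s h = B_of (l (H_coord h))" for h
  have gH: "H_coord (borel_to_H g) = B_to_H x" unfolding x_def by (rule H_coord_borel_to_H[OF g])
  have mx: "m (B_to_H x) = x $ 1 ^ 3" using H_lift_unique(2)[OF x(1)] unfolding m_def by simp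
  have in_W: "H_coord (borel_to_H g) \<in> W" unfolding gH W_def using B_to_H_dom[OF x(1)] mx V(2) by simp
  have sg: "s (borel_to_H g) = g" unfolding s_def gH l_def mx V(4) using H_lift_unique(1)[OF x(1)] x(2) by simp
  have sec: "s h \<in> carrier borel_group \<and> borel_to_H (s h) = h" if "h \<in> carrier H_group" "H_coord h \<in> W" for h
    using l[OF that(2)] H_of_coord(1)[OF that(1)] unfolding s_def carrier_borel_group by (simp add: borel_to_H_of)
  have "local_smooth H_chart B_chart s (borel_to_H g)"
  proof (rule local_smoothI[OF _ W _ _ sml])
    show "W \<subseteq> snd H_chart ` fst H_chart" unfolding H_chart_image W_def by blast
  qed (use borel_to_H_in[OF g] in_W sec in \<open>auto simp: H_chart_def B_chart_def s_def B_coord_of\<close>)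
  then show thesis using that W in_W sg sec by blast
qed

text \<open>\<open>quotient_atlas\<close> keeps only charts on which the coset map is injective, so
  each g needs a sufficiently small chart. Elements of one coset share the cube of the entry a and
  are determined by a, hence it suffices to confine a to a region on which cubing is
  injective.\<close>

lemma borel_injective_chart:
  assumes g: "g \<in> carrier borel_group"
  shows "\<exists>c\<in>charts_at borel_atlas g. inj_on borel_coset (fst c)"
proof -
  define a where "a = g $ 1 $ 1"
  have a: "a \<noteq> 0" using B_of_coord[OF g] unfolding a_def B_coord_def coord_dom_def by simp
  \<comment> \<open>The open sector of directions within pi/4 of that of a. Products of two elements
    of the normalised sector have positive real part, so u^2 + u v + v^2, the cofactor of u - v in
    u^3 - v^3, cannot vanish.\<close>
  define P where "P z \<longleftrightarrow> \<bar>Im (z / a)\<bar> < Re (z / a)" for z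
  have unique: "z = w" if "P z" "P w" "z ^ 3 = w ^ 3" for z w
  proof -
    define u v where "u = z / a" and "v = w / a"
    have "0 < Re (u * u) \<and> 0 < Re (u * v) \<and> 0 < Re (v * v)"
    proof -
      have *: "0 < Re (p * q)" if "\<bar>Im p\<bar> < Re p" "\<bar>Im q\<bar> < Re q" for p q
      proof -
        have "Im p * Im q \<le> \<bar>Im p\<bar> * \<bar>Im q\<bar>" by (metis abs_ge_self abs_mult)
        also have "\<dots> < Re p * Re q" using that by (intro mult_strict_mono) auto
        finally show ?thesis by simp
      qed
      show ?thesis using * that unfolding P_def u_def v_def by blast
    qed
    then have "Re (u * u + u * v + v * v) \<noteq> 0" by simp
    then have nz: "u * u + u * v + v * v \<noteq> 0" by force
    have "u ^ 3 = v ^ 3" using that(3) unfolding u_def v_def by (simp add: power_divide)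
    then have "(u - v) * (u * u + u * v + v * v) = 0" by (simp add: algebra_simps power3_eq_cube)
    then show ?thesis using nz a unfolding u_def v_def by simp
  qed
  define V where "V = {m :: complex ^ 3 ^ 3. P (m $ 1 $ 1)}"
  define U where "U = coord_dom \<inter> {x. P (x $ 1)}"
  have V: "open V" unfolding V_def P_def by (intro open_Collect_less continuous_intros) (use a in auto)
  have "open {x :: complex ^ 5. P (x $ 1)}" unfolding P_def by (intro open_Collect_less continuous_intros) (use a in auto)
  then have U: "open U" unfolding U_def using open_coord_dom by blast
  have 1: "smooth_on U B_of"
    unfolding B_of_def
    by (intro smooth_on_vec3I U; simp; intro smooth_intros U) (auto simp: coord_dom_def U_def)
  have 2: "smooth_on V B_coord"
    unfolding B_coord_def by (intro smooth_on_vec5I V; simp; intro smooth_intros V)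
  let ?c = "(carrier borel_group \<inter> V, B_coord)"
  have "?c \<in> borel_atlas" unfolding borel_atlas_def
    by (rule normed_space_submanifold_chart[OF U 1 _ _ _ _ V 2])
       (auto simp: B_coord_of B_of_coord U_def V_def carrier_borel_group B_of_entries)
  moreover have "g \<in> fst ?c" using g a by (simp add: V_def P_def flip: a_def)
  moreover have "inj_on borel_coset (fst ?c)"
  proof (rule inj_onI)
    fix h k assume hk: "h \<in> fst ?c" "k \<in> fst ?c" "borel_coset h = borel_coset k"
    obtain x y where xy: "h = B_of x" "k = B_of y" "x \<in> coord_dom" "y \<in> coord_dom"
      using hk by (auto simp: carrier_borel_group)
    have "borel_to_H h = borel_to_H k" using hk borel_coset_eq_iff by simp
    then have eq: "B_to_H x = B_to_H y" using H_coord_borel_to_H hk xy by (metis B_coord_of IntE fst_conv)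
    have "x $ 1 ^ 3 = y $ 1 ^ 3" using H_lift_unique(2)[OF xy(3)] H_lift_unique(2)[OF xy(4)] eq by simp
    then have "x $ 1 = y $ 1" using unique hk xy by (simp add: V_def B_of_entries)
    then show "h = k" using H_lift_unique(1)[OF xy(3)] H_lift_unique(1)[OF xy(4)] eq xy by metis
  qed
  ultimately show ?thesis by (auto simp: charts_at_def)
qed

text \<open>Both claims come from the comparison with H: in a quotient chart the induced map looks
  like j in the chart upstairs, and its inverse is the coset of a local section of j.\<close>

lemma borel_quotient_manifold:
  shows "smooth_manifold (carrier borel_quotient) borel_quotient_atlas"
    and "diffeomorphism (carrier borel_quotient) borel_quotient_atlas (carrier H_group) H_atlas borel_quotient_to_H"
proof -
  define qc where "qc c = (borel_coset ` fst c, snd c \<circ> inv_into (fst c) borel_coset)"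
    for c :: "(complex ^ 3 ^ 3, complex ^ 5) chart"
  have atlas: "borel_quotient_atlas = qc ` {c \<in> borel_atlas. inj_on borel_coset (fst c)}"
    unfolding borel_quotient_atlas_def quotient_atlas_def qc_def ..
  have qc_apply: "snd (qc c) (borel_coset g) = snd c g" if "inj_on borel_coset (fst c)" "g \<in> fst c" for c g
    using that by (simp add: qc_def)
  have qc_image: "snd (qc c) ` fst (qc c) = snd c ` fst c" if "inj_on borel_coset (fst c)" for c
    using that by (force simp: qc_def)
  have sub: "fst c \<subseteq> carrier borel_group" if "c \<in> borel_atlas" for c
    using smooth_atlasD(2)[OF smooth_atlas_borel that] .
  have wf: "wf_chart c" if "c \<in> borel_quotient_atlas" for c
  proof -
    obtain c' where c': "c = qc c'" "c' \<in> borel_atlas" "inj_on borel_coset (fst c')" using \<open>c \<in> _\<close> unfolding atlas by blast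
    have w: "wf_chart c'" using smooth_atlasD(1)[OF smooth_atlas_borel c'(2)] .
    have "inj_on (snd (qc c')) (fst (qc c'))"
    proof (rule inj_onI)
      fix P Q assume "P \<in> fst (qc c')" "Q \<in> fst (qc c')" and eq: "snd (qc c') P = snd (qc c') Q"
      then obtain g h where gh: "P = borel_coset g" "Q = borel_coset h" "g \<in> fst c'" "h \<in> fst c'" by (auto simp: qc_def)
      then have "g = h" using eq qc_apply[OF c'(3)] inj_onD[OF wf_chartD(1)[OF w]] by simp
      then show "P = Q" using gh by simp
    qed
    then show ?thesis unfolding c'(1) wf_chart_def qc_image[OF c'(3)] using wf_chartD(2)[OF w] by blast
  qed
  have cover: "\<Union> (fst ` borel_quotient_atlas) = carrier borel_quotient"
  proof (rule equalityI; rule subsetI)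
    fix P assume "P \<in> \<Union> (fst ` borel_quotient_atlas)"
    then obtain c where "c \<in> borel_atlas" "P \<in> borel_coset ` fst c" unfolding atlas by (auto simp: qc_def)
    then show "P \<in> carrier borel_quotient" using sub[of c] unfolding carrier_borel_quotient by blast
  next
    fix P assume "P \<in> carrier borel_quotient"
    then obtain g where g: "P = borel_coset g" "g \<in> carrier borel_group" unfolding carrier_borel_quotient by blast
    then obtain c where "c \<in> charts_at borel_atlas g" "inj_on borel_coset (fst c)" using borel_injective_chart by blast
    then have "qc c \<in> borel_quotient_atlas" "P \<in> fst (qc c)" using g unfolding atlas by (auto simp: charts_at_def qc_def)
    then show "P \<in> \<Union> (fst ` borel_quotient_atlas)" by blast
  qed
  have loc: "\<exists>d\<in>charts_at H_atlas (borel_quotient_to_H P). local_smooth c d borel_quotient_to_H P \<and>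
      local_smooth d c (inv_into (carrier borel_quotient) borel_quotient_to_H) (borel_quotient_to_H P)"
    if "c \<in> borel_quotient_atlas" "P \<in> fst c" for c P
  proof -
    obtain c' where c': "c = qc c'" "c' \<in> borel_atlas" "inj_on borel_coset (fst c')" using \<open>c \<in> _\<close> unfolding atlas by blast
    obtain g where g: "P = borel_coset g" "g \<in> fst c'" using \<open>P \<in> fst c\<close> unfolding c'(1) by (auto simp: qc_def)
    have gB: "g \<in> carrier borel_group" using g sub[OF c'(2)] by blast
    have c'_at: "c' \<in> charts_at borel_atlas g" using c' g by (simp add: charts_at_def)
    have FP: "borel_quotient_to_H P = borel_to_H g" unfolding g(1) by (rule borel_quotient_to_H_coset[OF gB])
    note H_at = H_chart_at[OF borel_to_H_in[OF gB]]
    have "local_smooth c' H_chart borel_to_H g"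
      by (rule local_smooth_change[OF smooth_atlas_borel smooth_atlas_H local_smooth_borel_to_H[OF gB]
            B_chart_at[OF gB] c'_at H_at H_at])
    then obtain V f where V: "g \<in> fst c'" "open V" "snd c' g \<in> V" "V \<subseteq> snd c' ` fst c'" "smooth_on V f"
      "\<forall>q\<in>fst c'. snd c' q \<in> V \<longrightarrow> borel_to_H q \<in> fst H_chart"
      "\<forall>q\<in>fst c'. snd c' q \<in> V \<longrightarrow> snd H_chart (borel_to_H q) = f (snd c' q)" by (rule local_smoothE)
    have 1: "local_smooth c H_chart borel_quotient_to_H P"
    proof (rule local_smoothI[OF \<open>P \<in> fst c\<close> V(2) _ _ V(5)])
      show "snd c P \<in> V" unfolding c'(1) g(1) using qc_apply[OF c'(3) g(2)] V(3) by simp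
      show "V \<subseteq> snd c ` fst c" unfolding c'(1) qc_image[OF c'(3)] by (rule V(4))
      fix Q assume Q: "Q \<in> fst c" "snd c Q \<in> V"
      then obtain h where h: "Q = borel_coset h" "h \<in> fst c'" unfolding c'(1) by (auto simp: qc_def)
      have e: "snd c Q = snd c' h" "borel_quotient_to_H Q = borel_to_H h"
        unfolding h(1) using qc_apply[OF c'(3) h(2)] borel_quotient_to_H_coset[of h] sub[OF c'(2)] h(2) c'(1) by auto
      show "borel_quotient_to_H Q \<in> fst H_chart" "snd H_chart (borel_quotient_to_H Q) = f (snd c Q)"
        using V(6,7) h Q e by auto
    qed
    obtain s W where s: "open W" "H_coord (borel_to_H g) \<in> W" "local_smooth H_chart B_chart s (borel_to_H g)"
      "s (borel_to_H g) = g"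
      "\<And>h. h \<in> carrier H_group \<Longrightarrow> H_coord h \<in> W \<Longrightarrow> s h \<in> carrier borel_group \<and> borel_to_H (s h) = h"
      using borel_local_section[OF gB] by metis
    have "local_smooth H_chart c' s (borel_to_H g)"
      by (rule local_smooth_change[OF smooth_atlas_H smooth_atlas_borel s(3) H_at H_at]) (simp_all add: s(4) B_chart_at gB c'_at)
    then obtain V' f' where V': "borel_to_H g \<in> fst H_chart" "open V'" "snd H_chart (borel_to_H g) \<in> V'"
      "V' \<subseteq> snd H_chart ` fst H_chart" "smooth_on V' f'"
      "\<forall>q\<in>fst H_chart. snd H_chart q \<in> V' \<longrightarrow> s q \<in> fst c'"
      "\<forall>q\<in>fst H_chart. snd H_chart q \<in> V' \<longrightarrow> snd c' (s q) = f' (snd H_chart q)" by (rule local_smoothE)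
    have 2: "local_smooth H_chart c (inv_into (carrier borel_quotient) borel_quotient_to_H) (borel_to_H g)"
    proof (rule local_smoothI[OF V'(1) open_Int[OF V'(2) s(1)]])
      show "snd H_chart (borel_to_H g) \<in> V' \<inter> W" using V' s(2) by (simp add: H_chart_def)
      show "V' \<inter> W \<subseteq> snd H_chart ` fst H_chart" using V' by blast
      show "smooth_on (V' \<inter> W) f'" by (rule smooth_on_subset[OF V'(5)]) blast
      fix h assume h: "h \<in> fst H_chart" "snd H_chart h \<in> V' \<inter> W"
      then have sh: "s h \<in> carrier borel_group" "borel_to_H (s h) = h" using s(5) by (auto simp: H_chart_def)
      have inv: "inv_into (carrier borel_quotient) borel_quotient_to_H h = borel_coset (s h)"
        using borel_quotient_to_H_inv[OF sh(1)] sh(2) by simp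
      have "s h \<in> fst c'" "snd c' (s h) = f' (snd H_chart h)" using V'(6,7) h by auto
      then show "inv_into (carrier borel_quotient) borel_quotient_to_H h \<in> fst c"
        "snd c (inv_into (carrier borel_quotient) borel_quotient_to_H h) = f' (snd H_chart h)"
        unfolding inv c'(1) using qc_apply[OF c'(3)] by (auto simp: qc_def)
    qed
    show ?thesis unfolding FP using 1 2 H_at by blast
  qed
  show "smooth_manifold (carrier borel_quotient) borel_quotient_atlas"
    "diffeomorphism (carrier borel_quotient) borel_quotient_atlas (carrier H_group) H_atlas borel_quotient_to_H"
    using transfer_manifold[OF borel_quotient_bij H_chart(2) wf cover loc] by blast+
qed

text \<open>Multiplication and inversion of G are those of G' conjugated by F, hence composites of
  smooth maps.\<close>

lemma lie_group_transfer:
  fixes B :: "('g, 'e::findim) atlas" and B' :: "('h, 'f::findim) atlas"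
  assumes G: "group G" "smooth_manifold (carrier G) B" and G': "lie_group G' B'"
    and F: "F \<in> hom G G'" "diffeomorphism (carrier G) B (carrier G') B' F"
  shows "lie_group G B"
proof -
  let ?X = "carrier G" let ?Y = "carrier G'" let ?I = "inv_into (carrier G) F"
  have A: "smooth_atlas ?X B" and A': "smooth_atlas ?Y B'"
    using G G' by (auto simp: smooth_manifold_iff lie_group_def)
  have grp: "group G'" using G' by (simp add: lie_group_def)
  interpret group_hom G G' F using G(1) grp F(1) by (simp add: group_hom_def group_hom_axioms_def)
  have inv: "?I (F x) = x" if "x \<in> ?X" for x using F(2) that by (simp add: diffeomorphism_def bij_betw_def)
  have sF: "smooth_map ?X B ?Y B' F" and sI: "smooth_map ?Y B' ?X B ?I" using F(2) by (simp_all add: diffeomorphism_def)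
  have mult': "smooth_map (?Y \<times> ?Y) (prod_atlas B' B') ?Y B' (\<lambda>(g, h). g \<otimes>\<^bsub>G'\<^esub> h)"
    and inv': "smooth_map ?Y B' ?Y B' (\<lambda>g. inv\<^bsub>G'\<^esub> g)" using G' by (simp_all add: lie_group_def)
  note P = smooth_atlas_prod[OF A A] and P' = smooth_atlas_prod[OF A' A']
  have FF: "smooth_map (?X \<times> ?X) (prod_atlas B B) (?Y \<times> ?Y) (prod_atlas B' B') (\<lambda>z. (F (fst z), F (snd z)))"
    unfolding smooth_map_iff[OF P P']
  proof (intro conjI ballI)
    show "(\<lambda>z. (F (fst z), F (snd z))) \<in> ?X \<times> ?X \<rightarrow> ?Y \<times> ?Y" by auto
    fix z assume z: "z \<in> ?X \<times> ?X"
    have "smooth_at B B' F (fst z)" "smooth_at B B' F (snd z)"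
      using sF z unfolding smooth_map_iff[OF A A'] by auto
    then show "smooth_at (prod_atlas B B) (prod_atlas B' B') (\<lambda>z. (F (fst z), F (snd z))) z"
      by (intro smooth_at_Pair[OF P A' A'] smooth_at_comp[OF P A A' smooth_at_fst(1)[OF A A z]]
          smooth_at_comp[OF P A A' smooth_at_fst(2)[OF A A z]])
  qed
  have 1: "smooth_map (?X \<times> ?X) (prod_atlas B B) ?X B (\<lambda>(g, h). g \<otimes>\<^bsub>G\<^esub> h)"
    by (rule smooth_map_cong[OF P A _ smooth_map_comp[OF P A' A smooth_map_comp[OF P P' A' FF mult'] sI]])
       (auto simp: inv simp flip: hom_mult)
  have 2: "smooth_map ?X B ?X B (\<lambda>g. inv\<^bsub>G\<^esub> g)"
    by (rule smooth_map_cong[OF A A _ smooth_map_comp[OF A A' A smooth_map_comp[OF A A' A' sF inv'] sI]])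
       (auto simp: inv simp flip: hom_inv)
  show ?thesis unfolding lie_group_def using G 1 2 by blast
qed

lemma borel_quotient_lie_group_iso:
  "lie_group_iso borel_quotient borel_quotient_atlas H_group H_atlas borel_quotient_to_H"
  unfolding lie_group_iso_def
proof (intro conjI lie_group_H borel_quotient_manifold)
  show hom: "borel_quotient_to_H \<in> hom borel_quotient H_group"
    using borel_quotient_iso by (simp add: iso_def)
  show "lie_group borel_quotient borel_quotient_atlas"
    by (rule lie_group_transfer[OF group_borel_quotient borel_quotient_manifold(1) lie_group_H hom borel_quotient_manifold(2)])
qed

section \<open>Principal bundles\<close>

text \<open>Change of the structure group along an isomorphism: trivialisations are precomposed with
  the product of the identity and F, and so is the action map.\<close>

lemma principal_bundle_iso:
  fixes AP :: "('p, 'e::findim) atlas" and AX :: "('a, 'f::findim) atlas"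
    and B :: "('g, 'k::findim) atlas" and B' :: "('h, 'l::findim) atlas"
  assumes P: "principal_bundle P AP X AX \<pi> G B act" and F: "lie_group_iso G' B' G B F"
  shows "principal_bundle P AP X AX \<pi> G' B' (\<lambda>p g. act p (F g))"
proof -
  have aP: "smooth_atlas P AP" and aX: "smooth_atlas X AX" and aG: "smooth_atlas (carrier G) B"
    and aG': "smooth_atlas (carrier G') B'"
    using P F by (auto simp: principal_bundle_def lie_group_iso_def lie_group_def smooth_manifold_iff)
  have "group G" "group G'" "F \<in> hom G' G" using F by (auto simp: lie_group_iso_def lie_group_def)
  then interpret group_hom G' G F by (simp add: group_hom_def group_hom_axioms_def)
  have dF: "diffeomorphism (carrier G') B' (carrier G) B F" using F by (simp add: lie_group_iso_def)
  have sm\<pi>: "smooth_map P AP X AX \<pi>" using P by (simp add: principal_bundle_def)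
  have "smooth_map (P \<times> carrier G') (prod_atlas AP B') (P \<times> carrier G) (prod_atlas AP B) (\<lambda>z. (fst z, F (snd z)))"
    using diffeomorphism_prod[OF aG' aG aP dF] by (simp add: diffeomorphism_def)
  from smooth_map_comp[OF smooth_atlas_prod[OF aP aG'] smooth_atlas_prod[OF aP aG] aP this, of "\<lambda>(p, g). act p g"]
  have sm: "smooth_map (P \<times> carrier G') (prod_atlas AP B') P AP (\<lambda>(p, g). act p (F g))"
    using P by (simp add: principal_bundle_def case_prod_unfold)
  have triv: "\<exists>U \<Phi>. openin (atlas_topology AX) U \<and> x \<in> U \<and>
      diffeomorphism (U \<times> carrier G') (prod_atlas (restrict_atlas AX U) B')
        {p \<in> P. \<pi> p \<in> U} (restrict_atlas AP {p \<in> P. \<pi> p \<in> U}) \<Phi> \<and>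
      (\<forall>y\<in>U. \<forall>g\<in>carrier G'. \<pi> (\<Phi> (y, g)) = y \<and>
           (\<forall>h\<in>carrier G'. act (\<Phi> (y, g)) (F h) = \<Phi> (y, g \<otimes>\<^bsub>G'\<^esub> h)))" if x: "x \<in> X" for x
  proof -
    obtain U \<Phi> where U: "openin (atlas_topology AX) U" "x \<in> U"
      "diffeomorphism (U \<times> carrier G) (prod_atlas (restrict_atlas AX U) B)
        {p \<in> P. \<pi> p \<in> U} (restrict_atlas AP {p \<in> P. \<pi> p \<in> U}) \<Phi>"
      "\<forall>y\<in>U. \<forall>g\<in>carrier G. \<pi> (\<Phi> (y, g)) = y \<and> (\<forall>h\<in>carrier G. act (\<Phi> (y, g)) h = \<Phi> (y, g \<otimes>\<^bsub>G\<^esub> h))"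
      using bspec[OF P[unfolded principal_bundle_def, THEN conjunct2, THEN conjunct2, THEN conjunct2, THEN conjunct2, THEN conjunct2, THEN conjunct2, THEN conjunct2, THEN conjunct2] x] by (elim exE conjE)
    have aU: "smooth_atlas U (restrict_atlas AX U)" by (rule smooth_atlas_restrict[OF aX U(1)])
    have "openin (atlas_topology AP) {p \<in> P. \<pi> p \<in> U}"
      using openin_continuous_map_preimage[OF smooth_map_continuous[OF aP aX sm\<pi>] U(1)]
      by (simp add: topspace_atlas_topology[OF aP])
    then have aPU: "smooth_atlas {p \<in> P. \<pi> p \<in> U} (restrict_atlas AP {p \<in> P. \<pi> p \<in> U})"
      by (rule smooth_atlas_restrict[OF aP])
    have "diffeomorphism (U \<times> carrier G') (prod_atlas (restrict_atlas AX U) B')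
        {p \<in> P. \<pi> p \<in> U} (restrict_atlas AP {p \<in> P. \<pi> p \<in> U}) (\<lambda>z. \<Phi> (fst z, F (snd z)))"
      by (rule diffeomorphism_comp[OF smooth_atlas_prod[OF aU aG'] smooth_atlas_prod[OF aU aG] aPU
            diffeomorphism_prod[OF aG' aG aU dF] U(3)])
    then show ?thesis using U(1,2) U(4) by (intro exI[of _ U] exI[of _ "\<lambda>z. \<Phi> (fst z, F (snd z))"]) auto
  qed
  show ?thesis
    using P F sm triv unfolding principal_bundle_def lie_group_iso_def by auto
qed

text \<open>All bundle axioms follow from local sections whose orbit map is, in one chart \<Psi> of
  P, the pair of base coordinates and group coordinates. Only an atlas of P is assumed; separation
  and countability of P are deduced from those of M.\<close>

lemma principal_bundle_from_sections:
  fixes A :: "('a, 'e::euclidean_space) atlas" and AP :: "('p, 'e \<times> (complex ^ 5)) atlas"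
  assumes M: "smooth_manifold M A" and P: "smooth_atlas P AP" and \<pi>: "\<pi> \<in> P \<rightarrow> M"
    and act_in: "\<And>p h. p \<in> P \<Longrightarrow> h \<in> carrier H_group \<Longrightarrow> act p h \<in> P \<and> \<pi> (act p h) = \<pi> p"
    and act_one: "\<And>p. p \<in> P \<Longrightarrow> act p (mat 1) = p"
    and act_mult: "\<And>p g h. p \<in> P \<Longrightarrow> g \<in> carrier H_group \<Longrightarrow> h \<in> carrier H_group \<Longrightarrow> act (act p g) h = act p (g ** h)"
    and triv: "\<And>x. x \<in> M \<Longrightarrow> \<exists>U c \<sigma> \<Psi>. openin (atlas_topology A) U \<and> x \<in> U \<and> c \<in> A \<and> U \<subseteq> fst c \<and>
      \<Psi> \<in> AP \<and> fst \<Psi> = {p \<in> P. \<pi> p \<in> U} \<and> (\<forall>y\<in>U. \<sigma> y \<in> P \<and> \<pi> (\<sigma> y) = y) \<and>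
      (\<forall>y\<in>U. \<forall>h\<in>carrier H_group. snd \<Psi> (act (\<sigma> y) h) = (snd c y, H_coord h)) \<and>
      (\<forall>p\<in>P. \<pi> p \<in> U \<longrightarrow> (\<exists>h\<in>carrier H_group. p = act (\<sigma> (\<pi> p)) h))"
  shows "principal_bundle P AP M A \<pi> H_group H_atlas act"
proof -
  interpret H: group H_group by (rule group_H)
  have aM: "smooth_atlas M A" using M by (simp add: smooth_manifold_iff)
  note aG = smooth_atlas_H
  define T where "T U c \<sigma> \<Psi> \<longleftrightarrow> openin (atlas_topology A) U \<and> c \<in> A \<and> U \<subseteq> fst c \<and>
      \<Psi> \<in> AP \<and> fst \<Psi> = {p \<in> P. \<pi> p \<in> U} \<and> (\<forall>y\<in>U. \<sigma> y \<in> P \<and> \<pi> (\<sigma> y) = y) \<and>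
      (\<forall>y\<in>U. \<forall>h\<in>carrier H_group. snd \<Psi> (act (\<sigma> y) h) = (snd c y, H_coord h)) \<and>
      (\<forall>p\<in>P. \<pi> p \<in> U \<longrightarrow> (\<exists>h\<in>carrier H_group. p = act (\<sigma> (\<pi> p)) h))"
    for U :: "'a set" and c :: "('a, 'e) chart" and \<sigma> :: "'a \<Rightarrow> 'p" and \<Psi> :: "('p, 'e \<times> (complex ^ 5)) chart"
  have T: "\<exists>U c \<sigma> \<Psi>. x \<in> U \<and> T U c \<sigma> \<Psi>" if "x \<in> M" for x using triv[OF that] unfolding T_def by blast
  have TD: "openin (atlas_topology A) U" "c \<in> A" "U \<subseteq> fst c" "\<Psi> \<in> AP" "fst \<Psi> = {p \<in> P. \<pi> p \<in> U}"
    "\<And>y. y \<in> U \<Longrightarrow> \<sigma> y \<in> P" "\<And>y. y \<in> U \<Longrightarrow> \<pi> (\<sigma> y) = y"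
    "\<And>y h. y \<in> U \<Longrightarrow> h \<in> carrier H_group \<Longrightarrow> snd \<Psi> (act (\<sigma> y) h) = (snd c y, H_coord h)"
    "\<And>p. p \<in> P \<Longrightarrow> \<pi> p \<in> U \<Longrightarrow> \<exists>h\<in>carrier H_group. p = act (\<sigma> (\<pi> p)) h"
    if "T U c \<sigma> \<Psi>" for U c \<sigma> \<Psi>
    using that unfolding T_def by blast+
  have image: "snd \<Psi> ` fst \<Psi> = snd c ` U \<times> coord_dom" if t: "T U c \<sigma> \<Psi>" for U c \<sigma> \<Psi>
  proof (rule equalityI; rule subsetI)
    fix z assume "z \<in> snd \<Psi> ` fst \<Psi>"
    then obtain p where p: "z = snd \<Psi> p" "p \<in> P" "\<pi> p \<in> U" using TD(5)[OF t] by auto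
    obtain h where h: "h \<in> carrier H_group" "p = act (\<sigma> (\<pi> p)) h" using TD(9)[OF t p(2,3)] by blast
    have "z = (snd c (\<pi> p), H_coord h)" using TD(8)[OF t p(3) h(1)] h(2) p(1) by simp
    then show "z \<in> snd c ` U \<times> coord_dom" using p(3) H_of_coord(2)[OF h(1)] by simp
  next
    fix z assume "z \<in> snd c ` U \<times> coord_dom"
    then obtain y v where z: "z = (snd c y, v)" "y \<in> U" "v \<in> coord_dom" by auto
    have h: "H_of v \<in> carrier H_group" using z by (simp add: carrier_H_group)
    have "act (\<sigma> y) (H_of v) \<in> fst \<Psi>" using TD(5-7)[OF t] z(2) act_in h by auto
    moreover have "snd \<Psi> (act (\<sigma> y) (H_of v)) = z" using TD(8)[OF t z(2) h] z H_coord_of by simp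
    ultimately show "z \<in> snd \<Psi> ` fst \<Psi>" by force
  qed
  have wc: "wf_chart c" if "T U c \<sigma> \<Psi>" for U c \<sigma> \<Psi> using smooth_atlasD(1)[OF aM TD(2)[OF that]] .
  have wP: "wf_chart \<Psi>" if "T U c \<sigma> \<Psi>" for U c \<sigma> \<Psi> using smooth_atlasD(1)[OF P TD(4)[OF that]] .
  have oU: "open (snd c ` U)" if t: "T U c \<sigma> \<Psi>" for U c \<sigma> \<Psi>
  proof -
    have "fst c \<inter> U = U" using TD(3)[OF t] by blast
    then show ?thesis using openin_atlasD[OF aM TD(1,2)[OF t]] by simp
  qed
  have fstP: "fst (snd \<Psi> p) = snd c (\<pi> p)" if t: "T U c \<sigma> \<Psi>" and p: "p \<in> fst \<Psi>" for U c \<sigma> \<Psi> p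
    using TD(8,9)[OF t] TD(5)[OF t] p by fastforce
  have sm\<pi>: "smooth_map P AP M A \<pi>" unfolding smooth_map_iff[OF P aM]
  proof (intro conjI \<pi> ballI)
    fix p assume p: "p \<in> P"
    then obtain U c \<sigma> \<Psi> where U: "\<pi> p \<in> U" and t: "T U c \<sigma> \<Psi>" using T \<pi> by blast
    have pP: "p \<in> fst \<Psi>" using TD(5)[OF t] p U by simp
    have "local_smooth \<Psi> c \<pi> p"
      using smooth_on_bounded_linear[OF bounded_linear_fst wf_chartD(2)[OF wP[OF t]]] pP fstP[OF t] TD(3,5)[OF t]
      by (intro local_smoothI[OF pP wf_chartD(2)[OF wP[OF t]], of fst]) auto
    then show "smooth_at AP A \<pi> p"
      using TD[OF t] U pP by (intro smooth_atI[of \<Psi> _ _ c]) (auto simp: charts_at_def)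
  qed
  \<comment> \<open>If a point of P is the translate of \<sigma> y by h, then g takes it to the
    translate by \<open>h ** g\<close>. So in the chart \<Psi> the action leaves the base
    coordinates alone and is \<open>H_mult\<close> on the group coordinates.\<close>
  have sm_act: "smooth_map (P \<times> carrier H_group) (prod_atlas AP H_atlas) P AP (\<lambda>(p, g). act p g)"
    unfolding smooth_map_iff[OF smooth_atlas_prod[OF P aG] P]
  proof (intro conjI ballI)
    show "(\<lambda>(p, g). act p g) \<in> P \<times> carrier H_group \<rightarrow> P" using act_in by auto
    fix z assume z: "z \<in> P \<times> carrier H_group"
    then obtain p k where pk: "z = (p, k)" "p \<in> P" "k \<in> carrier H_group" by blast
    then obtain U c \<sigma> \<Psi> where U: "\<pi> p \<in> U" and t: "T U c \<sigma> \<Psi>" using T \<pi> by blast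
    let ?C = "prod_chart \<Psi> H_chart"
    have pP: "p \<in> fst \<Psi>" "act p k \<in> fst \<Psi>" using TD(5)[OF t] pk U act_in by simp_all
    have w: "wf_chart ?C" by (rule wf_prod_chart[OF wP[OF t] smooth_atlasD(1)[OF aG H_chart(1)]])
    have im: "snd ?C ` fst ?C = (snd c ` U \<times> coord_dom) \<times> coord_dom"
      using map_prod_surj_on[OF image[OF t] H_chart_image] by (simp add: prod_chart_def)
    let ?V = "(snd c ` U \<times> coord_dom) \<times> coord_dom"
    have V: "open ?V" by (intro open_Times oU[OF t] open_coord_dom)
    have "local_smooth ?C \<Psi> (\<lambda>(p, g). act p g) z"
    proof (rule local_smoothI[OF _ V])
      show "z \<in> fst ?C" using pk pP by (simp add: prod_chart_def H_chart_def)
      then show "snd ?C z \<in> ?V" unfolding im[symmetric] by blast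
      show "?V \<subseteq> snd ?C ` fst ?C" by (simp add: im)
      show "smooth_on ?V (\<lambda>w. (fst (fst w), H_mult (snd (fst w)) (snd w)))"
        by (intro smooth_on_H_mult smooth_intros V) auto
      fix w assume "w \<in> fst ?C"
      then obtain q g where w: "w = (q, g)" "q \<in> fst \<Psi>" "g \<in> carrier H_group" by (auto simp: prod_chart_def H_chart_def)
      then have q: "q \<in> P" "\<pi> q \<in> U" using TD(5)[OF t] by auto
      then show "(\<lambda>(p, g). act p g) w \<in> fst \<Psi>" using w act_in TD(5)[OF t] by simp
      obtain h where h: "h \<in> carrier H_group" "q = act (\<sigma> (\<pi> q)) h" using TD(9)[OF t q] by blast
      have "act q g = act (\<sigma> (\<pi> q)) (h ** g)" using act_mult[OF TD(6)[OF t q(2)] h(1) w(3)] h(2) by simp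
      moreover have "snd \<Psi> q = (snd c (\<pi> q), H_coord h)" using TD(8)[OF t q(2) h(1)] h(2) by simp
      moreover have "h ** g \<in> carrier H_group" using H.m_closed[OF h(1) w(3)] by (simp add: H_group_simps)
      ultimately show "snd \<Psi> ((\<lambda>(p, g). act p g) w) =
          (fst (fst (snd ?C w)), H_mult (snd (fst (snd ?C w))) (snd (snd ?C w)))"
        using TD(8)[OF t q(2)] H_coord_mult[OF h(1) w(3)] unfolding w(1)
        by (simp add: prod_chart_def H_chart_def)
    qed
    then show "smooth_at (prod_atlas AP H_atlas) AP (\<lambda>(p, g). act p g) z"
    proof (rule smooth_atI[rotated 2])
      have "\<Psi> \<in> charts_at AP (fst z)" "H_chart \<in> charts_at H_atlas (snd z)"
        using pk pP(1) TD(4)[OF t] H_chart_at by (simp_all add: charts_at_def)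
      then show "?C \<in> charts_at (prod_atlas AP H_atlas) z" unfolding charts_at_prod by blast
      show "\<Psi> \<in> charts_at AP ((\<lambda>(p, g). act p g) z)"
        using pk pP(2) TD(4)[OF t] by (simp add: charts_at_def)
    qed
  qed
  have local_triv: "\<exists>U \<Phi>. openin (atlas_topology A) U \<and> x \<in> U \<and>
      diffeomorphism (U \<times> carrier H_group) (prod_atlas (restrict_atlas A U) H_atlas)
        {p \<in> P. \<pi> p \<in> U} (restrict_atlas AP {p \<in> P. \<pi> p \<in> U}) \<Phi> \<and>
      (\<forall>y\<in>U. \<forall>g\<in>carrier H_group. \<pi> (\<Phi> (y, g)) = y \<and>
           (\<forall>h\<in>carrier H_group. act (\<Phi> (y, g)) h = \<Phi> (y, g \<otimes>\<^bsub>H_group\<^esub> h)))" if x: "x \<in> M" for x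
  proof -
    obtain U c \<sigma> \<Psi> where U: "x \<in> U" and t: "T U c \<sigma> \<Psi>" using T[OF x] by blast
    define \<Phi> where "\<Phi> = (\<lambda>z. act (\<sigma> (fst z)) (snd z))"
    let ?PU = "{p \<in> P. \<pi> p \<in> U}"
    define c' where "c' = (fst c \<inter> U, snd c)"
    have c': "fst c' = U" "snd c' = snd c" using TD(3)[OF t] unfolding c'_def by auto
    have c'A: "c' \<in> restrict_atlas A U" unfolding c'_def restrict_atlas_def using TD(2)[OF t] by blast
    have "\<Psi> = (fst \<Psi> \<inter> ?PU, snd \<Psi>)" using TD(5)[OF t] by (simp add: prod_eq_iff)
    then have PA: "\<Psi> \<in> restrict_atlas AP ?PU" unfolding restrict_atlas_def using TD(4)[OF t] by blast
    have aU: "smooth_atlas U (restrict_atlas A U)" by (rule smooth_atlas_restrict[OF aM TD(1)[OF t]])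
    have "openin (atlas_topology AP) ?PU" using openin_chart[OF TD(4)[OF t]] TD(5)[OF t] by simp
    then have aPU: "smooth_atlas ?PU (restrict_atlas AP ?PU)" by (rule smooth_atlas_restrict[OF P])
    let ?C = "prod_chart c' H_chart"
    have C: "fst ?C = U \<times> carrier H_group" by (simp add: prod_chart_def c' H_chart_def)
    have im: "snd ?C ` fst ?C = snd c ` U \<times> coord_dom"
    proof -
      have "snd c' ` fst c' = snd c ` U" by (simp add: c')
      from map_prod_surj_on[OF this H_chart_image] show ?thesis by (simp add: prod_chart_def)
    qed
    have \<Phi>_in: "\<Phi> z \<in> fst \<Psi>" if "z \<in> fst ?C" for z
      using that act_in TD(5-7)[OF t] unfolding \<Phi>_def C by auto
    have coord: "snd \<Psi> (\<Phi> z) = snd ?C z" if "z \<in> fst ?C" for z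
      using that TD(8)[OF t, of "fst z" "snd z"] unfolding C \<Phi>_def by (auto simp: prod_chart_def c' H_chart_def)
    have wC: "wf_chart ?C"
    proof (rule wf_prod_chart[OF _ smooth_atlasD(1)[OF aG H_chart(1)]])
      show "wf_chart c'" using smooth_atlasD(1)[OF aU c'A] .
    qed
    have bij: "bij_betw \<Phi> (U \<times> carrier H_group) ?PU"
      unfolding bij_betw_def
    proof
      show "inj_on \<Phi> (U \<times> carrier H_group)"
        using coord wf_chartD(1)[OF wC] unfolding C[symmetric] inj_on_def by metis
      show "\<Phi> ` (U \<times> carrier H_group) = ?PU"
      proof (rule equalityI; rule subsetI)
        fix p assume "p \<in> \<Phi> ` (U \<times> carrier H_group)"
        then show "p \<in> ?PU" using \<Phi>_in TD(5)[OF t] unfolding C by auto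
      next
        fix p assume p: "p \<in> ?PU"
        then obtain h where "h \<in> carrier H_group" "p = act (\<sigma> (\<pi> p)) h" using TD(9)[OF t] by blast
        then show "p \<in> \<Phi> ` (U \<times> carrier H_group)" using p unfolding \<Phi>_def by force
      qed
    qed
    let ?V = "snd c ` U \<times> coord_dom"
    have V: "open ?V" by (intro open_Times oU[OF t] open_coord_dom)
    have "diffeomorphism (U \<times> carrier H_group) (prod_atlas (restrict_atlas A U) H_atlas) ?PU (restrict_atlas AP ?PU) \<Phi>"
    proof (rule diffeomorphismI[OF bij smooth_atlas_prod[OF aU aG] aPU])
      fix z assume z: "z \<in> U \<times> carrier H_group"
      then have zC: "z \<in> fst ?C" by (simp add: C)
      have 1: "?C \<in> charts_at (prod_atlas (restrict_atlas A U) H_atlas) z"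
      proof -
        have "c' \<in> charts_at (restrict_atlas A U) (fst z)" "H_chart \<in> charts_at H_atlas (snd z)"
          using z c'A c'(1) H_chart_at by (auto simp: charts_at_def)
        then show ?thesis unfolding charts_at_prod by blast
      qed
      have 2: "\<Psi> \<in> charts_at (restrict_atlas AP ?PU) (\<Phi> z)" using PA \<Phi>_in[OF zC] by (simp add: charts_at_def)
      have 3: "local_smooth ?C \<Psi> \<Phi> z"
        by (rule local_smoothI[OF zC V _ _ smooth_on_ident[OF V]]) (use zC im \<Phi>_in coord in auto)
      have 4: "local_smooth \<Psi> ?C (inv_into (U \<times> carrier H_group) \<Phi>) (\<Phi> z)"
      proof (rule local_smoothI[OF \<Phi>_in[OF zC] V _ _ smooth_on_ident[OF V]])
        show "snd \<Psi> (\<Phi> z) \<in> ?V" using coord[OF zC] zC im by auto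
        show "?V \<subseteq> snd \<Psi> ` fst \<Psi>" using image[OF t] by simp
        fix p assume "p \<in> fst \<Psi>"
        then have "p \<in> \<Phi> ` (U \<times> carrier H_group)" using bij TD(5)[OF t] by (simp add: bij_betw_def)
        then obtain w where w: "w \<in> U \<times> carrier H_group" "p = \<Phi> w" by blast
        have "inv_into (U \<times> carrier H_group) \<Phi> p = w" using w bij by (simp add: bij_betw_def)
        then show "inv_into (U \<times> carrier H_group) \<Phi> p \<in> fst ?C"
          "snd ?C (inv_into (U \<times> carrier H_group) \<Phi> p) = snd \<Psi> p"
          using w coord[of w] by (simp_all add: C)
      qed
      show "\<exists>c\<in>charts_at (prod_atlas (restrict_atlas A U) H_atlas) z. \<exists>d\<in>charts_at (restrict_atlas AP ?PU) (\<Phi> z).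
        local_smooth c d \<Phi> z \<and> local_smooth d c (inv_into (U \<times> carrier H_group) \<Phi>) (\<Phi> z)"
        using 1 2 3 4 by blast
    qed
    moreover have "\<pi> (\<Phi> (y, g)) = y \<and> (\<forall>h\<in>carrier H_group. act (\<Phi> (y, g)) h = \<Phi> (y, g \<otimes>\<^bsub>H_group\<^esub> h))"
      if "y \<in> U" "g \<in> carrier H_group" for y g
      using that act_in act_mult TD(6,7)[OF t that(1)] unfolding \<Phi>_def by (simp add: H_group_simps)
    ultimately show ?thesis using U TD(1)[OF t] by blast
  qed
  \<comment> \<open>Points of one fibre lie in a common chart, since the domain of \<Psi> is the
    full preimage of U. Points of different fibres are separated by preimages of open sets of
    M.\<close>
  have "Hausdorff_space (atlas_topology AP)"
  proof (rule Hausdorff_atlas[OF P])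
    fix p q assume pq: "p \<in> P" "q \<in> P" "p \<noteq> q"
    show "(\<exists>c\<in>AP. p \<in> fst c \<and> q \<in> fst c) \<or>
      (\<exists>U V. openin (atlas_topology AP) U \<and> openin (atlas_topology AP) V \<and> p \<in> U \<and> q \<in> V \<and> disjnt U V)"
    proof (cases "\<pi> p = \<pi> q")
      case True
      obtain U c \<sigma> \<Psi> where U: "\<pi> p \<in> U" and t: "T U c \<sigma> \<Psi>" using T \<pi> pq by blast
      have "\<Psi> \<in> AP" "p \<in> fst \<Psi>" "q \<in> fst \<Psi>" using TD(4,5)[OF t] pq U True by simp_all
      then show ?thesis by blast
    next
      case False
      have "Hausdorff_space (atlas_topology A)" using M by (simp add: smooth_manifold_iff)
      then obtain U V where UV: "openin (atlas_topology A) U" "openin (atlas_topology A) V" "\<pi> p \<in> U" "\<pi> q \<in> V" "disjnt U V"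
        unfolding Hausdorff_space_def topspace_atlas_topology[OF aM] using \<pi> pq False by (metis PiE)
      have o: "openin (atlas_topology AP) {p \<in> P. \<pi> p \<in> W}" if "openin (atlas_topology A) W" for W
        using openin_continuous_map_preimage[OF smooth_map_continuous[OF P aM sm\<pi>] that]
        by (simp add: topspace_atlas_topology[OF P])
      show ?thesis using o[OF UV(1)] o[OF UV(2)] UV pq
        by (intro disjI2 exI[of _ "{p \<in> P. \<pi> p \<in> U}"] exI[of _ "{p \<in> P. \<pi> p \<in> V}"]) (auto simp: disjnt_def)
    qed
  qed
  moreover have "second_countable (atlas_topology AP)"
  proof -
    obtain BB where BB: "countable BB" "\<And>U x. openin (atlas_topology A) U \<Longrightarrow> x \<in> U \<Longrightarrow> \<exists>V\<in>BB. x \<in> V \<and> V \<subseteq> U"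
      using M unfolding smooth_manifold_iff second_countable_def by metis
    \<comment> \<open>The members of a countable base of M that fit into a trivialising set; one
      chart of P for each of them is enough to cover P.\<close>
    define C where "C = {b \<in> BB. \<exists>U c \<sigma> \<Psi>. b \<subseteq> U \<and> T U c \<sigma> \<Psi>}"
    have "\<forall>b\<in>C. \<exists>\<Psi>. \<exists>U c \<sigma>. b \<subseteq> U \<and> T U c \<sigma> \<Psi>" unfolding C_def by blast
    then obtain ch where ch: "\<And>b. b \<in> C \<Longrightarrow> \<exists>U c \<sigma>. b \<subseteq> U \<and> T U c \<sigma> (ch b)" by metis
    show ?thesis
    proof (rule second_countable_atlas[OF P, of "ch ` C"])
      show "countable (ch ` C)" by (rule countable_image[OF countable_subset[OF _ BB(1)]]) (auto simp: C_def)
      show "ch ` C \<subseteq> AP"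
      proof (rule image_subsetI)
        fix b assume "b \<in> C"
        from ch[OF this] obtain U' c' \<sigma>' where "T U' c' \<sigma>' (ch b)" by (elim exE conjE)
        from TD(4)[OF this] show "ch b \<in> AP" .
      qed
      show "P \<subseteq> \<Union> (fst ` ch ` C)"
      proof
        fix p assume p: "p \<in> P"
        then obtain U c \<sigma> \<Psi> where U: "\<pi> p \<in> U" and t: "T U c \<sigma> \<Psi>" using T \<pi> by blast
        then obtain b where b: "b \<in> BB" "\<pi> p \<in> b" "b \<subseteq> U" using BB(2) TD(1)[OF t] by blast
        then have bC: "b \<in> C" unfolding C_def using t by blast
        from ch[OF bC] obtain U' c' \<sigma>' where ch_b: "b \<subseteq> U'" "T U' c' \<sigma>' (ch b)" by (elim exE conjE)
        have "p \<in> fst (ch b)" unfolding TD(5)[OF ch_b(2)] using p b(2) ch_b(1) by blast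
        then show "p \<in> \<Union> (fst ` ch ` C)" using bC by blast
      qed
    qed
  qed
  ultimately have mP: "smooth_manifold P AP" using P by (simp add: smooth_manifold_iff)
  show ?thesis
    unfolding principal_bundle_def
    using mP M lie_group_H sm\<pi> sm_act local_triv act_in act_one act_mult by (simp add: H_group_simps)
qed

section \<open>Adapted frames of a flag structure\<close>

definition cdot :: "complex ^ 3 \<Rightarrow> complex ^ 3 \<Rightarrow> complex" where
  "cdot a b = a $ 1 * b $ 1 + a $ 2 * b $ 2 + a $ 3 * b $ 3"

text \<open>Sends a pair of covectors to the vector that represents its wedge: (a \<and> b)(u, v) =
  (a x b) . (u x v). Like \<open>cdot\<close>, it is complex bilinear without conjugation, so that
  vectors can stand for complex covectors and for complex 2-forms.\<close>

definition ccross :: "complex ^ 3 \<Rightarrow> complex ^ 3 \<Rightarrow> complex ^ 3" where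
  "ccross a b = vector [a $ 2 * b $ 3 - a $ 3 * b $ 2, a $ 3 * b $ 1 - a $ 1 * b $ 3, a $ 1 * b $ 2 - a $ 2 * b $ 1]"

definition cvec :: "real ^ 3 \<Rightarrow> complex ^ 3" where
  "cvec e = (\<chi> i. of_real (e $ i))"

lemma cvec_nth [simp]: "cvec e $ i = of_real (e $ i)"
  by (simp add: cvec_def)

lemmas cvec3_simps = cdot_def ccross_def vec_eq_iff forall_3

lemma smooth_on_cdot [smooth_intros]:
  "open S \<Longrightarrow> smooth_on S f \<Longrightarrow> smooth_on S g \<Longrightarrow> smooth_on S (\<lambda>x. cdot (f x) (g x))"
  unfolding cdot_def by (intro smooth_intros)

lemma smooth_on_ccross [smooth_intros]:
  "open S \<Longrightarrow> smooth_on S f \<Longrightarrow> smooth_on S g \<Longrightarrow> smooth_on S (\<lambda>x. ccross (f x) (g x))"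
  unfolding ccross_def by (rule smooth_on_vec3I) (simp_all, (intro smooth_intros, assumption+)+)

lemma smooth_on_smult [smooth_intros]:
  fixes f :: "_ \<Rightarrow> complex"
  shows "open S \<Longrightarrow> smooth_on S f \<Longrightarrow> smooth_on S g \<Longrightarrow> smooth_on S (\<lambda>x. f x *s (g x :: complex ^ 'n))"
  unfolding vector_scalar_mult_def by (intro smooth_intros)

lemma cdot_linear:
  "cdot (a + b) c = cdot a c + cdot b c" "cdot (k *s a) c = k * cdot a c"
  "cdot c (a + b) = cdot c a + cdot c b" "cdot c (k *s a) = k * cdot c a"
  "cdot 0 c = 0" "cdot c 0 = 0"
  by (simp_all add: cdot_def algebra_simps)

lemma cdot_axis: "cdot a (axis 1 1) = a $ 1" "cdot a (axis 2 1) = a $ 2" "cdot a (axis 3 1) = a $ 3"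
  by (simp_all add: cdot_def axis_def)

lemma cdot_cvec_nonzero:
  assumes "a \<noteq> 0"
  obtains e where "cdot a (cvec e) \<noteq> 0"
proof -
  obtain i where i: "a $ i \<noteq> 0" using assms by (auto simp: vec_eq_iff)
  have "cvec (axis i 1) = axis i 1" for i :: 3 by (simp add: vec_eq_iff axis_def)
  then have "cdot a (cvec (axis i 1)) = a $ i" using exhaust_3[of i] cdot_axis by metis
  then show thesis using that i by metis
qed

lemma ccross_parallel:
  assumes "ccross a n = 0" "n \<noteq> 0"
  obtains k where "a = k *s n"
proof -
  obtain i where i: "n $ i \<noteq> 0" using assms by (auto simp: vec_eq_iff)
  have "a = (a $ i / n $ i) *s n"
    using assms(1) i exhaust_3[of i] by (auto simp: cvec3_simps field_simps)
  then show thesis using that by blast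
qed

lemma ccross_ccross: "ccross a (ccross b c) = cdot a c *s b - cdot a b *s c"
  by (simp add: cvec3_simps algebra_simps)

text \<open>Cramer's rule: the denominator is the determinant of the coframe, and the cross products
  of two of its members form the dual basis up to this factor.\<close>

lemma coframe_expansion:
  assumes "cdot \<theta> (ccross \<theta>1 \<theta>2) \<noteq> 0"
  shows "a = (cdot a (ccross \<theta>1 \<theta>2) / cdot \<theta> (ccross \<theta>1 \<theta>2)) *s \<theta>
    + (cdot a (ccross \<theta>2 \<theta>) / cdot \<theta> (ccross \<theta>1 \<theta>2)) *s \<theta>1
    + (cdot a (ccross \<theta> \<theta>1) / cdot \<theta> (ccross \<theta>1 \<theta>2)) *s \<theta>2"
proof -
  have "cdot \<theta> (ccross \<theta>1 \<theta>2) *s a =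
    cdot a (ccross \<theta>1 \<theta>2) *s \<theta> + cdot a (ccross \<theta>2 \<theta>) *s \<theta>1 + cdot a (ccross \<theta> \<theta>1) *s \<theta>2"
    by (simp add: cvec3_simps algebra_simps)
  then have "cdot \<theta> (ccross \<theta>1 \<theta>2) * a $ i =
    cdot a (ccross \<theta>1 \<theta>2) * \<theta> $ i + cdot a (ccross \<theta>2 \<theta>) * \<theta>1 $ i + cdot a (ccross \<theta> \<theta>1) * \<theta>2 $ i" for i
    by (simp add: vec_eq_iff)
  then show ?thesis using assms by (simp add: vec_eq_iff field_simps)
qed

text \<open>\<open>\<iota>(z2) d\<theta>\<close> and \<open>\<iota>(z1) d\<theta>\<close>, suitably scaled, satisfy \<open>d\<theta> = \<theta>1 \<and> \<theta>2\<close>, because both sides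
  have the same contractions with \<open>z1\<close> and \<open>z2\<close>. Here \<open>D\<close> is the curl of \<open>\<theta>\<close>.\<close>

lemma ccross_contractions:
  assumes f: "f = cdot D (ccross z1 z2)" "f \<noteq> 0"
  defines "\<theta>1 \<equiv> ccross z2 D" and "\<theta>2 \<equiv> (1 / f) *s ccross D z1"
  shows "ccross \<theta>1 \<theta>2 = D" "cdot \<theta>1 z1 = f" "cdot \<theta>1 z2 = 0" "cdot \<theta>2 z1 = 0" "cdot \<theta>2 z2 = 1"
proof -
  \<comment> \<open>The formula (a x b) x (b x c) = (a . (b x c)) b. It makes the wedge of the two
    contractions of d\<theta> a multiple of d\<theta> itself.\<close>
  have "ccross (ccross z2 D) (ccross D z1) = cdot D (ccross z1 z2) *s D" by (simp add: cvec3_simps algebra_simps)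
  moreover have "f *s \<theta>2 = ccross D z1" using f(2) by (simp add: \<theta>2_def vec_eq_iff)
  ultimately have "ccross \<theta>1 (f *s \<theta>2) = f *s D" unfolding \<theta>1_def f(1) by simp
  moreover have "ccross \<theta>1 (f *s \<theta>2) = f *s ccross \<theta>1 \<theta>2" by (simp add: cvec3_simps algebra_simps)
  ultimately show "ccross \<theta>1 \<theta>2 = D" using f(2) by (simp add: vec_eq_iff)
  show "cdot \<theta>1 z1 = f" "cdot \<theta>1 z2 = 0" unfolding \<theta>1_def f(1) by (simp_all add: cvec3_simps algebra_simps)
  have "f * cdot \<theta>2 z1 = 0" "f * cdot \<theta>2 z2 = f"
    using f unfolding \<theta>2_def cdot_linear by (simp_all add: cvec3_simps algebra_simps)
  then show "cdot \<theta>2 z1 = 0" "cdot \<theta>2 z2 = 1" using f(2) by simp_all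
qed

subsection \<open>Complex coordinates of covectors and complex tangent vectors\<close>

text \<open>A complex covector extends complex linearly to the complexified tangent space. This
  vector represents the extension, so that the kernels of \<open>ct_kernel\<close> become kernels of
  \<open>cdot\<close>.\<close>

definition cov_vec :: "('a, real ^ 3) atlas \<Rightarrow> ('a, real ^ 3) chart \<Rightarrow> 'a \<Rightarrow> ('a, real ^ 3) covector \<Rightarrow> complex ^ 3" where
  "cov_vec A c y \<alpha> = (\<chi> i. \<alpha> (coord_tangent A c y (axis i 1)))"

definition ct_vec :: "('a, real ^ 3) chart \<Rightarrow> ('a, real ^ 3) ctangent \<Rightarrow> complex ^ 3" where
  "ct_vec c z = (\<chi> i. Complex (fst z c $ i) (snd z c $ i))"

lemma linear_real3:
  fixes l :: "real ^ 3 \<Rightarrow> complex"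
  assumes "linear l"
  shows "l e = cdot (\<chi> i. l (axis i 1)) (cvec e)"
proof -
  have "r *\<^sub>R axis i 1 = axis i r" for i :: 3 and r :: real by (simp add: vec_eq_iff axis_def)
  then have "l (axis i (e $ i)) = of_real (e $ i) * l (axis i 1)" for i
    using linear_scale[OF assms, of "e $ i" "axis i 1"] by (simp only: scaleR_conv_of_real)
  moreover have "l e = (\<Sum>i\<in>UNIV. l (axis i (e $ i)))"
  proof -
    have "l e = l (\<Sum>i\<in>UNIV. axis i (e $ i))" by (rule arg_cong[OF vec_sum_axis])
    also have "\<dots> = (\<Sum>i\<in>UNIV. l (axis i (e $ i)))" by (rule linear_sum[OF assms])
    finally show ?thesis .
  qed
  ultimately show ?thesis by (simp only: sum_3 cdot_def vec_lambda_beta cvec_nth mult.commute)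
qed

lemma cov_vec_apply:
  assumes "smooth_atlas M A" "c \<in> charts_at A y" "\<alpha> \<in> covectors A y"
  shows "\<alpha> (coord_tangent A c y e) = cdot (cov_vec A c y \<alpha>) (cvec e)"
  using linear_real3[OF covector_linear[OF assms]] unfolding cov_vec_def .

lemma ct_eval_vec:
  assumes A: "smooth_atlas M A" and c: "c \<in> charts_at A y" and \<alpha>: "\<alpha> \<in> covectors A y"
    and z: "z \<in> ctangent_space A y"
  shows "ct_eval \<alpha> z = cdot (cov_vec A c y \<alpha>) (ct_vec c z)"
proof -
  have "fst z \<in> tangent_space A y" "snd z \<in> tangent_space A y" using z by (auto simp: ctangent_space_def)
  then have "\<alpha> (fst z) = cdot (cov_vec A c y \<alpha>) (cvec (fst z c))" "\<alpha> (snd z) = cdot (cov_vec A c y \<alpha>) (cvec (snd z c))"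
    using cov_vec_apply[OF A c \<alpha>] coord_tangent_eq[OF _ c] by metis+
  moreover have "ct_vec c z = cvec (fst z c) + \<i> *s cvec (snd z c)"
    by (simp add: vec_eq_iff ct_vec_def complex_eq_iff)
  ultimately show ?thesis by (simp add: ct_eval_def cdot_linear)
qed

lemma ct_vec_inj:
  assumes c: "c \<in> charts_at A y" and z: "z \<in> ctangent_space A y" "w \<in> ctangent_space A y" and eq: "ct_vec c z = ct_vec c w"
  shows "z = w"
proof -
  have "fst z c = fst w c" "snd z c = snd w c" using eq by (auto simp: ct_vec_def vec_eq_iff)
  moreover have "fst z \<in> tangent_space A y" "fst w \<in> tangent_space A y" "snd z \<in> tangent_space A y" "snd w \<in> tangent_space A y"
    using z by (auto simp: ctangent_space_def)
  ultimately have "fst z = fst w" "snd z = snd w" using coord_tangent_eq[OF _ c] by metis+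
  then show ?thesis by (simp add: prod_eq_iff)
qed

lemma ct_vec_surj:
  assumes "smooth_atlas M A" "c \<in> charts_at A y"
  obtains z where "z \<in> ctangent_space A y" "ct_vec c z = w"
proof
  show "(coord_tangent A c y (\<chi> i. Re (w $ i)), coord_tangent A c y (\<chi> i. Im (w $ i))) \<in> ctangent_space A y"
    using coord_tangent_in[OF assms] by (simp add: ctangent_space_def)
  show "ct_vec c (coord_tangent A c y (\<chi> i. Re (w $ i)), coord_tangent A c y (\<chi> i. Im (w $ i))) = w"
    by (simp add: ct_vec_def coord_tangent_self[OF assms] vec_eq_iff)
qed

lemma ct_vec_ops:
  "ct_vec c ct_zero = 0" "ct_vec c (ct_add z w) = ct_vec c z + ct_vec c w" "ct_vec c (ct_scale k z) = k *s ct_vec c z"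
  by (simp_all add: ct_vec_def ct_zero_def ct_add_def ct_scale_def vec_eq_iff complex_eq_iff)

lemma ct_zero_in:
  assumes A: "smooth_atlas M A" and c: "c \<in> charts_at A y"
  shows "ct_zero \<in> ctangent_space A y"
proof -
  have "coord_tangent A c y (0 *\<^sub>R 0) = (\<lambda>d. 0 *\<^sub>R coord_tangent A c y 0 d)" by (rule coord_tangent_linear(2)[OF A c])
  then have "(\<lambda>d. 0) = coord_tangent A c y 0" by (simp add: fun_eq_iff)
  then have "(\<lambda>d. 0) \<in> tangent_space A y" using coord_tangent_in[OF A c, of 0] by simp
  then show ?thesis by (simp add: ct_zero_def ctangent_space_def)
qed

lemma ct_vec_eq_0_iff:
  assumes "smooth_atlas M A" "c \<in> charts_at A y" "z \<in> ctangent_space A y"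
  shows "ct_vec c z = 0 \<longleftrightarrow> z = ct_zero"
  using ct_vec_inj[OF assms(2,3) ct_zero_in[OF assms(1,2)]] ct_vec_ops(1) by metis

text \<open>The interface between geometry and computation. The frame consists of functions of the
  coordinates, so that it can be differentiated; \<open>dtheta\<close> is d\<theta> = \<theta>1
  \<and> \<theta>2 on constant vector fields. The last three assumptions translate the conditions
  that define \<open>E_space\<close> and \<open>Y_space\<close> into coefficients with respect to
  the frame.\<close>

locale adapted_frame =
  fixes M :: "'a set" and A :: "('a, real ^ 3) atlas"
    and T1 T2 :: "'a \<Rightarrow> ('a, real ^ 3) ctangent set"
    and c :: "('a, real ^ 3) chart" and W :: "'a set" and \<theta> \<theta>1 \<theta>2 :: "real ^ 3 \<Rightarrow> complex ^ 3"
  assumes atlas: "smooth_atlas M A" and c: "c \<in> A" and W: "openin (atlas_topology A) W" "W \<subseteq> fst c"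
    and smooth: "smooth_on (snd c ` W) \<theta>" "smooth_on (snd c ` W) \<theta>1" "smooth_on (snd c ` W) \<theta>2"
    and coframe: "\<And>x. x \<in> snd c ` W \<Longrightarrow> cdot (\<theta> x) (ccross (\<theta>1 x) (\<theta>2 x)) \<noteq> 0"
    and dtheta: "\<And>x e f. x \<in> snd c ` W \<Longrightarrow>
      frechet_derivative (\<lambda>x. cdot (\<theta> x) (cvec f)) (at x) e - frechet_derivative (\<lambda>x. cdot (\<theta> x) (cvec e)) (at x) f =
      cdot (ccross (\<theta>1 x) (\<theta>2 x)) (ccross (cvec e) (cvec f))"
    and kernel_iff: "\<And>y \<alpha>. y \<in> W \<Longrightarrow> \<alpha> \<in> covectors A y \<Longrightarrow>
      ct_kernel A y \<alpha> = ct_sum (T1 y) (T2 y) \<longleftrightarrow> (\<exists>k. k \<noteq> 0 \<and> cov_vec A c y \<alpha> = k *s \<theta> (snd c y))"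
    and T1_iff: "\<And>y \<alpha>. y \<in> W \<Longrightarrow> \<alpha> \<in> covectors A y \<Longrightarrow>
      (\<forall>z\<in>T1 y - {ct_zero}. ct_eval \<alpha> z \<noteq> 0) \<and> (\<forall>z\<in>T2 y. ct_eval \<alpha> z = 0) \<longleftrightarrow>
      (\<exists>k v. k \<noteq> 0 \<and> cov_vec A c y \<alpha> = k *s \<theta>1 (snd c y) + v *s \<theta> (snd c y))"
    and T2_iff: "\<And>y \<alpha>. y \<in> W \<Longrightarrow> \<alpha> \<in> covectors A y \<Longrightarrow>
      (\<forall>z\<in>T1 y. ct_eval \<alpha> z = 0) \<and> (\<forall>z\<in>T2 y - {ct_zero}. ct_eval \<alpha> z \<noteq> 0) \<longleftrightarrow>
      (\<exists>k v. k \<noteq> 0 \<and> cov_vec A c y \<alpha> = k *s \<theta>2 (snd c y) + v *s \<theta> (snd c y))"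

text \<open>The vector that represents d\<theta> under the identification of 2-forms on 3-space with
  vectors by the cross product.\<close>

definition curl :: "(real ^ 3 \<Rightarrow> complex ^ 3) \<Rightarrow> real ^ 3 \<Rightarrow> complex ^ 3" where
  "curl \<theta> x = (let D = (\<lambda>i j. frechet_derivative (\<lambda>x. \<theta> x $ j) (at x) (axis i 1))
     in vector [D 2 3 - D 3 2, D 3 1 - D 1 3, D 1 2 - D 2 1])"

lemma smooth_on_curl: "open S \<Longrightarrow> smooth_on S \<theta> \<Longrightarrow> smooth_on S (curl \<theta>)"
  unfolding curl_def Let_def
  by (rule smooth_on_vec3I)
     (simp_all only: vector_3, (intro smooth_on_diff smooth_on_frechet_derivative smooth_on_vec_nth, assumption+)+)

lemma curl_apply:
  assumes "smooth_on S \<theta>" "open S" "x \<in> S"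
  shows "frechet_derivative (\<lambda>x. cdot (\<theta> x) (cvec f)) (at x) e - frechet_derivative (\<lambda>x. cdot (\<theta> x) (cvec e)) (at x) f =
      cdot (curl \<theta> x) (ccross (cvec e) (cvec f))"
proof -
  let ?D = "\<lambda>j. frechet_derivative (\<lambda>x. \<theta> x $ j) (at x)"
  have d: "((\<lambda>x. \<theta> x $ j) has_derivative ?D j) (at x)" for j
    using smooth_on_has_derivative[OF smooth_on_vec_nth[OF assms(2,1)] assms(3)] .
  have 1: "frechet_derivative (\<lambda>x. cdot (\<theta> x) (cvec f)) (at x) e =
      ?D 1 e * of_real (f $ 1) + ?D 2 e * of_real (f $ 2) + ?D 3 e * of_real (f $ 3)" for e f
  proof -
    have "((\<lambda>x. cdot (\<theta> x) (cvec f)) has_derivative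
        (\<lambda>e. ?D 1 e * of_real (f $ 1) + ?D 2 e * of_real (f $ 2) + ?D 3 e * of_real (f $ 3))) (at x)"
      unfolding cdot_def cvec_nth by (intro has_derivative_add has_derivative_mult_left d)
    from fun_cong[OF frechet_derivative_at[OF this], of e, symmetric] show ?thesis .
  qed
  have lin: "?D j e = cdot (\<chi> i. ?D j (axis i 1)) (cvec e)" for j e
    by (rule linear_real3[OF bounded_linear.linear[OF has_derivative_bounded_linear[OF d]]])
  have 2: "?D j e = ?D j (axis 1 1) * of_real (e $ 1) + ?D j (axis 2 1) * of_real (e $ 2) + ?D j (axis 3 1) * of_real (e $ 3)"
    for j e using lin[of j e] by (simp only: cdot_def vec_lambda_beta cvec_nth)
  show ?thesis
    unfolding 1 2[of _ e] 2[of _ f] curl_def Let_def by (simp add: cdot_def ccross_def algebra_simps)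
qed

text \<open>Covectors that kill z1 and z2 are multiples of z1 x z2, so \<theta> is one, and the
  contact condition D . \<theta> \<noteq> 0 gives f = d\<theta>(z1, z2) \<noteq> 0. Then (\<theta>,
  \<theta>1, \<theta>2) is a basis in which evaluation on z1 and z2 reads off the coefficients of
  \<theta>1, up to the factor f, and of \<theta>2; this gives the last two equivalences.\<close>

lemma frame_conditions:
  fixes \<theta> D z1 z2 :: "complex ^ 3"
  assumes ker: "\<And>w. cdot \<theta> w = 0 \<longleftrightarrow> (\<exists>k l. w = k *s z1 + l *s z2)"
    and indep: "\<And>k l. k *s z1 = l *s z2 \<Longrightarrow> k *s z1 = 0" and z: "z1 \<noteq> 0" "z2 \<noteq> 0"
    and contact: "cdot D \<theta> \<noteq> 0"
  defines "f \<equiv> cdot D (ccross z1 z2)"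
  defines "\<theta>1 \<equiv> ccross z2 D" and "\<theta>2 \<equiv> (1 / f) *s ccross D z1"
  shows "f \<noteq> 0" "cdot \<theta> (ccross \<theta>1 \<theta>2) \<noteq> 0" "ccross \<theta>1 \<theta>2 = D"
    "(\<forall>w. cdot a w = 0 \<longleftrightarrow> (\<exists>k l. w = k *s z1 + l *s z2)) \<longleftrightarrow> (\<exists>k. k \<noteq> 0 \<and> a = k *s \<theta>)"
    "cdot a z1 \<noteq> 0 \<and> cdot a z2 = 0 \<longleftrightarrow> (\<exists>k v. k \<noteq> 0 \<and> a = k *s \<theta>1 + v *s \<theta>)"
    "cdot a z1 = 0 \<and> cdot a z2 \<noteq> 0 \<longleftrightarrow> (\<exists>k v. k \<noteq> 0 \<and> a = k *s \<theta>2 + v *s \<theta>)"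
proof -
  have "z1 = 1 *s z1 + 0 *s z2" "z2 = 0 *s z1 + 1 *s z2" by simp_all
  then have \<theta>z: "cdot \<theta> z1 = 0" "cdot \<theta> z2 = 0" unfolding ker by blast+
  have \<theta>0: "\<theta> \<noteq> 0" using contact by (auto simp: cdot_linear)
  have n0: "ccross z1 z2 \<noteq> 0"
  proof
    assume "ccross z1 z2 = 0"
    then obtain k where "z1 = k *s z2" using ccross_parallel z(2) by blast
    then show False using indep[of 1 k] z(1) by simp
  qed
  have par: "\<exists>k. a = k *s ccross z1 z2" if "cdot a z1 = 0" "cdot a z2 = 0" for a
  proof -
    have "ccross a (ccross z1 z2) = 0" unfolding ccross_ccross using that by (simp add: vec_eq_iff)
    then show ?thesis using ccross_parallel n0 by blast
  qed
  obtain r where r: "\<theta> = r *s ccross z1 z2" using par \<theta>z by blast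
  then have "r \<noteq> 0" using \<theta>0 by (auto simp: vec_eq_iff)
  have "cdot D \<theta> = r * f" unfolding f_def r cdot_linear ..
  then show f0: "f \<noteq> 0" using contact by auto
  note con = ccross_contractions[OF f_def[THEN meta_eq_to_obj_eq] f0, folded \<theta>1_def \<theta>2_def]
  show D: "ccross \<theta>1 \<theta>2 = D" by (rule con(1))
  show cf: "cdot \<theta> (ccross \<theta>1 \<theta>2) \<noteq> 0" using contact unfolding D by (simp add: cdot_def mult.commute)
  show "(\<forall>w. cdot a w = 0 \<longleftrightarrow> (\<exists>k l. w = k *s z1 + l *s z2)) \<longleftrightarrow> (\<exists>k. k \<noteq> 0 \<and> a = k *s \<theta>)"
  proof
    assume "\<forall>w. cdot a w = 0 \<longleftrightarrow> (\<exists>k l. w = k *s z1 + l *s z2)"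
    then have eq: "cdot a w = 0 \<longleftrightarrow> cdot \<theta> w = 0" for w unfolding ker by blast
    then obtain k where k: "a = k *s ccross z1 z2" using par \<theta>z by blast
    then have a: "a = (k / r) *s \<theta>" using r \<open>r \<noteq> 0\<close> by (simp add: vec_eq_iff)
    \<comment> \<open>By the contact condition D, read as a vector, lies outside the kernel of
      \<theta> and hence outside that of a.\<close>
    have "a \<noteq> 0" using eq[of D] contact by (auto simp: cdot_linear) (simp add: cdot_def mult.commute)
    then have "k / r \<noteq> 0" using a by auto
    then show "\<exists>k. k \<noteq> 0 \<and> a = k *s \<theta>" using a by blast
  next
    assume "\<exists>k. k \<noteq> 0 \<and> a = k *s \<theta>"
    then show "\<forall>w. cdot a w = 0 \<longleftrightarrow> (\<exists>k l. w = k *s z1 + l *s z2)" unfolding ker[symmetric] by (auto simp: cdot_linear)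
  qed
  obtain b0 b1 b2 where b: "a = b0 *s \<theta> + b1 *s \<theta>1 + b2 *s \<theta>2" using coframe_expansion[OF cf, of a] by blast
  have az: "cdot a z1 = b1 * f" "cdot a z2 = b2" unfolding b cdot_linear \<theta>z con by simp_all
  show "cdot a z1 \<noteq> 0 \<and> cdot a z2 = 0 \<longleftrightarrow> (\<exists>k v. k \<noteq> 0 \<and> a = k *s \<theta>1 + v *s \<theta>)"
  proof
    assume "cdot a z1 \<noteq> 0 \<and> cdot a z2 = 0"
    then have "b1 \<noteq> 0" "b2 = 0" using az f0 by auto
    then show "\<exists>k v. k \<noteq> 0 \<and> a = k *s \<theta>1 + v *s \<theta>" using b by (intro exI[of _ b1] exI[of _ b0]) (simp add: add.commute)
  qed (use \<theta>z con f0 in \<open>auto simp: cdot_linear\<close>)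
  show "cdot a z1 = 0 \<and> cdot a z2 \<noteq> 0 \<longleftrightarrow> (\<exists>k v. k \<noteq> 0 \<and> a = k *s \<theta>2 + v *s \<theta>)"
  proof
    assume "cdot a z1 = 0 \<and> cdot a z2 \<noteq> 0"
    then have "b2 \<noteq> 0" "b1 = 0" using az f0 by auto
    then show "\<exists>k v. k \<noteq> 0 \<and> a = k *s \<theta>2 + v *s \<theta>" using b by (intro exI[of _ b2] exI[of _ b0]) (simp add: add.commute)
  qed (use \<theta>z con f0 in \<open>auto simp: cdot_linear\<close>)
qed

text \<open>The frame is built from the curl of a contact form and from generators of T1 and T2, all
  smooth over a common neighbourhood W. The rest is translation into coordinates, where
  \<open>frame_conditions\<close> applies point by point.\<close>

lemma ex_adapted_frame:
  assumes M: "smooth_manifold M A" and flag: "flag_structure M A T1 T2" and x: "x \<in> M"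
  obtains c W \<theta> \<theta>1 \<theta>2 where "x \<in> W" "adapted_frame M A T1 T2 c W \<theta> \<theta>1 \<theta>2"
proof -
  have A: "smooth_atlas M A" using M by (simp add: smooth_manifold_iff)
  have fl: "complex_line_subbundle M A T1" "complex_line_subbundle M A T2" "\<forall>x\<in>M. T1 x \<inter> T2 x = {ct_zero}"
    "\<forall>x\<in>M. \<exists>U \<theta>. openin (atlas_topology A) U \<and> x \<in> U \<and> smooth_form A U \<theta> \<and>
        (\<forall>y\<in>U. ct_kernel A y (\<theta> y) = ct_sum (T1 y) (T2 y) \<and>
           (\<exists>u\<in>tangent_space A y. \<exists>v\<in>tangent_space A y. \<exists>w\<in>tangent_space A y.
              wedge21 (ext_deriv A \<theta> y) (\<theta> y) u v w \<noteq> 0))"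
    using flag unfolding flag_structure_def by blast+
  obtain U1 Z1 where U1: "openin (atlas_topology A) U1" "x \<in> U1" "smooth_ctangent_field A U1 Z1"
    "\<forall>q\<in>U1. Z1 q \<noteq> ct_zero \<and> T1 q = range (\<lambda>k. ct_scale k (Z1 q))"
    using bspec[OF fl(1)[unfolded complex_line_subbundle_def] x] by (elim exE conjE)
  obtain U2 Z2 where U2: "openin (atlas_topology A) U2" "x \<in> U2" "smooth_ctangent_field A U2 Z2"
    "\<forall>q\<in>U2. Z2 q \<noteq> ct_zero \<and> T2 q = range (\<lambda>k. ct_scale k (Z2 q))"
    using bspec[OF fl(2)[unfolded complex_line_subbundle_def] x] by (elim exE conjE)
  obtain U t where U: "openin (atlas_topology A) U" "x \<in> U" "smooth_form A U t"
    "\<forall>y\<in>U. ct_kernel A y (t y) = ct_sum (T1 y) (T2 y) \<and>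
           (\<exists>u\<in>tangent_space A y. \<exists>v\<in>tangent_space A y. \<exists>w\<in>tangent_space A y.
              wedge21 (ext_deriv A t y) (t y) u v w \<noteq> 0)"
    using bspec[OF fl(4) x] by (elim exE conjE)
  obtain c where "c \<in> charts_at A x" using smooth_atlasD(3)[OF A x] by blast
  then have c: "c \<in> A" "x \<in> fst c" by (simp_all add: charts_at_def)
  have wc: "wf_chart c" by (rule smooth_atlasD(1)[OF A c(1)])
  define W where "W = fst c \<inter> U \<inter> U1 \<inter> U2"
  have W: "openin (atlas_topology A) W" "W \<subseteq> fst c" "x \<in> W" "W \<subseteq> U" "W \<subseteq> U1" "W \<subseteq> U2"
    unfolding W_def using openin_chart[OF c(1)] U U1 U2 c by (auto intro: openin_Int)
  define S where "S = snd c ` W"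
  have "fst c \<inter> W = W" using W(2) by blast
  then have S: "open S" using openin_atlasD[OF A W(1) c(1)] unfolding S_def by simp
  define \<theta> where "\<theta> x = (\<chi> i. coord_form A t c x (axis i 1))" for x
  define z1 where "z1 x = ct_vec c (Z1 (chart_inv c x))" for x
  define z2 where "z2 x = ct_vec c (Z2 (chart_inv c x))" for x
  define D where "D = curl \<theta>"
  define f where "f x = cdot (D x) (ccross (z1 x) (z2 x))" for x
  define \<theta>1 where "\<theta>1 x = ccross (z2 x) (D x)" for x
  define \<theta>2 where "\<theta>2 x = (1 / f x) *s ccross (D x) (z1 x)" for x
  have sub: "S \<subseteq> snd c ` (fst c \<inter> U)" "S \<subseteq> snd c ` (fst c \<inter> U1)" "S \<subseteq> snd c ` (fst c \<inter> U2)"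
    using W unfolding S_def by auto
  have sm\<theta>: "smooth_on S \<theta>" unfolding \<theta>_def
    using U(3) c(1) smooth_on_subset[OF _ sub(1)] unfolding smooth_form_def by (intro smooth_on_vec_lambda S) blast
  have Complex_eq': "Complex a b = of_real a + \<i> * of_real b" for a b by (simp add: complex_eq_iff)
  have smz: "smooth_on S z1" "smooth_on S z2"
  proof -
    have "smooth_on S (\<lambda>x. fst (Z1 (chart_inv c x)) c)" "smooth_on S (\<lambda>x. snd (Z1 (chart_inv c x)) c)"
      using U1(3) c(1) smooth_on_subset[OF _ sub(2)] unfolding smooth_ctangent_field_def by blast+
    then show "smooth_on S z1" unfolding z1_def ct_vec_def Complex_eq'
      by (intro smooth_on_vec_lambda S smooth_on_add smooth_on_mult smooth_on_const smooth_on_of_real smooth_on_vec_nth)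
    have "smooth_on S (\<lambda>x. fst (Z2 (chart_inv c x)) c)" "smooth_on S (\<lambda>x. snd (Z2 (chart_inv c x)) c)"
      using U2(3) c(1) smooth_on_subset[OF _ sub(3)] unfolding smooth_ctangent_field_def by blast+
    then show "smooth_on S z2" unfolding z2_def ct_vec_def Complex_eq'
      by (intro smooth_on_vec_lambda S smooth_on_add smooth_on_mult smooth_on_const smooth_on_of_real smooth_on_vec_nth)
  qed
  have smD: "smooth_on S D" unfolding D_def by (rule smooth_on_curl[OF S sm\<theta>])
  have at: "c \<in> charts_at A y" if "y \<in> W" for y using that W c by (auto simp: charts_at_def)
  have inv: "chart_inv c (snd c y) = y" if "y \<in> W" for y using chart_inv_eq[OF wc] that W by blast
  have tcov: "t y \<in> covectors A y" if "y \<in> W" for y using that W U(3) unfolding smooth_form_def by blast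
  have \<theta>y: "\<theta> (snd c y) = cov_vec A c y (t y)" if "y \<in> W" for y
    unfolding \<theta>_def cov_vec_def coord_form_def inv[OF that] ..
  have Zin: "Z1 y \<in> ctangent_space A y" "Z2 y \<in> ctangent_space A y" if "y \<in> W" for y
    using that W U1(3) U2(3) unfolding smooth_ctangent_field_def by blast+
  have zy: "z1 (snd c y) = ct_vec c (Z1 y)" "z2 (snd c y) = ct_vec c (Z2 y)" if "y \<in> W" for y
    unfolding z1_def z2_def inv[OF that] by simp_all
  have T1y: "T1 y = range (\<lambda>k. ct_scale k (Z1 y))" and T2y: "T2 y = range (\<lambda>k. ct_scale k (Z2 y))"
    and Znz: "Z1 y \<noteq> ct_zero" "Z2 y \<noteq> ct_zero" if "y \<in> W" for y
    using that W U1(4) U2(4) by auto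
  have scale_in: "ct_scale k z \<in> ctangent_space A y" "ct_add z w \<in> ctangent_space A y"
    if "y \<in> W" "z \<in> ctangent_space A y" "w \<in> ctangent_space A y" for k z w y
  proof -
    note t = tangent_space_add[OF A at[OF that(1)]]
    have m: "fst z \<in> tangent_space A y" "snd z \<in> tangent_space A y" "fst w \<in> tangent_space A y" "snd w \<in> tangent_space A y"
      using that by (auto simp: ctangent_space_def)
    show "ct_add z w \<in> ctangent_space A y" unfolding ct_add_def ctangent_space_def using t(1) m by simp
    have "(\<lambda>c. Re k *\<^sub>R fst z c + (- Im k) *\<^sub>R snd z c) \<in> tangent_space A y"
      "(\<lambda>c. Im k *\<^sub>R fst z c + Re k *\<^sub>R snd z c) \<in> tangent_space A y"
      by (rule t(1)[OF t(2)[OF m(1) m(1)] t(2)[OF m(2) m(2)]])+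
    then show "ct_scale k z \<in> ctangent_space A y" unfolding ct_scale_def ctangent_space_def by simp
  qed
  have sum_iff: "z \<in> ct_sum (T1 y) (T2 y) \<longleftrightarrow> (\<exists>k l. ct_vec c z = k *s z1 (snd c y) + l *s z2 (snd c y))"
    if y: "y \<in> W" and z: "z \<in> ctangent_space A y" for y z
  proof -
    have "z \<in> ct_sum (T1 y) (T2 y) \<longleftrightarrow> (\<exists>k l. z = ct_add (ct_scale k (Z1 y)) (ct_scale l (Z2 y)))"
      unfolding ct_sum_def T1y[OF y] T2y[OF y] by blast
    also have "\<dots> \<longleftrightarrow> (\<exists>k l. ct_vec c z = ct_vec c (ct_add (ct_scale k (Z1 y)) (ct_scale l (Z2 y))))"
      using ct_vec_inj[OF at[OF y] z scale_in(2)[OF y scale_in(1)[OF y Zin(1)[OF y] Zin(1)[OF y]]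
        scale_in(1)[OF y Zin(2)[OF y] Zin(2)[OF y]]]] by blast
    finally show ?thesis unfolding ct_vec_ops zy[OF y] .
  qed
  have sum_sub: "ct_sum (T1 y) (T2 y) \<subseteq> ctangent_space A y" if y: "y \<in> W" for y
  proof
    fix z assume "z \<in> ct_sum (T1 y) (T2 y)"
    then obtain k l where z: "z = ct_add (ct_scale k (Z1 y)) (ct_scale l (Z2 y))"
      unfolding ct_sum_def T1y[OF y] T2y[OF y] by blast
    show "z \<in> ctangent_space A y" unfolding z
      by (rule scale_in(2)[OF y scale_in(1)[OF y Zin(1)[OF y] Zin(1)[OF y]] scale_in(1)[OF y Zin(2)[OF y] Zin(2)[OF y]]])
  qed
  have ker_iff: "ct_kernel A y \<alpha> = ct_sum (T1 y) (T2 y) \<longleftrightarrow>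
      (\<forall>w. cdot (cov_vec A c y \<alpha>) w = 0 \<longleftrightarrow> (\<exists>k l. w = k *s z1 (snd c y) + l *s z2 (snd c y)))"
    if y: "y \<in> W" and \<alpha>: "\<alpha> \<in> covectors A y" for y \<alpha>
  proof -
    have 1: "z \<in> ct_kernel A y \<alpha> \<longleftrightarrow> cdot (cov_vec A c y \<alpha>) (ct_vec c z) = 0" if "z \<in> ctangent_space A y" for z
      using that ct_eval_vec[OF A at[OF y] \<alpha> that] by (simp add: ct_kernel_def)
    have "ct_kernel A y \<alpha> \<subseteq> ctangent_space A y" by (auto simp: ct_kernel_def)
    then have "ct_kernel A y \<alpha> = ct_sum (T1 y) (T2 y) \<longleftrightarrow>
        (\<forall>z\<in>ctangent_space A y. z \<in> ct_kernel A y \<alpha> \<longleftrightarrow> z \<in> ct_sum (T1 y) (T2 y))" using sum_sub[OF y] by blast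
    also have "\<dots> \<longleftrightarrow> (\<forall>z\<in>ctangent_space A y. cdot (cov_vec A c y \<alpha>) (ct_vec c z) = 0 \<longleftrightarrow>
        (\<exists>k l. ct_vec c z = k *s z1 (snd c y) + l *s z2 (snd c y)))" using 1 sum_iff[OF y] by simp
    also have "\<dots> \<longleftrightarrow> (\<forall>w. cdot (cov_vec A c y \<alpha>) w = 0 \<longleftrightarrow> (\<exists>k l. w = k *s z1 (snd c y) + l *s z2 (snd c y)))"
      using ct_vec_surj[OF A at[OF y]] by metis
    finally show ?thesis .
  qed
  have contact: "cdot (D (snd c y)) (\<theta> (snd c y)) \<noteq> 0" if y: "y \<in> W" for y
  proof -
    have "y \<in> U" using y W by blast
    have ySS: "snd c y \<in> S" using y by (simp add: S_def)
    have cf: "coord_form A t c \<eta> e = cdot (\<theta> \<eta>) (cvec e)" if \<eta>: "\<eta> \<in> S" for \<eta> e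
    proof -
      obtain q where q: "q \<in> W" "\<eta> = snd c q" using \<eta> by (auto simp: S_def)
      then show ?thesis using cov_vec_apply[OF A at[OF q(1)] tcov[OF q(1)], of e] \<theta>y[OF q(1)] inv[OF q(1)]
        by (simp add: coord_form_def)
    qed
    have fd: "frechet_derivative (\<lambda>\<eta>. coord_form A t c \<eta> e) (at (snd c y)) =
        frechet_derivative (\<lambda>\<eta>. cdot (\<theta> \<eta>) (cvec e)) (at (snd c y))" for e
    proof -
      have "((\<lambda>\<eta>. cdot (\<theta> \<eta>) (cvec e)) has_derivative frechet_derivative (\<lambda>\<eta>. cdot (\<theta> \<eta>) (cvec e)) (at (snd c y))) (at (snd c y))"
        by (rule smooth_on_has_derivative[OF smooth_on_cdot[OF S sm\<theta> smooth_on_const] ySS])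
      then have "((\<lambda>\<eta>. coord_form A t c \<eta> e) has_derivative frechet_derivative (\<lambda>\<eta>. cdot (\<theta> \<eta>) (cvec e)) (at (snd c y))) (at (snd c y))"
        by (rule has_derivative_transform_within_open[OF _ S ySS]) (simp add: cf)
      from frechet_derivative_at[OF this] show ?thesis by (rule sym)
    qed
    have ext: "ext_deriv A t y u v = cdot (D (snd c y)) (ccross (cvec (u c)) (cvec (v c)))"
      if "u \<in> tangent_space A y" "v \<in> tangent_space A y" for u v
    proof -
      have "ext_deriv A t y u v = frechet_derivative (\<lambda>\<eta>. coord_form A t c \<eta> (v c)) (at (snd c y)) (u c) -
        frechet_derivative (\<lambda>\<eta>. coord_form A t c \<eta> (u c)) (at (snd c y)) (v c)"
        by (rule ext_deriv_chart[OF A at[OF y] U(1) \<open>y \<in> U\<close> _ _ that]) (use U(3) c(1) in \<open>auto simp: smooth_form_def\<close>)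
      then show ?thesis unfolding fd curl_apply[OF sm\<theta> S ySS] D_def .
    qed
    obtain u v w where uvw: "u \<in> tangent_space A y" "v \<in> tangent_space A y" "w \<in> tangent_space A y"
      "wedge21 (ext_deriv A t y) (t y) u v w \<noteq> 0" using U(4) \<open>y \<in> U\<close> by blast
    have tw: "t y u = cdot (\<theta> (snd c y)) (cvec (u c))" if "u \<in> tangent_space A y" for u
      using cov_vec_apply[OF A at[OF y] tcov[OF y], of "u c"] coord_tangent_eq[OF that at[OF y]] \<theta>y[OF y] by simp
    \<comment> \<open>Wedging the 2-form of D with t gives D . t times the determinant of the three
      arguments, so the nonvanishing of d\<theta> \<and> \<theta> yields D . \<theta> \<noteq>
      0.\<close>
    have "cdot D (ccross a b) * cdot t c + cdot D (ccross b c) * cdot t a + cdot D (ccross c a) * cdot t b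
        = cdot D t * cdot a (ccross b c)" for D t a b c
      by (simp add: cdot_def ccross_def algebra_simps)
    then show ?thesis using uvw(4) unfolding wedge21_def ext[OF uvw(1,2)] ext[OF uvw(2,3)] ext[OF uvw(3,1)]
        tw[OF uvw(1)] tw[OF uvw(2)] tw[OF uvw(3)] by auto
  qed
  have fr: "f (snd c y) \<noteq> 0"
    "cdot (\<theta> (snd c y)) (ccross (\<theta>1 (snd c y)) (\<theta>2 (snd c y))) \<noteq> 0"
    "ccross (\<theta>1 (snd c y)) (\<theta>2 (snd c y)) = D (snd c y)"
    "(\<forall>w. cdot a w = 0 \<longleftrightarrow> (\<exists>k l. w = k *s z1 (snd c y) + l *s z2 (snd c y))) \<longleftrightarrow> (\<exists>k. k \<noteq> 0 \<and> a = k *s \<theta> (snd c y))"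
    "cdot a (z1 (snd c y)) \<noteq> 0 \<and> cdot a (z2 (snd c y)) = 0 \<longleftrightarrow> (\<exists>k v. k \<noteq> 0 \<and> a = k *s \<theta>1 (snd c y) + v *s \<theta> (snd c y))"
    "cdot a (z1 (snd c y)) = 0 \<and> cdot a (z2 (snd c y)) \<noteq> 0 \<longleftrightarrow> (\<exists>k v. k \<noteq> 0 \<and> a = k *s \<theta>2 (snd c y) + v *s \<theta> (snd c y))"
    if y: "y \<in> W" for y a
  proof -
    have 1: "cdot (\<theta> (snd c y)) w = 0 \<longleftrightarrow> (\<exists>k l. w = k *s z1 (snd c y) + l *s z2 (snd c y))" for w
      using U(4) y W(4) ker_iff[OF y tcov[OF y]] \<theta>y[OF y] by (metis subsetD)
    have "y \<in> M" using openin_subset[OF W(1)] y topspace_atlas_topology[OF A] by blast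
    then have int: "T1 y \<inter> T2 y = {ct_zero}" using fl(3) by blast
    \<comment> \<open>A common multiple of the two generators represents an element of T1 \<inter>
      T2, which contains only zero.\<close>
    have 2: "k *s z1 (snd c y) = 0" if eq: "k *s z1 (snd c y) = l *s z2 (snd c y)" for k l
    proof -
      have "ct_vec c (ct_scale k (Z1 y)) = ct_vec c (ct_scale l (Z2 y))" using eq unfolding ct_vec_ops zy[OF y] .
      then have "ct_scale k (Z1 y) = ct_scale l (Z2 y)"
        using ct_vec_inj[OF at[OF y]] scale_in(1)[OF y] Zin[OF y] by metis
      then have "ct_scale k (Z1 y) \<in> T1 y \<inter> T2 y" unfolding T1y[OF y] T2y[OF y] by (metis IntI rangeI)
      then have "ct_scale k (Z1 y) = ct_zero" using int by blast
      then show ?thesis using ct_vec_ops(1,3) zy(1)[OF y] by metis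
    qed
    have 3: "z1 (snd c y) \<noteq> 0" "z2 (snd c y) \<noteq> 0"
      unfolding zy[OF y] using ct_vec_eq_0_iff[OF A at[OF y]] Zin[OF y] Znz[OF y] by blast+
    note fc = frame_conditions[OF 1 2 3 contact[OF y], folded f_def, folded \<theta>1_def \<theta>2_def]
    show "f (snd c y) \<noteq> 0" by (rule fc(1))
    show "cdot (\<theta> (snd c y)) (ccross (\<theta>1 (snd c y)) (\<theta>2 (snd c y))) \<noteq> 0" by (rule fc(2))
    show "ccross (\<theta>1 (snd c y)) (\<theta>2 (snd c y)) = D (snd c y)" by (rule fc(3))
    show "(\<forall>w. cdot a w = 0 \<longleftrightarrow> (\<exists>k l. w = k *s z1 (snd c y) + l *s z2 (snd c y))) \<longleftrightarrow> (\<exists>k. k \<noteq> 0 \<and> a = k *s \<theta> (snd c y))"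
      by (rule fc(4))
    show "cdot a (z1 (snd c y)) \<noteq> 0 \<and> cdot a (z2 (snd c y)) = 0 \<longleftrightarrow> (\<exists>k v. k \<noteq> 0 \<and> a = k *s \<theta>1 (snd c y) + v *s \<theta> (snd c y))"
      by (rule fc(5))
    show "cdot a (z1 (snd c y)) = 0 \<and> cdot a (z2 (snd c y)) \<noteq> 0 \<longleftrightarrow> (\<exists>k v. k \<noteq> 0 \<and> a = k *s \<theta>2 (snd c y) + v *s \<theta> (snd c y))"
      by (rule fc(6))
  qed
  have eval: "ct_eval \<alpha> (ct_scale k (Z1 y)) = k * cdot (cov_vec A c y \<alpha>) (z1 (snd c y))"
    "ct_eval \<alpha> (ct_scale k (Z2 y)) = k * cdot (cov_vec A c y \<alpha>) (z2 (snd c y))"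
    "ct_scale k (Z1 y) = ct_zero \<longleftrightarrow> k = 0" "ct_scale k (Z2 y) = ct_zero \<longleftrightarrow> k = 0"
    if y: "y \<in> W" and \<alpha>: "\<alpha> \<in> covectors A y" for y \<alpha> k
  proof -
    note i = scale_in(1)[OF y Zin(1)[OF y] Zin(1)[OF y], of k] scale_in(1)[OF y Zin(2)[OF y] Zin(2)[OF y], of k]
    show "ct_eval \<alpha> (ct_scale k (Z1 y)) = k * cdot (cov_vec A c y \<alpha>) (z1 (snd c y))"
      "ct_eval \<alpha> (ct_scale k (Z2 y)) = k * cdot (cov_vec A c y \<alpha>) (z2 (snd c y))"
      unfolding ct_eval_vec[OF A at[OF y] \<alpha> i(1)] ct_eval_vec[OF A at[OF y] \<alpha> i(2)] ct_vec_ops zy[OF y] cdot_linear by simp_all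
    have "ct_vec c (Z1 y) \<noteq> 0" "ct_vec c (Z2 y) \<noteq> 0"
      using ct_vec_eq_0_iff[OF A at[OF y]] Zin[OF y] Znz[OF y] by blast+
    then show "ct_scale k (Z1 y) = ct_zero \<longleftrightarrow> k = 0" "ct_scale k (Z2 y) = ct_zero \<longleftrightarrow> k = 0"
      unfolding ct_vec_eq_0_iff[OF A at[OF y] i(1), symmetric] ct_vec_eq_0_iff[OF A at[OF y] i(2), symmetric] ct_vec_ops
      by (auto simp: vec_eq_iff)
  qed
  have "adapted_frame M A T1 T2 c W \<theta> \<theta>1 \<theta>2"
  proof
    show "smooth_atlas M A" "c \<in> A" "openin (atlas_topology A) W" "W \<subseteq> fst c" by fact+
    have f_nz: "f x \<noteq> 0" if "x \<in> S" for x using that fr(1) by (auto simp: S_def)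
    have smf: "smooth_on S (\<lambda>x. 1 / f x)"
      by (rule smooth_on_divide[OF S smooth_on_const _ f_nz]) (unfold f_def, intro smooth_intros S smD smz)
    show "smooth_on (snd c ` W) \<theta>" "smooth_on (snd c ` W) \<theta>1" "smooth_on (snd c ` W) \<theta>2"
      unfolding \<theta>1_def \<theta>2_def S_def[symmetric] by (intro sm\<theta> smooth_on_ccross smooth_on_smult S smD smz smf)+
    fix x assume "x \<in> snd c ` W"
    then obtain y where y: "x = snd c y" "y \<in> W" by blast
    show "cdot (\<theta> x) (ccross (\<theta>1 x) (\<theta>2 x)) \<noteq> 0" unfolding y(1) by (rule fr(2)[OF y(2)])
    show "frechet_derivative (\<lambda>x. cdot (\<theta> x) (cvec f)) (at x) e - frechet_derivative (\<lambda>x. cdot (\<theta> x) (cvec e)) (at x) f =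
      cdot (ccross (\<theta>1 x) (\<theta>2 x)) (ccross (cvec e) (cvec f))" for e f
      using curl_apply[OF sm\<theta> S, of x f e] y fr(3)[OF y(2)] by (simp add: S_def D_def)
  next
    fix y \<alpha> assume y: "y \<in> W" and \<alpha>: "\<alpha> \<in> covectors A y"
    show "ct_kernel A y \<alpha> = ct_sum (T1 y) (T2 y) \<longleftrightarrow> (\<exists>k. k \<noteq> 0 \<and> cov_vec A c y \<alpha> = k *s \<theta> (snd c y))"
      unfolding ker_iff[OF y \<alpha>] fr(4)[OF y] ..
    \<comment> \<open>Each line is spanned by its generator, and scaling by k multiplies the value
      of the covector by k. So the conditions on all of T1 and T2 become conditions at z1 and
      z2.\<close>
    have "(\<forall>z\<in>range (\<lambda>k. ct_scale k (Z1 y)) - {ct_zero}. ct_eval \<alpha> z \<noteq> 0) \<longleftrightarrow> (\<forall>k. k \<noteq> 0 \<longrightarrow> ct_eval \<alpha> (ct_scale k (Z1 y)) \<noteq> 0)"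
      "(\<forall>z\<in>range (\<lambda>k. ct_scale k (Z2 y)) - {ct_zero}. ct_eval \<alpha> z \<noteq> 0) \<longleftrightarrow> (\<forall>k. k \<noteq> 0 \<longrightarrow> ct_eval \<alpha> (ct_scale k (Z2 y)) \<noteq> 0)"
      "(\<forall>z\<in>range (\<lambda>k. ct_scale k (Z1 y)). ct_eval \<alpha> z = 0) \<longleftrightarrow> (\<forall>k. ct_eval \<alpha> (ct_scale k (Z1 y)) = 0)"
      "(\<forall>z\<in>range (\<lambda>k. ct_scale k (Z2 y)). ct_eval \<alpha> z = 0) \<longleftrightarrow> (\<forall>k. ct_eval \<alpha> (ct_scale k (Z2 y)) = 0)"
      using eval(3,4)[OF y \<alpha>] by blast+
    then have e: "(\<forall>z\<in>range (\<lambda>k. ct_scale k (Z1 y)) - {ct_zero}. ct_eval \<alpha> z \<noteq> 0) \<longleftrightarrow> cdot (cov_vec A c y \<alpha>) (z1 (snd c y)) \<noteq> 0"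
      "(\<forall>z\<in>range (\<lambda>k. ct_scale k (Z2 y)) - {ct_zero}. ct_eval \<alpha> z \<noteq> 0) \<longleftrightarrow> cdot (cov_vec A c y \<alpha>) (z2 (snd c y)) \<noteq> 0"
      "(\<forall>z\<in>range (\<lambda>k. ct_scale k (Z1 y)). ct_eval \<alpha> z = 0) \<longleftrightarrow> cdot (cov_vec A c y \<alpha>) (z1 (snd c y)) = 0"
      "(\<forall>z\<in>range (\<lambda>k. ct_scale k (Z2 y)). ct_eval \<alpha> z = 0) \<longleftrightarrow> cdot (cov_vec A c y \<alpha>) (z2 (snd c y)) = 0"
      unfolding eval(1,2)[OF y \<alpha>] mult_eq_0_iff by (auto dest: spec[of _ 1])
    show "(\<forall>z\<in>T1 y - {ct_zero}. ct_eval \<alpha> z \<noteq> 0) \<and> (\<forall>z\<in>T2 y. ct_eval \<alpha> z = 0) \<longleftrightarrow>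
      (\<exists>k v. k \<noteq> 0 \<and> cov_vec A c y \<alpha> = k *s \<theta>1 (snd c y) + v *s \<theta> (snd c y))"
      unfolding fr(5)[OF y, symmetric] T1y[OF y] T2y[OF y] e by blast
    show "(\<forall>z\<in>T1 y. ct_eval \<alpha> z = 0) \<and> (\<forall>z\<in>T2 y - {ct_zero}. ct_eval \<alpha> z \<noteq> 0) \<longleftrightarrow>
      (\<exists>k v. k \<noteq> 0 \<and> cov_vec A c y \<alpha> = k *s \<theta>2 (snd c y) + v *s \<theta> (snd c y))"
      unfolding fr(6)[OF y, symmetric] T1y[OF y] T2y[OF y] e by blast
  qed
  then show thesis using that W(3) by blast
qed

section \<open>The bundle of contact forms\<close>

lemma covector_of_self:
  assumes "\<alpha> \<in> covectors A p" "c \<in> charts_at A p"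
  shows "covector_of A c p (\<lambda>e. \<alpha> (coord_tangent A c p e)) = \<alpha>"
proof
  fix u show "covector_of A c p (\<lambda>e. \<alpha> (coord_tangent A c p e)) u = \<alpha> u"
    using coord_tangent_eq[OF _ assms(2), of u] covector_out[OF assms(1), of u] by (simp add: covector_of_def)
qed

text \<open>The form in which pullbacks along the projection and the dilations are computed:
  composition with the derivative in charts. Both sides are 0 outside the tangent space, so the
  equation holds between functions.\<close>

lemma pullback_covector_of:
  fixes A :: "('a, 'e::findim) atlas" and B :: "('b, 'f::findim) atlas"
  assumes A: "smooth_atlas X A" and B: "smooth_atlas Y B"
    and c: "c \<in> charts_at A p" and d: "d \<in> charts_at B (F p)" and F: "local_smooth c d F p"
  shows "pullback A B F p (covector_of B d (F p) l) = covector_of A c p (\<lambda>e. l (chart_deriv c d F p e))"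
proof
  fix u
  show "pullback A B F p (covector_of B d (F p) l) u = covector_of A c p (\<lambda>e. l (chart_deriv c d F p e)) u"
  proof (cases "u \<in> tangent_space A p")
    case True
    then have "pullback A B F p (covector_of B d (F p) l) u =
        pullback A B F p (covector_of B d (F p) l) (coord_tangent A c p (u c))"
      using coord_tangent_eq[OF True c] by simp
    then show ?thesis
      unfolding pullback_coord[OF A B c d F] covector_of_coord[OF B d] using True by (simp add: covector_of_def)
  qed (simp add: pullback_def covector_of_def)
qed

lemma linear_cdot_cvec: "linear (\<lambda>e. cdot w (cvec e))"
  by (rule linearI) (simp_all add: cdot_def algebra_simps scaleR_conv_of_real[where 'a = complex])

lemma cdot_cvec_axis: "cdot w (cvec (axis i 1)) = w $ i"
proof -
  have "cvec (axis i 1) = axis i 1" by (simp add: vec_eq_iff axis_def)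
  then show ?thesis using exhaust_3[of i] cdot_axis by metis
qed

context adapted_frame
begin

abbreviation "E \<equiv> E_space M A T1 T2"
abbreviation "EA \<equiv> E_atlas M A T1 T2"

text \<open>By Cramer's rule X0, X1, X2 form the frame dual to (\<theta>, \<theta>1, \<theta>2),
  with \<Delta> the determinant of the coframe. Contraction with X0 thus picks out the coefficient
  of \<theta>.\<close>

definition "\<Delta> x = cdot (\<theta> x) (ccross (\<theta>1 x) (\<theta>2 x))"
definition "X0 x = (1 / \<Delta> x) *s ccross (\<theta>1 x) (\<theta>2 x)"
definition "X1 x = (1 / \<Delta> x) *s ccross (\<theta>2 x) (\<theta> x)"
definition "X2 x = (1 / \<Delta> x) *s ccross (\<theta> x) (\<theta>1 x)"

lemma dual_frame:
  assumes "x \<in> snd c ` W"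
  shows "cdot (\<theta> x) (X0 x) = 1" "cdot (\<theta>1 x) (X0 x) = 0" "cdot (\<theta>2 x) (X0 x) = 0"
    "cdot (\<theta> x) (X1 x) = 0" "cdot (\<theta>1 x) (X1 x) = 1" "cdot (\<theta>2 x) (X1 x) = 0"
    "cdot (\<theta> x) (X2 x) = 0" "cdot (\<theta>1 x) (X2 x) = 0" "cdot (\<theta>2 x) (X2 x) = 1"
proof -
  have nz: "\<Delta> x \<noteq> 0" using coframe[OF assms] by (simp add: \<Delta>_def)
  have "cdot (\<theta>1 x) (ccross (\<theta>2 x) (\<theta> x)) = \<Delta> x" "cdot (\<theta>2 x) (ccross (\<theta> x) (\<theta>1 x)) = \<Delta> x"
    "cdot (\<theta>1 x) (ccross (\<theta>1 x) (\<theta>2 x)) = 0" "cdot (\<theta>2 x) (ccross (\<theta>1 x) (\<theta>2 x)) = 0"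
    "cdot (\<theta> x) (ccross (\<theta>2 x) (\<theta> x)) = 0" "cdot (\<theta>2 x) (ccross (\<theta>2 x) (\<theta> x)) = 0"
    "cdot (\<theta> x) (ccross (\<theta> x) (\<theta>1 x)) = 0" "cdot (\<theta>1 x) (ccross (\<theta> x) (\<theta>1 x)) = 0"
    unfolding \<Delta>_def by (simp_all add: cdot_def ccross_def algebra_simps)
  then show "cdot (\<theta> x) (X0 x) = 1" "cdot (\<theta>1 x) (X0 x) = 0" "cdot (\<theta>2 x) (X0 x) = 0"
    "cdot (\<theta> x) (X1 x) = 0" "cdot (\<theta>1 x) (X1 x) = 1" "cdot (\<theta>2 x) (X1 x) = 0"
    "cdot (\<theta> x) (X2 x) = 0" "cdot (\<theta>1 x) (X2 x) = 0" "cdot (\<theta>2 x) (X2 x) = 1"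
    unfolding X0_def X1_def X2_def cdot_linear using nz by (simp_all add: \<Delta>_def)
qed

lemma open_W: "open (snd c ` W)"
proof -
  have "fst c \<inter> W = W" using W by blast
  then show ?thesis using openin_atlasD[OF atlas W(1) c] by simp
qed

lemma smooth_dual_frame: "smooth_on (snd c ` W) X0" "smooth_on (snd c ` W) X1" "smooth_on (snd c ` W) X2"
proof -
  have d: "smooth_on (snd c ` W) (\<lambda>x. 1 / \<Delta> x)"
    by (rule smooth_on_divide[OF open_W smooth_on_const])
       (unfold \<Delta>_def, (intro smooth_intros open_W smooth | simp add: coframe)+)
  show "smooth_on (snd c ` W) X0" "smooth_on (snd c ` W) X1" "smooth_on (snd c ` W) X2"
    unfolding X0_def X1_def X2_def by (intro smooth_on_smult smooth_on_ccross open_W smooth d)+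
qed

lemma wf_c: "wf_chart c"
  by (rule smooth_atlasD(1)[OF atlas c])

lemma c_at: "y \<in> W \<Longrightarrow> c \<in> charts_at A y"
  using c W by (auto simp: charts_at_def)

lemma W_sub_M: "W \<subseteq> M"
  using openin_subset[OF W(1)] topspace_atlas_topology[OF atlas] by simp

lemma covector_of_vec:
  assumes "y \<in> W"
  shows "covector_of A c y (\<lambda>e. cdot w (cvec e)) \<in> covectors A y"
    "cov_vec A c y (covector_of A c y (\<lambda>e. cdot w (cvec e))) = w"
  using covector_of_in[OF atlas c_at[OF assms] linear_cdot_cvec]
  by (simp_all add: cov_vec_def covector_of_coord[OF atlas c_at[OF assms]] cdot_cvec_axis)

lemma covector_of_cov_vec:
  assumes "y \<in> W" "\<alpha> \<in> covectors A y"
  shows "covector_of A c y (\<lambda>e. cdot (cov_vec A c y \<alpha>) (cvec e)) = \<alpha>"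
  using covector_of_self[OF assms(2) c_at[OF assms(1)]] cov_vec_apply[OF atlas c_at[OF assms(1)] assms(2)] by simp

section \<open>The trivialisation of E over the domain of a frame\<close>

definition E_sec :: "'a \<Rightarrow> complex \<Rightarrow> 'a E_pt" where
  "E_sec y k = (y, covector_of A c y (\<lambda>e. cdot (k *s \<theta> (snd c y)) (cvec e)))"

lemma fst_E_sec [simp]: "fst (E_sec y k) = y"
  by (simp add: E_sec_def)

lemma E_sec:
  assumes y: "y \<in> W"
  shows "snd (E_sec y k) \<in> covectors A y" "cov_vec A c y (snd (E_sec y k)) = k *s \<theta> (snd c y)"
    "k \<noteq> 0 \<Longrightarrow> E_sec y k \<in> E"
proof -
  show 1: "snd (E_sec y k) \<in> covectors A y" "cov_vec A c y (snd (E_sec y k)) = k *s \<theta> (snd c y)"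
    using covector_of_vec[OF y] by (simp_all add: E_sec_def)
  assume "k \<noteq> 0"
  then have "ct_kernel A y (snd (E_sec y k)) = ct_sum (T1 y) (T2 y)" using kernel_iff[OF y 1(1)] 1(2) by blast
  then show "E_sec y k \<in> E" using 1 y W_sub_M unfolding E_space_def by (auto simp: E_sec_def)
qed

lemma E_rep:
  assumes "\<epsilon> \<in> E" "fst \<epsilon> \<in> W"
  obtains k where "k \<noteq> 0" "\<epsilon> = E_sec (fst \<epsilon>) k"
proof -
  obtain y \<alpha> where \<epsilon>: "\<epsilon> = (y, \<alpha>)" by (cases \<epsilon>)
  then have \<alpha>: "y \<in> W" "\<alpha> \<in> covectors A y" "ct_kernel A y \<alpha> = ct_sum (T1 y) (T2 y)" using assms by (auto simp: E_space_def)
  then obtain k where k: "k \<noteq> 0" "cov_vec A c y \<alpha> = k *s \<theta> (snd c y)" using kernel_iff by blast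
  have "\<epsilon> = E_sec (fst \<epsilon>) k" unfolding E_sec_def \<epsilon> using covector_of_cov_vec[OF \<alpha>(1,2)] k(2) by simp
  then show thesis using that k by blast
qed

text \<open>Contraction with X0 recovers the factor k of k \<theta> and makes sense for every
  covector over W; this provides the smooth extension to the covector bundle that a submanifold
  chart requires.\<close>

definition E_chart :: "('a E_pt, (real ^ 3) \<times> complex) chart" where
  "E_chart = ({\<epsilon> \<in> E. fst \<epsilon> \<in> W},
     \<lambda>\<epsilon>. (snd c (fst \<epsilon>), cdot (cov_vec A c (fst \<epsilon>) (snd \<epsilon>)) (X0 (snd c (fst \<epsilon>)))))"

lemma E_chart_fst: "fst E_chart = {\<epsilon> \<in> E. fst \<epsilon> \<in> W}"
  by (simp add: E_chart_def)

lemma E_sec_chart: "y \<in> W \<Longrightarrow> k \<noteq> 0 \<Longrightarrow> E_sec y k \<in> fst E_chart"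
  using E_sec(3) by (simp add: E_chart_fst)

lemma E_chart_rep: "\<epsilon> \<in> fst E_chart \<Longrightarrow> \<exists>y k. y \<in> W \<and> k \<noteq> 0 \<and> \<epsilon> = E_sec y k"
  using E_rep unfolding E_chart_fst by blast

lemma E_chart_sec: "y \<in> W \<Longrightarrow> snd E_chart (E_sec y k) = (snd c y, k)"
  using E_sec(2) dual_frame(1) by (simp add: E_chart_def cdot_linear)

lemma E_chart_image: "snd E_chart ` fst E_chart = snd c ` W \<times> (- {0})"
proof (rule equalityI; rule subsetI)
  fix z assume "z \<in> snd E_chart ` fst E_chart"
  then show "z \<in> snd c ` W \<times> (- {0})" using E_chart_rep E_chart_sec by fastforce
next
  fix z assume "z \<in> snd c ` W \<times> (- {0 :: complex})"
  then obtain y k where "y \<in> W" "k \<noteq> 0" "z = (snd c y, k)" by auto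
  then show "z \<in> snd E_chart ` fst E_chart" using E_sec_chart E_chart_sec by (metis image_eqI)
qed

lemma open_E_chart: "open (snd c ` W \<times> (- {0 :: complex}))"
  by (intro open_Times open_W) auto

lemma wf_E_chart: "wf_chart E_chart"
  unfolding wf_chart_def E_chart_image
proof (intro conjI open_E_chart inj_onI)
  fix \<epsilon> \<epsilon>' assume e: "\<epsilon> \<in> fst E_chart" "\<epsilon>' \<in> fst E_chart" "snd E_chart \<epsilon> = snd E_chart \<epsilon>'"
  obtain y k y' k' where y: "y \<in> W" "k \<noteq> 0" "\<epsilon> = E_sec y k" "y' \<in> W" "k' \<noteq> 0" "\<epsilon>' = E_sec y' k'"
    using E_chart_rep e by metis
  then have "snd c y = snd c y'" "k = k'" using e(3) E_chart_sec by auto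
  moreover have "y = y'" using wf_chartD(1)[OF wf_c] \<open>snd c y = snd c y'\<close> y W by (meson inj_onD subsetD)
  ultimately show "\<epsilon> = \<epsilon>'" using y by simp
qed

lemma E_chart_in: "E_chart \<in> EA"
  unfolding E_atlas_def submanifold_atlas_iff[OF smooth_atlas_covector[OF atlas]]
proof (intro conjI wf_E_chart ballI)
  let ?C = "covector_chart A c"
  have C: "?C \<in> covector_atlas A" unfolding covector_atlas_eq using c by blast
  \<comment> \<open>Only the base point is restricted and the covector is left free, since the
    extension of the chart must be defined on an open set of ambient coordinates.\<close>
  let ?V = "snd c ` W \<times> (UNIV :: ((real ^ 3) \<Rightarrow>\<^sub>L complex) set)"
  have V: "open ?V" using open_W by (intro open_Times) auto
  have Vsub: "?V \<subseteq> snd ?C ` fst ?C" unfolding wf_covector_chart(2)[OF atlas c] using W by blast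
  have "fst E_chart = (fst ?C \<inter> snd ?C -` ?V) \<inter> E"
  proof (rule equalityI; rule subsetI)
    fix \<epsilon> assume "\<epsilon> \<in> fst E_chart"
    then show "\<epsilon> \<in> (fst ?C \<inter> snd ?C -` ?V) \<inter> E"
      using W by (cases \<epsilon>) (auto simp: E_chart_fst covector_chart_def E_space_def)
  next
    fix \<epsilon> assume "\<epsilon> \<in> (fst ?C \<inter> snd ?C -` ?V) \<inter> E"
    then have "\<epsilon> \<in> E" "fst \<epsilon> \<in> fst c" "snd c (fst \<epsilon>) \<in> snd c ` W" by (auto simp: covector_chart_def)
    moreover have "fst c \<inter> W = W" using W by blast
    ultimately show "\<epsilon> \<in> fst E_chart" using chart_mem[OF wf_c, of "fst \<epsilon>" W] by (simp add: E_chart_fst)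
  qed
  then show "openin (subtopology (atlas_topology (covector_atlas A)) E) (fst E_chart)"
    unfolding openin_subtopology using openin_chart_vimage[OF C V] by blast
  fix \<epsilon> assume \<epsilon>: "\<epsilon> \<in> fst E_chart"
  have Cin: "\<epsilon>' \<in> fst ?C" if "\<epsilon>' \<in> fst E_chart" for \<epsilon>'
    using that W by (cases \<epsilon>') (auto simp: E_chart_fst covector_chart_def E_space_def)
  have Capp: "snd ?C (E_sec y k) = (snd c y, coord_covector A c y (snd (E_sec y k)))" for y k
    by (simp add: covector_chart_def E_sec_def)
  have cc: "blinfun_apply (coord_covector A c y (snd (E_sec y k))) e = cdot (k *s \<theta> (snd c y)) (cvec e)" if "y \<in> W" for y k e
    using coord_covector_apply[OF atlas c_at[OF that] E_sec(1)[OF that]]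
      cov_vec_apply[OF atlas c_at[OF that] E_sec(1)[OF that]] E_sec(2)[OF that] by simp
  let ?S = "snd c ` W \<times> (- {0 :: complex})"
  have S: "open ?S" by (rule open_E_chart)
  have bl: "bounded_linear (\<lambda>e. cdot w (cvec e))" for w
    using linear_cdot_cvec linear_conv_bounded_linear by blast
  have comp: "smooth_on ?S (\<lambda>z. f (fst z))" if "smooth_on (snd c ` W) f" for f :: "real ^ 3 \<Rightarrow> complex ^ 3"
    by (rule smooth_on_compose[OF smooth_on_bounded_linear[OF bounded_linear_fst S] that S open_W]) auto
  show "\<exists>C\<in>charts_at (covector_atlas A) \<epsilon>. local_smooth E_chart C id \<epsilon> \<and>
       (\<exists>V g. open V \<and> V \<subseteq> snd C ` fst C \<and> snd C \<epsilon> \<in> V \<and> smooth_on V g \<and>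
          (\<forall>q\<in>fst E_chart \<inter> fst C. snd C q \<in> V \<longrightarrow> snd E_chart q = g (snd C q)))"
  proof (intro bexI[of _ ?C] conjI exI)
    show "?C \<in> charts_at (covector_atlas A) \<epsilon>" using C Cin[OF \<epsilon>] by (simp add: charts_at_def)
    show "local_smooth E_chart ?C id \<epsilon>"
    proof (rule local_smoothI[OF \<epsilon> S])
      show "snd E_chart \<epsilon> \<in> ?S" unfolding E_chart_image[symmetric] using \<epsilon> by blast
      show "?S \<subseteq> snd E_chart ` fst E_chart" unfolding E_chart_image ..
      show "smooth_on ?S (\<lambda>z. (fst z, Blinfun (\<lambda>e. cdot (snd z *s \<theta> (fst z)) (cvec e))))"
      proof (rule smooth_on_Pair[OF S smooth_on_bounded_linear[OF bounded_linear_fst S] smooth_on_blinfun[OF S]])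
        show "smooth_on ?S (\<lambda>z. blinfun_apply (Blinfun (\<lambda>e. cdot (snd z *s \<theta> (fst z)) (cvec e))) e)" for e
          unfolding bounded_linear_Blinfun_apply[OF bl]
          by (intro smooth_on_cdot smooth_on_smult smooth_on_const comp smooth S smooth_on_bounded_linear bounded_linear_snd)
      qed
      fix q assume q: "q \<in> fst E_chart"
      then show "id q \<in> fst ?C" using Cin by simp
      obtain y k where y: "y \<in> W" "k \<noteq> 0" "q = E_sec y k" using E_chart_rep[OF q] by blast
      show "snd ?C (id q) = (fst (snd E_chart q), Blinfun (\<lambda>e. cdot (snd (snd E_chart q) *s \<theta> (fst (snd E_chart q))) (cvec e)))"
        unfolding y(3) id_apply Capp E_chart_sec[OF y(1)] using cc[OF y(1)]
        by (auto intro!: blinfun_eqI simp: bounded_linear_Blinfun_apply[OF bl])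
    qed
    show "open ?V" by (rule V)
    show "?V \<subseteq> snd ?C ` fst ?C" by (rule Vsub)
    obtain y k where y: "y \<in> W" "k \<noteq> 0" "\<epsilon> = E_sec y k" using E_chart_rep[OF \<epsilon>] by blast
    show "snd ?C \<epsilon> \<in> ?V" unfolding y(3) Capp using y by simp
    show "smooth_on ?V (\<lambda>z. (fst z, cdot (\<chi> i. blinfun_apply (snd z) (axis i 1)) (X0 (fst z))))"
    proof -
      have X: "smooth_on ?V (\<lambda>z. X0 (fst z))"
        by (rule smooth_on_compose[OF smooth_on_bounded_linear[OF bounded_linear_fst V] smooth_dual_frame(1) V open_W]) auto
      show ?thesis
        by (intro smooth_on_Pair smooth_on_cdot[OF V _ X] smooth_on_vec_lambda smooth_on_blinfun_apply smooth_on_const V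
            smooth_on_bounded_linear bounded_linear_fst bounded_linear_snd)
    qed
    show "\<forall>q\<in>fst E_chart \<inter> fst ?C. snd ?C q \<in> ?V \<longrightarrow>
        snd E_chart q = (fst (snd ?C q), cdot (\<chi> i. blinfun_apply (snd (snd ?C q)) (axis i 1)) (X0 (fst (snd ?C q))))"
    proof (intro ballI impI)
      fix q assume "q \<in> fst E_chart \<inter> fst ?C"
      then obtain y k where y: "y \<in> W" "k \<noteq> 0" "q = E_sec y k" using E_chart_rep by blast
      have "(\<chi> i. blinfun_apply (coord_covector A c y (snd (E_sec y k))) (axis i 1)) = k *s \<theta> (snd c y)"
        unfolding cc[OF y(1)] cdot_cvec_axis by (simp add: vec_eq_iff)
      then show "snd E_chart q = (fst (snd ?C q), cdot (\<chi> i. blinfun_apply (snd (snd ?C q)) (axis i 1)) (X0 (fst (snd ?C q))))"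
        unfolding y(3) Capp E_chart_sec[OF y(1)] using dual_frame(1) y(1) by (simp add: cdot_linear)
    qed
  qed
qed

end

lemma smooth_atlas_E:
  assumes M: "smooth_manifold M A" and flag: "flag_structure M A T1 T2"
  shows "smooth_atlas (E_space M A T1 T2) (E_atlas M A T1 T2)"
proof -
  have A: "smooth_atlas M A" using M by (simp add: smooth_manifold_iff)
  show ?thesis unfolding E_atlas_def
  proof (rule smooth_atlas_submanifold[OF smooth_atlas_covector[OF A]])
    fix \<epsilon> assume \<epsilon>: "\<epsilon> \<in> E_space M A T1 T2"
    then have "fst \<epsilon> \<in> M" by (auto simp: E_space_def)
    then obtain c W \<theta> \<theta>1 \<theta>2 where fr: "fst \<epsilon> \<in> W" "adapted_frame M A T1 T2 c W \<theta> \<theta>1 \<theta>2"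
      using ex_adapted_frame[OF M flag] by metis
    then interpret adapted_frame M A T1 T2 c W \<theta> \<theta>1 \<theta>2 by simp
    have "E_chart \<in> charts_at EA \<epsilon>" using E_chart_in \<epsilon> fr(1) by (simp add: charts_at_def E_chart_fst)
    then show "\<exists>d :: ('a E_pt, (real ^ 3) \<times> complex) chart. d \<in> charts_at (submanifold_atlas (covector_atlas A) (E_space M A T1 T2)) \<epsilon>"
      unfolding E_atlas_def by blast
  qed
qed

text \<open>That the charts of E cover E needs frames around all points of M, so it cannot be
  obtained inside the context of one frame. It is assumed here and discharged by
  \<open>smooth_atlas_E\<close>.\<close>

locale adapted_frame_bundle = adapted_frame +
  assumes E_atlas: "smooth_atlas (E_space M A T1 T2) (E_atlas M A T1 T2)"
begin

lemma E_chart_at: "y \<in> W \<Longrightarrow> k \<noteq> 0 \<Longrightarrow> E_chart \<in> charts_at EA (E_sec y k)"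
  using E_chart_in E_sec_chart by (simp add: charts_at_def)

section \<open>The projection, the tautological form and the dilations in the chart of E\<close>

lemma E_chart_proj:
  assumes y: "y \<in> W" "k \<noteq> 0"
  shows "local_smooth E_chart c fst (E_sec y k)" "chart_deriv E_chart c fst (E_sec y k) = fst"
proof -
  have m: "snd E_chart (E_sec y k) \<in> snd c ` W \<times> (- {0})" using E_chart_sec[OF y(1)] y by simp
  have eq: "snd c (fst q) = fst (snd E_chart q)" for q by (simp add: E_chart_def)
  show "local_smooth E_chart c fst (E_sec y k)"
    by (rule local_smoothI[OF E_sec_chart[OF y] open_E_chart m equalityD2[OF E_chart_image]
          smooth_on_bounded_linear[OF bounded_linear_fst open_E_chart]])
       (use W in \<open>auto simp: eq E_chart_fst\<close>)
  show "chart_deriv E_chart c fst (E_sec y k) = fst"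
    by (rule chart_deriv_eqI[where g = fst, OF wf_E_chart E_sec_chart[OF y] open_E_chart m
          equalityD2[OF E_chart_image] eq bounded_linear_imp_has_derivative[OF bounded_linear_fst]])
qed

lemma pullback_proj:
  assumes y: "y \<in> W" "k \<noteq> 0" and \<alpha>: "\<alpha> \<in> covectors A y"
  shows "pullback EA A fst (E_sec y k) \<alpha> =
    covector_of EA E_chart (E_sec y k) (\<lambda>z. cdot (cov_vec A c y \<alpha>) (cvec (fst z)))"
proof -
  have c: "c \<in> charts_at A (fst (E_sec y k))" using c_at y by simp
  from pullback_covector_of[OF E_atlas atlas E_chart_at[OF y] c E_chart_proj(1)[OF y],
      of "\<lambda>e. cdot (cov_vec A c y \<alpha>) (cvec e)"]
  show ?thesis unfolding E_chart_proj(2)[OF y] fst_E_sec covector_of_cov_vec[OF y(1) \<alpha>] .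
qed

lemma tautological_coord:
  assumes y: "y \<in> W" "k \<noteq> 0"
  shows "tautological_form M A T1 T2 (E_sec y k) =
    covector_of EA E_chart (E_sec y k) (\<lambda>z. k * cdot (\<theta> (snd c y)) (cvec (fst z)))"
  unfolding tautological_form_def pullback_proj[OF y E_sec(1)[OF y(1)]] E_sec(2)[OF y(1)] cdot_linear ..

lemma linear_cdot_fst: "linear (\<lambda>z :: (real ^ 3) \<times> complex. k * cdot w (cvec (fst z)))"
  by (rule linearI) (simp_all add: cdot_def algebra_simps scaleR_conv_of_real[where 'a = complex])

text \<open>\<open>d\<omega> = d\<lambda> \<and> \<theta> + \<lambda> d\<theta>\<close>\<close>

lemma ext_deriv_tautological:
  assumes y: "y \<in> W" "k \<noteq> 0"
    and u: "u \<in> tangent_space EA (E_sec y k)" and v: "v \<in> tangent_space EA (E_sec y k)"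
  shows "ext_deriv EA (tautological_form M A T1 T2) (E_sec y k) u v =
    snd (u E_chart) * cdot (\<theta> (snd c y)) (cvec (fst (v E_chart))) -
    snd (v E_chart) * cdot (\<theta> (snd c y)) (cvec (fst (u E_chart))) +
    k * cdot (ccross (\<theta>1 (snd c y)) (\<theta>2 (snd c y))) (ccross (cvec (fst (u E_chart))) (cvec (fst (v E_chart))))"
proof -
  let ?\<omega> = "tautological_form M A T1 T2"
  let ?S = "snd c ` W \<times> (- {0 :: complex})"
  let ?z = "(snd c y, k)"
  have S: "open ?S" by (rule open_E_chart)
  have z: "?z \<in> ?S" using y by simp
  have cf: "coord_form EA ?\<omega> E_chart z e = snd z * cdot (\<theta> (fst z)) (cvec (fst e))" if z: "z \<in> ?S" for z e
  proof -
    obtain y k where yk: "y \<in> W" "k \<noteq> 0" "z = (snd c y, k)" using z by auto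
    then have zE: "z = snd E_chart (E_sec y k)" using E_chart_sec by simp
    have "coord_form EA ?\<omega> E_chart z e = ?\<omega> (E_sec y k) (coord_tangent EA E_chart (E_sec y k) e)"
      unfolding zE by (rule coord_form_eq[OF wf_E_chart E_sec_chart[OF yk(1,2)]])
    then show ?thesis unfolding tautological_coord[OF yk(1,2)]
        covector_of_coord[OF E_atlas E_chart_at[OF yk(1,2)]] yk(3) by simp
  qed
  have comp: "smooth_on ?S (\<lambda>z. \<theta> (fst z))"
    by (rule smooth_on_compose[OF smooth_on_bounded_linear[OF bounded_linear_fst S] smooth(1) S open_W]) auto
  have sm: "smooth_on ?S (\<lambda>z. coord_form EA ?\<omega> E_chart z e)" for e
  proof -
    have "smooth_on ?S (\<lambda>z. snd z * cdot (\<theta> (fst z)) (cvec (fst e)))"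
      by (intro smooth_on_mult smooth_on_cdot smooth_on_const comp S smooth_on_bounded_linear bounded_linear_snd)
    then show ?thesis
      by (rule smooth_on_cong[OF S, THEN iffD2, rotated]) (simp add: cf)
  qed
  have dth: "((\<lambda>x. cdot (\<theta> x) (cvec e)) has_derivative frechet_derivative (\<lambda>x. cdot (\<theta> x) (cvec e)) (at (snd c y))) (at (snd c y))" for e
    by (rule smooth_on_has_derivative[OF smooth_on_cdot[OF open_W smooth(1) smooth_on_const]]) (use y in blast)
  have d: "frechet_derivative (\<lambda>z. coord_form EA ?\<omega> E_chart z e) (at ?z) h =
      snd h * cdot (\<theta> (snd c y)) (cvec (fst e)) + k * frechet_derivative (\<lambda>x. cdot (\<theta> x) (cvec (fst e))) (at (snd c y)) (fst h)" for e h
  proof -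
    have 1: "((\<lambda>z. cdot (\<theta> (fst z)) (cvec (fst e))) has_derivative
        (\<lambda>h. frechet_derivative (\<lambda>x. cdot (\<theta> x) (cvec (fst e))) (at (snd c y)) (fst h))) (at ?z)"
      using diff_chain_at[OF bounded_linear_imp_has_derivative[OF bounded_linear_fst], of "\<lambda>x. cdot (\<theta> x) (cvec (fst e))" _ ?z]
        dth[of "fst e"] by (simp add: comp_def)
    have "((\<lambda>z. snd z * cdot (\<theta> (fst z)) (cvec (fst e))) has_derivative
      (\<lambda>h. snd ?z * frechet_derivative (\<lambda>x. cdot (\<theta> x) (cvec (fst e))) (at (snd c y)) (fst h) + snd h * cdot (\<theta> (fst ?z)) (cvec (fst e)))) (at ?z)"
      by (rule has_derivative_mult[OF bounded_linear_imp_has_derivative[OF bounded_linear_snd] 1])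
    then have "((\<lambda>z. coord_form EA ?\<omega> E_chart z e) has_derivative
      (\<lambda>h. snd ?z * frechet_derivative (\<lambda>x. cdot (\<theta> x) (cvec (fst e))) (at (snd c y)) (fst h) + snd h * cdot (\<theta> (fst ?z)) (cvec (fst e)))) (at ?z)"
      by (rule has_derivative_transform_within_open[OF _ S z]) (simp add: cf)
    from fun_cong[OF frechet_derivative_at[OF this], of h, symmetric] show ?thesis by (simp add: add.commute)
  qed
  have "ext_deriv EA ?\<omega> (E_sec y k) u v =
    frechet_derivative (\<lambda>z. coord_form EA ?\<omega> E_chart z (v E_chart)) (at (snd E_chart (E_sec y k))) (u E_chart) -
    frechet_derivative (\<lambda>z. coord_form EA ?\<omega> E_chart z (u E_chart)) (at (snd E_chart (E_sec y k))) (v E_chart)"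
  proof (rule ext_deriv_chart[OF E_atlas E_chart_at[OF y] openin_chart[OF E_chart_in] E_sec_chart[OF y] _ _ u v])
    fix q assume "q \<in> fst E_chart"
    then obtain y k where q: "y \<in> W" "k \<noteq> 0" "q = E_sec y k" using E_chart_rep by blast
    show "?\<omega> q \<in> covectors EA q"
      unfolding q(3) tautological_coord[OF q(1,2)] by (rule covector_of_in[OF E_atlas E_chart_at[OF q(1,2)] linear_cdot_fst])
  next
    show "smooth_on (snd E_chart ` (fst E_chart \<inter> fst E_chart)) (\<lambda>z. coord_form EA ?\<omega> E_chart z e)" for e
      unfolding Int_absorb E_chart_image by (rule sm)
  qed
  then show ?thesis
    unfolding E_chart_sec[OF y(1)] d using dtheta[of "snd c y" "fst (v E_chart)" "fst (u E_chart)"] y(1)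
    by (simp add: algebra_simps flip: dtheta)
qed

lemma dilation_E_sec: "dilation j (E_sec y k) = E_sec y (j * k)"
  unfolding dilation_def E_sec_def covector_of_def by (auto simp: cdot_linear)

lemma dilation_chart:
  assumes y: "y \<in> W" "k \<noteq> 0" and j: "j \<noteq> 0"
  shows "local_smooth E_chart E_chart (dilation j) (E_sec y k)"
    "chart_deriv E_chart E_chart (dilation j) (E_sec y k) = (\<lambda>z. (fst z, j * snd z))"
proof -
  have m: "snd E_chart (E_sec y k) \<in> snd c ` W \<times> (- {0})" using E_chart_sec[OF y(1)] y by simp
  have eq: "dilation j q \<in> fst E_chart" "snd E_chart (dilation j q) = (fst (snd E_chart q), j * snd (snd E_chart q))"
    if q: "q \<in> fst E_chart" for q
  proof -
    obtain y k where q: "y \<in> W" "k \<noteq> 0" "q = E_sec y k" using E_chart_rep[OF q] by blast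
    show "dilation j q \<in> fst E_chart" "snd E_chart (dilation j q) = (fst (snd E_chart q), j * snd (snd E_chart q))"
      unfolding q(3) dilation_E_sec E_chart_sec[OF q(1)] using E_sec_chart[of y "j * k"] q j by auto
  qed
  have bl: "bounded_linear (\<lambda>z :: (real ^ 3) \<times> complex. (fst z, j * snd z))"
    by (intro bounded_linear_Pair bounded_linear_fst bounded_linear_compose[OF bounded_linear_mult_right bounded_linear_snd])
  show "local_smooth E_chart E_chart (dilation j) (E_sec y k)"
    by (rule local_smoothI[OF E_sec_chart[OF y] open_E_chart m _ smooth_on_bounded_linear[OF bl open_E_chart]])
       (use eq in \<open>auto simp: E_chart_image\<close>)
  show "chart_deriv E_chart E_chart (dilation j) (E_sec y k) = (\<lambda>z. (fst z, j * snd z))"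
    by (rule chart_deriv_eqI[where g = "\<lambda>z. (fst z, j * snd z)", OF wf_E_chart E_sec_chart[OF y] open_E_chart m
          equalityD2[OF E_chart_image] eq(2) bounded_linear_imp_has_derivative[OF bl]])
qed

end

section \<open>The coframe bundle\<close>

lemma cdot_ccross_ccross: "cdot (ccross a b) (ccross u v) = cdot a u * cdot b v - cdot a v * cdot b u"
  by (simp add: cdot_def ccross_def algebra_simps)

text \<open>The cross products of the real basis vectors already span, so real arguments detect
  every component of C.\<close>

lemma ccross_cvec_zero:
  assumes "\<And>e f. cdot C (ccross (cvec e) (cvec f)) = 0"
  shows "C = 0"
proof -
  have "cvec (axis i 1) = axis i 1" for i by (simp add: vec_eq_iff axis_def)
  then have "cdot C (ccross (axis i 1) (axis j 1)) = 0" for i j using assms by metis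
  from this[of 2 3] this[of 3 1] this[of 1 2] show ?thesis
    by (simp add: cvec3_simps axis_def)
qed

context adapted_frame_bundle
begin

abbreviation "Y \<equiv> Y_space M A T1 T2"
abbreviation "YA \<equiv> Y_atlas M A T1 T2"
abbreviation "act \<equiv> Y_act M A T1 T2"

text \<open>The row vector \<open>(\<theta>, \<theta>1, \<theta>2, - d\<lambda>)\<close> is a point of \<open>Y\<close> over \<open>\<lambda> = 1\<close>; its orbit is the fibre.\<close>

definition base_coframe :: "real ^ 3 \<Rightarrow> real ^ 3 \<Rightarrow> complex \<Rightarrow> complex ^ 4" where
  "base_coframe x e m = vector [cdot (\<theta> x) (cvec e), cdot (\<theta>1 x) (cvec e), cdot (\<theta>2 x) (cvec e), - m]"

text \<open>The fourth entry of the base row is - d\<lambda> at \<lambda> = 1. Transport to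
  \<lambda> = \<open>h $ 1 $ 1\<close> pulls back along the inverse dilation, which divides the
  vertical component \<open>snd z\<close> by that factor; this is the origin of - d\<lambda> /
  \<lambda>.\<close>

definition coframe_coord :: "real ^ 3 \<Rightarrow> complex ^ 4 ^ 4 \<Rightarrow> 4 \<Rightarrow> (real ^ 3) \<times> complex \<Rightarrow> complex" where
  "coframe_coord x h j z = (\<Sum>i\<in>UNIV. base_coframe x (fst z) (snd z / h $ 1 $ 1) $ i * h $ i $ j)"

definition Y_pt :: "'a \<Rightarrow> complex ^ 4 ^ 4 \<Rightarrow> 'a Y_pt" where
  "Y_pt y h = (E_sec y (h $ 1 $ 1), \<chi> j. covector_of EA E_chart (E_sec y (h $ 1 $ 1)) (coframe_coord (snd c y) h j))"

section \<open>The orbit of the base coframe and the structure equation\<close>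

lemma coframe_coord_H:
  "coframe_coord x (H_of v) 1 z = v $ 1 * v $ 2 * cdot (\<theta> x) (cvec (fst z))"
  "coframe_coord x (H_of v) 2 z = cdot (v $ 1 *s \<theta>1 x + (v $ 3 * (v $ 1 * v $ 2)) *s \<theta> x) (cvec (fst z))"
  "coframe_coord x (H_of v) 3 z = cdot (v $ 2 *s \<theta>2 x + (v $ 4 * (v $ 1 * v $ 2)) *s \<theta> x) (cvec (fst z))"
  "coframe_coord x (H_of v) 4 z = v $ 5 * cdot (\<theta> x) (cvec (fst z)) + v $ 1 * v $ 4 * cdot (\<theta>1 x) (cvec (fst z)) -
    v $ 2 * v $ 3 * cdot (\<theta>2 x) (cvec (fst z)) - snd z / (v $ 1 * v $ 2)"
  by (simp_all add: coframe_coord_def sum_4 base_coframe_def H_of_entries cdot_linear)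

lemma H_11: "h \<in> carrier H_group \<Longrightarrow> h $ 1 $ 1 \<noteq> 0"
  by (auto simp: carrier_H_group H_of_entries coord_dom_def)

lemma H_11_mult: "h \<in> carrier H_group \<Longrightarrow> k \<in> carrier H_group \<Longrightarrow> (h ** k) $ 1 $ 1 = h $ 1 $ 1 * k $ 1 $ 1"
  by (auto simp: carrier_H_group H_of_mult H_of_entries H_mult_def)

lemma linear_coframe_coord: "linear (coframe_coord x h j)"
proof (rule linearI)
  have cv: "cvec (e + f) = cvec e + cvec f" "cvec (r *\<^sub>R e) = of_real r *s cvec e" for e f r
    by (simp_all add: vec_eq_iff)
  show "coframe_coord x h j (z + w) = coframe_coord x h j z + coframe_coord x h j w" for z w
    by (simp add: coframe_coord_def base_coframe_def sum_4 cv cdot_linear add_divide_distrib algebra_simps)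
  show "coframe_coord x h j (r *\<^sub>R z) = r *\<^sub>R coframe_coord x h j z" for r z
    by (simp add: coframe_coord_def base_coframe_def sum_4 cv cdot_linear scaleR_conv_of_real[where 'a = complex] algebra_simps)
qed

text \<open>The two successive transports along dilations divide the vertical component by
  \<open>h $ 1 $ 1\<close> and by \<open>k $ 1 $ 1\<close>, which together is the upper left entry
  of the product. What remains is associativity of a row vector with two matrices.\<close>

lemma Y_act_pt:
  assumes y: "y \<in> W" and h: "h \<in> carrier H_group" and k: "k \<in> carrier H_group"
  shows "act (Y_pt y h) k = Y_pt y (h ** k)"
proof -
  let ?p = "h $ 1 $ 1" let ?q = "k $ 1 $ 1" let ?x = "snd c y"
  have nz: "?p \<noteq> 0" "?q \<noteq> 0" "?q * ?p \<noteq> 0" using H_11 h k by auto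
  have d1: "dilation ?q (E_sec y ?p) = E_sec y (?q * ?p)" by (rule dilation_E_sec)
  have d2: "dilation (inverse ?q) (E_sec y (?q * ?p)) = E_sec y ?p"
    unfolding dilation_E_sec using nz by (simp add: mult.assoc[symmetric])
  have pq: "(h ** k) $ 1 $ 1 = ?q * ?p" using H_11_mult[OF h k] by simp
  have "pullback EA EA (dilation (inverse ?q)) (E_sec y (?q * ?p)) (\<lambda>u. \<Sum>i\<in>UNIV. (snd (Y_pt y h) $ i) u * k $ i $ j)
      = covector_of EA E_chart (E_sec y (?q * ?p)) (coframe_coord ?x (h ** k) j)" for j
  proof -
    let ?l = "\<lambda>z. \<Sum>i\<in>UNIV. coframe_coord ?x h i z * k $ i $ j"
    have 1: "(\<lambda>u. \<Sum>i\<in>UNIV. (snd (Y_pt y h) $ i) u * k $ i $ j) = covector_of EA E_chart (E_sec y ?p) ?l"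
      by (simp add: Y_pt_def covector_of_def fun_eq_iff)
    have at: "E_chart \<in> charts_at EA (dilation (inverse ?q) (E_sec y (?q * ?p)))"
      unfolding d2 by (rule E_chart_at[OF y nz(1)])
    have i: "inverse ?q \<noteq> 0" using nz by simp
    have 2: "pullback EA EA (dilation (inverse ?q)) (E_sec y (?q * ?p)) (covector_of EA E_chart (E_sec y ?p) ?l)
      = covector_of EA E_chart (E_sec y (?q * ?p)) (\<lambda>z. ?l (fst z, inverse ?q * snd z))"
      using pullback_covector_of[OF E_atlas E_atlas E_chart_at[OF y nz(3)] at dilation_chart(1)[OF y nz(3) i], of ?l]
      unfolding d2 dilation_chart(2)[OF y nz(3) i] .
    have div: "inverse ?q * m / ?p = m / (?q * ?p)" for m by (simp add: field_simps)
    have "(\<lambda>z. ?l (fst z, inverse ?q * snd z)) = coframe_coord ?x (h ** k) j"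
      unfolding coframe_coord_def fst_conv snd_conv div pq
      by (simp add: fun_eq_iff matrix_matrix_mult_def sum_4 algebra_simps)
    then show ?thesis unfolding 1 2 by simp
  qed
  then show ?thesis unfolding Y_act_def by (simp add: Y_pt_def d1 pq vec_eq_iff)
qed

text \<open>Coordinate tangents exhaust the tangent space of E, so the structure equation becomes an
  identity in z and w between the coordinate expressions l.\<close>

lemma two_form_iff:
  assumes y: "y \<in> W" "k \<noteq> 0" and \<eta>: "\<And>i. \<eta> $ i = covector_of EA E_chart (E_sec y k) (l i)"
  shows "(\<forall>u\<in>tangent_space EA (E_sec y k). \<forall>v\<in>tangent_space EA (E_sec y k).
      ext_deriv EA (tautological_form M A T1 T2) (E_sec y k) u v =
        wedge (\<eta> $ 1) (\<eta> $ 4) u v + wedge (\<eta> $ 2) (\<eta> $ (3 :: 4)) u v) \<longleftrightarrow>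
    (\<forall>z w. snd z * cdot (\<theta> (snd c y)) (cvec (fst w)) - snd w * cdot (\<theta> (snd c y)) (cvec (fst z)) +
        k * (cdot (\<theta>1 (snd c y)) (cvec (fst z)) * cdot (\<theta>2 (snd c y)) (cvec (fst w)) -
             cdot (\<theta>1 (snd c y)) (cvec (fst w)) * cdot (\<theta>2 (snd c y)) (cvec (fst z))) =
        l 1 z * l 4 w - l 1 w * l 4 z + (l 2 z * l 3 w - l 2 w * l 3 z))"
    (is "(\<forall>u\<in>?T. \<forall>v\<in>?T. ?P u v) \<longleftrightarrow> (\<forall>z w. ?Q z w)")
proof -
  note at = E_chart_at[OF y]
  have PQ: "?P u v \<longleftrightarrow> ?Q (u E_chart) (v E_chart)" if "u \<in> ?T" "v \<in> ?T" for u v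
    unfolding ext_deriv_tautological[OF y that] wedge_def \<eta> covector_of_def cdot_ccross_ccross using that by simp
  have "?Q z w" if "\<forall>u\<in>?T. \<forall>v\<in>?T. ?P u v" for z w
    using PQ[OF coord_tangent_in[OF E_atlas at] coord_tangent_in[OF E_atlas at], of z w] that
      coord_tangent_in[OF E_atlas at] unfolding coord_tangent_self[OF E_atlas at] by blast
  then show ?thesis using PQ by blast
qed

text \<open>The terms in v1 and v2 of \<omega>1 \<and> \<omega>2 cancel against those of \<omega>
  \<and> \<phi>, which dictates the entries a1 v2 and - a2 v1 of the last column. The relation a1 a2
  = \<lambda> matches \<lambda> d\<theta>, and - d\<lambda> / \<lambda> produces d\<lambda> \<and>
  \<theta>. The entry s is free because \<theta> \<and> \<theta> = 0.\<close>

lemma Y_pt_in: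
  assumes y: "y \<in> W" and h: "h \<in> carrier H_group"
  shows "Y_pt y h \<in> Y"
proof -
  obtain v where v: "h = H_of v" "v \<in> coord_dom" using h unfolding carrier_H_group by blast
  note vd = coord_domD[OF v(2)]
  let ?k = "v $ 1 * v $ 2" let ?x = "snd c y"
  have k: "h $ 1 $ 1 = ?k" "?k \<noteq> 0" using vd by (simp_all add: v(1) H_of_entries)
  have at: "E_chart \<in> charts_at EA (E_sec y ?k)" by (rule E_chart_at[OF y k(2)])
  define \<eta> where "\<eta> = (\<chi> j. covector_of EA E_chart (E_sec y ?k) (coframe_coord ?x h j))"
  have \<eta>: "\<eta> $ j = covector_of EA E_chart (E_sec y ?k) (coframe_coord ?x (H_of v) j)" for j
    by (simp add: \<eta>_def v(1))
  have Y: "Y_pt y h = (E_sec y ?k, \<eta>)" unfolding Y_pt_def \<eta>_def k(1) ..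
  define \<alpha> where "\<alpha> = covector_of A c y (\<lambda>e. cdot (v $ 1 *s \<theta>1 ?x + (v $ 3 * ?k) *s \<theta> ?x) (cvec e))"
  define \<beta> where "\<beta> = covector_of A c y (\<lambda>e. cdot (v $ 2 *s \<theta>2 ?x + (v $ 4 * ?k) *s \<theta> ?x) (cvec e))"
  have \<alpha>: "\<alpha> \<in> covectors A y" "cov_vec A c y \<alpha> = v $ 1 *s \<theta>1 ?x + (v $ 3 * ?k) *s \<theta> ?x"
    unfolding \<alpha>_def by (rule covector_of_vec[OF y])+
  have \<beta>: "\<beta> \<in> covectors A y" "cov_vec A c y \<beta> = v $ 2 *s \<theta>2 ?x + (v $ 4 * ?k) *s \<theta> ?x"
    unfolding \<beta>_def by (rule covector_of_vec[OF y])+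
  have 1: "\<eta> $ i \<in> covectors EA (E_sec y ?k)" for i
    unfolding \<eta> by (rule covector_of_in[OF E_atlas at linear_coframe_coord])
  have 2: "\<eta> $ 1 = tautological_form M A T1 T2 (E_sec y ?k)"
    unfolding \<eta> tautological_coord[OF y k(2)] coframe_coord_H ..
  have 3: "\<eta> $ 2 = pullback EA A fst (E_sec y ?k) \<alpha>" "\<eta> $ 3 = pullback EA A fst (E_sec y ?k) \<beta>"
    unfolding \<eta> pullback_proj[OF y k(2) \<alpha>(1)] pullback_proj[OF y k(2) \<beta>(1)] \<alpha>(2) \<beta>(2) coframe_coord_H by (rule refl)+
  have 4: "(\<forall>z\<in>T1 y - {ct_zero}. ct_eval \<alpha> z \<noteq> 0) \<and> (\<forall>z\<in>T2 y. ct_eval \<alpha> z = 0)"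
    unfolding T1_iff[OF y \<alpha>(1)] using \<alpha>(2) vd by blast
  have 5: "(\<forall>z\<in>T1 y. ct_eval \<beta> z = 0) \<and> (\<forall>z\<in>T2 y - {ct_zero}. ct_eval \<beta> z \<noteq> 0)"
    unfolding T2_iff[OF y \<beta>(1)] using \<beta>(2) vd by blast
  have 6: "\<forall>u\<in>tangent_space EA (E_sec y ?k). \<forall>v'\<in>tangent_space EA (E_sec y ?k).
      ext_deriv EA (tautological_form M A T1 T2) (E_sec y ?k) u v' =
        wedge (\<eta> $ 1) (\<eta> $ 4) u v' + wedge (\<eta> $ 2) (\<eta> $ (3 :: 4)) u v'"
    unfolding two_form_iff[OF y k(2) \<eta>] coframe_coord_H cdot_linear using vd by (simp add: field_simps)
  show ?thesis
    unfolding Y Y_space_def mem_Collect_eq prod.case fst_E_sec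
    using E_sec(3)[OF y k(2)] 1 2 3 4 5 6 \<alpha>(1) \<beta>(1) by blast
qed

text \<open>The coefficients of the structure equation force the shape of the matrix.\<close>

lemma coframe_coefficients:
  assumes fr: "cdot t0 (ccross t1 t2) \<noteq> 0" and k: "k \<noteq> 0"
    and lin: "\<And>z. l4 z = cdot p (cvec (fst z)) + m (snd z)" and m0: "m 0 = 0"
    and eq: "\<And>z w. snd z * cdot t0 (cvec (fst w)) - snd w * cdot t0 (cvec (fst z)) +
        k * (cdot t1 (cvec (fst z)) * cdot t2 (cvec (fst w)) - cdot t1 (cvec (fst w)) * cdot t2 (cvec (fst z))) =
        k * cdot t0 (cvec (fst z)) * l4 w - k * cdot t0 (cvec (fst w)) * l4 z +
        (cdot (a1 *s t1 + v *s t0) (cvec (fst z)) * cdot (a2 *s t2 + w' *s t0) (cvec (fst w)) -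
         cdot (a1 *s t1 + v *s t0) (cvec (fst w)) * cdot (a2 *s t2 + w' *s t0) (cvec (fst z)))"
  obtains s where "k = a1 * a2" "p = s *s t0 + (a1 * w' / k) *s t1 + (- (a2 * v) / k) *s t2" "\<And>x. m x = - x / k"
proof -
  obtain p0 p1 p2 where p: "p = p0 *s t0 + p1 *s t1 + p2 *s t2" using coframe_expansion[OF fr, of p] by blast
  have "t0 \<noteq> 0" using fr by (auto simp: cdot_linear)
  then obtain e where e: "cdot t0 (cvec e) \<noteq> 0" using cdot_cvec_nonzero by blast
  have c0: "cvec 0 = 0" by (simp add: vec_eq_iff)
  \<comment> \<open>Testing on a horizontal vector on which t0 does not vanish and on a vertical
    vector isolates the vertical part of l4.\<close>
  have m: "m x = - x / k" for x
  proof -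
    have "- x * cdot t0 (cvec e) = k * cdot t0 (cvec e) * m x"
      using eq[of "(e, 0)" "(0, x)"] unfolding lin by (simp add: c0 cdot_linear)
    then have "k * m x * cdot t0 (cvec e) = - x * cdot t0 (cvec e)" by (simp add: mult_ac)
    then have "k * m x = - x" using e by (metis mult_cancel_right)
    then show ?thesis using k by (simp add: field_simps)
  qed
  \<comment> \<open>The difference of both sides on horizontal vectors, written as a vector by means
    of the cross product. Contraction with t0, t1 or t2 kills two of the three terms and leaves the
    determinant times one coefficient, up to sign.\<close>
  define C where "C = (k - a1 * a2) *s ccross t1 t2 + (a1 * w' - k * p1) *s ccross t0 t1 - (k * p2 + v * a2) *s ccross t0 t2"
  have diff: "cdot (a - b) x = cdot a x - cdot b x" for a b x by (simp add: cdot_def algebra_simps)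
  have "C = 0"
  proof (rule ccross_cvec_zero)
    fix e f
    show "cdot C (ccross (cvec e) (cvec f)) = 0"
      using eq[of "(e, 0)" "(f, 0)"] unfolding lin p C_def cdot_linear diff cdot_ccross_ccross by (simp add: m0 algebra_simps)
  qed
  then have 0: "cdot t0 C = 0" "cdot t1 C = 0" "cdot t2 C = 0" by (simp_all add: cdot_linear)
  have "(k - a1 * a2) * cdot t0 (ccross t1 t2) = cdot t0 C" unfolding C_def
    by (simp add: cdot_def ccross_def algebra_simps)
  then have k1: "k = a1 * a2" using fr 0 by simp
  have "(k * p2 + v * a2) * cdot t0 (ccross t1 t2) = cdot t1 C" unfolding C_def
    by (simp add: cdot_def ccross_def algebra_simps)
  then have "k * p2 + v * a2 = 0" using fr 0 by simp
  then have p2: "p2 = - (a2 * v) / k" using k by (simp add: field_simps add_eq_0_iff)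
  have "(a1 * w' - k * p1) * cdot t0 (ccross t1 t2) = cdot t2 C" unfolding C_def
    by (simp add: cdot_def ccross_def algebra_simps)
  then have "a1 * w' - k * p1 = 0" using fr 0 by simp
  then have p1: "p1 = a1 * w' / k" using k by (simp add: field_simps)
  show thesis using that[of p0] k1 p m unfolding p1 p2 by blast
qed

text \<open>The conditions on \<omega>1 and \<omega>2 give their coefficients with respect to the
  frame, and \<open>coframe_coefficients\<close> determines \<phi> up to its \<theta>-coefficient s.
  Together these are the five coordinates of an element of H.\<close>

lemma Y_rep:
  assumes p: "p \<in> Y" and W: "Y_proj p \<in> W"
  obtains h where "h \<in> carrier H_group" "p = Y_pt (Y_proj p) h"
proof -
  obtain \<epsilon> \<eta> where p\<epsilon>: "p = (\<epsilon>, \<eta>)" by (cases p)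
  have pY: "\<epsilon> \<in> E" "\<And>i. \<eta> $ i \<in> covectors EA \<epsilon>" "\<eta> $ 1 = tautological_form M A T1 T2 \<epsilon>"
    "\<exists>\<alpha>\<in>covectors A (fst \<epsilon>). \<eta> $ 2 = pullback EA A fst \<epsilon> \<alpha> \<and>
           (\<forall>z\<in>T1 (fst \<epsilon>) - {ct_zero}. ct_eval \<alpha> z \<noteq> 0) \<and> (\<forall>z\<in>T2 (fst \<epsilon>). ct_eval \<alpha> z = 0)"
    "\<exists>\<alpha>\<in>covectors A (fst \<epsilon>). \<eta> $ 3 = pullback EA A fst \<epsilon> \<alpha> \<and>
           (\<forall>z\<in>T1 (fst \<epsilon>). ct_eval \<alpha> z = 0) \<and> (\<forall>z\<in>T2 (fst \<epsilon>) - {ct_zero}. ct_eval \<alpha> z \<noteq> 0)"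
    "\<forall>u\<in>tangent_space EA \<epsilon>. \<forall>v\<in>tangent_space EA \<epsilon>.
           ext_deriv EA (tautological_form M A T1 T2) \<epsilon> u v = wedge (\<eta> $ 1) (\<eta> $ 4) u v + wedge (\<eta> $ 2) (\<eta> $ 3) u v"
    using p unfolding p\<epsilon> Y_space_def by blast+
  define y where "y = fst \<epsilon>"
  have y: "y \<in> W" "Y_proj p = y" using W by (simp_all add: p\<epsilon> Y_proj_def y_def)
  let ?x = "snd c y"
  obtain k where k: "k \<noteq> 0" "\<epsilon> = E_sec y k" using E_rep[OF pY(1)] y unfolding y_def by blast
  note at = E_chart_at[OF y(1) k(1)]
  define l where "l i z = (\<eta> $ i) (coord_tangent EA E_chart \<epsilon> z)" for i z
  have \<eta>l: "\<eta> $ i = covector_of EA E_chart (E_sec y k) (l i)" for i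
    using covector_of_self[OF pY(2)[unfolded k(2)] at] unfolding l_def k(2) by simp
  have ll: "linear (l i)" for i unfolding l_def k(2) by (rule covector_linear[OF E_atlas at pY(2)[unfolded k(2)]])
  have l1: "l 1 z = k * cdot (\<theta> ?x) (cvec (fst z))" for z
    unfolding l_def pY(3) unfolding k(2) tautological_coord[OF y(1) k(1)] covector_of_coord[OF E_atlas at] ..
  obtain \<alpha> where \<alpha>: "\<alpha> \<in> covectors A y" "\<eta> $ 2 = pullback EA A fst (E_sec y k) \<alpha>"
    "(\<forall>z\<in>T1 y - {ct_zero}. ct_eval \<alpha> z \<noteq> 0) \<and> (\<forall>z\<in>T2 y. ct_eval \<alpha> z = 0)" using pY(4) unfolding k(2) by auto
  then obtain a1 v where a1: "a1 \<noteq> 0" "cov_vec A c y \<alpha> = a1 *s \<theta>1 ?x + v *s \<theta> ?x" using T1_iff[OF y(1) \<alpha>(1)] by blast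
  have l2: "l 2 z = cdot (a1 *s \<theta>1 ?x + v *s \<theta> ?x) (cvec (fst z))" for z
    unfolding l_def \<alpha>(2) unfolding k(2) pullback_proj[OF y(1) k(1) \<alpha>(1)] covector_of_coord[OF E_atlas at] a1(2) ..
  obtain \<beta> where \<beta>: "\<beta> \<in> covectors A y" "\<eta> $ 3 = pullback EA A fst (E_sec y k) \<beta>"
    "(\<forall>z\<in>T1 y. ct_eval \<beta> z = 0) \<and> (\<forall>z\<in>T2 y - {ct_zero}. ct_eval \<beta> z \<noteq> 0)" using pY(5) unfolding k(2) by auto
  then obtain a2 w where a2: "a2 \<noteq> 0" "cov_vec A c y \<beta> = a2 *s \<theta>2 ?x + w *s \<theta> ?x" using T2_iff[OF y(1) \<beta>(1)] by blast
  have l3: "l 3 z = cdot (a2 *s \<theta>2 ?x + w *s \<theta> ?x) (cvec (fst z))" for z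
    unfolding l_def \<beta>(2) unfolding k(2) pullback_proj[OF y(1) k(1) \<beta>(1)] covector_of_coord[OF E_atlas at] a2(2) ..
  \<comment> \<open>\<phi> is a priori only real linear on \<real>^3 times \<complex>. Its
    horizontal part is represented by a complex vector, while its vertical part stays a function of
    \<open>snd z\<close> that is shown to be - x / k only by the structure equation.\<close>
  define q where "q = (\<chi> i. l 4 (axis i 1, 0))"
  have l4: "l 4 z = cdot q (cvec (fst z)) + l 4 (0, snd z)" for z
  proof -
    have "l 4 z = l 4 ((fst z, 0) + (0, snd z))" by simp
    also have "\<dots> = l 4 (fst z, 0) + l 4 (0, snd z)" by (rule linear_add[OF ll])
    also have "linear (\<lambda>e. l 4 (e, 0))"
      using linear_compose[of "\<lambda>e. (e, 0)" "l 4"] ll by (simp add: comp_def linear_iff)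
    then have "l 4 (fst z, 0) = cdot q (cvec (fst z))" unfolding q_def by (rule linear_real3)
    finally show ?thesis .
  qed
  have l40: "l 4 (0, 0) = 0" using linear_0[OF ll] by (simp add: zero_prod_def)
  have eqs: "\<forall>z w'. snd z * cdot (\<theta> ?x) (cvec (fst w')) - snd w' * cdot (\<theta> ?x) (cvec (fst z)) +
        k * (cdot (\<theta>1 ?x) (cvec (fst z)) * cdot (\<theta>2 ?x) (cvec (fst w')) -
             cdot (\<theta>1 ?x) (cvec (fst w')) * cdot (\<theta>2 ?x) (cvec (fst z))) =
        l 1 z * l 4 w' - l 1 w' * l 4 z + (l 2 z * l 3 w' - l 2 w' * l 3 z)"
    using pY(6) unfolding k(2) two_form_iff[OF y(1) k(1) \<eta>l] .
  have cfr: "cdot (\<theta> ?x) (ccross (\<theta>1 ?x) (\<theta>2 ?x)) \<noteq> 0" using coframe y(1) by blast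
  obtain s where s: "k = a1 * a2" "q = s *s \<theta> ?x + (a1 * w / k) *s \<theta>1 ?x + (- (a2 * v) / k) *s \<theta>2 ?x"
    "\<And>x. l 4 (0, x) = - x / k"
    using coframe_coefficients[OF cfr k(1) l4 l40 eqs[rule_format, unfolded l1 l2 l3]] by blast
  \<comment> \<open>In the matrices of H the \<theta>-coefficients of \<omega>1 and \<omega>2 are v1
    \<lambda> and v2 \<lambda>, hence the division by k.\<close>
  define u :: "complex ^ 5" where "u = vector [a1, a2, v / k, w / k, s]"
  have u: "u \<in> coord_dom" using a1 a2 by (simp add: u_def coord_dom_def)
  have u_k: "u $ 1 * u $ 2 = k" "H_of u $ 1 $ 1 = k" by (simp_all add: u_def s(1) H_of_entries)
  have "\<forall>i. l i = coframe_coord ?x (H_of u) i"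
    unfolding forall_4 fun_eq_iff coframe_coord_H l1 l2 l3 l4[unfolded s(3)] s(2) u_k cdot_linear using k(1)
    by (simp add: u_def cdot_linear field_simps)
  then have "\<eta> $ i = covector_of EA E_chart (E_sec y k) (coframe_coord ?x (H_of u) i)" for i using \<eta>l by simp
  then have "p = Y_pt y (H_of u)" unfolding p\<epsilon> Y_pt_def u_k k(2) by (simp add: vec_eq_iff)
  then show thesis using that[of "H_of u"] u y(2) by (simp add: carrier_H_group)
qed

lemma Y_proj_pt [simp]: "Y_proj (Y_pt y h) = y"
  by (simp add: Y_proj_def Y_pt_def)

section \<open>Charts of Y\<close>

definition horizontal_eval :: "(((real ^ 3) \<times> complex) \<Rightarrow>\<^sub>L complex) \<Rightarrow> complex ^ 3 \<Rightarrow> complex" where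
  "horizontal_eval L X = cdot (\<chi> i. blinfun_apply L (axis i 1, 0)) X"

text \<open>Reads off the matrix: a1 = \<omega>1(X1), a2 = \<omega>2(X2), v1 = \<omega>1(X0) /
  \<lambda>, v2 = \<omega>2(X0) / \<lambda>, s = \<phi>(X0). These formulas make sense for arbitrary
  quadruples of covectors over W with \<lambda> \<noteq> 0, hence extend the chart to the ambient
  bundle.\<close>

definition Y_coord :: "((real ^ 3) \<times> complex) \<times> ((((real ^ 3) \<times> complex) \<Rightarrow>\<^sub>L complex) ^ 4) \<Rightarrow> (real ^ 3) \<times> (complex ^ 5)" where
  "Y_coord z = (fst (fst z), vector [horizontal_eval (snd z $ 2) (X1 (fst (fst z))),
     horizontal_eval (snd z $ 3) (X2 (fst (fst z))),
     horizontal_eval (snd z $ 2) (X0 (fst (fst z))) / snd (fst z),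
     horizontal_eval (snd z $ 3) (X0 (fst (fst z))) / snd (fst z),
     horizontal_eval (snd z $ 4) (X0 (fst (fst z)))])"

abbreviation "ambient_chart \<equiv> covector4_chart EA E_chart"

definition Y_chart :: "('a Y_pt, (real ^ 3) \<times> (complex ^ 5)) chart" where
  "Y_chart = ({p \<in> Y. Y_proj p \<in> W}, \<lambda>p. Y_coord (snd ambient_chart p))"

lemma Y_chart_fst: "fst Y_chart = {p \<in> Y. Y_proj p \<in> W}"
  by (simp add: Y_chart_def)

lemma blinfun_coframe: "blinfun_apply (Blinfun (coframe_coord x h j)) = coframe_coord x h j"
  using linear_coframe_coord linear_conv_bounded_linear bounded_linear_Blinfun_apply by blast

lemma ambient_chart_pt:
  assumes y: "y \<in> W" and h: "h \<in> carrier H_group"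
  shows "snd ambient_chart (Y_pt y h) = ((snd c y, h $ 1 $ 1), \<chi> j. Blinfun (coframe_coord (snd c y) h j))"
proof -
  note at = E_chart_at[OF y H_11[OF h]]
  have "coord_covector EA E_chart (E_sec y (h $ 1 $ 1)) (covector_of EA E_chart (E_sec y (h $ 1 $ 1)) (coframe_coord (snd c y) h j))
      = Blinfun (coframe_coord (snd c y) h j)" for j
    unfolding coord_covector_def covector_of_coord[OF E_atlas at] ..
  then show ?thesis unfolding covector4_chart_def Y_pt_def by (simp add: E_chart_sec[OF y])
qed

lemma Y_chart_pt:
  assumes y: "y \<in> W" and h: "h \<in> carrier H_group"
  shows "snd Y_chart (Y_pt y h) = (snd c y, H_coord h)"
proof -
  let ?x = "snd c y"
  have "(\<chi> i. coframe_coord ?x h j (axis i 1, 0)) = h $ 1 $ j *s \<theta> ?x + h $ 2 $ j *s \<theta>1 ?x + h $ 3 $ j *s \<theta>2 ?x" for j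
    by (simp add: vec_eq_iff coframe_coord_def base_coframe_def sum_4 cdot_cvec_axis mult.commute)
  then have "horizontal_eval (Blinfun (coframe_coord ?x h j)) X =
      h $ 1 $ j * cdot (\<theta> ?x) X + h $ 2 $ j * cdot (\<theta>1 ?x) X + h $ 3 $ j * cdot (\<theta>2 ?x) X" for j X
    by (simp add: horizontal_eval_def blinfun_coframe cdot_linear)
  moreover have "?x \<in> snd c ` W" using y by blast
  ultimately show ?thesis
    using H_11[OF h] dual_frame[of ?x]
    by (simp add: Y_chart_def ambient_chart_pt[OF y h] Y_coord_def H_coord_def)
qed

lemma Y_chart_rep: "p \<in> fst Y_chart \<Longrightarrow> \<exists>y h. y \<in> W \<and> h \<in> carrier H_group \<and> p = Y_pt y h"
  using Y_rep unfolding Y_chart_fst by blast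

lemma Y_pt_chart: "y \<in> W \<Longrightarrow> h \<in> carrier H_group \<Longrightarrow> Y_pt y h \<in> fst Y_chart"
  using Y_pt_in by (simp add: Y_chart_fst)

lemma Y_chart_image: "snd Y_chart ` fst Y_chart = snd c ` W \<times> coord_dom"
proof (rule equalityI; rule subsetI)
  fix z assume "z \<in> snd Y_chart ` fst Y_chart"
  then obtain y h where "y \<in> W" "h \<in> carrier H_group" "z = snd Y_chart (Y_pt y h)" using Y_chart_rep by blast
  then show "z \<in> snd c ` W \<times> coord_dom" using Y_chart_pt H_of_coord(2) by simp
next
  fix z assume "z \<in> snd c ` W \<times> coord_dom"
  then obtain y v where z: "z = (snd c y, v)" "y \<in> W" "v \<in> coord_dom" by auto
  then have h: "H_of v \<in> carrier H_group" by (simp add: carrier_H_group)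
  have "snd Y_chart (Y_pt y (H_of v)) = z" using Y_chart_pt[OF z(2) h] z H_coord_of by simp
  then show "z \<in> snd Y_chart ` fst Y_chart" using Y_pt_chart[OF z(2) h] by (metis image_eqI)
qed

lemma open_Y_chart: "open (snd c ` W \<times> coord_dom)"
  by (intro open_Times open_W open_coord_dom)

lemma wf_Y_chart: "wf_chart Y_chart"
  unfolding wf_chart_def Y_chart_image
proof (intro conjI open_Y_chart inj_onI)
  fix p q assume pq: "p \<in> fst Y_chart" "q \<in> fst Y_chart" "snd Y_chart p = snd Y_chart q"
  obtain y h y' h' where y: "y \<in> W" "h \<in> carrier H_group" "p = Y_pt y h" "y' \<in> W" "h' \<in> carrier H_group" "q = Y_pt y' h'"
    using Y_chart_rep[OF pq(1)] Y_chart_rep[OF pq(2)] by blast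
  then have "snd c y = snd c y'" "H_coord h = H_coord h'" using pq(3) Y_chart_pt by auto
  moreover have "y = y'" using wf_chartD(1)[OF wf_c] \<open>snd c y = snd c y'\<close> y W by (meson inj_onD subsetD)
  ultimately show "p = q" using y H_of_coord(1) by metis
qed

lemma smooth_coframe_coord:
  assumes S: "open S" and f: "smooth_on S f" "f ` S \<subseteq> snd c ` W" and v: "smooth_on S v" "v ` S \<subseteq> coord_dom"
  shows "smooth_on S (\<lambda>s. coframe_coord (f s) (H_of (v s)) j z)"
proof -
  have nz: "v s $ 1 * v s $ 2 \<noteq> 0" if "s \<in> S" for s using v(2) that by (auto simp: coord_dom_def)
  have th: "smooth_on S (\<lambda>s. \<theta> (f s))" "smooth_on S (\<lambda>s. \<theta>1 (f s))" "smooth_on S (\<lambda>s. \<theta>2 (f s))"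
    by (rule smooth_on_compose[OF f(1) _ S open_W f(2)], rule smooth)+
  have ct: "smooth_on S (\<lambda>s. cdot (\<theta> (f s)) (cvec e))" "smooth_on S (\<lambda>s. cdot (\<theta>1 (f s)) (cvec e))"
    "smooth_on S (\<lambda>s. cdot (\<theta>2 (f s)) (cvec e))" for e
    by (rule smooth_on_cdot[OF S _ smooth_on_const], rule th)+
  have vi: "smooth_on S (\<lambda>s. v s $ i)" for i by (rule smooth_on_vec_nth[OF S v(1)])
  have "\<forall>j. smooth_on S (\<lambda>s. coframe_coord (f s) (H_of (v s)) j z)"
    unfolding forall_4 coframe_coord_H cdot_linear
    by (intro conjI smooth_on_add smooth_on_diff smooth_on_mult ct vi S smooth_on_divide[OF S smooth_on_const _ nz])
  then show ?thesis by blast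
qed

text \<open>The chart domain is the trace on Y of one ambient chart domain. The inverse chart is
  smooth because the coframe entries are rational in the group coordinates with the smooth frame as
  coefficients, and \<open>Y_coord\<close> is the smooth extension of the chart.\<close>

lemma Y_chart_in: "Y_chart \<in> YA"
  unfolding Y_atlas_def submanifold_atlas_iff[OF smooth_atlas_covector4[OF E_atlas]]
proof (intro conjI wf_Y_chart ballI)
  let ?C = ambient_chart
  have C: "?C \<in> covector4_atlas EA" unfolding covector4_atlas_eq using E_chart_in by blast
  have oC: "openin (atlas_topology (covector4_atlas EA)) (fst ?C)" by (rule openin_chart[OF C])
  have Y_sub: "fst Y_chart = fst ?C \<inter> Y"
    by (auto simp: Y_chart_fst covector4_chart_def E_chart_fst Y_proj_def Y_space_def)
  then show "openin (subtopology (atlas_topology (covector4_atlas EA)) Y) (fst Y_chart)"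
    unfolding openin_subtopology using oC by blast
  let ?S = "snd c ` W \<times> coord_dom"
  have S: "open ?S" by (rule open_Y_chart)
  let ?V = "(snd c ` W \<times> (- {0 :: complex})) \<times> (UNIV :: ((((real ^ 3) \<times> complex) \<Rightarrow>\<^sub>L complex) ^ 4) set)"
  have V: "open ?V" by (rule open_Times[OF open_E_chart open_UNIV])
  have imC: "snd ?C ` fst ?C = ?V" unfolding wf_covector_chart(4)[OF E_atlas E_chart_in] E_chart_image ..
  fix p assume p: "p \<in> fst Y_chart"
  show "\<exists>C\<in>charts_at (covector4_atlas EA) p. local_smooth Y_chart C id p \<and>
       (\<exists>V g. open V \<and> V \<subseteq> snd C ` fst C \<and> snd C p \<in> V \<and> smooth_on V g \<and>
          (\<forall>q\<in>fst Y_chart \<inter> fst C. snd C q \<in> V \<longrightarrow> snd Y_chart q = g (snd C q)))"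
  proof (intro bexI[of _ ?C] conjI exI)
    show "?C \<in> charts_at (covector4_atlas EA) p" using C p Y_sub by (auto simp: charts_at_def)
    show "local_smooth Y_chart ?C id p"
    proof (rule local_smoothI[OF p S])
      show "snd Y_chart p \<in> ?S" unfolding Y_chart_image[symmetric] using p by blast
      show "?S \<subseteq> snd Y_chart ` fst Y_chart" unfolding Y_chart_image ..
      let ?g = "\<lambda>s. ((fst s, snd s $ 1 * snd s $ 2), \<chi> j. Blinfun (coframe_coord (fst s) (H_of (snd s)) j))"
      have fs: "smooth_on ?S fst" "smooth_on ?S snd"
        by (rule smooth_on_bounded_linear[OF bounded_linear_fst S] smooth_on_bounded_linear[OF bounded_linear_snd S])+
      have "smooth_on ?S (\<lambda>s. Blinfun (coframe_coord (fst s) (H_of (snd s)) j))" for j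
      proof (rule smooth_on_blinfun[OF S])
        fix z
        show "smooth_on ?S (\<lambda>s. blinfun_apply (Blinfun (coframe_coord (fst s) (H_of (snd s)) j)) z)"
          unfolding blinfun_coframe by (rule smooth_coframe_coord[OF S fs(1) _ fs(2)]) auto
      qed
      then show "smooth_on ?S ?g"
        by (intro smooth_on_Pair[OF S smooth_on_Pair[OF S fs(1)]] smooth_on_mult smooth_on_vec_nth S fs(2) smooth_on_vec_lambda)
      fix q assume q: "q \<in> fst Y_chart"
      then show "id q \<in> fst ?C" using Y_sub by auto
      obtain y h where y: "y \<in> W" "h \<in> carrier H_group" "q = Y_pt y h" using Y_chart_rep[OF q] by blast
      have "H_coord h $ 1 * H_coord h $ 2 = h $ 1 $ 1"
        using H_of_coord(1)[OF y(2)] H_of_entries(1)[of "H_coord h"] by simp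
      then show "snd ?C (id q) = ?g (snd Y_chart q)"
        unfolding y(3) id_apply ambient_chart_pt[OF y(1,2)] Y_chart_pt[OF y(1,2)] using H_of_coord(1)[OF y(2)] by simp
    qed
    show "open ?V" by (rule V)
    show "?V \<subseteq> snd ?C ` fst ?C" unfolding imC ..
    show "snd ?C p \<in> ?V" unfolding imC[symmetric] using p Y_sub by blast
    show "smooth_on ?V Y_coord"
    proof -
      have f: "smooth_on ?V (\<lambda>z. fst (fst z))" "smooth_on ?V (\<lambda>z. snd (fst z))" "smooth_on ?V (\<lambda>z. snd z $ j)" for j
        by (intro smooth_on_fst smooth_on_snd smooth_on_vec_nth smooth_on_ident V)+
      have sub: "(\<lambda>z. fst (fst z)) ` ?V \<subseteq> snd c ` W" by auto
      have X: "smooth_on ?V (\<lambda>z. X0 (fst (fst z)))" "smooth_on ?V (\<lambda>z. X1 (fst (fst z)))" "smooth_on ?V (\<lambda>z. X2 (fst (fst z)))"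
        by (rule smooth_on_compose[OF f(1) _ V open_W sub], rule smooth_dual_frame)+
      have ev: "smooth_on ?V (\<lambda>z. horizontal_eval (snd z $ j) (g z))" if "smooth_on ?V g" for g j
        unfolding horizontal_eval_def
        by (intro smooth_on_cdot[OF V _ that] smooth_on_vec_lambda smooth_on_blinfun_apply smooth_on_const V f(3))
      have nz: "snd (fst z) \<noteq> 0" if "z \<in> ?V" for z using that by auto
      show ?thesis unfolding Y_coord_def[abs_def]
      proof (rule smooth_on_Pair[OF V f(1)], rule smooth_on_vec5I[OF V], unfold vector_5)
        show "smooth_on ?V (\<lambda>z. horizontal_eval (snd z $ 2) (X1 (fst (fst z))))"
          "smooth_on ?V (\<lambda>z. horizontal_eval (snd z $ 3) (X2 (fst (fst z))))"
          "smooth_on ?V (\<lambda>z. horizontal_eval (snd z $ 4) (X0 (fst (fst z))))"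
          by (rule ev, rule X)+
        show "smooth_on ?V (\<lambda>z. horizontal_eval (snd z $ 2) (X0 (fst (fst z))) / snd (fst z))"
          by (rule smooth_on_divide[OF V ev[OF X(1)] f(2) nz])
        show "smooth_on ?V (\<lambda>z. horizontal_eval (snd z $ 3) (X0 (fst (fst z))) / snd (fst z))"
          by (rule smooth_on_divide[OF V ev[OF X(1)] f(2) nz])
      qed
    qed
    show "\<forall>q\<in>fst Y_chart \<inter> fst ?C. snd ?C q \<in> ?V \<longrightarrow> snd Y_chart q = Y_coord (snd ?C q)"
      by (simp add: Y_chart_def)
  qed
qed

end

section \<open>From local frames to the whole bundle\<close>

lemma ex_adapted_frame_bundle:
  assumes M: "smooth_manifold M A" and flag: "flag_structure M A T1 T2" and x: "x \<in> M"
  obtains c W \<theta> \<theta>1 \<theta>2 where "x \<in> W" "adapted_frame_bundle M A T1 T2 c W \<theta> \<theta>1 \<theta>2"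
proof -
  obtain c W \<theta> \<theta>1 \<theta>2 where fr: "x \<in> W" "adapted_frame M A T1 T2 c W \<theta> \<theta>1 \<theta>2"
    using ex_adapted_frame[OF M flag x] .
  then show thesis
    using that smooth_atlas_E[OF M flag] by (simp add: adapted_frame_bundle_def adapted_frame_bundle_axioms_def)
qed

lemma smooth_atlas_Y:
  assumes M: "smooth_manifold M A" and flag: "flag_structure M A T1 T2"
  shows "smooth_atlas (Y_space M A T1 T2) (Y_atlas M A T1 T2)"
  unfolding Y_atlas_def
proof (rule smooth_atlas_submanifold[OF smooth_atlas_covector4[OF smooth_atlas_E[OF M flag]]])
  fix p assume p: "p \<in> Y_space M A T1 T2"
  then have "Y_proj p \<in> M" by (auto simp: Y_space_def E_space_def Y_proj_def)
  then obtain c W \<theta> \<theta>1 \<theta>2 where fr: "Y_proj p \<in> W" "adapted_frame_bundle M A T1 T2 c W \<theta> \<theta>1 \<theta>2"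
    using ex_adapted_frame_bundle[OF M flag] by metis
  then interpret adapted_frame_bundle M A T1 T2 c W \<theta> \<theta>1 \<theta>2 by simp
  have "Y_chart \<in> charts_at YA p" using Y_chart_in p fr(1) by (simp add: charts_at_def Y_chart_fst)
  then show "\<exists>d :: ('a Y_pt, (real ^ 3) \<times> (complex ^ 5)) chart.
      d \<in> charts_at (submanifold_atlas (covector4_atlas (E_atlas M A T1 T2)) (Y_space M A T1 T2)) p"
    unfolding Y_atlas_def by blast
qed

text \<open>Each fibre is the orbit of the base coframe, along which the action is multiplication of
  matrices; this gives the axioms of an action. \<open>Y_chart\<close>, with the base coframe as
  local section, gives local triviality.\<close>

lemma principal_bundle_Y:
  assumes M: "smooth_manifold M A" and flag: "flag_structure M A T1 T2"
  shows "principal_bundle (Y_space M A T1 T2) (Y_atlas M A T1 T2) M A Y_proj H_group H_atlas (Y_act M A T1 T2)"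
proof (rule principal_bundle_from_sections[OF M smooth_atlas_Y[OF M flag]])
  let ?Y = "Y_space M A T1 T2" let ?act = "Y_act M A T1 T2"
  interpret H: group H_group by (rule group_H)
  have one: "mat 1 \<in> carrier H_group" using H.one_closed by (simp add: H_group_simps)
  have mult: "g ** h \<in> carrier H_group" if "g \<in> carrier H_group" "h \<in> carrier H_group" for g h
    using H.m_closed[OF that] by (simp add: H_group_simps)
  show proj: "Y_proj \<in> ?Y \<rightarrow> M" by (auto simp: Y_space_def E_space_def Y_proj_def)
  \<comment> \<open>An existential form of the parametrisation by \<open>Y_pt\<close>, which keeps
    the action axioms below free of a choice of frame.\<close>
  have orbit: "\<exists>f. f ` carrier H_group \<subseteq> ?Y \<and> (\<forall>h\<in>carrier H_group. Y_proj (f h) = Y_proj p) \<and>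
      p \<in> f ` carrier H_group \<and> (\<forall>h\<in>carrier H_group. \<forall>k\<in>carrier H_group. ?act (f h) k = f (h ** k))" if p: "p \<in> ?Y" for p
  proof -
    have "Y_proj p \<in> M" using proj p by blast
    then obtain c W \<theta> \<theta>1 \<theta>2 where fr: "Y_proj p \<in> W" "adapted_frame_bundle M A T1 T2 c W \<theta> \<theta>1 \<theta>2"
      by (rule ex_adapted_frame_bundle[OF M flag])
    then interpret adapted_frame_bundle M A T1 T2 c W \<theta> \<theta>1 \<theta>2 by simp
    obtain h where "h \<in> carrier H_group" "p = Y_pt (Y_proj p) h" using Y_rep[OF p fr(1)] .
    then have "p \<in> Y_pt (Y_proj p) ` carrier H_group" by (metis image_eqI)
    then show ?thesis using Y_pt_in[OF fr(1)] Y_act_pt[OF fr(1)]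
      by (intro exI[of _ "Y_pt (Y_proj p)"] conjI) (simp_all add: image_subset_iff)
  qed
  show "?act p h \<in> ?Y \<and> Y_proj (?act p h) = Y_proj p" if p: "p \<in> ?Y" and h: "h \<in> carrier H_group" for p h
  proof -
    obtain f where f: "f ` carrier H_group \<subseteq> ?Y" "\<forall>h\<in>carrier H_group. Y_proj (f h) = Y_proj p" "p \<in> f ` carrier H_group"
      "\<forall>h\<in>carrier H_group. \<forall>k\<in>carrier H_group. ?act (f h) k = f (h ** k)" using orbit[OF p] by (elim exE conjE)
    then obtain g where g: "g \<in> carrier H_group" "p = f g" by blast
    then have "?act p h = f (g ** h)" using f(4) h by blast
    then show ?thesis using f(1,2) mult[OF g(1) h] by (metis image_subset_iff)
  qed
  show "?act p (mat 1) = p" if p: "p \<in> ?Y" for p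
  proof -
    obtain f where f: "p \<in> f ` carrier H_group"
      "\<forall>h\<in>carrier H_group. \<forall>k\<in>carrier H_group. ?act (f h) k = f (h ** k)" using orbit[OF p] by (elim exE conjE)
    then obtain g where "g \<in> carrier H_group" "p = f g" by blast
    then show ?thesis using f(2) one by (simp add: matrix_mul_rid)
  qed
  show "?act (?act p g) h = ?act p (g ** h)" if p: "p \<in> ?Y" and gh: "g \<in> carrier H_group" "h \<in> carrier H_group" for p g h
  proof -
    obtain f where f: "p \<in> f ` carrier H_group"
      "\<forall>h\<in>carrier H_group. \<forall>k\<in>carrier H_group. ?act (f h) k = f (h ** k)" using orbit[OF p] by (elim exE conjE)
    then obtain k where "k \<in> carrier H_group" "p = f k" by blast
    then show ?thesis using f(2) gh mult by (simp add: matrix_mul_assoc)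
  qed
  show "\<exists>U c \<sigma> \<Psi>. openin (atlas_topology A) U \<and> x \<in> U \<and> c \<in> A \<and> U \<subseteq> fst c \<and>
      \<Psi> \<in> Y_atlas M A T1 T2 \<and> fst \<Psi> = {p \<in> ?Y. Y_proj p \<in> U} \<and> (\<forall>y\<in>U. \<sigma> y \<in> ?Y \<and> Y_proj (\<sigma> y) = y) \<and>
      (\<forall>y\<in>U. \<forall>h\<in>carrier H_group. snd \<Psi> (?act (\<sigma> y) h) = (snd c y, H_coord h)) \<and>
      (\<forall>p\<in>?Y. Y_proj p \<in> U \<longrightarrow> (\<exists>h\<in>carrier H_group. p = ?act (\<sigma> (Y_proj p)) h))" if x: "x \<in> M" for x
  proof -
    obtain c W \<theta> \<theta>1 \<theta>2 where fr: "x \<in> W" "adapted_frame_bundle M A T1 T2 c W \<theta> \<theta>1 \<theta>2"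
      using ex_adapted_frame_bundle[OF M flag x] .
    then interpret adapted_frame_bundle M A T1 T2 c W \<theta> \<theta>1 \<theta>2 by simp
    have act: "act (Y_pt y (mat 1)) h = Y_pt y h" if "y \<in> W" "h \<in> carrier H_group" for y h
      using Y_act_pt[OF that(1) one that(2)] by (simp add: matrix_mul_lid)
    have "\<exists>h\<in>carrier H_group. p = act (Y_pt (Y_proj p) (mat 1)) h" if p: "p \<in> Y" "Y_proj p \<in> W" for p
    proof -
      obtain h where "h \<in> carrier H_group" "p = Y_pt (Y_proj p) h" using Y_rep[OF p] .
      then show ?thesis using act[OF p(2)] by metis
    qed
    then show ?thesis
      using fr(1) W c Y_chart_in Y_chart_fst Y_pt_in[OF _ one] Y_chart_pt act
      by (intro exI[of _ W] exI[of _ c] exI[of _ "\<lambda>y. Y_pt y (mat 1)"] exI[of _ Y_chart]) simp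
  qed
qed

text \<open>The conjuncts on \<open>borel_to_H\<close> and \<open>borel_quotient_to_H\<close> fix
  the identification of H with B/(Z/3Z) through which the quotient acts. The bundle statement is the
  one for H, transported along this isomorphism of Lie groups.\<close>

theorem proposition3p2:
  fixes M :: "'a set" and A :: "('a, real^3) atlas"
    and T1 T2 :: "'a \<Rightarrow> ('a, real^3) ctangent set"
  assumes "smooth_manifold M A" and "flag_structure M A T1 T2"
  shows "borel_to_H \<in> hom borel_group H_group
    \<and> borel_to_H ` carrier borel_group = carrier H_group
    \<and> kernel borel_group H_group borel_to_H = scalar_subgroup
    \<and> lie_group_iso borel_quotient borel_quotient_atlas H_group H_atlas borel_quotient_to_H
    \<and> principal_bundle (Y_space M A T1 T2) (Y_atlas M A T1 T2) M A Y_proj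
        borel_quotient borel_quotient_atlas
        (\<lambda>y C. Y_act M A T1 T2 y (borel_quotient_to_H C))"
  using borel_to_H_hom borel_to_H_onto kernel_borel_to_H borel_quotient_lie_group_iso
    principal_bundle_iso[OF principal_bundle_Y[OF assms] borel_quotient_lie_group_iso] by blast

end
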